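(* For any $\beta\in(0,1)$ there exists a constant $C>0$ (depending on $\beta$) such that the following holds for every $\epsilon\in(0,\frac12]$. Let $\delta=\epsilon\log\frac1\epsilon$. Suppose $\gamma\in(\beta,2-\beta)$ and $\mu\in M_\gamma$ is the minimiser of $E_\epsilon^\gamma$. Then \[ \Big|E^\gamma_\epsilon(\mu)-\frac{\pi\gamma^2}{2\log\frac1\delta}\Big|\le\frac{C}{(\log\frac1\delta)^2}. \] Let $u\in W^{1,2}(B_1^+(0))$ solve $\Delta u=0$ in $B_1^+(0)$, $\partial u/\partial x_2=-\mu'$ on $(-1,1)\times\{0\}$, and $x\cdot\nabla u=0$ on $\partial^+B_1(0)$. Then \[ \epsilon\int_{-1}^1\frac{(\mu')^2}{1-\mu^2}dx_1+\int_{B_1^+(0)\setminus B_\delta(0)}\Big|\nabla u(x)-\frac{\gamma x^\perp}{|x|^2\log\frac1\delta}\Big|^2dx+\int_{B_\delta(0)\cap\mathbb{R}^2_+}|\nabla u|^2dx\le\frac{C}{(\log\frac1\delta)^2} \] and \[ \int_{\partial^+B_1(0)}|\nabla u|^2\,d\sigma\le\frac{C}{(\log\frac1\delta)^2}. \]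
   Context: $B_r^+(x_0)=B_r(x_0)\cap\mathbb{R}^2_+$, $\partial^+B_1(0)=\partial B_1(0)\cap\mathbb{R}^2_+$, $x^\perp=(-x_2,x_1)$. For $\gamma\in(0,2)$, $M_\gamma=\{\mu\in W^{1,2}(-1,1):\mu(0)=1,\ \mu(\pm1)\le1-\gamma\}$. For $\mu\in M_\gamma$, $W^{1,2}_\mu(B_1^+(0))$ is the set of $w\in W^{1,2}(B_1^+(0))$ with $w(x_1,0)=\mu(x_1)$ for $x_1\in(-1,1)$ and $w\le1-\gamma$ on $\partial^+B_1(0)$, and $E^\gamma_\epsilon(\mu)=\frac\epsilon2\int_{-1}^1\frac{(\mu')^2}{1-\mu^2}dx_1+\frac12\inf_{w\in W^{1,2}_\mu(B_1^+(0))}\int_{B_1^+(0)}|\nabla w|^2dx$, which has a unique minimiser on $M_\gamma$. *)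

theory Defs
  imports "HOL-Analysis.Analysis"
begin

definition L2_on :: "'a::euclidean_space set \<Rightarrow> ('a \<Rightarrow> 'b::{real_normed_vector, second_countable_topology}) \<Rightarrow> bool" where
  "L2_on U f \<longleftrightarrow> (\<lambda>x. indicator U x *\<^sub>R f x) \<in> borel_measurable lebesgue \<and>
     (\<integral>\<^sup>+x. indicator U x * ennreal ((norm (f x))\<^sup>2) \<partial>lebesgue) < \<infinity>"

fun Ck :: "nat \<Rightarrow> ('a::real_normed_vector \<Rightarrow> real) \<Rightarrow> bool" where
  "Ck 0 f = continuous_on UNIV f"
| "Ck (Suc k) f = (\<exists>Df. (\<forall>x. (f has_derivative Df x) (at x)) \<and> (\<forall>h. Ck k (\<lambda>x. Df x h)))"

definition test_fun :: "'a::euclidean_space set \<Rightarrow> ('a \<Rightarrow> real) \<Rightarrow> bool" where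
  "test_fun U \<phi> \<longleftrightarrow> (\<forall>k. Ck k \<phi>) \<and> compact (closure {x. \<phi> x \<noteq> 0}) \<and> closure {x. \<phi> x \<noteq> 0} \<subseteq> U"

text \<open>W^{1,2}(-1,1), with mu the continuous representative on [-1,1] and g its weak derivative.\<close>
definition W12_interval :: "(real \<Rightarrow> real) \<Rightarrow> (real \<Rightarrow> real) \<Rightarrow> bool" where
  "W12_interval \<mu> g \<longleftrightarrow> continuous_on {-1..1} \<mu> \<and> L2_on {-1<..<1} \<mu> \<and> L2_on {-1<..<1} g \<and>
     (\<forall>\<phi>. test_fun {-1<..<1} \<phi> \<longrightarrow>
        (LINT x:{-1<..<1}|lebesgue. \<mu> x * deriv \<phi> x) = - (LINT x:{-1<..<1}|lebesgue. g x * \<phi> x))"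

definition in_M :: "real \<Rightarrow> (real \<Rightarrow> real) \<Rightarrow> (real \<Rightarrow> real) \<Rightarrow> bool" where
  "in_M \<gamma> \<mu> g \<longleftrightarrow> W12_interval \<mu> g \<and> \<mu> 0 = 1 \<and> \<mu> (-1) \<le> 1 - \<gamma> \<and> \<mu> 1 \<le> 1 - \<gamma>"

definition Hp :: "(real \<times> real) set" where
  "Hp = {x. snd x > 0 \<and> norm x < 1}"

definition W12_on :: "(real \<times> real) set \<Rightarrow> (real \<times> real \<Rightarrow> real) \<Rightarrow> (real \<times> real \<Rightarrow> real \<times> real) \<Rightarrow> bool" where
  "W12_on U w G \<longleftrightarrow> L2_on U w \<and> L2_on U G \<and>
     (\<forall>\<phi> e. test_fun U \<phi> \<and> e \<in> Basis \<longrightarrow>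
        (LINT x:U|lebesgue. w x * frechet_derivative \<phi> (at x) e) = - (LINT x:U|lebesgue. (G x \<bullet> e) * \<phi> x))"

definition C1_fun :: "(real \<times> real \<Rightarrow> real) \<Rightarrow> (real \<times> real \<Rightarrow> real \<times> real) \<Rightarrow> bool" where
  "C1_fun v Dv \<longleftrightarrow> (\<forall>x. (v has_derivative (\<lambda>h. Dv x \<bullet> h)) (at x)) \<and> continuous_on UNIV Dv"

definition W12_dist_sq :: "(real \<times> real) set \<Rightarrow> (real \<times> real \<Rightarrow> real) \<Rightarrow> (real \<times> real \<Rightarrow> real \<times> real)
     \<Rightarrow> (real \<times> real \<Rightarrow> real) \<Rightarrow> (real \<times> real \<Rightarrow> real \<times> real) \<Rightarrow> ennreal" where
  "W12_dist_sq U v Dv w G = (\<integral>\<^sup>+x. indicator U x * ennreal ((v x - w x)\<^sup>2 + (norm (Dv x - G x))\<^sup>2) \<partial>lebesgue)"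

definition trace_flat :: "(real \<times> real \<Rightarrow> real) \<Rightarrow> (real \<times> real \<Rightarrow> real \<times> real) \<Rightarrow> (real \<Rightarrow> real) \<Rightarrow> bool" where
  "trace_flat w G f \<longleftrightarrow> (\<exists>v Dv. (\<forall>n. C1_fun (v n) (Dv n)) \<and>
      (\<lambda>n. W12_dist_sq Hp (v n) (Dv n) w G) \<longlonglongrightarrow> 0 \<and>
      (\<lambda>n. \<integral>\<^sup>+t. indicator {-1<..<1} t * ennreal ((v n (t, 0) - f t)\<^sup>2) \<partial>lebesgue) \<longlonglongrightarrow> 0)"

definition trace_arc :: "(real \<times> real \<Rightarrow> real) \<Rightarrow> (real \<times> real \<Rightarrow> real \<times> real) \<Rightarrow> (real \<Rightarrow> real) \<Rightarrow> bool" where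
  "trace_arc w G f \<longleftrightarrow> (\<exists>v Dv. (\<forall>n. C1_fun (v n) (Dv n)) \<and>
      (\<lambda>n. W12_dist_sq Hp (v n) (Dv n) w G) \<longlonglongrightarrow> 0 \<and>
      (\<lambda>n. \<integral>\<^sup>+\<theta>. indicator {0<..<pi} \<theta> * ennreal ((v n (cos \<theta>, sin \<theta>) - f \<theta>)\<^sup>2) \<partial>lebesgue) \<longlonglongrightarrow> 0)"

definition W12_mu :: "real \<Rightarrow> (real \<Rightarrow> real) \<Rightarrow> (real \<times> real \<Rightarrow> real) \<Rightarrow> (real \<times> real \<Rightarrow> real \<times> real) \<Rightarrow> bool" where
  "W12_mu \<gamma> \<mu> w G \<longleftrightarrow> W12_on Hp w G \<and> trace_flat w G \<mu> \<and>
     (\<exists>h. trace_arc w G h \<and> (AE \<theta> in lebesgue. \<theta> \<in> {0<..<pi} \<longrightarrow> h \<theta> \<le> 1 - \<gamma>))"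

definition dir_inf :: "real \<Rightarrow> (real \<Rightarrow> real) \<Rightarrow> ennreal" where
  "dir_inf \<gamma> \<mu> = (INF wG \<in> {(w, G). W12_mu \<gamma> \<mu> w G}.
      \<integral>\<^sup>+x. indicator Hp x * ennreal ((norm (snd wG x))\<^sup>2) \<partial>lebesgue)"

definition wgt :: "real \<Rightarrow> real \<Rightarrow> ennreal" where
  "wgt m d = (if m\<^sup>2 < 1 then ennreal (d\<^sup>2 / (1 - m\<^sup>2)) else if d = 0 then 0 else \<infinity>)"

definition wterm :: "(real \<Rightarrow> real) \<Rightarrow> (real \<Rightarrow> real) \<Rightarrow> ennreal" where
  "wterm \<mu> g = (\<integral>\<^sup>+t. indicator {-1<..<1} t * wgt (\<mu> t) (g t) \<partial>lebesgue)"

definition Eng :: "real \<Rightarrow> real \<Rightarrow> (real \<Rightarrow> real) \<Rightarrow> (real \<Rightarrow> real) \<Rightarrow> ennreal" where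
  "Eng \<epsilon> \<gamma> \<mu> g = ennreal (\<epsilon> / 2) * wterm \<mu> g + ennreal (1 / 2) * dir_inf \<gamma> \<mu>"

definition is_minimiser :: "real \<Rightarrow> real \<Rightarrow> (real \<Rightarrow> real) \<Rightarrow> (real \<Rightarrow> real) \<Rightarrow> bool" where
  "is_minimiser \<epsilon> \<gamma> \<mu> g \<longleftrightarrow> in_M \<gamma> \<mu> g \<and> (\<forall>\<nu> h. in_M \<gamma> \<nu> h \<longrightarrow> Eng \<epsilon> \<gamma> \<mu> g \<le> Eng \<epsilon> \<gamma> \<nu> h)"

text \<open>Weak formulation of: Delta u = 0 in B_1^+, du/dx2 = -mu' on the flat part,
  x . grad u = 0 on the arc (natural boundary condition).\<close>
definition neumann_sol :: "(real \<Rightarrow> real) \<Rightarrow> (real \<times> real \<Rightarrow> real) \<Rightarrow> (real \<times> real \<Rightarrow> real \<times> real) \<Rightarrow> bool" where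
  "neumann_sol g u G \<longleftrightarrow> W12_on Hp u G \<and>
     (\<forall>\<phi> D\<phi>. C1_fun \<phi> D\<phi> \<longrightarrow>
        (LINT x:Hp|lebesgue. G x \<bullet> D\<phi> x) = (LINT t:{-1<..<1}|lebesgue. g t * \<phi> (t, 0)))"

end

(* The energy is computed through boundary potentials.  For mu with mu(+-1) = 1 - gamma, the minimal extension has
   Dirichlet energy Q(mu'), the logarithmic energy of mu' for the Neumann kernel ln|x-t| + ln(1-tx) of the half disc.
   A logarithmic competitor bounds E from above; duality against a dipole at depth delta/128 below the origin bounds it
   from below, and the two differ by O(1/L^2), L = log(1/delta), which also controls the weighted term.  A regularised
   Neumann Green function shows that grad u comes from the logarithmic potential of mu', so that
   |grad u - dipole field|^2 integrates to at most the gap between the two energy bounds; away from the core the dipole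
   field is the vortex field gamma x^perp/(|x|^2 L).  The boundary estimate is a Pohozaev argument: comparing mu with
   its dilations mu(x/r) as r -> 1 bounds the square sum of the moments of mu', which is the energy of the trace of
   grad u on the arc by Parseval. *)
theory Submission
 imports Defs "HOL-Complex_Analysis.Complex_Analysis" "HOL-Computational_Algebra.Polynomial"
begin

text \<open>Traces are defined by approximation with functions that are C1 on the whole plane,
  whereas the potential of an L2 density need not be regular up to the flat side. So every potential
  is first taken with its poles at depth h > 0 below that side, where it is holomorphic across it;
  all identities are proved there, and h tends to 0 with a rate h^(1/4), the price of pairing a
  logarithm with an L2 density. The Dirichlet extension and the Neumann solution are harmonic
  conjugates: up to constants they are the imaginary and the real part of one holomorphic function.
  That is why an energy gap proved for the one measures the error of the other. The scale \<delta>
  is chosen so that the weighted term of the competitor is O(1/L^2): it costs \<epsilon> / (\<beta>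
  \<delta> L), and \<epsilon> / \<delta> = 1 / log(1/\<epsilon>). The parameter \<beta> enters
  because 1 - \<mu>^2 also degenerates at -1; \<gamma> < 2 - \<beta> keeps the competitor away from
  there. The lower bound contains the unknown weighted energy as a loss, but with a factor 1/2, so
  that it can be absorbed.\<close>

abbreviation (input) limseq (infix "--->" 60) where "X ---> L \<equiv> X \<longlonglongrightarrow> (L :: 'a::topological_space)"

section \<open>Divergence theorem on the half disc\<close>

lemma mem_Hp: "(x, y) \<in> Hp \<longleftrightarrow> 0 < y \<and> x^2 + y^2 < 1"
 by (auto simp: Hp_def norm_Pair)

lemma Hp_bounds:
 assumes "x \<in> Hp" shows "0 < snd x" "(fst x)^2 + (snd x)^2 < 1" "norm x < 1"
 using assms by (cases x; auto simp: Hp_def norm_Pair)+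

lemma open_Hp: "open Hp"
proof -
 have "Hp = {x. 0 < snd x} \<inter> {x. norm x < 1}" by (auto simp: Hp_def)
 moreover have "open {x::real \<times> real. 0 < snd x}" "open {x::real \<times> real. norm x < 1}"
 by (intro open_Collect_less continuous_intros)+
 ultimately show ?thesis by (metis open_Int)
qed

lemma Hp_measurable [measurable]: "Hp \<in> sets borel"
 using open_Hp by simp

text \<open>Every C1 approximant and every regularised potential is continuous on this compact set,
  which is how integrability and bounds on \<open>Hp\<close> are obtained.\<close>

definition Kp :: "(real \<times> real) set" where
 "Kp = {x. snd x \<ge> 0 \<and> norm x <= 1}"

lemma compact_Kp: "compact Kp"
proof -
 have "Kp = {x. 0 <= snd x} \<inter> cball 0 1" by (auto simp: Kp_def)
 moreover have "closed {x::real \<times> real. 0 <= snd x}"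
 by (intro closed_Collect_le continuous_intros)
 ultimately show ?thesis by (metis Int_commute compact_Int_closed compact_cball)
qed

lemma Hp_subset_Kp: "Hp \<subseteq> Kp" by (auto simp: Hp_def Kp_def)

lemma set_integrable_Hp:
 fixes f :: "real \<times> real => 'b::euclidean_space"
 assumes "continuous_on Kp f"
 shows "set_integrable lborel Hp f"
proof (rule set_integrable_subset)
 show "set_integrable lborel Kp f"
 unfolding set_integrable_def by (rule borel_integrable_compact[OF compact_Kp assms])
qed (use Hp_subset_Kp in auto)

lemma section_Hp:
 assumes "\<bar>x\<bar> < 1"
 shows "(x, y) \<in> Hp \<longleftrightarrow> y \<in> {0<..<sqrt (1 - x^2)}"
proof -
 have "x^2 < 1" using assms by (simp add: abs_square_less_1)
 have "y < sqrt (1 - x^2) \<longleftrightarrow> x^2 + y^2 < 1" if "0 < y"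
 proof -
 have "y < sqrt (1 - x^2) \<longleftrightarrow> sqrt (y^2) < sqrt (1 - x^2)" using that by simp
 also have "... \<longleftrightarrow> x^2 + y^2 < 1" by (subst real_sqrt_less_iff) auto
 finally show ?thesis .
 qed
 then show ?thesis by (auto simp: mem_Hp)
qed

lemma section_Hp':
 assumes "0 < y" "y < 1"
 shows "(x, y) \<in> Hp \<longleftrightarrow> x \<in> {- sqrt (1 - y^2)<..<sqrt (1 - y^2)}"
proof -
 have "\<bar>x\<bar> < sqrt (1 - y^2) \<longleftrightarrow> x^2 + y^2 < 1"
 proof -
 have "\<bar>x\<bar> < sqrt (1 - y^2) \<longleftrightarrow> sqrt (x^2) < sqrt (1 - y^2)" by simp
 also have "... \<longleftrightarrow> x^2 + y^2 < 1" by (subst real_sqrt_less_iff) auto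
 finally show ?thesis .
 qed
 then show ?thesis using assms by (auto simp: mem_Hp abs_less_iff)
qed

lemma FTC_open_interval:
 fixes f F :: "real => real"
 assumes "a <= b" "continuous_on {a..b} f"
 and "!!y. a <= y ==> y <= b ==> (F has_real_derivative f y) (at y)"
 shows "(\<integral>y. indicator {a<..<b} y * f y \<partial>lborel) = F b - F a"
proof -
 have "(LBINT y=a..b. f y) = F b - F a"
 using assms by (intro interval_integral_FTC_finite)
 (auto simp: min_def max_def has_real_derivative_iff_has_vector_derivative
 intro: has_vector_derivative_at_within)
 moreover have "(LBINT y=a..b. f y) = (\<integral>y. indicator {a<..<b} y * f y \<partial>lborel)"
 using assms(1) by (simp add: interval_lebesgue_integral_def set_lebesgue_integral_def)
 ultimately show ?thesis by simp
qed

lemma integral_open_closed: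
 fixes f :: "real => real"
 shows "(LBINT y:{a<..<b}. f y) = (LBINT y:{a..b}. f y)"
proof -
 have "(LBINT y:{a<..<b}. f y) = (\<integral>y. indicator {a..b} y * f y \<partial>lborel)"
 unfolding set_lebesgue_integral_def
 proof (rule integral_discrete_difference[where X="{a,b}"])
 qed (auto simp: indicator_def)
 then show ?thesis by (simp add: set_lebesgue_integral_def)
qed

lemma LBINT_eq_HK:
 fixes f :: "real => real"
 assumes "continuous_on {a..b} f"
 shows "(LBINT y:{a..b}. f y) = integral {a..b} f" "set_integrable lborel {a..b} f"
proof -
 show "set_integrable lborel {a..b} f"
 unfolding set_integrable_def by (rule borel_integrable_compact[OF compact_Icc assms])
 then show "(LBINT y:{a..b}. f y) = integral {a..b} f"
 by (rule set_borel_integral_eq_integral(2))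
qed

text \<open>Fubini over vertical sections, the fundamental theorem of calculus on each, and the
  substitution x = cos th on their upper ends. The flat side enters with a minus sign because its
  outer normal is (0, -1).\<close>

lemma div_Hp_y:
 fixes F :: "real \<times> real => real"
 assumes F: "!!x y. (x,y) \<in> Kp ==> ((%y. F (x, y)) has_real_derivative f (x, y)) (at y)"
 and cF: "continuous_on Kp F" and cf: "continuous_on Kp f"
 shows "(LBINT x:Hp. f x) = (LBINT th:{0..pi}. F (cos th, sin th) * sin th) - (LBINT t:{-1..1}. F (t, 0))"
proof -
 have inK: "(x, y) \<in> Kp" if "\<bar>x\<bar> <= 1" "0 <= y" "y <= sqrt (1 - x^2)" for x y
 proof -
 have "y^2 <= (sqrt (1 - x^2))^2" using that by (intro power_mono) auto
 moreover have "x^2 <= 1" using that by (simp add: abs_square_le_1)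
 ultimately have "x^2 + y^2 <= 1" by simp
 then show ?thesis using that by (simp add: Kp_def norm_Pair)
 qed
 have arcK: "(x, sqrt (1 - x^2)) \<in> Kp" if "x \<in> {-1..1}" for x
 using that by (intro inK) (auto simp: abs_square_le_1)
 let ?h = "%p. indicator Hp p *\<^sub>R f p"
 have int: "integrable (lborel \<Otimes>\<^sub>M lborel) ?h"
 using set_integrable_Hp[OF cf] by (simp add: set_integrable_def lborel_prod)
 have "(LBINT x:Hp. f x) = (\<integral>x. (\<integral>y. ?h (x, y) \<partial>lborel) \<partial>lborel)"
 unfolding set_lebesgue_integral_def lborel_prod[symmetric]
 by (rule lborel_pair.integral_fst'[OF int, symmetric])
 also have "... = (\<integral>x. indicator {-1<..<1} x * (F (x, sqrt (1 - x^2)) - F (x, 0)) \<partial>lborel)"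
 proof (rule Bochner_Integration.integral_cong[OF refl])
 fix x :: real
 show "(\<integral>y. ?h (x, y) \<partial>lborel) = indicator {-1<..<1} x * (F (x, sqrt (1 - x^2)) - F (x, 0))"
 proof (cases "\<bar>x\<bar> < 1")
 case True
 have x2: "x^2 < 1" using True by (simp add: abs_square_less_1)
 have "(\<integral>y. ?h (x, y) \<partial>lborel) = (\<integral>y. indicator {0<..<sqrt (1 - x^2)} y * f (x, y) \<partial>lborel)"
 using section_Hp[OF True] by (intro Bochner_Integration.integral_cong) (auto simp: indicator_def)
 also have "... = F (x, sqrt (1 - x^2)) - F (x, 0)"
 proof (rule FTC_open_interval)
 show "continuous_on {0..sqrt (1 - x^2)} (%y. f (x, y))"
 using True inK by (intro continuous_on_compose2[OF cf] continuous_intros) auto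
 qed (use F inK True x2 in auto)
 finally show ?thesis using True by (auto simp: indicator_def)
 next
 case False
 then have "(x, y) \<notin> Hp" for y
 using Hp_bounds(2)[of "(x,y)"] abs_square_less_1[of x]
 by (smt (verit, ccfv_threshold) fst_conv snd_conv zero_le_power2)
 then show ?thesis using False by (auto simp: indicator_def)
 qed
 qed
 also have "... = (LBINT x:{-1..1}. F (x, sqrt (1 - x^2)) - F (x, 0))"
 by (subst integral_open_closed[symmetric]) (simp add: set_lebesgue_integral_def)
 also have "... = (LBINT x:{-1..1}. F (x, sqrt (1 - x^2))) - (LBINT t:{-1..1}. F (t, 0))"
 proof (rule set_integral_diff(2))
 show "set_integrable lborel {-1..1} (%x. F (x, 0))"
 by (intro LBINT_eq_HK(2) continuous_on_compose2[OF cF] continuous_intros) (auto simp: Kp_def norm_Pair)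
 show "set_integrable lborel {-1..1} (%x. F (x, sqrt (1 - x^2)))"
 by (intro LBINT_eq_HK(2) continuous_on_compose2[OF cF] continuous_intros) (auto intro!: arcK)
 qed
 also have "(LBINT x:{-1..1}. F (x, sqrt (1 - x^2))) = (LBINT th:{0..pi}. F (cos th, sin th) * sin th)"
 proof -
 have c1: "continuous_on {-1..1} (%x. F (x, sqrt (1 - x^2)))"
 by (intro continuous_on_compose2[OF cF] continuous_intros) (auto intro!: arcK)
 have c2: "continuous_on {0..pi} (%th. F (cos th, sin th) * sin th)"
 by (intro continuous_intros continuous_on_compose2[OF cF]) (auto simp: Kp_def norm_Pair sin_ge_zero)
 \<comment> \<open>\<open>cos\<close> decreases, so the first of the two integrals runs over the
   empty interval \<open>{1..-1}\<close> and vanishes; the second one remains with its minus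
   sign.\<close>
 have sub: "((%th. (- sin th) *\<^sub>R F (cos th, sqrt (1 - (cos th)^2))) has_integral
 (integral {cos 0..cos pi} (%x. F (x, sqrt (1 - x^2)))
 - integral {cos pi..cos 0} (%x. F (x, sqrt (1 - x^2))))) {0..pi}"
 by (rule has_integral_substitution_general[where s="{}" and c="-1" and d=1])
 (use c1 in \<open>auto intro!: continuous_intros intro: has_field_derivative_at_within[OF DERIV_cos]\<close>)
 have "((%th. - ((- sin th) *\<^sub>R F (cos th, sqrt (1 - (cos th)^2)))) has_integral
 (integral {-1..1} (%x. F (x, sqrt (1 - x^2))))) {0..pi}"
 using has_integral_neg[OF sub] by (simp del: scaleR_minus_left real_scaleR_def)
 then have "((%th. F (cos th, sin th) * sin th) has_integral
 (integral {-1..1} (%x. F (x, sqrt (1 - x^2))))) {0..pi}"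
 proof (rule has_integral_eq[rotated])
 fix th :: real assume "th \<in> {0..pi}"
 then have "sqrt (1 - (cos th)^2) = sin th"
 by (simp add: sin_squared_eq[symmetric] sin_ge_zero)
 then show "- ((- sin th) *\<^sub>R F (cos th, sqrt (1 - (cos th)^2))) = F (cos th, sin th) * sin th" by simp
 qed
 then show ?thesis by (simp add: LBINT_eq_HK(1)[OF c1] LBINT_eq_HK(1)[OF c2] integral_unique)
 qed
 finally show ?thesis .
qed

text \<open>Horizontal sections end on the arc on both sides and the flat side has a vertical
  normal, so the arc carries the whole boundary term.\<close>

lemma div_Hp_x:
 fixes F :: "real \<times> real => real"
 assumes F: "!!x y. (x,y) \<in> Kp ==> ((%x. F (x, y)) has_real_derivative f (x, y)) (at x)"
 and cF: "continuous_on Kp F" and cf: "continuous_on Kp f"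
 shows "(LBINT x:Hp. f x) = (LBINT th:{0..pi}. F (cos th, sin th) * cos th)"
proof -
 have inK: "(x, y) \<in> Kp" if "\<bar>x\<bar> <= sqrt (1 - y^2)" "0 <= y" "y <= 1" for x y
 proof -
 have "\<bar>x\<bar>\<^sup>2 <= (sqrt (1 - y^2))^2" using that by (intro power_mono) auto
 moreover have "y^2 <= 1" using that by (simp add: abs_square_le_1)
 ultimately have "x^2 + y^2 <= 1" by simp
 then show ?thesis using that by (simp add: Kp_def norm_Pair)
 qed
 have arcK: "(sqrt (1 - y^2), y) \<in> Kp" "(- sqrt (1 - y^2), y) \<in> Kp" if "y \<in> {0..1}" for y
 using that by (auto intro!: inK simp: abs_square_le_1)
 let ?h = "%p. indicator Hp p *\<^sub>R f p"
 have int: "integrable (lborel \<Otimes>\<^sub>M lborel) ?h"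
 using set_integrable_Hp[OF cf] by (simp add: set_integrable_def lborel_prod)
 have "(LBINT x:Hp. f x) = (\<integral>y. (\<integral>x. ?h (x, y) \<partial>lborel) \<partial>lborel)"
 unfolding set_lebesgue_integral_def lborel_prod[symmetric]
 using lborel_pair.integral_snd[of "%x y. ?h (x, y)"] int
 by (simp add: case_prod_unfold del: real_scaleR_def)
 also have "... = (\<integral>y. indicator {0<..<1} y * (F (sqrt (1 - y^2), y) - F (- sqrt (1 - y^2), y)) \<partial>lborel)"
 proof (rule Bochner_Integration.integral_cong[OF refl])
 fix y :: real
 show "(\<integral>x. ?h (x, y) \<partial>lborel) = indicator {0<..<1} y * (F (sqrt (1 - y^2), y) - F (- sqrt (1 - y^2), y))"
 proof (cases "0 < y \<and> y < 1")
 case True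
 have y2: "y^2 < 1" using True by (simp add: abs_square_less_1)
 have "(\<integral>x. ?h (x, y) \<partial>lborel) = (\<integral>x. indicator {- sqrt (1 - y^2)<..<sqrt (1 - y^2)} x * f (x, y) \<partial>lborel)"
 using section_Hp'[of y] True by (intro Bochner_Integration.integral_cong) (auto simp: indicator_def)
 also have "... = F (sqrt (1 - y^2), y) - F (- sqrt (1 - y^2), y)"
 proof (rule FTC_open_interval)
 have "sqrt (1 - y^2) \<ge> 0" using y2 by simp
 then show "- sqrt (1 - y^2) <= sqrt (1 - y^2)" by linarith
 show "continuous_on {- sqrt (1 - y^2)..sqrt (1 - y^2)} (%x. f (x, y))"
 using True inK by (intro continuous_on_compose2[OF cf] continuous_intros) auto
 qed (use F inK True y2 in auto)
 finally show ?thesis using True by (auto simp: indicator_def)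
 next
 case False
 then have "(x, y) \<notin> Hp" for x
 using Hp_bounds(1,2)[of "(x,y)"] abs_square_less_1[of y]
 by (smt (verit, ccfv_threshold) fst_conv snd_conv zero_le_power2)
 then show ?thesis using False by (auto simp: indicator_def)
 qed
 qed
 also have "... = (LBINT y:{0..1}. F (sqrt (1 - y^2), y) - F (- sqrt (1 - y^2), y))"
 by (subst integral_open_closed[symmetric]) (simp add: set_lebesgue_integral_def)
 also have "... = (LBINT y:{0..1}. F (sqrt (1 - y^2), y)) - (LBINT y:{0..1}. F (- sqrt (1 - y^2), y))"
 proof (rule set_integral_diff(2))
 show "set_integrable lborel {0..1} (%y. F (sqrt (1 - y^2), y))"
 by (intro LBINT_eq_HK(2) continuous_on_compose2[OF cF] continuous_intros) (auto intro!: arcK)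
 show "set_integrable lborel {0..1} (%y. F (- sqrt (1 - y^2), y))"
 by (intro LBINT_eq_HK(2) continuous_on_compose2[OF cF] continuous_intros) (auto intro!: arcK)
 qed
 also have "... = (LBINT th:{0..pi}. F (cos th, sin th) * cos th)"
 proof -
 have c1: "continuous_on {0..1} (%y. F (sqrt (1 - y^2), y))"
 and c1': "continuous_on {0..1} (%y. F (- sqrt (1 - y^2), y))"
 by (intro continuous_on_compose2[OF cF] continuous_intros; auto intro!: arcK)+
 have c2: "continuous_on {0..pi} (%th. F (cos th, sin th) * cos th)"
 by (intro continuous_intros continuous_on_compose2[OF cF]) (auto simp: Kp_def norm_Pair sin_ge_zero)
 \<comment> \<open>The right and left ends of the sections trace the two quarter arcs, on each of
   which \<open>sin th\<close> is monotone; hence the split at \<open>pi/2\<close>.\<close>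
 have 1: "((%th. cos th *\<^sub>R F (sqrt (1 - (sin th)^2), sin th)) has_integral
 (integral {sin 0..sin (pi/2)} (%y. F (sqrt (1 - y^2), y))
 - integral {sin (pi/2)..sin 0} (%y. F (sqrt (1 - y^2), y)))) {0..pi/2}"
 by (rule has_integral_substitution_general[where s="{}" and c="0" and d=1])
 (use c1 in \<open>auto intro!: continuous_intros sin_ge_zero intro: has_field_derivative_at_within[OF DERIV_sin]\<close>)
 have 2: "((%th. cos th *\<^sub>R F (- sqrt (1 - (sin th)^2), sin th)) has_integral
 (integral {sin (pi/2)..sin pi} (%y. F (- sqrt (1 - y^2), y))
 - integral {sin pi..sin (pi/2)} (%y. F (- sqrt (1 - y^2), y)))) {pi/2..pi}"
 by (rule has_integral_substitution_general[where s="{}" and c="0" and d=1])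
 (use c1' in \<open>auto intro!: continuous_intros sin_ge_zero intro: has_field_derivative_at_within[OF DERIV_sin]\<close>)
 have "((%th. F (cos th, sin th) * cos th) has_integral (integral {0..1} (%y. F (sqrt (1 - y^2), y)))) {0..pi/2}"
 proof (rule has_integral_eq)
 show "((%th. cos th *\<^sub>R F (sqrt (1 - (sin th)^2), sin th)) has_integral
 (integral {0..1} (%y. F (sqrt (1 - y^2), y)))) {0..pi/2}" using 1 by simp
 fix th :: real assume "th \<in> {0..pi/2}"
 then show "cos th *\<^sub>R F (sqrt (1 - (sin th)^2), sin th) = F (cos th, sin th) * cos th"
 by (simp add: cos_squared_eq[symmetric] cos_ge_zero)
 qed
 moreover have "((%th. F (cos th, sin th) * cos th) has_integral - (integral {0..1} (%y. F (- sqrt (1 - y^2), y)))) {pi/2..pi}"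
 proof (rule has_integral_eq)
 show "((%th. cos th *\<^sub>R F (- sqrt (1 - (sin th)^2), sin th)) has_integral
 - (integral {0..1} (%y. F (- sqrt (1 - y^2), y)))) {pi/2..pi}" using 2 by simp
 fix th :: real assume th: "th \<in> {pi/2..pi}"
 have "cos th <= 0" using th cos_ge_zero[of "th - pi"] by (simp add: cos_diff)
 then have "- sqrt (1 - (sin th)^2) = cos th"
 by (simp add: cos_squared_eq[symmetric])
 then show "cos th *\<^sub>R F (- sqrt (1 - (sin th)^2), sin th) = F (cos th, sin th) * cos th"
 by simp
 qed
 ultimately have "((%th. F (cos th, sin th) * cos th) has_integral (integral {0..1} (%y. F (sqrt (1 - y^2), y)))
 + - (integral {0..1} (%y. F (- sqrt (1 - y^2), y)))) {0..pi}"
 by (intro has_integral_combine[where c="pi/2"]) auto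
 then show ?thesis by (simp add: LBINT_eq_HK(1)[OF c1] LBINT_eq_HK(1)[OF c1'] LBINT_eq_HK(1)[OF c2] integral_unique)
 qed
 finally show ?thesis .
qed

lemma DERIV_quadratic_bound:
 fixes f :: "real => real"
 assumes "!!h. \<bar>f (x + h) - f x - d * h\<bar> <= K * h^2"
 shows "(f has_real_derivative d) (at x)"
proof -
 have "(%h. (f (x + h) - f x) / h - d) \<midarrow>0\<rightarrow> 0"
 proof (rule Lim_null_comparison)
 show "\<forall>\<^sub>F h in at 0. norm ((f (x + h) - f x) / h - d) <= K * \<bar>h\<bar>"
 unfolding eventually_at_topological
 proof (intro exI[of _ UNIV] conjI ballI impI)
 fix h :: real assume h: "h \<noteq> 0"
 have "norm ((f (x + h) - f x) / h - d) = \<bar>f (x + h) - f x - d * h\<bar> / \<bar>h\<bar>"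
 using h by (simp add: diff_divide_distrib flip: abs_divide)
 also have "... <= K * h^2 / \<bar>h\<bar>" by (intro divide_right_mono assms) auto
 also have "... = K * \<bar>h\<bar>" using h by (simp add: power2_eq_square abs_if)
 finally show "norm ((f (x + h) - f x) / h - d) <= K * \<bar>h\<bar>" .
 qed auto
 show "(%h. K * \<bar>h\<bar>) \<midarrow>0\<rightarrow> 0" by (auto intro!: tendsto_eq_intros)
 qed
 then show ?thesis by (simp add: DERIV_def LIM_zero_iff)
qed

text \<open>Squaring removes the kink of the positive part. The smoothed truncation and the
  extension of potentials below the axis are both built from this C1 function.\<close>

lemma DERIV_max_sq [derivative_intros]:
 assumes "(f has_real_derivative d) (at x within S)"
 shows "((%x. (max (f x) 0)^2) has_real_derivative 2 * max (f x) 0 * d) (at x within S)"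
proof -
 have "((%y. (max y 0)^2) has_real_derivative 2 * max (f x) 0) (at (f x))"
 proof (rule DERIV_quadratic_bound[where K=1])
 fix h :: real
 define y where "y = f x"
 consider "y \<ge> 0" "y + h \<ge> 0" | "y < 0" "y + h < 0" | "y \<ge> 0" "y + h < 0" | "y < 0" "y + h \<ge> 0"
 by linarith
 then have "\<bar>(max (y + h) 0)\<^sup>2 - (max y 0)^2 - 2 * max y 0 * h\<bar> <= 1 * h^2"
 proof cases
 case 1 then show ?thesis by (simp add: max_def power2_eq_square algebra_simps)
 next
 case 2 then show ?thesis by (simp add: max_def)
 next
 case 3
 have "h^2 - (- (y^2) - 2 * y * h) = (y + h)^2" "h^2 + (- (y^2) - 2 * y * h) = (- (y + h)) * (y - h) + 2 * (y * (- h))"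
 by (simp_all add: power2_eq_square algebra_simps)
 moreover have "(- (y + h)) * (y - h) \<ge> 0" "y * (- h) \<ge> 0" using 3 by (auto intro!: mult_nonpos_nonneg mult_nonneg_nonpos)
 ultimately have "\<bar>- (y^2) - 2 * y * h\<bar> <= h^2"
 using zero_le_power2[of "y + h"] unfolding abs_le_iff by linarith
 then show ?thesis using 3 by (simp add: max_def)
 next
 case 4
 then have "(y + h)^2 <= h^2" by (intro power_mono) auto
 then show ?thesis using 4 by (simp add: max_def)
 qed
 then show "\<bar>(max (f x + h) 0)\<^sup>2 - (max (f x) 0)^2 - 2 * max (f x) 0 * h\<bar> <= 1 * h^2"
 by (simp add: y_def)
 qed
 from DERIV_chain2[OF this assms] show ?thesis .
qed

section \<open>Green's formula for holomorphic fields; radial integrals\<close>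

definition cx :: "real \<times> real => complex" where "cx p = Complex (fst p) (snd p)"

lemma cx_simps [simp]: "Re (cx p) = fst p" "Im (cx p) = snd p"
 by (simp_all add: cx_def)

lemma norm_cx [simp]: "cmod (cx p) = norm p"
 by (cases p) (simp add: cmod_def norm_Pair)

lemma bounded_linear_cx: "bounded_linear cx"
proof (rule bounded_linear_intro[where K=1])
 show "norm (cx p) <= norm p * 1" for p by simp
qed (auto simp: complex_eq_iff)

lemma continuous_on_cx [continuous_intros]:
 "continuous_on S f ==> continuous_on S (%x. cx (f x))"
 using bounded_linear.continuous_on[OF bounded_linear_cx] .

lemma cx_polar [simp]: "cx (cos th, sin th) = cis th" "cx (t, 0) = of_real t"
 by (auto simp: complex_eq_iff)

lemma has_derivative_cx: "(cx has_derivative cx) (at x within S)"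
 by (rule bounded_linear_imp_has_derivative[OF bounded_linear_cx])

text \<open>Cauchy-Riemann equations: the gradients of the imaginary and of the real part are the
  same vector up to a right-angle turn. This lets one holomorphic derivative describe both the
  Dirichlet extension and the Neumann solution.\<close>

lemma has_derivative_holo:
 assumes "(F has_field_derivative f) (at (cx x))"
 shows "((%p. Im (F (cx p))) has_derivative (%h. (Im f, Re f) \<bullet> h)) (at x)"
 and "((%p. Re (F (cx p))) has_derivative (%h. (Re f, - Im f) \<bullet> h)) (at x)"
proof -
 have "((%p. F (cx p)) has_derivative (%h. f * cx h)) (at x)"
 using has_derivative_compose[OF has_derivative_cx assms[unfolded has_field_derivative_def]] .
 from has_derivative_Im[OF this] has_derivative_Re[OF this]
 show "((%p. Im (F (cx p))) has_derivative (%h. (Im f, Re f) \<bullet> h)) (at x)"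
 "((%p. Re (F (cx p))) has_derivative (%h. (Re f, - Im f) \<bullet> h)) (at x)"
 by (simp_all add: inner_prod_def algebra_simps case_prod_unfold)
qed

lemma has_derivative_grad_partials:
 assumes "(v has_derivative (%h. D \<bullet> h)) (at (x::real, y::real))"
 shows "((%x. v (x, y)) has_real_derivative fst D) (at x)"
 "((%y. v (x, y)) has_real_derivative snd D) (at y)"
proof -
 have "((%x. (x, y)) has_derivative (%h. (h, 0))) (at x)" "((%y. (x, y)) has_derivative (%h. (0, h))) (at y)"
 by (auto intro!: derivative_eq_intros)
 from this[THEN has_derivative_compose] assms
 have "((%x. v (x, y)) has_derivative (%h. D \<bullet> (h, 0))) (at x)" "((%y. v (x, y)) has_derivative (%h. D \<bullet> (0, h))) (at y)"
 by blast+
 then show "((%x. v (x, y)) has_real_derivative fst D) (at x)"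
 "((%y. v (x, y)) has_real_derivative snd D) (at y)"
 by (auto simp: has_field_derivative_def inner_prod_def mult.commute[of _ "fst D"] mult.commute[of _ "snd D"]
 elim!: has_derivative_eq_rhs)
qed

lemma C1_funD:
 assumes "C1_fun v Dv"
 shows "(v has_derivative (%h. Dv x \<bullet> h)) (at x)" "continuous_on S Dv" "continuous_on S v"
 "((%x. v (x, b)) has_real_derivative fst (Dv (a, b))) (at a)"
 "((%y. v (a, y)) has_real_derivative snd (Dv (a, b))) (at b)"
proof -
 show *: "(v has_derivative (%h. Dv x \<bullet> h)) (at x)" for x using assms unfolding C1_fun_def by blast
 show "continuous_on S Dv" using assms by (auto simp: C1_fun_def intro: continuous_on_subset)
 show "continuous_on S v"
 by (intro continuous_at_imp_continuous_on ballI has_derivative_continuous[OF *])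
 show "((%x. v (x, b)) has_real_derivative fst (Dv (a, b))) (at a)"
 "((%y. v (a, y)) has_real_derivative snd (Dv (a, b))) (at b)"
 using has_derivative_grad_partials[OF *] by blast+
qed

lemma open_Im_gt: "open {z. - c < Im z}"
 by (intro open_Collect_less continuous_intros)

text \<open>The field (Im f, Re f) is divergence free by the Cauchy-Riemann equations, so the
  divergence of \<open>v\<close> times this field is its product with \<open>Dv\<close>. Its outer
  normal component is Im (cis th f) on the arc and - Re f on the flat side.\<close>

lemma green_holo:
 assumes c: "c > 0" and f: "f holomorphic_on {z. - c < Im z}" and v: "C1_fun v Dv"
 shows "(LBINT x:Hp. (Im (f (cx x)), Re (f (cx x))) \<bullet> Dv x) =
 (LBINT th:{0..pi}. v (cos th, sin th) * Im (cis th * f (cis th))) - (LBINT t:{-1..1}. v (t, 0) * Re (f t))"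
proof -
 let ?S = "{z. - c < Im z}"
 have Kin: "cx x \<in> ?S" if "x \<in> Kp" for x using that c by (auto simp: Kp_def)
 have cf: "continuous_on Kp (%x. f (cx x))"
 by (rule continuous_on_compose2[OF holomorphic_on_imp_continuous_on[OF f]])
 (use Kin in \<open>auto intro!: continuous_intros\<close>)
 have cf': "continuous_on Kp (%x. deriv f (cx x))"
 by (rule continuous_on_compose2[OF holomorphic_on_imp_continuous_on[OF holomorphic_deriv[OF f open_Im_gt]]])
 (use Kin in \<open>auto intro!: continuous_intros\<close>)
 have D: "(f has_field_derivative deriv f (cx x)) (at (cx x))" if "x \<in> Kp" for x
 using holomorphic_derivI[OF f open_Im_gt] Kin[OF that] by blast
 note DI = has_derivative_grad_partials[OF has_derivative_holo(1)[OF D]]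
 note DR = has_derivative_grad_partials[OF has_derivative_holo(2)[OF D]]
 note [continuous_intros] = C1_funD(2,3)[OF v]
 \<comment> \<open>The two halves of that divergence; the terms with \<open>deriv f\<close> cancel
   in their sum.\<close>
 let ?f1 = "%x. fst (Dv x) * Im (f (cx x)) + v x * Im (deriv f (cx x))"
 let ?f2 = "%x. snd (Dv x) * Re (f (cx x)) - v x * Im (deriv f (cx x))"
 have c1: "continuous_on Kp ?f1" and c2: "continuous_on Kp ?f2"
 by (intro continuous_intros cf cf')+
 have 1: "(LBINT x:Hp. ?f1 x) = (LBINT th:{0..pi}. v (cos th, sin th) * Im (f (cx (cos th, sin th))) * cos th)"
 proof (rule div_Hp_x)
 show "((%x. v (x, y) * Im (f (cx (x, y)))) has_real_derivative ?f1 (x, y)) (at x)" if "(x, y) \<in> Kp" for x y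
 using DERIV_mult[OF C1_funD(4)[OF v] DI(1)[OF that]] by (simp add: algebra_simps)
 qed (intro c1 continuous_intros cf)+
 have 2: "(LBINT x:Hp. ?f2 x) = (LBINT th:{0..pi}. v (cos th, sin th) * Re (f (cx (cos th, sin th))) * sin th)
 - (LBINT t:{-1..1}. v (t, 0) * Re (f (cx (t, 0))))"
 proof (rule div_Hp_y)
 show "((%y. v (x, y) * Re (f (cx (x, y)))) has_real_derivative ?f2 (x, y)) (at y)" if "(x, y) \<in> Kp" for x y
 using DERIV_mult[OF C1_funD(5)[OF v] DR(2)[OF that]] by (simp add: algebra_simps)
 qed (intro c2 continuous_intros cf)+
 have arcK: "(cos th, sin th) \<in> Kp" if "th \<in> {0..pi}" for th
 using that by (auto simp: Kp_def norm_Pair sin_ge_zero)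
 have cfa: "continuous_on {0..pi} (%th. f (cis th))"
 using continuous_on_compose2[OF cf, of "{0..pi}" "%th. (cos th, sin th)"] arcK
 by (simp add: continuous_on_Pair continuous_on_cos continuous_on_sin image_subset_iff)
 have "(LBINT x:Hp. (Im (f (cx x)), Re (f (cx x))) \<bullet> Dv x) = (LBINT x:Hp. ?f1 x + ?f2 x)"
 by (simp add: inner_prod_def algebra_simps)
 also have "... = (LBINT x:Hp. ?f1 x) + (LBINT x:Hp. ?f2 x)"
 by (intro set_integral_add(2) set_integrable_Hp c1 c2)
 also have "... = ((LBINT th:{0..pi}. v (cos th, sin th) * Im (f (cis th)) * cos th)
 + (LBINT th:{0..pi}. v (cos th, sin th) * Re (f (cis th)) * sin th)) - (LBINT t:{-1..1}. v (t, 0) * Re (f t))"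
 unfolding 1 2 by simp
 also have "(LBINT th:{0..pi}. v (cos th, sin th) * Im (f (cis th)) * cos th)
 + (LBINT th:{0..pi}. v (cos th, sin th) * Re (f (cis th)) * sin th)
 = (LBINT th:{0..pi}. v (cos th, sin th) * Im (f (cis th)) * cos th + v (cos th, sin th) * Re (f (cis th)) * sin th)"
 by (intro set_integral_add(2)[symmetric] LBINT_eq_HK(2) continuous_intros cfa
 continuous_on_compose2[OF C1_funD(3)[OF v, of UNIV], of _ "%x. (cos x, sin x)"]) auto
 also have "... = (LBINT th:{0..pi}. v (cos th, sin th) * Im (cis th * f (cis th)))"
 by (simp add: algebra_simps)
 finally show ?thesis .
qed

text \<open>Divergence theorem for the field v^2 x, whose normal component is v^2 on the arc and 0
  on the flat side. For C1 functions it bounds the L2 norm on the arc by the Sobolev norm.\<close>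

lemma arc_trace_identity:
 assumes v: "C1_fun v Dv"
 shows "(LBINT th:{0..pi}. (v (cos th, sin th))^2) = (LBINT x:Hp. 2 * (v x)^2 + 2 * v x * (x \<bullet> Dv x))"
proof -
 note [continuous_intros] = C1_funD(2,3)[OF v]
 let ?f1 = "%x. (v x)^2 + 2 * v x * fst (Dv x) * fst x"
 let ?f2 = "%x. (v x)^2 + 2 * v x * snd (Dv x) * snd x"
 have c1: "continuous_on Kp ?f1" and c2: "continuous_on Kp ?f2"
 by (intro continuous_intros)+
 have cva: "continuous_on S (%th. v (cos th, sin th))" for S
 by (rule continuous_on_compose2[OF C1_funD(3)[OF v, of UNIV]]) (auto intro!: continuous_intros)
 note [continuous_intros] = cva
 have 1: "(LBINT x:Hp. ?f1 x) = (LBINT th:{0..pi}. (v (cos th, sin th))^2 * fst (cos th, sin th) * cos th)"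
 by (rule div_Hp_x) (auto intro!: derivative_eq_intros C1_funD(4)[OF v] continuous_intros simp: algebra_simps)
 have 2: "(LBINT x:Hp. ?f2 x) = (LBINT th:{0..pi}. (v (cos th, sin th))^2 * snd (cos th, sin th) * sin th)
 - (LBINT t:{-1..1}. (v (t, 0))^2 * snd (t, 0::real))"
 by (rule div_Hp_y) (auto intro!: derivative_eq_intros C1_funD(5)[OF v] continuous_intros simp: algebra_simps)
 have "(LBINT x:Hp. 2 * (v x)^2 + 2 * v x * (x \<bullet> Dv x)) = (LBINT x:Hp. ?f1 x + ?f2 x)"
 by (simp add: inner_prod_def algebra_simps)
 also have "... = (LBINT x:Hp. ?f1 x) + (LBINT x:Hp. ?f2 x)"
 by (intro set_integral_add(2) set_integrable_Hp c1 c2)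
 also have "... = (LBINT th:{0..pi}. (v (cos th, sin th))^2 * cos th * cos th + (v (cos th, sin th))^2 * sin th * sin th)"
 unfolding 1 2 by (subst set_integral_add(2)) (auto intro!: LBINT_eq_HK(2) continuous_intros)
 also have "... = (LBINT th:{0..pi}. (v (cos th, sin th))^2)"
 proof (intro set_lebesgue_integral_cong allI impI)
 fix th :: real
 have "(v (cos th, sin th))^2 * cos th * cos th + (v (cos th, sin th))^2 * sin th * sin th
 = (v (cos th, sin th))^2 * ((sin th)^2 + (cos th)^2)" by (simp only: power2_eq_square algebra_simps)
 then show "(v (cos th, sin th))^2 * cos th * cos th + (v (cos th, sin th))^2 * sin th * sin th = (v (cos th, sin th))^2"
 by simp
 qed auto
 finally show ?thesis by simp
qed

text \<open>Divergence theorem for the field H(|x|^2) x: radial integrals without polar coordinates.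
  To integrate a profile in s = |x|^2 one looks for H such that 2 (s H)' equals it or dominates
  it.\<close>

lemma integral_radial:
 assumes H: "!!s. 0 <= s ==> s <= 1 ==> (H has_real_derivative H' s) (at s)"
 and cH: "continuous_on {0..1} H'"
 shows "(LBINT x:Hp. 2 * (H ((norm x)^2) + (norm x)^2 * H' ((norm x)^2))) = pi * H 1"
 and "set_integrable lborel Hp (%x. 2 * (H ((norm x)^2) + (norm x)^2 * H' ((norm x)^2)))"
proof -
 have nK: "(norm x)^2 \<in> {0..1}" if "x \<in> Kp" for x
 using that by (auto simp: Kp_def abs_square_le_1)
 have cH0: "continuous_on {0..1} H" using H
 by (intro continuous_at_imp_continuous_on ballI) (auto intro: DERIV_isCont)
 have cc: "continuous_on Kp (%x. H ((norm x)^2))" "continuous_on Kp (%x. H' ((norm x)^2))"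
 by (rule continuous_on_compose2[OF cH0] continuous_on_compose2[OF cH];
 use nK in \<open>auto intro!: continuous_intros\<close>)+
 note [continuous_intros] = cc
 let ?f1 = "%x. H ((norm x)^2) + 2 * (fst x)^2 * H' ((norm x)^2)"
 let ?f2 = "%x. H ((norm x)^2) + 2 * (snd x)^2 * H' ((norm x)^2)"
 have n2: "(norm (x, y))^2 = x^2 + y^2" for x y :: real by (simp add: norm_Pair)
 have c1: "continuous_on Kp ?f1" and c2: "continuous_on Kp ?f2"
 by (intro continuous_intros)+
 have DH1: "((%x. H ((norm (x, y))^2)) has_real_derivative H' ((norm (x, y))^2) * (2 * x)) (at x)" if "(x, y) \<in> Kp" for x y
 unfolding n2 using nK[OF that] by (intro DERIV_chain2[OF H]) (auto simp: n2 intro!: derivative_eq_intros)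
 have DH2: "((%y. H ((norm (x, y))^2)) has_real_derivative H' ((norm (x, y))^2) * (2 * y)) (at y)" if "(x, y) \<in> Kp" for x y
 unfolding n2 using nK[OF that] by (intro DERIV_chain2[OF H]) (auto simp: n2 intro!: derivative_eq_intros)
 have 1: "(LBINT x:Hp. ?f1 x) = (LBINT th:{0..pi}. H ((norm (cos th, sin th))^2) * fst (cos th, sin th) * cos th)"
 by (rule div_Hp_x[where F="%p. H ((norm p)^2) * fst p"]) (auto intro!: derivative_eq_intros DH1 continuous_intros, simp add: algebra_simps power2_eq_square)
 have 2: "(LBINT x:Hp. ?f2 x) = (LBINT th:{0..pi}. H ((norm (cos th, sin th))^2) * snd (cos th, sin th) * sin th)
 - (LBINT t::real:{-1..1}. H ((norm (t, 0::real))^2) * snd (t, 0::real))"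
 by (rule div_Hp_y[where F="%p. H ((norm p)^2) * snd p"]) (auto intro!: derivative_eq_intros DH2 continuous_intros, simp add: algebra_simps power2_eq_square)
 have eq: "2 * (H ((norm x)^2) + (norm x)^2 * H' ((norm x)^2)) = ?f1 x + ?f2 x" for x :: "real \<times> real"
 by (cases x) (simp add: n2 algebra_simps)
 show "set_integrable lborel Hp (%x. 2 * (H ((norm x)^2) + (norm x)^2 * H' ((norm x)^2)))"
 by (intro set_integrable_Hp continuous_intros)
 have "(LBINT x:Hp. 2 * (H ((norm x)^2) + (norm x)^2 * H' ((norm x)^2))) = (LBINT x:Hp. ?f1 x) + (LBINT x:Hp. ?f2 x)"
 unfolding eq by (intro set_integral_add(2) set_integrable_Hp c1 c2)
 also have "... = (LBINT th:{0..pi}. H 1 * cos th * cos th + H 1 * sin th * sin th)"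
 unfolding 1 2 by (subst set_integral_add(2)) (auto intro!: LBINT_eq_HK(2) continuous_intros simp: n2)
 also have "... = (LBINT th:{0..pi}. H 1)"
 proof (intro set_lebesgue_integral_cong allI impI)
 fix th :: real
 have "H 1 * cos th * cos th + H 1 * sin th * sin th = H 1 * ((sin th)^2 + (cos th)^2)"
 by (simp only: power2_eq_square algebra_simps)
 then show "H 1 * cos th * cos th + H 1 * sin th * sin th = H 1" by simp
 qed auto
 also have "... = pi * H 1" by (subst LBINT_eq_HK) auto
 finally show "(LBINT x:Hp. 2 * (H ((norm x)^2) + (norm x)^2 * H' ((norm x)^2))) = pi * H 1" .
qed

text \<open>\<open>C1_fun\<close> asks for the whole plane, but F lives on Im z > -c only. The
  height y is therefore replaced by a C1 function \<open>hq\<close> of y that is the identity for y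
  \<ge> 0 and stays above -c; on the closed upper half plane nothing changes.\<close>

lemma C1_ext:
 assumes c: "c > 0" and F: "F holomorphic_on {z. - c < Im z}"
 shows "\<exists>v Dv. C1_fun v Dv \<and> (\<forall>x. snd x \<ge> 0 \<longrightarrow> v x = Im (F (cx x)) \<and>
 Dv x = (Im (deriv F (cx x)), Re (deriv F (cx x))))"
proof -
 let ?S = "{z. - c < Im z}"
 let ?m = "%y. (max (- y) 0)^2"
 define r where "r y = sqrt (1 + (max (- y) 0)^2 / c^2)" for y :: real
 define hq where "hq y = y / r y" for y :: real
 define hq' where "hq' y = (r y - y * (- max (- y) 0 / c^2 / r y)) / (r y)^2" for y :: real
 have rpos: "1 <= r y" for y by (simp add: r_def)
 have r2: "(r y)^2 = 1 + (max (- y) 0)^2 / c^2" for y by (simp add: r_def)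
 have hq_pos: "hq y = y" "hq' y = 1" if "y \<ge> 0" for y using that by (auto simp: hq_def hq'_def r_def max_def)
 have hq_gt: "- c < hq y" for y
 proof (cases "y \<ge> 0")
 case True then show ?thesis using c by (simp add: hq_pos)
 next
 case False
 have "(- y)^2 < (c * r y)^2" using False c by (simp add: power_mult_distrib r2 max_def field_simps)
 then have "- y < c * r y" using c rpos[of y] by (intro power_less_imp_less_base[of "-y" 2]) auto
 then show ?thesis using rpos[of y] by (simp add: hq_def field_simps)
 qed
 have Dhq: "(hq has_real_derivative hq' y) (at y)" for y
 proof -
 have r: "(r has_real_derivative (- max (- y) 0 / c^2 / r y)) (at y)"
 proof -
 have p: "0 < 1 + (max (- y) 0)^2 / c^2" by (intro add_pos_nonneg) auto
 have "((%y. 1 + (max (- y) 0)^2 / c^2) has_real_derivative (0 + 2 * max (- y) 0 * (- 1) / c^2)) (at y)"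
 by (intro DERIV_add DERIV_const DERIV_cdivide DERIV_max_sq DERIV_minus[OF DERIV_ident])
 from DERIV_chain2[OF DERIV_real_sqrt[OF p] this]
 show ?thesis unfolding r_def[abs_def] by (rule DERIV_cong) (simp add: field_simps)
 qed
 show ?thesis unfolding hq_def[abs_def] hq'_def
 using rpos[of y] by (auto intro!: derivative_eq_intros r simp: power2_eq_square)
 qed
 have cr: "continuous_on UNIV r" unfolding r_def by (intro continuous_intros) (use c in auto)
 have r0: "r y \<noteq> 0" for y using rpos[of y] by auto
 have chq: "continuous_on UNIV hq'" "continuous_on UNIV hq" unfolding hq'_def hq_def
 by (intro continuous_intros cr; use c r0 in auto)+
 let ?q = "%p::real \<times> real. (fst p, hq (snd p))"
 have q_in: "cx (?q p) \<in> ?S" for p using hq_gt by simp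
 have chq2: "continuous_on UNIV (%p::real \<times> real. hq (snd p))" "continuous_on UNIV (%p::real \<times> real. hq' (snd p))"
 by (rule continuous_on_compose2[OF chq(2)] continuous_on_compose2[OF chq(1)]; auto intro!: continuous_intros)+
 have cq: "continuous_on UNIV (%p. cx (?q p))" by (intro continuous_intros chq2)
 define v where "v p = Im (F (cx (?q p)))" for p
 define Dv where "Dv p = (Im (deriv F (cx (?q p))), Re (deriv F (cx (?q p))) * hq' (snd p))" for p
 have "C1_fun v Dv"
 unfolding C1_fun_def
 proof (intro conjI allI)
 fix p :: "real \<times> real"
 have D: "(F has_field_derivative deriv F (cx (?q p))) (at (cx (?q p)))"
 using holomorphic_derivI[OF F open_Im_gt q_in] .
 have dq: "(?q has_derivative (%h. (fst h, hq' (snd p) * snd h))) (at p)"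
 by (intro has_derivative_Pair has_derivative_compose[OF _ Dhq[unfolded has_field_derivative_def]] derivative_intros)
 show "(v has_derivative (%h. Dv p \<bullet> h)) (at p)"
 unfolding v_def using has_derivative_compose[OF dq has_derivative_holo(1)[OF D]]
 by (simp add: Dv_def inner_prod_def algebra_simps)
 next
 have "continuous_on UNIV (%p. deriv F (cx (?q p)))"
 by (rule continuous_on_compose2[OF holomorphic_on_imp_continuous_on[OF holomorphic_deriv[OF F open_Im_gt]]])
 (use q_in cq in auto)
 then show "continuous_on UNIV Dv" unfolding Dv_def by (intro continuous_intros chq2)
 qed
 moreover have "v x = Im (F (cx x)) \<and> Dv x = (Im (deriv F (cx x)), Re (deriv F (cx x)))" if "snd x \<ge> 0" for x
 using that by (simp add: v_def Dv_def hq_pos)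
 ultimately show ?thesis by blast
qed

section \<open>Smooth functions of class C^k and the du Bois-Reymond lemma\<close>

lemma Ck_scale: "Ck k f ==> Ck k (%x. f x * c)"
proof (induction k arbitrary: f)
 case 0 then show ?case by (simp add: continuous_on_mult_right)
next
 case (Suc k)
 then obtain Df where D: "!!x. (f has_derivative Df x) (at x)" "!!h. Ck k (%x. Df x h)" by auto
 have "((%x. f x * c) has_derivative (%h. Df x h * c)) (at x)" for x
 using has_derivative_mult_left[OF D(1)] .
 with Suc.IH[OF D(2)] show ?case by (auto intro!: exI[of _ "%x h. Df x h * c"])
qed

lemma Ck_add: "Ck k f ==> Ck k g ==> Ck k (%x. f x + g x)"
proof (induction k arbitrary: f g)
 case 0 then show ?case by (simp add: continuous_on_add)
next
 case (Suc k)
 from Suc.prems obtain Df Dg where D: "!!x. (f has_derivative Df x) (at x)" "!!h. Ck k (%x. Df x h)"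
 "!!x. (g has_derivative Dg x) (at x)" "!!h. Ck k (%x. Dg x h)" by auto
 have "((%x. f x + g x) has_derivative (%h. Df x h + Dg x h)) (at x)" for x
 using has_derivative_add[OF D(1,3)] .
 with Suc.IH[OF D(2,4)] show ?case by (auto intro!: exI[of _ "%x h. Df x h + Dg x h"])
qed

lemma Ck_Suc_imp_Ck: "Ck (Suc k) f ==> Ck k f"
proof (induction k arbitrary: f)
 case 0
 then obtain Df where "!!x. (f has_derivative Df x) (at x)" by auto
 then show ?case
 by (auto intro!: continuous_at_imp_continuous_on intro: has_derivative_continuous)
next
 case (Suc k)
 from Suc.prems obtain Df where D: "!!x. (f has_derivative Df x) (at x)" "!!h. Ck (Suc k) (%x. Df x h)"
 using Ck.simps(2)[of "Suc k" f] by blast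
 with Suc.IH[OF D(2)] show ?case by auto
qed

lemma Ck_mult: "Ck k f ==> Ck k g ==> Ck k (%x. f x * g x)"
proof (induction k arbitrary: f g)
 case 0 then show ?case by (simp add: continuous_on_mult)
next
 case (Suc k)
 from Suc.prems obtain Df Dg where D: "!!x. (f has_derivative Df x) (at x)" "!!h. Ck k (%x. Df x h)"
 "!!x. (g has_derivative Dg x) (at x)" "!!h. Ck k (%x. Dg x h)" by auto
 have "((%x. f x * g x) has_derivative (%h. f x * Dg x h + Df x h * g x)) (at x)" for x
 using has_derivative_mult[OF D(1,3)] .
 moreover have "Ck k (%x. f x * Dg x h + Df x h * g x)" for h
 by (intro Ck_add Suc.IH D Ck_Suc_imp_Ck[OF Suc.prems(1)] Ck_Suc_imp_Ck[OF Suc.prems(2)])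
 ultimately show ?case by (auto intro!: exI[of _ "%x h. f x * Dg x h + Df x h * g x"])
qed

lemma Ck_real_SucI:
 fixes f :: "real => real"
 assumes "!!x. (f has_real_derivative f' x) (at x)" "Ck k f'"
 shows "Ck (Suc k) f"
 using assms Ck_scale[OF assms(2)]
 by (auto simp: has_field_derivative_def intro!: exI[of _ "%x h. f' x * h"])

text \<open>The functions p(1/x) exp(-1/x), extended by 0, are closed under differentiation. Keeping
  \<open>p\<close> arbitrary makes smoothness of all orders a single induction.\<close>

definition flat_poly :: "real poly => real => real" where
 "flat_poly p x = (if x > 0 then poly p (1/x) * exp (- 1/x) else 0)"

lemma poly_exp_tendsto_0: "((%t. poly p t * exp (- t)) \<longlongrightarrow> (0::real)) at_top"
proof -
 have "((%t. \<Sum>i\<le>degree p. coeff p i * (t ^ i / exp t)) \<longlongrightarrow> (\<Sum>i\<le>degree p. coeff p i * 0)) at_top"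
 by (intro tendsto_intros tendsto_power_div_exp_0)
 moreover have "poly p t * exp (- t) = (\<Sum>i\<le>degree p. coeff p i * (t ^ i / exp t))" for t
 by (simp add: poly_altdef sum_distrib_right exp_minus divide_inverse mult.assoc)
 ultimately show ?thesis by simp
qed

text \<open>With t = 1/x, d/dx is -t^2 d/dt, which turns p(t) exp(-t) into t^2 (p - p')(t) exp(-t).
  At x = 0 the difference quotient from the right is t p(t) exp(-t), so exponential decay gives
  derivative 0.\<close>

lemma DERIV_flat_poly:
 "(flat_poly p has_real_derivative flat_poly ([:0,0,1:] * (p - pderiv p)) x) (at x)"
proof -
 consider "x > 0" | "x < 0" | "x = 0" by linarith
 then show ?thesis
 proof cases
 case 1
 have "((%x. poly p (1/x) * exp (- 1/x)) has_real_derivative flat_poly ([:0,0,1:] * (p - pderiv p)) x) (at x)"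
 proof -
 have i: "((%x. 1/x) has_real_derivative (- 1 / x^2)) (at x)"
 using 1 by (auto intro!: derivative_eq_intros simp: power2_eq_square)
 have i': "((%x. - 1/x) has_real_derivative (1 / x^2)) (at x)"
 using DERIV_minus[OF i] by simp
 have "((%x. poly p (1/x) * exp (- 1/x)) has_real_derivative
 poly (pderiv p) (1/x) * (- 1 / x^2) * exp (- 1/x) + exp (- 1/x) * (1 / x^2) * poly p (1/x)) (at x)"
 by (intro DERIV_mult DERIV_chain2[OF poly_DERIV i] DERIV_chain2[OF DERIV_exp i'])
 then show ?thesis
 by (rule DERIV_cong) (use 1 in \<open>simp add: flat_poly_def algebra_simps power2_eq_square\<close>)
 qed
 then show ?thesis
 by (rule has_field_derivative_transform_within_open[where S="{0<..}"]) (use 1 in \<open>auto simp: flat_poly_def\<close>)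
 next
 case 2
 have "((%x. 0) has_real_derivative flat_poly ([:0,0,1:] * (p - pderiv p)) x) (at x)"
 using 2 by (auto simp: flat_poly_def)
 then show ?thesis
 by (rule has_field_derivative_transform_within_open[where S="{..<0}"]) (use 2 in \<open>auto simp: flat_poly_def\<close>)
 next
 case 3
 have R: "((%h. flat_poly p h / h) \<longlongrightarrow> 0) (at_right 0)"
 proof (rule Lim_transform_eventually)
 show "((%h. poly (pCons 0 p) (inverse h) * exp (- inverse h)) \<longlongrightarrow> 0) (at_right (0::real))"
 using filterlim_compose[OF poly_exp_tendsto_0 filterlim_inverse_at_top_right] .
 show "\<forall>\<^sub>F h in at_right 0. poly (pCons 0 p) (inverse h) * exp (- inverse h) = flat_poly p h / h"
 by (auto simp: eventually_at_filter flat_poly_def field_simps)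
 qed
 have L: "((%h. flat_poly p h / h) \<longlongrightarrow> 0) (at_left 0)"
 by (rule Lim_transform_eventually[OF tendsto_const]) (auto simp: eventually_at_filter flat_poly_def)
 show ?thesis using filterlim_split_at[OF L R] 3 by (simp add: DERIV_def flat_poly_def)
 qed
qed

lemma Ck_flat_poly: "Ck k (%x. flat_poly p (a * x + b))"
proof (induction k arbitrary: p)
 case 0
 have "continuous_on UNIV (flat_poly p)"
 by (intro continuous_at_imp_continuous_on ballI DERIV_isCont[OF DERIV_flat_poly])
 then show ?case by (auto intro!: continuous_on_compose2[of UNIV "flat_poly p"] continuous_intros)
next
 case (Suc k)
 show ?case
 proof (rule Ck_real_SucI)
 show "((%x. flat_poly p (a * x + b)) has_real_derivative flat_poly ([:0,0,1:] * (p - pderiv p)) (a * x + b) * a) (at x)" for x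
 by (rule DERIV_chain2[OF DERIV_flat_poly]) (auto intro!: derivative_eq_intros)
 show "Ck k (%x. flat_poly ([:0,0,1:] * (p - pderiv p)) (a * x + b) * a)"
 by (intro Ck_scale Suc.IH)
 qed
qed

definition bump :: "real => real => real => real" where
 "bump a d x = flat_poly 1 (1 * x + (d - a)) * flat_poly 1 ((-1) * x + (a + d))"

lemma Ck_bump: "Ck k (bump a d)"
 unfolding bump_def[abs_def] by (intro Ck_mult Ck_flat_poly)

lemma continuous_bump: "continuous_on S (bump a d)"
 using Ck_bump[of 0 a d] by (auto intro: continuous_on_subset)

lemma bump_nonneg: "0 <= bump a d x"
 and bump_pos: "d > 0 ==> 0 < bump a d a"
 and bump_zero: "d <= \<bar>x - a\<bar> ==> bump a d x = 0"
 and bump_shift: "bump a d (x - s) = bump (a + s) d x"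
proof -
 show "0 <= bump a d x" by (simp add: bump_def flat_poly_def)
 show "0 < bump a d a" if "d > 0" using that by (simp add: bump_def flat_poly_def)
 show "bump a d x = 0" if "d <= \<bar>x - a\<bar>" using that by (auto simp: bump_def flat_poly_def abs_if split: if_splits)
 have "1 * (x - s) + (d - a) = 1 * x + (d - (a + s))" "(-1) * (x - s) + (a + d) = (-1) * x + (a + s + d)" by simp_all
 then show "bump a d (x - s) = bump (a + s) d x" unfolding bump_def by (simp only:)
qed

lemma DERIV_zero_eq:
 fixes F :: "real => real"
 assumes "x <= y" "!!z. (F has_real_derivative f z) (at z)" "!!z. x < z ==> z < y ==> f z = 0"
 shows "F x = F y"
proof (cases "x = y")
 case False
 then obtain z where "x < z" "z < y" "F y - F x = (y - x) * f z"
 using MVT2[of x y F f] assms by auto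
 then show ?thesis using assms(3) by simp
qed simp

text \<open>The difference of two translates of one antiderivative of a bump has compact support, so
 no normalisation of the bump is needed.\<close>
lemma du_Bois_Reymond:
 assumes m: "continuous_on {-1..1} m"
 and test: "!!ph. test_fun {-1<..<1} ph ==> (LBINT x:{-1..1}. m x * deriv ph x) = 0"
 and ab: "-1 < a" "a < b" "b < 1"
 shows "m a = m b"
proof (rule ccontr)
 assume ne: "m a \<noteq> m b"
 \<comment> \<open>With a quarter of the assumed jump, the two averaging errors together cover at
   most half of it.\<close>
 define e where "e = \<bar>m a - m b\<bar> / 4"
 have e: "e > 0" using ne by (simp add: e_def)
 have "continuous_on {-1<..<1} m" by (rule continuous_on_subset[OF m]) auto
 then have cont: "isCont m x" if "x \<in> {-1<..<1}" for x
 using continuous_on_eq_continuous_at[of "{-1<..<1}" m] that by auto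
 from cont[of a] ab e obtain da where da: "da > 0" "!!x. \<bar>x - a\<bar> < da ==> \<bar>m x - m a\<bar> < e"
 unfolding continuous_at_eps_delta dist_real_def
 by (metis greaterThanLessThan_iff less_trans)
 from cont[of b] ab e obtain db where db: "db > 0" "!!x. \<bar>x - b\<bar> < db ==> \<bar>m x - m b\<bar> < e"
 unfolding continuous_at_eps_delta dist_real_def
 by (metis greaterThanLessThan_iff less_trans)
 define d where "d = min (min da db) (min ((a + 1)/2) ((1 - b)/2))"
 have d: "d > 0" "d <= da" "d <= db" "-1 < a - d" "b + d < 1"
 using da db ab by (auto simp: d_def min_def field_simps)
 obtain F where F: "!!x. (F has_real_derivative bump a d x) (at x)"
 proof -
 have "\<exists>F. \<forall>x::real. -\<infinity> < ereal x \<longrightarrow> ereal x < \<infinity> \<longrightarrow> (F has_vector_derivative bump a d x) (at x)"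
 proof (rule einterval_antiderivative)
 show "isCont (bump a d) x" for x
 using continuous_bump[of UNIV a d] by (simp add: continuous_on_eq_continuous_at)
 qed auto
 then show thesis using that by (auto simp: has_real_derivative_iff_has_vector_derivative)
 qed
 \<comment> \<open>Its derivative is the bump at \<open>a\<close> minus the bump at
   \<open>b\<close>, so testing with it compares the averages of \<open>m\<close> near the two
   points.\<close>
 define ph where "ph x = F x - F (x - (b - a))" for x
 have Dph: "(ph has_real_derivative (bump a d x - bump b d x)) (at x)" for x
 unfolding ph_def[abs_def] using bump_shift[of a d x "b - a"]
 by (auto intro!: derivative_eq_intros F DERIV_chain2[OF F])
 have dphi: "deriv ph x = bump a d x - bump b d x" for x using Dph by (rule DERIV_imp_deriv)
 have ph0: "ph x = 0" if "x <= a - d \<or> b + d <= x" for x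
 proof -
 have "F (x - (b - a)) = F x"
 by (rule DERIV_zero_eq[OF _ F]) (use that ab in \<open>auto intro!: bump_zero\<close>)
 then show ?thesis by (simp add: ph_def)
 qed
 have supp: "{x. ph x \<noteq> 0} \<subseteq> {a - d..b + d}"
 proof
 fix x assume "x \<in> {x. ph x \<noteq> 0}"
 then have "\<not> (x <= a - d \<or> b + d <= x)" using ph0[of x] by blast
 then show "x \<in> {a - d..b + d}" by auto
 qed
 then have "closure {x. ph x \<noteq> 0} \<subseteq> {a - d..b + d}" by (rule closure_minimal) simp
 moreover have "Ck k ph" for k
 proof -
 have "Ck (Suc k) ph"
 proof (rule Ck_real_SucI[OF Dph])
 show "Ck k (%x. bump a d x - bump b d x)"
 using Ck_add[OF Ck_bump Ck_scale[OF Ck_bump, of k b d "-1"]] by simp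
 qed
 then show ?thesis by (rule Ck_Suc_imp_Ck)
 qed
 ultimately have "test_fun {-1<..<1} ph"
 unfolding test_fun_def compact_closure
 using d bounded_subset[OF compact_imp_bounded[OF compact_Icc] supp] by auto
 from test[OF this] have z: "(LBINT x:{-1..1}. m x * (bump a d x - bump b d x)) = 0" by (simp add: dphi)
 define Z where "Z = (LBINT x:{-1..1}. bump a d x)"
 have ib: "set_integrable lborel {-1..1} (bump c d)" for c by (rule LBINT_eq_HK(2)[OF continuous_bump])
 have im: "set_integrable lborel {-1..1} (%x. m x * bump c d x)" for c
 by (intro LBINT_eq_HK(2) continuous_intros m continuous_bump)
 have Zb: "(LBINT x:{-1..1}. bump b d x) = Z"
 proof -
 have "(LBINT x:{-1<..<1}. (bump a d x - bump b d x)) = ph 1 - ph (-1)"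
 unfolding set_lebesgue_integral_def real_scaleR_def
 by (rule FTC_open_interval) (auto intro!: continuous_intros continuous_bump Dph)
 also have "... = 0" using d ph0 ab by auto
 finally show ?thesis unfolding integral_open_closed
 by (subst (asm) set_integral_diff(2)[OF ib ib]) (simp add: Z_def)
 qed
 have Zpos: "Z > 0"
 proof -
 have "Z \<ge> 0" unfolding Z_def set_lebesgue_integral_def by (rule Bochner_Integration.integral_nonneg) (auto simp: bump_nonneg)
 moreover have "Z \<noteq> 0"
 proof
 assume "Z = 0"
 then have "integral {-1..1} (bump a d) = 0" by (simp add: Z_def LBINT_eq_HK(1)[OF continuous_bump])
 then have "(bump a d has_integral 0) (cbox (-1) 1)"
 using integrable_continuous_interval[OF continuous_bump[of "{-1..1}" a d]] by (auto simp: has_integral_integral)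
 from has_integral_0_cbox_imp_0[OF continuous_bump _ this, of a] bump_nonneg bump_pos[OF d(1), of a] ab
 show False by (auto simp: less_imp_le)
 qed
 ultimately show ?thesis by simp
 qed
 have err: "\<bar>(LBINT x:{-1..1}. m x * bump c d x) - m c * Z\<bar> <= e * Z"
 if "!!x. \<bar>x - c\<bar> < d ==> \<bar>m x - m c\<bar> < e" "(LBINT x:{-1..1}. bump c d x) = Z" for c
 proof -
 have "(LBINT x:{-1..1}. m x * bump c d x) - m c * Z = (LBINT x:{-1..1}. m x * bump c d x - m c * bump c d x)"
 by (subst set_integral_diff(2)[OF im]) (auto intro!: set_integrable_mult_right ib simp: that(2))
 also have "\<bar>...\<bar> <= (LBINT x:{-1..1}. e * bump c d x)"
 proof -
 have "\<bar>(LBINT x:{-1..1}. m x * bump c d x - m c * bump c d x)\<bar> <= (LBINT x:{-1..1}. \<bar>m x * bump c d x - m c * bump c d x\<bar>)"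
 using set_integral_norm_bound[OF set_integral_diff(1)[OF im[of c] set_integrable_mult_right[OF ib[of c], of "m c"]]]
 by simp
 also have "... <= (LBINT x:{-1..1}. e * bump c d x)"
 proof (rule set_integral_mono)
 show "\<bar>m x * bump c d x - m c * bump c d x\<bar> <= e * bump c d x" for x
 proof (cases "\<bar>x - c\<bar> < d")
 case True
 have "\<bar>m x * bump c d x - m c * bump c d x\<bar> = \<bar>m x - m c\<bar> * bump c d x"
 using bump_nonneg[of c d x] by (simp add: abs_mult flip: left_diff_distrib)
 also have "... <= e * bump c d x" using that(1)[OF True] bump_nonneg[of c d x] by (intro mult_right_mono) auto
 finally show ?thesis .
 qed (use bump_zero in auto)
 qed (intro LBINT_eq_HK(2) continuous_intros m continuous_bump)+
 finally show ?thesis .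
 qed
 also have "... = e * Z" using that(2) by simp
 finally show ?thesis .
 qed
 have "\<bar>(LBINT x:{-1..1}. m x * bump a d x) - m a * Z\<bar> <= e * Z"
 using da d by (intro err) (auto simp: Z_def)
 moreover have "\<bar>(LBINT x:{-1..1}. m x * bump b d x) - m b * Z\<bar> <= e * Z"
 using db d by (intro err Zb) auto
 moreover have "(LBINT x:{-1..1}. m x * bump a d x) = (LBINT x:{-1..1}. m x * bump b d x)"
 using z set_integral_diff(2)[OF im im, of a b] by (simp add: right_diff_distrib)
 ultimately have "\<bar>m a * Z - m b * Z\<bar> <= 2 * (e * Z)" by linarith
 then have "\<bar>m a - m b\<bar> * Z <= 2 * e * Z" using Zpos by (simp add: abs_mult flip: left_diff_distrib)
 then have "\<bar>m a - m b\<bar> <= 2 * e" using Zpos by simp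
 then show False using e by (simp add: e_def)
qed

section \<open>Sobolev functions on the interval as primitives\<close>

lemma continuous_on_compact_bound:
 fixes f :: "'a::topological_space => 'b::real_normed_vector"
 assumes "compact S" "continuous_on S f"
 obtains B where "B \<ge> 0" "!!x. x \<in> S ==> norm (f x) <= B"
proof -
 from compact_imp_bounded[OF compact_continuous_image[OF assms(2,1)]]
 obtain B where "!!x. x \<in> S ==> norm (f x) <= B" by (auto simp: bounded_iff)
 then show thesis using that[of "max B 0"] by (auto simp: le_max_iff_disj)
qed

text \<open>Densities are normalised to be Borel measurable and zero off the open interval, so that
  all integrals can run over the whole line with respect to \<open>lborel\<close>.\<close>

definition L2_unit :: "(real => real) => bool" where
 "L2_unit g \<longleftrightarrow> g \<in> borel_measurable borel \<and> (\<forall>x. x \<notin> {-1<..<1} \<longrightarrow> g x = 0) \<and> integrable lborel (%x. (g x)^2)"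

text \<open>As densities vanish off the interval, this is the primitive with value 0 at -1, and
  \<open>prim g 1\<close> is the total mass. The condition \<open>prim g 1 = 0\<close> used later
  says that \<mu> has the same value at both ends.\<close>

definition prim :: "(real => real) => real => real" where
 "prim g x = (\<integral>t. indicator {..x} t * g t \<partial>lborel)"

lemma L2_unitD:
 assumes "L2_unit g"
 shows L2_unit_measurable: "g \<in> borel_measurable borel"
 and L2_unit_zero: "x \<notin> {-1<..<1} ==> g x = 0"
 and L2_unit_sq: "integrable lborel (%x. (g x)^2)"
 and L2_unit_integrable: "integrable lborel g"
proof -
 show m: "g \<in> borel_measurable borel" "x \<notin> {-1<..<1} ==> g x = 0" and s: "integrable lborel (%x. (g x)^2)"
 using assms by (auto simp: L2_unit_def)
 have z: "g x = 0" if "x \<notin> {-1<..<1}" for x using assms that by (auto simp: L2_unit_def)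
 have "integrable lborel (%x. indicator {-1<..<1} x + (g x)^2)"
 by (intro Bochner_Integration.integrable_add s) simp
 then show "integrable lborel g"
 proof (rule Bochner_Integration.integrable_bound)
 show "AE x in lborel. norm (g x) <= norm (indicator {-1<..<1} x + (g x)^2)"
 proof (rule AE_I2)
 fix x
 have "\<bar>g x\<bar> <= 1 + (g x)^2"
 using zero_le_power2[of "\<bar>g x\<bar> - 1"] unfolding power2_eq_square
 by (smt (verit) abs_mult_self_eq mult_cancel_left1 left_diff_distrib right_diff_distrib mult_nonneg_nonneg)
 then show "norm (g x) <= norm (indicator {-1<..<1} x + (g x)^2)"
 using z[of x] by (auto simp: indicator_def)
 qed
 qed (use m in simp)
qed

lemma L2_unit_bound:
 assumes "L2_unit g" "h \<in> borel_measurable borel" "!!x. \<bar>h x\<bar> <= \<bar>g x\<bar>"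
 shows "L2_unit h"
 unfolding L2_unit_def
proof (intro conjI allI impI)
 show "integrable lborel (%x. (h x)^2)"
 by (rule Bochner_Integration.integrable_bound[OF L2_unit_sq[OF assms(1)]])
 (use assms in \<open>auto simp: abs_le_square_iff[symmetric]\<close>)
 show "h x = 0" if "x \<notin> {-1<..<1}" for x
 using assms(3)[of x] L2_unit_zero[OF assms(1) that] by simp
qed (use assms in auto)

lemma integrable_L2_unit_bounded:
 assumes "L2_unit g" "h \<in> borel_measurable borel" "!!x. \<bar>x\<bar> < 1 ==> norm (h x) <= K"
 shows "integrable lborel (%t. g t *\<^sub>R (h t :: 'b :: euclidean_space))"
proof -
 have "integrable lborel (%t. K * g t)" using L2_unit_integrable[OF assms(1)] by simp
 then show ?thesis
 proof (rule Bochner_Integration.integrable_bound)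
 have "norm (g x *\<^sub>R h x) <= norm (K * g x)" for x
 proof (cases "\<bar>x\<bar> < 1")
 case True
 then have "norm (h x) <= \<bar>K\<bar>" using assms(3)[of x] by linarith
 then show ?thesis by (simp add: abs_mult mult.commute[of "\<bar>K\<bar>"] mult_left_mono)
 next
 case False
 then have "x \<notin> {-1<..<1}" by (auto simp: abs_if split: if_splits)
 then show ?thesis using L2_unit_zero[OF assms(1), of x] by simp
 qed
 then show "AE x in lborel. norm (g x *\<^sub>R h x) <= norm (K * g x)" by simp
 qed (use assms(2) L2_unit_measurable[OF assms(1)] in simp)
qed

lemma integral_diff_indicator:
 assumes "L2_unit g" "x <= y"
 shows prim_diff: "prim g y - prim g x = (\<integral>t. indicator {x<..y} t * g t \<partial>lborel)"
proof -
 have i: "integrable lborel (%t. indicator {..z} t * g t)" for z :: real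
 using integrable_mult_indicator[OF _ L2_unit_integrable[OF assms(1)], of "{..z}"] by simp
 have "prim g y - prim g x = (\<integral>t. indicator {..y} t * g t - indicator {..x} t * g t \<partial>lborel)"
 unfolding prim_def by (rule Bochner_Integration.integral_diff[symmetric, OF i i])
 also have "... = (\<integral>t. indicator {x<..y} t * g t \<partial>lborel)"
 using assms(2) by (intro Bochner_Integration.integral_cong) (auto simp: indicator_def)
 finally show ?thesis .
qed

lemma prim_diff_bound:
 assumes g: "L2_unit g" "x <= y"
 shows "\<bar>prim g y - prim g x\<bar> <= prim (%t. \<bar>g t\<bar>) y - prim (%t. \<bar>g t\<bar>) x"
proof -
 have g': "L2_unit (%t. \<bar>g t\<bar>)" using L2_unit_measurable[OF g(1)] by (intro L2_unit_bound[OF g(1)]) auto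
 show ?thesis unfolding prim_diff[OF g] prim_diff[OF g' g(2)]
 using integral_norm_bound[of lborel "%t. indicator {x<..y} t * g t"] by (simp add: abs_mult)
qed

lemma prim_outside:
 assumes "L2_unit g"
 shows prim_lower: "x <= -1 ==> prim g x = 0"
 and prim_upper: "1 <= x ==> prim g x = (\<integral>t. g t \<partial>lborel)"
proof -
 note z = L2_unit_zero[OF assms]
 show "prim g x = 0" if "x <= -1"
 unfolding prim_def using that z by (subst Bochner_Integration.integral_cong[OF refl, of _ _ "%_. 0"]) (auto simp: indicator_def)
 show "prim g x = (\<integral>t. g t \<partial>lborel)" if "1 <= x"
 unfolding prim_def using that z by (intro Bochner_Integration.integral_cong) (auto simp: indicator_def)
qed

lemma isCont_prim:
 assumes g: "L2_unit g"
 shows "isCont (prim g) x"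
 unfolding continuous_at_sequentially comp_def
proof (intro allI impI)
 fix X assume X: "X ---> x"
 note [measurable] = L2_unit_measurable[OF g]
 show "(%n. prim g (X n)) ---> prim g x"
 unfolding prim_def
 proof (rule integral_dominated_convergence[where w="%t. \<bar>g t\<bar>"])
 show "integrable lborel (%t. \<bar>g t\<bar>)" using L2_unit_integrable[OF g] by simp
 have "(%n. indicator {..X n} t * g t) ---> indicator {..x} t * g t" if "t \<noteq> x" for t
 proof (cases "t < x")
 case True
 then have "\<forall>\<^sub>F n in sequentially. t < X n" using order_tendstoD(1)[OF X] by blast
 then have "\<forall>\<^sub>F n in sequentially. indicator {..x} t * g t = indicator {..X n} t * g t"
 by eventually_elim (use True in auto)
 then show ?thesis by (rule Lim_transform_eventually[OF tendsto_const])
 next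
 case False
 then have "\<forall>\<^sub>F n in sequentially. X n < t" using order_tendstoD(2)[OF X] that by simp
 then have "\<forall>\<^sub>F n in sequentially. indicator {..x} t * g t = indicator {..X n} t * g t"
 by eventually_elim (use False that in auto)
 then show ?thesis by (rule Lim_transform_eventually[OF tendsto_const])
 qed
 then show "AE t in lborel. (%n. indicator {..X n} t * g t) ---> indicator {..x} t * g t"
 using AE_lborel_singleton[of x] by (auto elim!: eventually_mono)
 qed (auto simp: indicator_def)
qed

lemma continuous_prim: "L2_unit g ==> continuous_on S (prim g)"
 by (intro continuous_at_imp_continuous_on ballI isCont_prim)

text \<open>Write ph t as ph 1 minus the integral of ph' over (t, 1) and exchange the integrals;
  Fubini replaces a product rule, because the density is only L2.\<close>

lemma integral_mult_by_parts:
 assumes g: "L2_unit g"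
 and D: "!!x. (ph has_real_derivative ph' x) (at x)" and c: "continuous_on UNIV ph'"
 shows "(\<integral>t. g t * ph t \<partial>lborel) = prim g 1 * ph 1 - (LBINT x:{-1..1}. prim g x * ph' x)"
proof -
 note [measurable] = L2_unit_measurable[OF g]
 have [measurable]: "ph' \<in> borel_measurable borel" by (rule borel_measurable_continuous_onI[OF c])
 have cphi: "continuous_on UNIV ph" by (intro continuous_at_imp_continuous_on ballI DERIV_isCont[OF D])
 note [measurable] = borel_measurable_continuous_onI[OF cphi]
 define k where "k t x = (if t < x then indicator {-1<..<1} x * ph' x else 0)" for t x :: real
 have k: "(\<integral>x. k t x \<partial>lborel) = ph 1 - ph t" if "\<bar>t\<bar> < 1" for t
 proof -
 have "(\<integral>x. k t x \<partial>lborel) = (\<integral>x. indicator {t<..<1} x * ph' x \<partial>lborel)"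
 using that by (intro Bochner_Integration.integral_cong) (auto simp: k_def indicator_def)
 also have "... = ph 1 - ph t"
 using that by (intro FTC_open_interval D continuous_on_subset[OF c]) auto
 finally show ?thesis .
 qed
 obtain K where K0: "K \<ge> 0" and K: "!!x. x \<in> {-1..1} ==> \<bar>ph' x\<bar> <= K"
 using continuous_on_compact_bound[OF compact_Icc continuous_on_subset[OF c], of "-1" 1] by auto
 obtain B where B: "!!x. x \<in> {-1..1} ==> \<bar>ph x\<bar> <= B"
 using continuous_on_compact_bound[OF compact_Icc continuous_on_subset[OF cphi], of "-1" 1] by auto
 have ig: "integrable lborel (%t. g t * ph t)"
 using integrable_L2_unit_bounded[OF g, of ph B] B by (auto simp: abs_less_iff)
 have "integrable (lborel \<Otimes>\<^sub>M lborel) (%(t, x). g t * indicator {-1<..<1::real} x)"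
 proof (rule lborel_pair.Fubini_integrable)
 show "integrable lborel (%x. \<integral>y. norm (case (x, y) of (t, x) => g t * indicator {-1<..<1::real} x) \<partial>lborel)"
 using L2_unit_integrable[OF g] by (simp add: abs_mult)
 show "AE x in lborel. integrable lborel (%y. case (x, y) of (t, x) => g t * indicator {-1<..<1::real} x)"
 by (auto intro!: integrable_mult_right)
 qed measurable
 then have "integrable (lborel \<Otimes>\<^sub>M lborel) (%p. K * (case p of (t, x) => g t * indicator {-1<..<1::real} x))" by simp
 then have int: "integrable (lborel \<Otimes>\<^sub>M lborel) (%(t, x). g t * k t x)"
 proof (rule Bochner_Integration.integrable_bound)
 have "\<bar>g t * k t x\<bar> <= \<bar>K * (g t * indicator {-1<..<1} x)\<bar>" for t x
 proof -
 have "\<bar>k t x\<bar> <= K * indicator {-1<..<1} x"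
 using K[of x] K0 by (auto simp: k_def indicator_def)
 then have "\<bar>g t\<bar> * \<bar>k t x\<bar> <= \<bar>g t\<bar> * (K * indicator {-1<..<1} x)" by (rule mult_left_mono) simp
 then show ?thesis using K0 by (simp add: abs_mult algebra_simps)
 qed
 then show "AE x in lborel \<Otimes>\<^sub>M lborel. norm (case x of (t, x) => g t * k t x) <= norm (K * (case x of (t, x) => g t * indicator {-1<..<1} x))"
 by auto
 qed (unfold k_def, measurable)
 have "(\<integral>t. g t * ph t \<partial>lborel) = (\<integral>t. g t * ph 1 - g t * (\<integral>x. k t x \<partial>lborel) \<partial>lborel)"
 proof (rule Bochner_Integration.integral_cong[OF refl])
 show "g t * ph t = g t * ph 1 - g t * (\<integral>x. k t x \<partial>lborel)" for t
 proof (cases "\<bar>t\<bar> < 1")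
 case True
 then have "ph t = ph 1 - (\<integral>x. k t x \<partial>lborel)" using k by simp
 then show ?thesis by (simp only: right_diff_distrib)
 next
 case False
 then have "g t = 0" using L2_unit_zero[OF g, of t] by (auto simp: abs_less_iff)
 then show ?thesis by simp
 qed
 qed
 also have "... = (\<integral>t. g t * ph 1 \<partial>lborel) - (\<integral>t. (\<integral>x. g t * k t x \<partial>lborel) \<partial>lborel)"
 proof (subst Bochner_Integration.integral_diff)
 show "integrable lborel (%t. g t * (\<integral>x. k t x \<partial>lborel))"
 using lborel_pair.integrable_fst'[OF int] by simp
 qed (use L2_unit_integrable[OF g] in auto)
 also have "(\<integral>t. (\<integral>x. g t * k t x \<partial>lborel) \<partial>lborel) = (\<integral>x. (\<integral>t. g t * k t x \<partial>lborel) \<partial>lborel)"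
 by (rule lborel_pair.Fubini_integral[OF int, symmetric])
 also have "... = (\<integral>x. indicator {-1<..<1} x * (prim g x * ph' x) \<partial>lborel)"
 proof (rule Bochner_Integration.integral_cong[OF refl])
 fix x :: real
 have "(\<integral>t. g t * k t x \<partial>lborel) = (\<integral>t. (indicator {..x} t * g t) * (indicator {-1<..<1} x * ph' x) \<partial>lborel)"
 proof (rule integral_cong_AE)
 show "AE t in lborel. g t * k t x = indicator {..x} t * g t * (indicator {-1<..<1} x * ph' x)"
 using AE_lborel_singleton[of x] by eventually_elim (auto simp: k_def indicator_def)
 qed (unfold k_def, measurable)
 also have "... = indicator {-1<..<1} x * (prim g x * ph' x)" by (simp add: prim_def)
 finally show "(\<integral>t. g t * k t x \<partial>lborel) = indicator {-1<..<1} x * (prim g x * ph' x)" .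
 qed
 also have "... = (LBINT x:{-1..1}. prim g x * ph' x)"
 by (subst integral_open_closed[symmetric]) (simp add: set_lebesgue_integral_def)
 finally show ?thesis using prim_upper[OF g, of 1] by simp
qed

lemma test_fun_realD:
 fixes ph :: "real => real"
 assumes "test_fun U ph"
 shows "(ph has_real_derivative deriv ph x) (at x)" "continuous_on UNIV (deriv ph)" "x \<notin> U ==> ph x = 0"
proof -
 from assms have "Ck (Suc 0) ph" by (simp add: test_fun_def del: Ck.simps)
 then obtain D where D: "!!x. (ph has_derivative D x) (at x)" "!!h. continuous_on UNIV (%x. D x h)"
 unfolding Ck.simps by blast
 have "(ph has_real_derivative D x 1) (at x)" for x
 proof -
 interpret bounded_linear "D x" using has_derivative_bounded_linear[OF D(1)] .
 have "D x h = D x 1 * h" for h using scaleR[of h 1] by simp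
 then have "D x = (*) (D x 1)" by (intro ext)
 then show ?thesis using D(1)[of x] by (simp add: has_field_derivative_def)
 qed
 moreover from this have "deriv ph = (%x. D x 1)" by (auto intro!: DERIV_imp_deriv)
 ultimately show "(ph has_real_derivative deriv ph x) (at x)" "continuous_on UNIV (deriv ph)" using D(2) by auto
 show "x \<notin> U ==> ph x = 0" using assms closure_subset[of "{x. ph x \<noteq> 0}"] by (auto simp: test_fun_def)
qed

lemma set_lebesgue_integral_lebesgue:
 fixes f :: "'a::euclidean_space => 'b::euclidean_space"
 assumes "(%x. indicator S x *\<^sub>R f x) \<in> borel_measurable borel"
 shows "(LINT x:S|lebesgue. f x) = (LINT x:S|lborel. f x)"
 unfolding set_lebesgue_integral_def using assms by (intro integral_completion) simp

text \<open>Used to admit competitors: the truncated, the dilated and the logarithmic one are all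
  given as a constant plus a primitive.\<close>

lemma W12_interval_prim:
 assumes g: "L2_unit g" and mu: "!!x. x \<in> {-1..1} ==> \<mu> x = a + prim g x"
 shows "W12_interval \<mu> g"
 unfolding W12_interval_def
proof (intro conjI allI impI)
 note [measurable] = L2_unit_measurable[OF g]
 have cont: "continuous_on {-1..1} (%x. a + prim g x)" by (intro continuous_intros continuous_prim g)
 then show c: "continuous_on {-1..1} \<mu>" by (rule continuous_on_eq) (simp add: mu)
 have c': "continuous_on {-1<..<1} \<mu>" by (rule continuous_on_subset[OF c]) auto
 have m: "(%x. indicator {-1<..<1} x *\<^sub>R \<mu> x) \<in> borel_measurable borel"
 by (rule borel_measurable_continuous_on_indicator[OF _ c']) auto
 obtain B where "B \<ge> 0" and B: "!!x. x \<in> {-1..1} ==> \<bar>\<mu> x\<bar> <= \<bar>B\<bar>"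
 using continuous_on_compact_bound[OF compact_Icc c] by (metis abs_of_nonneg real_norm_def)
 have "(\<integral>\<^sup>+x. indicator {-1<..<1} x * ennreal ((norm (\<mu> x))^2) \<partial>lborel) <= (\<integral>\<^sup>+x. ennreal (B^2) * indicator {-1<..<1::real} x \<partial>lborel)"
 by (intro nn_integral_mono) (use B in \<open>auto simp: indicator_def abs_le_square_iff[symmetric] intro!: ennreal_leI\<close>)
 also have "... < \<infinity>" by (subst nn_integral_cmult_indicator) (auto simp: ennreal_mult_less_top)
 finally show "L2_on {-1<..<1} \<mu>" unfolding L2_on_def nn_integral_completion using m by (auto intro: measurable_completion)
 have "(\<integral>\<^sup>+x. indicator {-1<..<1} x * ennreal ((norm (g x))^2) \<partial>lborel) <= (\<integral>\<^sup>+x. ennreal (norm ((g x)^2)) \<partial>lborel)"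
 by (intro nn_integral_mono) (auto simp: indicator_def)
 also have "... < \<infinity>" using L2_unit_sq[OF g] by (simp add: integrable_iff_bounded)
 finally show "L2_on {-1<..<1} g" unfolding L2_on_def nn_integral_completion by (auto intro!: measurable_completion)
 fix ph :: "real => real" assume t: "test_fun {-1<..<1} ph"
 note ph = test_fun_realD[OF t]
 have [measurable]: "deriv ph \<in> borel_measurable borel" by (rule borel_measurable_continuous_onI[OF ph(2)])
 have "continuous_on UNIV ph" by (intro continuous_at_imp_continuous_on ballI DERIV_isCont[OF ph(1)])
 then have [measurable]: "ph \<in> borel_measurable borel" by (rule borel_measurable_continuous_onI)
 have "(LINT x:{-1<..<1}|lebesgue. \<mu> x * deriv ph x) = (LBINT x:{-1<..<1}. \<mu> x * deriv ph x)"
 proof (rule set_lebesgue_integral_lebesgue)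
 have "(%x. (indicator {-1<..<1} x *\<^sub>R \<mu> x) * deriv ph x) \<in> borel_measurable borel"
 by (intro borel_measurable_times m) auto
 then show "(%x. indicator {-1<..<1} x *\<^sub>R (\<mu> x * deriv ph x)) \<in> borel_measurable borel" by (simp add: mult.assoc)
 qed
 also have "... = (LBINT x:{-1..1}. \<mu> x * deriv ph x)" by (rule integral_open_closed)
 also have "... = (LBINT x:{-1..1}. a * deriv ph x + prim g x * deriv ph x)"
 by (rule set_lebesgue_integral_cong) (auto simp: mu algebra_simps)
 also have "... = (LBINT x:{-1..1}. a * deriv ph x) + (LBINT x:{-1..1}. prim g x * deriv ph x)"
 by (intro set_integral_add(2) LBINT_eq_HK(2) continuous_intros continuous_prim g continuous_on_subset[OF ph(2)]) auto
 also have "(LBINT x:{-1..1}. a * deriv ph x) = a * (ph 1 - ph (-1))"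
 using FTC_open_interval[of "-1" 1 "deriv ph" ph] ph(1) continuous_on_subset[OF ph(2)]
 by (simp add: integral_open_closed[symmetric]) (simp add: set_lebesgue_integral_def)
 also have "... = 0" using ph(3) by simp
 also have "0 + (LBINT x:{-1..1}. prim g x * deriv ph x) = - (\<integral>t. g t * ph t \<partial>lborel)"
 using integral_mult_by_parts[OF g ph(1,2)] ph(3)[of 1] by simp
 also have "(\<integral>t. g t * ph t \<partial>lborel) = (LBINT x:{-1<..<1}. g x * ph x)"
 unfolding set_lebesgue_integral_def using L2_unit_zero[OF g]
 by (intro Bochner_Integration.integral_cong) (auto simp: indicator_def)
 also have "(LBINT x:{-1<..<1}. g x * ph x) = (LINT x:{-1<..<1}|lebesgue. g x * ph x)"
 by (rule set_lebesgue_integral_lebesgue[symmetric]) measurable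
 finally show "(LINT x:{-1<..<1}|lebesgue. \<mu> x * deriv ph x) = - (LINT x:{-1<..<1}|lebesgue. g x * ph x)" .
qed

text \<open>The weak derivative is only Lebesgue measurable, so it is replaced by a Borel density
  equal to it almost everywhere. Then \<mu> minus the primitive of that density has weak derivative
  zero and is constant by the du Bois-Reymond lemma.\<close>

lemma W12_intervalE:
 assumes W: "W12_interval \<mu> g"
 obtains g0 where "L2_unit g0" "AE t in lebesgue. t \<in> {-1<..<1} \<longrightarrow> g t = g0 t"
 "!!x. x \<in> {-1..1} ==> \<mu> x = \<mu> (-1) + prim g0 x"
proof -
 have c: "continuous_on {-1..1} \<mu>" and L: "L2_on {-1<..<1} g"
 and weak: "!!ph. test_fun {-1<..<1} ph ==>
 (LINT x:{-1<..<1}|lebesgue. \<mu> x * deriv ph x) = - (LINT x:{-1<..<1}|lebesgue. g x * ph x)"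
 using W by (auto simp: W12_interval_def)
 have gm: "(%x. indicator {-1<..<1} x *\<^sub>R g x) \<in> borel_measurable lebesgue"
 and gf: "(\<integral>\<^sup>+x. indicator {-1<..<1} x * ennreal ((norm (g x))^2) \<partial>lebesgue) < \<infinity>"
 using L by (auto simp: L2_on_def)
 from completion_ex_borel_measurable_real[OF gm] obtain g' where
 g'[measurable]: "g' \<in> borel_measurable borel" and "AE x in lborel. indicator {-1<..<1} x *\<^sub>R g x = g' x" by auto
 then have ae: "AE x in lebesgue. indicator {-1<..<1} x *\<^sub>R g x = g' x" by (intro AE_completion)
 define g0 where "g0 x = indicator {-1<..<1} x * g' x" for x
 have [measurable]: "g0 \<in> borel_measurable borel" unfolding g0_def[abs_def] by measurable
 have ae0: "AE t in lebesgue. t \<in> {-1<..<1} \<longrightarrow> g t = g0 t"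
 using ae by eventually_elim (auto simp: g0_def)
 have L0: "L2_unit g0"
 unfolding L2_unit_def
 proof (intro conjI allI impI)
 have "(\<integral>\<^sup>+x. ennreal (norm ((g0 x)^2)) \<partial>lborel) = (\<integral>\<^sup>+x. ennreal (norm ((g0 x)^2)) \<partial>lebesgue)"
 by (simp add: nn_integral_completion)
 also have "... = (\<integral>\<^sup>+x. indicator {-1<..<1} x * ennreal ((norm (g x))^2) \<partial>lebesgue)"
 by (rule nn_integral_cong_AE) (use ae0 in eventually_elim, auto simp: indicator_def g0_def)
 finally show "integrable lborel (%x. (g0 x)^2)" using gf by (auto intro!: integrableI_bounded)
 qed (auto simp: g0_def)
 have const: "\<mu> x - prim g0 x = \<mu> 0 - prim g0 0" if "x \<in> {-1..1}" for x
 proof -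
 let ?m = "%x. \<mu> x - prim g0 x"
 have cm: "continuous_on {-1..1} ?m" by (intro continuous_intros c continuous_prim L0)
 have T: "(LBINT x:{-1..1}. ?m x * deriv ph x) = 0" if t: "test_fun {-1<..<1} ph" for ph :: "real => real"
 proof -
 note ph = test_fun_realD[OF t]
 note cph = continuous_on_subset[OF ph(2) subset_UNIV]
 have cphi: "continuous_on UNIV ph" by (intro continuous_at_imp_continuous_on ballI DERIV_isCont[OF ph(1)])
 then have [measurable]: "ph \<in> borel_measurable borel" by (rule borel_measurable_continuous_onI)
 have "(LINT x:{-1<..<1}|lebesgue. \<mu> x * deriv ph x) = (LBINT x:{-1<..<1}. \<mu> x * deriv ph x)"
 by (intro set_lebesgue_integral_lebesgue borel_measurable_continuous_on_indicator continuous_intros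
 continuous_on_subset[OF c] cph) auto
 also have "... = (LBINT x:{-1..1}. \<mu> x * deriv ph x)" by (rule integral_open_closed)
 finally have 1: "(LINT x:{-1<..<1}|lebesgue. \<mu> x * deriv ph x) = (LBINT x:{-1..1}. \<mu> x * deriv ph x)" .
 have "(LINT x:{-1<..<1}|lebesgue. g x * ph x) = (LINT x|lebesgue. g0 x * ph x)"
 unfolding set_lebesgue_integral_def
 proof (rule integral_cong_AE)
 have [measurable]: "ph \<in> borel_measurable lebesgue" by (rule measurable_completion) simp
 have "(%x. (indicator {-1<..<1} x *\<^sub>R g x) * ph x) \<in> borel_measurable lebesgue"
 by (intro borel_measurable_times gm) auto
 then show "(%x. indicator {-1<..<1} x *\<^sub>R (g x * ph x)) \<in> borel_measurable lebesgue" by (simp add: mult.assoc)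
 show "(%x. g0 x * ph x) \<in> borel_measurable lebesgue" by (intro measurable_completion) simp
 show "AE x in lebesgue. indicat_real {-1<..<1} x *\<^sub>R (g x * ph x) = g0 x * ph x"
 using ae0 by eventually_elim (auto simp: g0_def indicator_def)
 qed
 also have "... = (\<integral>x. g0 x * ph x \<partial>lborel)" by (intro integral_completion) simp
 also have "... = - (LBINT x:{-1..1}. prim g0 x * deriv ph x)"
 using integral_mult_by_parts[OF L0 ph(1,2)] ph(3)[of 1] by simp
 finally have 2: "(LBINT x:{-1..1}. \<mu> x * deriv ph x) = (LBINT x:{-1..1}. prim g0 x * deriv ph x)"
 using weak[OF t] 1 by simp
 have "(LBINT x:{-1..1}. ?m x * deriv ph x) = (LBINT x:{-1..1}. \<mu> x * deriv ph x) - (LBINT x:{-1..1}. prim g0 x * deriv ph x)"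
 unfolding left_diff_distrib
 by (intro set_integral_diff(2) LBINT_eq_HK(2) continuous_intros c cph continuous_prim L0)
 with 2 show ?thesis by simp
 qed
 have eq: "?m y = ?m 0" if "y \<in> {-1<..<1}" for y
 proof -
 consider "y < 0" | "y = 0" | "0 < y" by linarith
 then show ?thesis
 proof cases
 case 1 then show ?thesis using du_Bois_Reymond[OF cm T, of y 0] that by simp
 next
 case 3 then show ?thesis using du_Bois_Reymond[OF cm T, of 0 y] that by simp
 qed simp
 qed
 \<comment> \<open>The du Bois-Reymond lemma compares interior points; continuity carries the
   constant to the two end points.\<close>
 have cl: "closure {-1<..<1::real} = {-1..1}" by simp
 show ?thesis
 by (rule continuous_constant_on_closure[of "{-1<..<1}" ?m]) (unfold cl, fact cm, fact eq, fact that)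
 qed
 have "\<mu> x = \<mu> (-1) + prim g0 x" if "x \<in> {-1..1}" for x
 using const[OF that] const[of "-1"] prim_lower[OF L0, of "-1"] by simp
 then show thesis using that L0 ae0 by blast
qed

section \<open>Sobolev functions on the half disc as limits of C1 functions\<close>

lemma emeasure_Hp: "emeasure lborel Hp < \<infinity>"
 by (rule emeasure_bounded_finite[OF bounded_subset[OF compact_imp_bounded[OF compact_Kp] Hp_subset_Kp]])

lemma nn_integral_Hp_eq:
 assumes "continuous_on Kp f" "!!x. x \<in> Hp ==> 0 <= f x"
 shows "(\<integral>\<^sup>+x. indicator Hp x * ennreal (f x) \<partial>lebesgue) = ennreal (LBINT x:Hp. f x)"
proof -
 have "(\<integral>\<^sup>+x. indicator Hp x * ennreal (f x) \<partial>lebesgue) = (\<integral>\<^sup>+x. ennreal (indicator Hp x *\<^sub>R f x) \<partial>lborel)"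
 unfolding nn_integral_completion by (intro nn_integral_cong) (auto simp: indicator_def)
 also have "... = ennreal (LBINT x:Hp. f x)"
 unfolding set_lebesgue_integral_def
 using set_integrable_Hp[OF assms(1)] assms(2)
 by (intro nn_integral_eq_integral) (auto simp: set_integrable_def indicator_def)
 finally show ?thesis .
qed

lemma nn_integral_interval_eq:
 fixes f :: "real => real"
 assumes "continuous_on {a..b} f" "!!x. x \<in> {a..b} ==> 0 <= f x"
 shows "(\<integral>\<^sup>+x. indicator {a<..<b} x * ennreal (f x) \<partial>lebesgue) = ennreal (LBINT x:{a..b}. f x)"
proof -
 have i: "set_integrable lborel {a<..<b} f"
 by (rule set_integrable_subset[OF LBINT_eq_HK(2)[OF assms(1)]]) auto
 have "(\<integral>\<^sup>+x. indicator {a<..<b} x * ennreal (f x) \<partial>lebesgue) = (\<integral>\<^sup>+x. ennreal (indicator {a<..<b} x *\<^sub>R f x) \<partial>lborel)"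
 unfolding nn_integral_completion by (intro nn_integral_cong) (auto simp: indicator_def)
 also have "... = ennreal (LBINT x:{a<..<b}. f x)"
 unfolding set_lebesgue_integral_def
 using i assms(2) by (intro nn_integral_eq_integral) (auto simp: set_integrable_def indicator_def)
 finally show ?thesis by (simp add: integral_open_closed)
qed

text \<open>Convergence in L2 over a set of finite measure implies convergence against bounded
  weights. Instead of Cauchy-Schwarz the pointwise inequality |f \<psi>| \<le> q + K^2 f^2 / q is
  integrated, with q a small constant.\<close>

lemma L2_tendsto_integral:
 fixes f :: "nat => 'a::euclidean_space => real"
 assumes A: "A \<in> sets borel" "emeasure lborel A < \<infinity>"
 and f: "!!n. (%x. indicator A x * f n x) \<in> borel_measurable lebesgue"
 and \<psi>: "!!x. x \<in> A ==> \<bar>\<psi> x\<bar> <= K"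
 and lim: "(%n. \<integral>\<^sup>+x. indicator A x * ennreal ((f n x)^2) \<partial>lebesgue) ---> 0"
 shows "(%n. LINT x:A|lebesgue. f n x * \<psi> x) ---> 0"
proof (rule tendstoI)
 fix e :: real assume e: "e > 0"
 define m where "m = measure lborel A"
 have m: "emeasure lborel A = ennreal m" "m \<ge> 0" using A(2) by (auto simp: m_def emeasure_eq_ennreal_measure)
 \<comment> \<open>The first error is then \<open>hq * m\<close> \<le> e/2, and \<open>dl\<close>
   makes the second one, K^2 / hq * dl, at most e/4. The added 1s guard against m = 0 and K =
   0.\<close>
 define hq where "hq = e / (2 * (m + 1))"
 define dl where "dl = e * hq / (4 * (K^2 + 1))"
 have pos: "hq > 0" "dl > 0" using e m by (auto simp: hq_def dl_def add_nonneg_pos)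
 have "\<forall>\<^sub>F n in sequentially. (\<integral>\<^sup>+x. indicator A x * ennreal ((f n x)^2) \<partial>lebesgue) < ennreal dl"
 using order_tendstoD(2)[OF lim, of "ennreal dl"] pos by auto
 then show "\<forall>\<^sub>F n in sequentially. dist (LINT x:A|lebesgue. f n x * \<psi> x) 0 < e"
 proof eventually_elim
 case (elim n)
 let ?g = "%x. indicator A x *\<^sub>R (f n x * \<psi> x)"
 show ?case
 proof (cases "integrable lebesgue ?g")
 case True
 have "ennreal (norm (LINT x:A|lebesgue. f n x * \<psi> x)) <= (\<integral>\<^sup>+x. norm (?g x) \<partial>lebesgue)"
 unfolding set_lebesgue_integral_def by (rule integral_norm_bound_ennreal[OF True])
 also have "... <= (\<integral>\<^sup>+x. ennreal hq * indicator A x + ennreal (K^2 / hq) * (indicator A x * ennreal ((f n x)^2)) \<partial>lebesgue)"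
 proof (rule nn_integral_mono)
 fix x
 show "ennreal (norm (?g x)) <= ennreal hq * indicator A x + ennreal (K^2 / hq) * (indicator A x * ennreal ((f n x)^2))"
 proof (cases "x \<in> A")
 case True
 have "\<bar>f n x\<bar> * \<bar>\<psi> x\<bar> <= \<bar>f n x\<bar> * \<bar>K\<bar>" using \<psi>[OF True] by (intro mult_left_mono) auto
 also have "... <= hq + K^2 / hq * (f n x)^2"
 proof -
 have "0 <= (\<bar>f n x\<bar> * \<bar>K\<bar> - hq)^2" by simp
 then have "2 * (\<bar>f n x\<bar> * \<bar>K\<bar>) * hq <= hq^2 + K^2 * (f n x)^2"
 by (simp add: power2_diff power_mult_distrib algebra_simps)
 then have "2 * (\<bar>f n x\<bar> * \<bar>K\<bar>) <= hq + K^2 / hq * (f n x)^2"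
 using pos by (simp add: field_simps power2_eq_square)
 moreover have "0 <= \<bar>f n x\<bar> * \<bar>K\<bar>" by simp
 ultimately show ?thesis by linarith
 qed
 finally show ?thesis using True pos
 by (simp add: abs_mult ennreal_plus[symmetric] ennreal_mult[symmetric] ennreal_leI del: ennreal_plus)
 qed simp
 qed
 also have "... = ennreal hq * ennreal m + ennreal (K^2 / hq) * (\<integral>\<^sup>+x. indicator A x * ennreal ((f n x)^2) \<partial>lebesgue)"
 proof (subst nn_integral_add)
 have "(%x. ennreal ((indicator A x * f n x)^2)) \<in> borel_measurable lebesgue" using f by measurable
 moreover have "(%x. ennreal ((indicator A x * f n x)^2)) = (%x. indicator A x * ennreal ((f n x)^2))"
 by (auto simp: indicator_def)
 ultimately have *: "(%x. indicator A x * ennreal ((f n x)^2)) \<in> borel_measurable lebesgue" by simp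
 then show "(%x. ennreal (K^2 / hq) * (indicator A x * ennreal ((f n x)^2))) \<in> borel_measurable lebesgue" by measurable
 have "(%x. ennreal hq * indicator A x) \<in> borel_measurable lborel" using A(1) by simp
 then show "(%x. ennreal hq * indicator A x) \<in> borel_measurable lebesgue" by (rule measurable_completion)
 show "(\<integral>\<^sup>+x. ennreal hq * indicator A x \<partial>lebesgue) + (\<integral>\<^sup>+x. ennreal (K^2 / hq) * (indicator A x * ennreal ((f n x)^2)) \<partial>lebesgue)
 = ennreal hq * ennreal m + ennreal (K^2 / hq) * (\<integral>\<^sup>+x. indicator A x * ennreal ((f n x)^2) \<partial>lebesgue)"
 using A(1) m * by (simp add: nn_integral_cmult nn_integral_cmult_indicator)
 qed
 also have "... <= ennreal hq * ennreal m + ennreal (K^2 / hq) * ennreal dl"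
 using elim by (intro add_left_mono mult_left_mono) auto
 also have "... = ennreal (hq * m + K^2 / hq * dl)"
 using pos m by (simp add: ennreal_plus[symmetric] ennreal_mult[symmetric] del: ennreal_plus)
 finally have "norm (LINT x:A|lebesgue. f n x * \<psi> x) <= hq * m + K^2 / hq * dl"
 using pos m by (subst (asm) ennreal_le_iff) auto
 also have "hq * m <= e / 2"
 using e m by (simp add: hq_def field_simps)
 also have "K^2 / hq * dl = e * (K^2 / (4 * (K^2 + 1)))" using pos by (simp add: dl_def)
 also have "... <= e * (1 / 4)"
 using e add_nonneg_pos[OF zero_le_power2[of K] zero_less_one] by (intro mult_left_mono) (simp_all add: pos_divide_le_eq)
 finally show ?thesis using e by simp
 next
 \<comment> \<open>A product that is not integrable has Bochner integral 0 by convention, so the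
   estimate holds trivially.\<close>
 case False
 then show ?thesis using e by (simp add: set_lebesgue_integral_def not_integrable_integral_eq)
 qed
 qed
qed

lemma test_fun_planeD:
 fixes ph :: "real \<times> real => real"
 assumes "test_fun U ph"
 obtains Dph where "C1_fun ph Dph" "!!x e. frechet_derivative ph (at x) e = Dph x \<bullet> e" "!!x. x \<notin> U ==> ph x = 0"
proof -
 from assms have "Ck (Suc 0) ph" by (simp add: test_fun_def del: Ck.simps)
 then obtain D where D: "!!x. (ph has_derivative D x) (at x)" "!!h. continuous_on UNIV (%x. D x h)"
 unfolding Ck.simps by blast
 define Dph where "Dph x = (D x (1, 0), D x (0, 1))" for x
 have eq: "D x h = Dph x \<bullet> h" for x h
 proof -
 interpret bounded_linear "D x" using has_derivative_bounded_linear[OF D(1)] .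
 have "h = fst h *\<^sub>R (1, 0) + snd h *\<^sub>R (0, 1)" by (cases h) simp
 then have "D x h = fst h * D x (1, 0) + snd h * D x (0, 1)" using add scaleR by (metis real_scaleR_def)
 then show ?thesis by (simp add: Dph_def inner_prod_def mult.commute)
 qed
 show thesis
 proof
 have "(ph has_derivative (%h. Dph x \<bullet> h)) (at x)" for x
 using D(1)[of x] by (simp only: eq[symmetric])
 moreover have "continuous_on UNIV Dph" unfolding Dph_def by (intro continuous_intros D)
 ultimately show "C1_fun ph Dph" unfolding C1_fun_def by blast
 show "frechet_derivative ph (at x) e = Dph x \<bullet> e" for x e
 using frechet_derivative_at[OF D(1)[of x]] eq by metis
 show "x \<notin> U ==> ph x = 0" for x using assms closure_subset[of "{x. ph x \<noteq> 0}"] by (auto simp: test_fun_def)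
 qed
qed

lemma indicator_Hp_measurable:
 fixes f :: "real \<times> real => 'b::euclidean_space"
 assumes "continuous_on Kp f"
 shows "(%x. indicator Hp x *\<^sub>R f x) \<in> borel_measurable borel" "(%x. indicator Hp x *\<^sub>R f x) \<in> borel_measurable lebesgue"
proof -
 show "(%x. indicator Hp x *\<^sub>R f x) \<in> borel_measurable borel"
 by (intro borel_measurable_continuous_on_indicator continuous_on_subset[OF assms Hp_subset_Kp]) auto
 then show "(%x. indicator Hp x *\<^sub>R f x) \<in> borel_measurable lebesgue" by (intro measurable_completion) simp
qed

lemma integral_by_parts_C1:
 assumes v: "C1_fun v Dv" and ph: "C1_fun ph Dph" "!!x. x \<notin> Hp ==> ph x = 0" and e: "e \<in> Basis"
 shows "(LBINT x:Hp. v x * (Dph x \<bullet> e)) = - (LBINT x:Hp. (Dv x \<bullet> e) * ph x)"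
proof -
 note [continuous_intros] = C1_funD(2,3)[OF v] C1_funD(2,3)[OF ph(1)]
 have arc0: "ph (cos th, sin th) = 0" "ph (t, 0) = 0" for th t :: real
 by (rule ph(2); auto simp: mem_Hp)+
 have eq: "(LBINT x:Hp. v x * (Dph x \<bullet> e)) + (LBINT x:Hp. (Dv x \<bullet> e) * ph x) = (LBINT x:Hp. v x * (Dph x \<bullet> e) + (Dv x \<bullet> e) * ph x)"
 by (intro set_integral_add(2)[symmetric] set_integrable_Hp continuous_intros)
 from e consider "e = (1, 0)" | "e = (0, 1)" by (auto simp: Basis_prod_def)
 then have "(LBINT x:Hp. v x * (Dph x \<bullet> e) + (Dv x \<bullet> e) * ph x) = 0"
 proof cases
 case 1
 have "(LBINT x:Hp. v x * (Dph x \<bullet> e) + (Dv x \<bullet> e) * ph x) = (LBINT th:{0..pi}. v (cos th, sin th) * ph (cos th, sin th) * cos th)"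
 by (rule div_Hp_x) (auto intro!: continuous_intros derivative_eq_intros C1_funD(4)[OF v] C1_funD(4)[OF ph(1)]
 simp: 1 inner_prod_def)
 then show ?thesis by (simp add: arc0)
 next
 case 2
 have "(LBINT x:Hp. v x * (Dph x \<bullet> e) + (Dv x \<bullet> e) * ph x) = (LBINT th:{0..pi}. v (cos th, sin th) * ph (cos th, sin th) * sin th)
 - (LBINT t:{-1..1}. v (t, 0) * ph (t, 0))"
 by (rule div_Hp_y) (auto intro!: continuous_intros derivative_eq_intros C1_funD(5)[OF v] C1_funD(5)[OF ph(1)]
 simp: 2 inner_prod_def)
 then show ?thesis by (simp add: arc0)
 qed
 with eq show ?thesis by simp
qed

lemma L2_on_integrable_bounded:
 fixes w \<psi> :: "real \<times> real => real"
 assumes w: "L2_on Hp w" and \<psi>: "continuous_on Kp \<psi>"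
 shows "set_integrable lebesgue Hp (%x. w x * \<psi> x)"
proof -
 obtain K where K: "K \<ge> 0" "!!x. x \<in> Kp ==> norm (\<psi> x) <= K" using continuous_on_compact_bound[OF compact_Kp \<psi>] by blast
 have m: "(%x. indicator Hp x *\<^sub>R w x) \<in> borel_measurable lebesgue"
 and fin: "(\<integral>\<^sup>+x. indicator Hp x * ennreal ((norm (w x))^2) \<partial>lebesgue) < \<infinity>" using w by (auto simp: L2_on_def)
 show ?thesis
 unfolding set_integrable_def
 proof (rule integrableI_bounded)
 have "(%x. (indicator Hp x *\<^sub>R w x) * (indicator Hp x *\<^sub>R \<psi> x)) \<in> borel_measurable lebesgue"
 by (intro borel_measurable_times m indicator_Hp_measurable \<psi>)
 moreover have "(%x. (indicator Hp x *\<^sub>R w x) * (indicator Hp x *\<^sub>R \<psi> x)) = (%x. indicator Hp x *\<^sub>R (w x * \<psi> x))"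
 by (auto simp: indicator_def)
 ultimately show "(%x. indicator Hp x *\<^sub>R (w x * \<psi> x)) \<in> borel_measurable lebesgue" by simp
 have "(%x. ennreal ((indicator Hp x *\<^sub>R w x)^2)) \<in> borel_measurable lebesgue" using m by measurable
 then have m2: "(%x. indicator Hp x * ennreal ((norm (w x))^2)) \<in> borel_measurable lebesgue"
 by (rule measurable_cong[THEN iffD1, rotated]) (auto simp: indicator_def)
 have "(\<integral>\<^sup>+x. ennreal (norm (indicator Hp x *\<^sub>R (w x * \<psi> x))) \<partial>lebesgue)
 <= (\<integral>\<^sup>+x. ennreal K * indicator Hp x + ennreal K * (indicator Hp x * ennreal ((norm (w x))^2)) \<partial>lebesgue)"
 proof (rule nn_integral_mono)
 fix x
 show "ennreal (norm (indicator Hp x *\<^sub>R (w x * \<psi> x))) <= ennreal K * indicator Hp x + ennreal K * (indicator Hp x * ennreal ((norm (w x))^2))"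
 proof (cases "x \<in> Hp")
 case True
 have "\<bar>w x\<bar> <= 1 + (w x)^2" using zero_le_power2[of "\<bar>w x\<bar> - 1"] abs_ge_zero[of "w x"]
 by (simp add: power2_diff del: abs_ge_zero)
 then have "\<bar>w x\<bar> * \<bar>\<psi> x\<bar> <= (1 + (w x)^2) * K" using K(2)[of x] True Hp_subset_Kp by (intro mult_mono) auto
 then show ?thesis using True K(1)
 by (simp add: abs_mult ennreal_plus[symmetric] ennreal_mult[symmetric] ennreal_leI algebra_simps del: ennreal_plus)
 qed simp
 qed
 also have "... = ennreal K * emeasure lborel Hp + ennreal K * (\<integral>\<^sup>+x. indicator Hp x * ennreal ((norm (w x))^2) \<partial>lebesgue)"
 proof (subst nn_integral_add)
 have "(%x. ennreal K * indicator Hp x) \<in> borel_measurable lborel" by simp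
 then show "(%x. ennreal K * indicator Hp x) \<in> borel_measurable lebesgue" by (rule measurable_completion)
 qed (use m2 in \<open>auto simp: nn_integral_cmult nn_integral_cmult_indicator\<close>)
 also have "... < \<infinity>" using fin emeasure_Hp by (auto simp: ennreal_mult_less_top)
 finally show "(\<integral>\<^sup>+x. ennreal (norm (indicator Hp x *\<^sub>R (w x * \<psi> x))) \<partial>lebesgue) < \<infinity>" .
 qed
qed

lemma L2_on_continuous:
 assumes "continuous_on Kp f"
 shows "L2_on Hp (f :: _ => 'b::euclidean_space)"
 unfolding L2_on_def
proof (intro conjI indicator_Hp_measurable assms)
 show "(\<integral>\<^sup>+x. indicator Hp x * ennreal ((norm (f x))^2) \<partial>lebesgue) < \<infinity>"
 by (subst nn_integral_Hp_eq) (auto intro!: continuous_intros assms)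
qed

lemma L2_on_inner:
 assumes "L2_on Hp G" "norm e <= 1"
 shows "L2_on Hp (%x. G x \<bullet> (e :: real \<times> real))"
 unfolding L2_on_def
proof (intro conjI)
 have "(%x. (indicator Hp x *\<^sub>R G x) \<bullet> e) \<in> borel_measurable lebesgue"
 using assms by (intro borel_measurable_inner) (auto simp: L2_on_def)
 then show "(%x. indicator Hp x *\<^sub>R (G x \<bullet> e)) \<in> borel_measurable lebesgue" by simp
 have "(\<integral>\<^sup>+x. indicator Hp x * ennreal ((norm (G x \<bullet> e))^2) \<partial>lebesgue) <= (\<integral>\<^sup>+x. indicator Hp x * ennreal ((norm (G x))^2) \<partial>lebesgue)"
 proof (intro nn_integral_mono mult_left_mono ennreal_leI power_mono)
 show "norm (G x \<bullet> e) <= norm (G x)" for x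
 using Cauchy_Schwarz_ineq2[of "G x" e] mult_left_mono[OF assms(2), of "norm (G x)"] by simp
 qed auto
 also have "... < \<infinity>" using assms by (auto simp: L2_on_def)
 finally show "(\<integral>\<^sup>+x. indicator Hp x * ennreal ((norm (G x \<bullet> e))^2) \<partial>lebesgue) < \<infinity>" .
qed

lemma W12_dist_sq_components:
 assumes L: "L2_on Hp w" "L2_on Hp G" and v: "C1_fun v Dv"
 shows "(%x. indicator Hp x * (v x - w x)) \<in> borel_measurable lebesgue"
 "(%x. indicator Hp x *\<^sub>R (Dv x - G x)) \<in> borel_measurable lebesgue"
 "(%x. indicator Hp x * ennreal ((v x - w x)^2 + (norm (Dv x - G x))^2)) \<in> borel_measurable lebesgue"
proof -
 have "(%x. indicator Hp x *\<^sub>R v x - indicator Hp x *\<^sub>R w x) \<in> borel_measurable lebesgue"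
 using L(1) by (intro borel_measurable_diff indicator_Hp_measurable(2)[OF C1_funD(3)[OF v]]) (auto simp: L2_on_def)
 then show 1: "(%x. indicator Hp x * (v x - w x)) \<in> borel_measurable lebesgue" by (simp add: algebra_simps)
 have "(%x. indicator Hp x *\<^sub>R Dv x - indicator Hp x *\<^sub>R G x) \<in> borel_measurable lebesgue"
 using L(2) by (intro borel_measurable_diff indicator_Hp_measurable(2)[OF C1_funD(2)[OF v]]) (auto simp: L2_on_def)
 then show 2: "(%x. indicator Hp x *\<^sub>R (Dv x - G x)) \<in> borel_measurable lebesgue" by (simp add: algebra_simps)
 have "(%x. ennreal ((indicator Hp x * (v x - w x))^2 + (norm (indicator Hp x *\<^sub>R (Dv x - G x)))^2)) \<in> borel_measurable lebesgue"
 using 1 2 by measurable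
 then show "(%x. indicator Hp x * ennreal ((v x - w x)^2 + (norm (Dv x - G x))^2)) \<in> borel_measurable lebesgue"
 by (rule measurable_cong[THEN iffD1, rotated]) (auto simp: indicator_def)
qed

text \<open>The weak derivative identity holds for C1 functions by the divergence theorem, and both
  of its sides are continuous in L2. For a limit of C1 functions only square integrability remains
  to be checked.\<close>

lemma W12_on_limit:
 assumes v: "!!n. C1_fun (v n) (Dv n)" and L: "L2_on Hp w" "L2_on Hp G"
 and lim: "(%n. W12_dist_sq Hp (v n) (Dv n) w G) ---> 0"
 shows "W12_on Hp w G"
 unfolding W12_on_def
proof (intro conjI allI impI L)
 fix ph :: "real \<times> real => real" and e :: "real \<times> real"
 assume "test_fun Hp ph \<and> e \<in> Basis"
 then have t: "test_fun Hp ph" and e: "e \<in> Basis" by auto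
 obtain Dph where ph: "C1_fun ph Dph" "!!x e. frechet_derivative ph (at x) e = Dph x \<bullet> e" "!!x. x \<notin> Hp ==> ph x = 0"
 using test_fun_planeD[OF t] by blast
 note [continuous_intros] = C1_funD(2,3)[OF ph(1)]
 have c1: "continuous_on Kp (%x. Dph x \<bullet> e)" and c2: "continuous_on Kp ph" by (intro continuous_intros)+
 obtain K1 where K1: "!!x. x \<in> Kp ==> norm (Dph x \<bullet> e) <= K1" using continuous_on_compact_bound[OF compact_Kp c1] by blast
 obtain K2 where K2: "!!x. x \<in> Kp ==> norm (ph x) <= K2" using continuous_on_compact_bound[OF compact_Kp c2] by blast
 have ne: "norm e <= 1" using e by simp
 have Le: "L2_on Hp (%x. G x \<bullet> e)" by (rule L2_on_inner[OF L(2) ne])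
 have vc: "L2_on Hp (v n)" "L2_on Hp (%x. Dv n x \<bullet> e)" for n
 by (intro L2_on_continuous L2_on_inner C1_funD[OF v] ne)+
 have dist: "(\<integral>\<^sup>+x. indicator Hp x * ennreal ((v n x - w x)^2) \<partial>lebesgue) <= W12_dist_sq Hp (v n) (Dv n) w G"
 "(\<integral>\<^sup>+x. indicator Hp x * ennreal ((Dv n x \<bullet> e - G x \<bullet> e)^2) \<partial>lebesgue) <= W12_dist_sq Hp (v n) (Dv n) w G" for n
 proof -
 have "(Dv n x \<bullet> e - G x \<bullet> e)^2 <= (norm (Dv n x - G x))^2" for x
 using Cauchy_Schwarz_ineq2[of "Dv n x - G x" e] mult_left_mono[OF ne, of "norm (Dv n x - G x)"]
 by (simp add: inner_diff_left flip: abs_le_square_iff)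
 then have *: "(Dv n x \<bullet> e - G x \<bullet> e)^2 <= (v n x - w x)^2 + (norm (Dv n x - G x))^2" for x
 using zero_le_power2[of "v n x - w x"] by (meson add_increasing)
 show "(\<integral>\<^sup>+x. indicator Hp x * ennreal ((v n x - w x)^2) \<partial>lebesgue) <= W12_dist_sq Hp (v n) (Dv n) w G"
 "(\<integral>\<^sup>+x. indicator Hp x * ennreal ((Dv n x \<bullet> e - G x \<bullet> e)^2) \<partial>lebesgue) <= W12_dist_sq Hp (v n) (Dv n) w G"
 unfolding W12_dist_sq_def using * by (intro nn_integral_mono mult_left_mono ennreal_leI; simp)+
 qed
 have l1: "(%n. LINT x:Hp|lebesgue. (v n x - w x) * (Dph x \<bullet> e)) ---> 0"
 proof (rule L2_tendsto_integral[where K=K1])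
 show "(%n. \<integral>\<^sup>+x. indicator Hp x * ennreal ((v n x - w x)^2) \<partial>lebesgue) ---> 0"
 by (rule tendsto_sandwich[OF _ _ tendsto_const lim]) (auto intro!: always_eventually dist)
 qed (use K1 Hp_subset_Kp emeasure_Hp W12_dist_sq_components[OF L v] in auto)
 have l2: "(%n. LINT x:Hp|lebesgue. (Dv n x \<bullet> e - G x \<bullet> e) * ph x) ---> 0"
 proof (rule L2_tendsto_integral[where K=K2])
 show "(%n. \<integral>\<^sup>+x. indicator Hp x * ennreal ((Dv n x \<bullet> e - G x \<bullet> e)^2) \<partial>lebesgue) ---> 0"
 by (rule tendsto_sandwich[OF _ _ tendsto_const lim]) (auto intro!: always_eventually dist)
 show "(%x. indicator Hp x * (Dv n x \<bullet> e - G x \<bullet> e)) \<in> borel_measurable lebesgue" for n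
 proof -
 have "(%x. (indicator Hp x *\<^sub>R (Dv n x - G x)) \<bullet> e) \<in> borel_measurable lebesgue"
 using W12_dist_sq_components(2)[OF L v] by measurable
 then show ?thesis by (simp add: inner_diff_left)
 qed
 qed (use K2 Hp_subset_Kp emeasure_Hp in auto)
 have sm: "!!f. (%x. indicator Hp x *\<^sub>R f x) \<in> borel_measurable borel ==> (LINT x:Hp|lebesgue. f x :: real) = (LBINT x:Hp. f x)"
 by (rule set_lebesgue_integral_lebesgue)
 have parts: "(LINT x:Hp|lebesgue. v n x * (Dph x \<bullet> e)) = - (LINT x:Hp|lebesgue. (Dv n x \<bullet> e) * ph x)" for n
 proof -
 have cA: "continuous_on Kp (%x. v n x * (Dph x \<bullet> e))" and cB: "continuous_on Kp (%x. (Dv n x \<bullet> e) * ph x)"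
 by (intro continuous_intros C1_funD[OF v])+
 show ?thesis using integral_by_parts_C1[OF v ph(1) ph(3) e, of n]
 unfolding sm[OF indicator_Hp_measurable(1)[OF cA]] sm[OF indicator_Hp_measurable(1)[OF cB]] .
 qed
 have e1: "(LINT x:Hp|lebesgue. (v n x - w x) * (Dph x \<bullet> e)) = (LINT x:Hp|lebesgue. v n x * (Dph x \<bullet> e)) - (LINT x:Hp|lebesgue. w x * (Dph x \<bullet> e))" for n
 unfolding left_diff_distrib by (intro set_integral_diff(2) L2_on_integrable_bounded vc L c1)
 have e2: "(LINT x:Hp|lebesgue. (Dv n x \<bullet> e - G x \<bullet> e) * ph x) = (LINT x:Hp|lebesgue. (Dv n x \<bullet> e) * ph x) - (LINT x:Hp|lebesgue. (G x \<bullet> e) * ph x)" for n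
 unfolding left_diff_distrib by (intro set_integral_diff(2) L2_on_integrable_bounded vc Le c2)
 have "(%n. (LINT x:Hp|lebesgue. (v n x - w x) * (Dph x \<bullet> e)) + (LINT x:Hp|lebesgue. (Dv n x \<bullet> e - G x \<bullet> e) * ph x)) ---> 0 + 0"
 by (intro tendsto_add l1 l2)
 moreover have "(LINT x:Hp|lebesgue. (v n x - w x) * (Dph x \<bullet> e)) + (LINT x:Hp|lebesgue. (Dv n x \<bullet> e - G x \<bullet> e) * ph x)
 = - (LINT x:Hp|lebesgue. w x * (Dph x \<bullet> e)) - (LINT x:Hp|lebesgue. (G x \<bullet> e) * ph x)" for n
 unfolding e1 e2 parts by simp
 ultimately have "- (LINT x:Hp|lebesgue. w x * (Dph x \<bullet> e)) - (LINT x:Hp|lebesgue. (G x \<bullet> e) * ph x) = 0"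
 by (simp add: LIMSEQ_const_iff)
 then show "(LINT x:Hp|lebesgue. w x * frechet_derivative ph (at x) e) = - (LINT x:Hp|lebesgue. (G x \<bullet> e) * ph x)"
 by (simp add: ph(2))
qed

text \<open>One sequence serves both traces: the approximants take the value 1 - gm on the arc
  exactly, so nothing has to converge there.\<close>

lemma W12_muI:
 assumes v: "!!n. C1_fun (v n) (Dv n)" and L: "L2_on Hp w" "L2_on Hp G"
 and lim: "(%n. W12_dist_sq Hp (v n) (Dv n) w G) ---> 0"
 and flat: "(%n. \<integral>\<^sup>+t. indicator {-1<..<1} t * ennreal ((v n (t, 0) - \<nu> t)^2) \<partial>lebesgue) ---> 0"
 and arc: "!!n th. 0 < th ==> th < pi ==> v n (cos th, sin th) = 1 - gm"
 shows "W12_mu gm \<nu> w G"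
 unfolding W12_mu_def
proof (intro conjI exI[of _ "%_. 1 - gm"])
 show "W12_on Hp w G" by (rule W12_on_limit[OF v L lim])
 show "trace_flat w G \<nu>" unfolding trace_flat_def using v lim flat by blast
 have "(\<integral>\<^sup>+th. indicator {0<..<pi} th * ennreal ((v n (cos th, sin th) - (1 - gm))^2) \<partial>lebesgue) = (\<integral>\<^sup>+th. 0 \<partial>(lebesgue :: real measure))" for n
 by (intro nn_integral_cong) (auto simp: indicator_def arc)
 then show "trace_arc w G (%_. 1 - gm)" unfolding trace_arc_def using v lim by (intro exI[of _ v] exI[of _ Dv]) simp
qed simp


section \<open>Smoothed truncation and the dual lower bound\<close>

definition smooth_pos :: "real => real => real" where
 "smooth_pos tq y = sqrt ((max y 0)^2 + tq^2) - tq"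

text \<open>Reverse triangle inequality for the vector (max y 0, tq). The truncation has to be C1
  because Green's formula is stated for C1 functions; being 1-Lipschitz, it inherits the convergence
  of the flat traces.\<close>

lemma smooth_pos_lipschitz: "\<bar>smooth_pos tq y - smooth_pos tq z\<bar> <= \<bar>y - z\<bar>"
proof -
 have "\<bar>norm (max y 0, tq) - norm (max z 0, tq)\<bar> <= norm ((max y 0, tq) - (max z 0, tq))"
 by (rule norm_triangle_ineq3)
 also have "... = \<bar>max y 0 - max z 0\<bar>" by (simp add: norm_Pair)
 also have "... <= \<bar>y - z\<bar>" by (auto simp: max_def)
 finally show ?thesis by (simp add: smooth_pos_def norm_Pair)
qed

lemma smooth_pos_bounds:
 assumes "tq > 0"
 shows "0 <= smooth_pos tq y" "smooth_pos tq y <= max y 0" "max y 0 - tq <= smooth_pos tq y"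
proof -
 have "sqrt (tq^2) <= sqrt ((max y 0)^2 + tq^2)" by (intro real_sqrt_le_mono) simp
 then show "0 <= smooth_pos tq y" using assms by (simp add: smooth_pos_def)
 have "sqrt ((max y 0)^2 + tq^2) <= max y 0 + tq"
 using assms by (intro real_le_lsqrt) (auto simp: power2_sum)
 then show "smooth_pos tq y <= max y 0" by (simp add: smooth_pos_def)
 have "sqrt ((max y 0)^2) <= sqrt ((max y 0)^2 + tq^2)" by (intro real_sqrt_le_mono) simp
 then show "max y 0 - tq <= smooth_pos tq y" by (simp add: smooth_pos_def)
qed

lemma smooth_pos_DERIV:
 assumes "tq > 0"
 shows "(smooth_pos tq has_real_derivative max y 0 / sqrt ((max y 0)^2 + tq^2)) (at y)"
proof -
 have p: "0 < (max y 0)^2 + tq^2" using assms by (intro add_nonneg_pos) auto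
 have "((%y. (max y 0)^2 + tq^2) has_real_derivative (2 * max y 0 * 1 + 0)) (at y)"
 by (intro DERIV_add DERIV_const DERIV_max_sq DERIV_ident)
 from DERIV_diff[OF DERIV_chain2[OF DERIV_real_sqrt[OF p] this] DERIV_const]
 show ?thesis unfolding smooth_pos_def[abs_def] by (rule DERIV_cong) (simp add: field_simps)
qed

lemma smooth_pos_deriv_bounds:
 assumes "tq > 0"
 shows "0 <= max y 0 / sqrt ((max y 0)^2 + tq^2)" "max y 0 / sqrt ((max y 0)^2 + tq^2) <= 1"
proof -
 have "sqrt ((max y 0)^2) <= sqrt ((max y 0)^2 + tq^2)" by (intro real_sqrt_le_mono) simp
 moreover have "0 < sqrt ((max y 0)^2 + tq^2)" using assms by (simp add: add_nonneg_pos)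
 ultimately show "0 <= max y 0 / sqrt ((max y 0)^2 + tq^2)" "max y 0 / sqrt ((max y 0)^2 + tq^2) <= 1"
 by (auto simp: divide_le_eq)
qed

lemma C1_smooth_pos:
 assumes v: "C1_fun v Dv" and tq: "tq > 0"
 shows "C1_fun (%x. smooth_pos tq (v x - c)) (%x. (max (v x - c) 0 / sqrt ((max (v x - c) 0)^2 + tq^2)) *\<^sub>R Dv x)"
 unfolding C1_fun_def
proof (intro conjI allI)
 fix x
 have "((%x. v x - c) has_derivative (%h. Dv x \<bullet> h)) (at x)"
 using has_derivative_diff[OF C1_funD(1)[OF v] has_derivative_const] by simp
 from has_derivative_compose[OF this smooth_pos_DERIV[OF tq, unfolded has_field_derivative_def]]
 show "((%x. smooth_pos tq (v x - c)) has_derivative (%h. ((max (v x - c) 0 / sqrt ((max (v x - c) 0)^2 + tq^2)) *\<^sub>R Dv x) \<bullet> h)) (at x)"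
 by simp
 show "continuous_on UNIV (%x. (max (v x - c) 0 / sqrt ((max (v x - c) 0)^2 + tq^2)) *\<^sub>R Dv x)"
 proof -
 have "sqrt ((max (v x - c) 0)^2 + tq^2) \<noteq> 0" for x
 using tq add_nonneg_pos[of "(max (v x - c) 0)^2" "tq^2"] by auto
 then show ?thesis by (intro continuous_intros C1_funD[OF v]) auto
 qed
qed

lemma nn_integral_sq_add_le:
 assumes "f \<in> borel_measurable M" "g \<in> borel_measurable M" "!!x. h x <= a * f x + b * (g x :: ennreal)"
 shows "nn_integral M h <= a * nn_integral M f + b * nn_integral M g"
proof -
 have "nn_integral M h <= (\<integral>\<^sup>+x. a * f x + b * g x \<partial>M)" by (intro nn_integral_mono assms)
 also have "... = a * nn_integral M f + b * nn_integral M g"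
 using assms by (simp add: nn_integral_add nn_integral_cmult)
 finally show ?thesis .
qed

text \<open>The two trace predicates carry separate approximating sequences; the arc trace of a difference
 is controlled by the Sobolev distance, so the flat sequence also satisfies the arc bound.  Only the
 one-sided information \<open>h <= 1 - gm\<close> is kept, because \<open>h\<close> need not be measurable.\<close>
lemma arc_excess_tendsto:
 assumes v: "!!n. C1_fun (v n) (Dv n)" "(%n. W12_dist_sq Hp (v n) (Dv n) w G) ---> 0"
 and L: "L2_on Hp w" "L2_on Hp G"
 and tr: "trace_arc w G h" "AE th in lebesgue. th \<in> {0<..<pi} \<longrightarrow> h th <= c"
 shows "(%n. \<integral>\<^sup>+th. indicator {0<..<pi} th * ennreal ((max (v n (cos th, sin th) - c) 0)^2) \<partial>lebesgue) ---> 0"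
proof -
 obtain u Du where u: "!!n. C1_fun (u n) (Du n)" "(%n. W12_dist_sq Hp (u n) (Du n) w G) ---> 0"
 "(%n. \<integral>\<^sup>+th. indicator {0<..<pi} th * ennreal ((u n (cos th, sin th) - h th)^2) \<partial>lebesgue) ---> 0"
 using tr(1) unfolding trace_arc_def by blast
 let ?a = "%n. \<integral>\<^sup>+th. indicator {0<..<pi} th * ennreal ((u n (cos th, sin th) - h th)^2) \<partial>lebesgue"
 let ?d = "%n. W12_dist_sq Hp (v n) (Dv n) w G" and ?d' = "%n. W12_dist_sq Hp (u n) (Du n) w G"
 have cpol: "continuous_on S (%th. f (cos th, sin th))" if "C1_fun f Df" for f Df and S :: "real set"
 by (rule continuous_on_compose2[OF C1_funD(3)[OF that, of UNIV]]) (auto intro!: continuous_intros)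
 have meas: "(%th. indicator {0<..<pi} th * ennreal (f th)) \<in> borel_measurable lebesgue" if "continuous_on UNIV f" for f
 using borel_measurable_continuous_onI[OF that] by (intro measurable_completion) simp
 have bound: "(\<integral>\<^sup>+th. indicator {0<..<pi} th * ennreal ((max (v n (cos th, sin th) - c) 0)^2) \<partial>lebesgue) <= 2 * ?a n + 12 * (?d n + ?d' n)" for n
 proof -
 let ?e = "%x. v n x - u n x" and ?De = "%x. Dv n x - Du n x"
 have e: "C1_fun ?e ?De" unfolding C1_fun_def
 proof (intro conjI allI)
 show "((%x. v n x - u n x) has_derivative (%h. (Dv n x - Du n x) \<bullet> h)) (at x)" for x
 using has_derivative_diff[OF C1_funD(1)[OF v(1)[of n]] C1_funD(1)[OF u(1)[of n]]] by (simp add: inner_diff_left)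
 show "continuous_on UNIV (%x. Dv n x - Du n x)" by (intro continuous_intros C1_funD(2)[OF v(1)] C1_funD(2)[OF u(1)])
 qed
 have "(\<integral>\<^sup>+th. indicator {0<..<pi} th * ennreal ((max (v n (cos th, sin th) - c) 0)^2) \<partial>lebesgue)
 <= 2 * (\<integral>\<^sup>+th. indicator {0<..<pi} th * ennreal ((max (u n (cos th, sin th) - c) 0)^2) \<partial>lebesgue)
 + 2 * (\<integral>\<^sup>+th. indicator {0<..<pi} th * ennreal ((?e (cos th, sin th))^2) \<partial>lebesgue)"
 proof (rule nn_integral_sq_add_le)
 fix th :: real
 define a b where "a = max (u n (cos th, sin th) - c) 0" and "b = ?e (cos th, sin th)"
 have "max (v n (cos th, sin th) - c) 0 <= a + \<bar>b\<bar>" by (auto simp: a_def b_def max_def)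
 then have "(max (v n (cos th, sin th) - c) 0)^2 <= (a + \<bar>b\<bar>)^2" by (intro power_mono) auto
 also have "... <= 2 * a^2 + 2 * b^2" using zero_le_power2[of "a - \<bar>b\<bar>"] by (simp add: power2_sum power2_diff)
 finally have "ennreal ((max (v n (cos th, sin th) - c) 0)^2) <= ennreal (2 * a^2 + 2 * b^2)" by (rule ennreal_leI)
 also have "... = 2 * ennreal (a^2) + 2 * ennreal (b^2)" by (simp add: ennreal_mult)
 finally show "indicator {0<..<pi} th * ennreal ((max (v n (cos th, sin th) - c) 0)^2) \<le>
 2 * (indicator {0<..<pi} th * ennreal ((max (u n (cos th, sin th) - c) 0)^2)) + 2 * (indicator {0<..<pi} th * ennreal ((?e (cos th, sin th))^2))"
 by (simp add: indicator_def a_def b_def)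
 qed (intro meas continuous_intros cpol[OF u(1)] cpol[OF e])+
 also have "(\<integral>\<^sup>+th. indicator {0<..<pi} th * ennreal ((max (u n (cos th, sin th) - c) 0)^2) \<partial>lebesgue) <= ?a n"
 proof (rule nn_integral_mono_AE)
 show "AE th in lebesgue. indicator {0<..<pi} th * ennreal ((max (u n (cos th, sin th) - c) 0)^2)
 <= indicator {0<..<pi} th * ennreal ((u n (cos th, sin th) - h th)^2)"
 using tr(2)
 proof eventually_elim
 case (elim th)
 show ?case
 proof (cases "th \<in> {0<..<pi}")
 case True
 then have "max (u n (cos th, sin th) - c) 0 <= \<bar>u n (cos th, sin th) - h th\<bar>" using elim by auto
 then have "(max (u n (cos th, sin th) - c) 0)^2 <= \<bar>u n (cos th, sin th) - h th\<bar>\<^sup>2" by (intro power_mono) auto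
 then show ?thesis by (intro mult_left_mono ennreal_leI) auto
 qed simp
 qed
 qed
 also have "(\<integral>\<^sup>+th. indicator {0<..<pi} th * ennreal ((?e (cos th, sin th))^2) \<partial>lebesgue) = ennreal (LBINT th:{0..pi}. (?e (cos th, sin th))^2)"
 by (rule nn_integral_interval_eq) (auto intro!: continuous_intros cpol[OF v(1)] cpol[OF u(1)])
 also have "(LBINT th:{0..pi}. (?e (cos th, sin th))^2) = (LBINT x:Hp. 2 * (?e x)^2 + 2 * ?e x * (x \<bullet> ?De x))"
 by (rule arc_trace_identity[OF e])
 also have "... <= (LBINT x:Hp. 3 * ((?e x)^2 + (norm (?De x))^2))"
 proof (rule set_integral_mono)
 show "set_integrable lborel Hp (%x. 2 * (?e x)^2 + 2 * ?e x * (x \<bullet> ?De x))"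
 "set_integrable lborel Hp (%x. 3 * ((?e x)^2 + (norm (?De x))^2))"
 by (intro set_integrable_Hp continuous_intros C1_funD[OF v(1)] C1_funD[OF u(1)])+
 fix x assume "x \<in> Hp"
 then have "\<bar>x \<bullet> ?De x\<bar> <= 1 * norm (?De x)"
 by (intro order_trans[OF Cauchy_Schwarz_ineq2] mult_right_mono) (auto simp: Hp_def)
 then have "\<bar>?e x\<bar> * \<bar>x \<bullet> ?De x\<bar> <= \<bar>?e x\<bar> * norm (?De x)" by (intro mult_left_mono) auto
 then have "?e x * (x \<bullet> ?De x) <= \<bar>?e x\<bar> * norm (?De x)" using abs_ge_self[of "?e x * (x \<bullet> ?De x)"] by (simp add: abs_mult)
 moreover have "2 * (\<bar>?e x\<bar> * norm (?De x)) <= (?e x)^2 + (norm (?De x))^2"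
 using zero_le_power2[of "\<bar>?e x\<bar> - norm (?De x)"] by (simp add: power2_diff)
 ultimately show "2 * (?e x)^2 + 2 * ?e x * (x \<bullet> ?De x) <= 3 * ((?e x)^2 + (norm (?De x))^2)"
 using zero_le_power2[of "norm (?De x)"] unfolding distrib_left by linarith
 qed
 also have "ennreal (LBINT x:Hp. 3 * ((?e x)^2 + (norm (?De x))^2)) = (\<integral>\<^sup>+x. indicator Hp x * ennreal (3 * ((?e x)^2 + (norm (?De x))^2)) \<partial>lebesgue)"
 by (rule nn_integral_Hp_eq[symmetric]) (auto intro!: continuous_intros C1_funD[OF v(1)] C1_funD[OF u(1)])
 also have "... <= 6 * ?d n + 6 * ?d' n"
 unfolding W12_dist_sq_def
 proof (rule nn_integral_sq_add_le)
 fix x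
 let ?p = "v n x - w x" and ?q = "u n x - w x" and ?P = "Dv n x - G x" and ?Q = "Du n x - G x"
 have "(?e x)^2 = (?p - ?q)^2" by simp
 also have "... <= 2 * ?p\<^sup>2 + 2 * ?q\<^sup>2" using zero_le_power2[of "?p + ?q"] by (simp add: power2_sum power2_diff algebra_simps)
 finally have 1: "(?e x)^2 <= 2 * ?p\<^sup>2 + 2 * ?q\<^sup>2" .
 have "norm (?De x) = norm (?P - ?Q)" by simp
 also have "... <= norm ?P + norm ?Q" by (rule norm_triangle_ineq4)
 finally have "(norm (?De x))^2 <= (norm ?P + norm ?Q)^2" by (intro power_mono) auto
 also have "... <= 2 * (norm ?P)^2 + 2 * (norm ?Q)^2" using zero_le_power2[of "norm ?P - norm ?Q"] by (simp add: power2_sum power2_diff)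
 finally have "3 * ((?e x)^2 + (norm (?De x))^2) <= 6 * (?p\<^sup>2 + (norm ?P)^2) + 6 * (?q\<^sup>2 + (norm ?Q)^2)" using 1 by argo
 then have "ennreal (3 * ((?e x)^2 + (norm (?De x))^2)) <= ennreal (6 * (?p\<^sup>2 + (norm ?P)^2) + 6 * (?q\<^sup>2 + (norm ?Q)^2))" by (rule ennreal_leI)
 also have "... = 6 * ennreal (?p\<^sup>2 + (norm ?P)^2) + 6 * ennreal (?q\<^sup>2 + (norm ?Q)^2)"
 proof -
 have E: "ennreal (6 * z) = 6 * ennreal z" for z by (simp add: ennreal_mult')
 have "ennreal (6 * (?p\<^sup>2 + (norm ?P)^2) + 6 * (?q\<^sup>2 + (norm ?Q)^2)) = ennreal (6 * (?p\<^sup>2 + (norm ?P)^2)) + ennreal (6 * (?q\<^sup>2 + (norm ?Q)^2))"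
 by (rule ennreal_plus) auto
 then show ?thesis by (simp only: E)
 qed
 finally show "indicator Hp x * ennreal (3 * ((?e x)^2 + (norm (?De x))^2)) \<le>
 6 * (indicator Hp x * ennreal (?p\<^sup>2 + (norm ?P)^2)) + 6 * (indicator Hp x * ennreal (?q\<^sup>2 + (norm ?Q)^2))"
 by (simp add: indicator_def)
 qed (intro W12_dist_sq_components(3)[OF L v(1)] W12_dist_sq_components(3)[OF L u(1)])+
 finally show ?thesis by (simp add: distrib_left mult.assoc[symmetric] add_mono mult_left_mono ennreal_leI)
 qed
 have "(%n. 2 * ?a n + 12 * (?d n + ?d' n)) ---> 2 * 0 + 12 * (0 + 0)"
 by (intro tendsto_add ennreal_tendsto_cmult v(2) u(2,3)) auto
 then have "(%n. 2 * ?a n + 12 * (?d n + ?d' n)) ---> 0" by simp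
 from tendsto_sandwich[OF _ _ tendsto_const this] bound show ?thesis
 by (simp add: always_eventually)
qed

lemma continuous_holo_cx:
 assumes "c > 0" "f holomorphic_on {z. - c < Im z}"
 shows "continuous_on Kp (%x. f (cx x))" "continuous_on {a..b} (%t. f (of_real t))"
 "continuous_on {0..pi} (%th. f (cis th))"
 by (rule continuous_on_compose2[OF holomorphic_on_imp_continuous_on[OF assms(2)]];
 use assms(1) in \<open>auto intro!: continuous_intros less_le_trans[OF _ sin_ge_zero] simp: Kp_def\<close>)+

text \<open>Duality: pairing \<open>\<nabla>w\<close> with the divergence-free field \<open>(Im f, Re f)\<close> and truncating \<open>w\<close> at the
 level \<open>1 - gm\<close>, which annihilates the boundary term on the arc.\<close>
lemma dirichlet_dual_bound:
 assumes mu: "continuous_on {-1..1} \<mu>" and W: "W12_mu gm \<mu> w G"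
 and c0: "c0 > 0" and f: "f holomorphic_on {z. - c0 < Im z}"
 shows "ennreal (2 * (LBINT t:{-1..1}. max (\<mu> t - (1 - gm)) 0 * (- Re (f t))) - (LBINT x:Hp. (cmod (f (cx x)))^2))
 <= (\<integral>\<^sup>+x. indicator Hp x * ennreal ((norm (G x))^2) \<partial>lebesgue)"
proof -
 define c where "c = 1 - gm"
 from W obtain h where W12: "W12_on Hp w G" and tf: "trace_flat w G \<mu>" and ta: "trace_arc w G h"
 "AE th in lebesgue. th \<in> {0<..<pi} \<longrightarrow> h th <= c" by (auto simp: W12_mu_def c_def)
 have L: "L2_on Hp w" "L2_on Hp G" using W12 by (auto simp: W12_on_def)
 obtain v Dv where v: "!!n. C1_fun (v n) (Dv n)" "(%n. W12_dist_sq Hp (v n) (Dv n) w G) ---> 0"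
 "(%n. \<integral>\<^sup>+t. indicator {-1<..<1} t * ennreal ((v n (t, 0) - \<mu> t)^2) \<partial>lebesgue) ---> 0"
 using tf unfolding trace_flat_def by blast
 define A where "A = enn2real (\<integral>\<^sup>+x. indicator Hp x * ennreal ((norm (G x))^2) \<partial>lebesgue)"
 have A: "(\<integral>\<^sup>+x. indicator Hp x * ennreal ((norm (G x))^2) \<partial>lebesgue) = ennreal A" "A \<ge> 0"
 using L(2) by (auto simp: L2_on_def A_def)
 note cf = continuous_holo_cx[OF c0 f]
 define F where "F = (LBINT x:Hp. (cmod (f (cx x)))^2)"
 have excess: "(%n. \<integral>\<^sup>+th. indicator {0<..<pi} th * ennreal ((max (v n (cos th, sin th) - c) 0)^2) \<partial>lebesgue) ---> 0"
 by (rule arc_excess_tendsto[OF v(1,2) L ta])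
 have cpol: "continuous_on S (%th. v n (cos th, sin th))" for n and S :: "real set"
 by (rule continuous_on_compose2[OF C1_funD(3)[OF v(1), of UNIV]]) (auto intro!: continuous_intros)
 have cflat: "continuous_on S (%t. v n (t, 0))" for n and S :: "real set"
 by (rule continuous_on_compose2[OF C1_funD(3)[OF v(1), of UNIV]]) (auto intro!: continuous_intros)
 have csp: "continuous_on S (%x. smooth_pos tq (h x))" if "continuous_on S h" for S :: "real set" and h tq
 unfolding smooth_pos_def by (intro continuous_intros that)
 have toHK: "(LBINT t:{a..b}. k t) = (LINT t:{a<..<b}|lebesgue. k t)" if "continuous_on {a..b} k" for a b :: real and k :: "real => real"
 unfolding integral_open_closed[symmetric]
 by (intro set_lebesgue_integral_lebesgue[symmetric] borel_measurable_continuous_on_indicator continuous_on_subset[OF that]) auto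
 have lebm: "(%x. indicator {a<..<b} x * k x) \<in> borel_measurable lebesgue" if "continuous_on {a..b} k" for a b :: real and k :: "real => real"
 proof -
 have "(%x. indicator {a<..<b} x *\<^sub>R k x) \<in> borel_measurable borel"
 by (intro borel_measurable_continuous_on_indicator continuous_on_subset[OF that]) auto
 then show ?thesis by (intro measurable_completion) simp
 qed
 have main: "2 * (LBINT t:{-1..1}. smooth_pos tq (\<mu> t - c) * (- Re (f t))) - F <= A" if tq: "tq > 0" for tq
 proof -
 define V where "V n x = smooth_pos tq (v n x - c)" for n x
 define k where "k n x = max (v n x - c) 0 / sqrt ((max (v n x - c) 0)^2 + tq^2)" for n x
 have V: "C1_fun (V n) (%x. k n x *\<^sub>R Dv n x)" for n
 unfolding V_def[abs_def] k_def[abs_def] by (rule C1_smooth_pos[OF v(1) tq])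
 have k: "0 <= k n x" "k n x <= 1" for n x unfolding k_def using smooth_pos_deriv_bounds[OF tq] by auto
 let ?arc = "%n. LBINT th:{0..pi}. V n (cos th, sin th) * Im (cis th * f (cis th))"
 let ?flat = "%n. LBINT t:{-1..1}. V n (t, 0) * Re (f t)"
 \<comment> \<open>Pointwise, twice the inner product of X and Y minus |X|^2 is at most |Y|^2. The
   truncation multiplies the gradient by a factor \<open>k\<close> in [0, 1] and so can only shorten
   it.\<close>
 have step: "2 * (?arc n - ?flat n) - F <= (LBINT x:Hp. (norm (Dv n x))^2)" for n
 proof -
 let ?X = "%x. (Im (f (cx x)), Re (f (cx x)))"
 have cX: "continuous_on Kp ?X" by (intro continuous_intros cf)
 have nX: "(norm (?X x))^2 = (cmod (f (cx x)))^2" for x by (simp add: norm_Pair cmod_power2)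
 note cc = continuous_intros cX C1_funD(2)[OF V] C1_funD(2)[OF v(1)]
 have "2 * (?arc n - ?flat n) - F = (LBINT x:Hp. 2 * (?X x \<bullet> (k n x *\<^sub>R Dv n x))) - (LBINT x:Hp. (norm (?X x))^2)"
 unfolding green_holo[OF c0 f V, symmetric] F_def nX[symmetric] by simp
 also have "... = (LBINT x:Hp. 2 * (?X x \<bullet> (k n x *\<^sub>R Dv n x)) - (norm (?X x))^2)"
 by (intro set_integral_diff(2)[symmetric] set_integrable_Hp cc)
 also have "... <= (LBINT x:Hp. (norm (Dv n x))^2)"
 proof (rule set_integral_mono)
 show "set_integrable lborel Hp (%x. 2 * (?X x \<bullet> (k n x *\<^sub>R Dv n x)) - (norm (?X x))^2)"
 "set_integrable lborel Hp (%x. (norm (Dv n x))^2)" by (intro set_integrable_Hp cc)+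
 fix x
 let ?Y = "k n x *\<^sub>R Dv n x"
 have "0 <= (norm (?X x - ?Y))^2" by simp
 also have "... = (norm (?X x))^2 - 2 * (?X x \<bullet> ?Y) + (norm ?Y)^2"
 unfolding power2_norm_eq_inner by (simp add: inner_diff_left inner_diff_right inner_commute)
 finally have "2 * (?X x \<bullet> ?Y) - (norm (?X x))^2 <= (norm ?Y)^2" by simp
 also have "... <= (norm (Dv n x))^2" using k[of n x] by (intro power_mono) (auto intro: mult_left_le_one_le)
 finally show "2 * (?X x \<bullet> ?Y) - (norm (?X x))^2 <= (norm (Dv n x))^2" .
 qed
 finally show ?thesis .
 qed
 \<comment> \<open>On the arc the truncation is at most the excess over c, which tends to 0 in L2.
   This is why the arc condition may be an inequality.\<close>
 have arc0: "?arc ---> 0"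
 proof -
 have ck: "continuous_on {0..pi} (%th. Im (cis th * f (cis th)))" by (intro continuous_intros cf)
 obtain K where K: "!!x. x \<in> {0..pi} ==> norm (Im (cis x * f (cis x))) <= K" using continuous_on_compact_bound[OF compact_Icc ck] by blast
 have "(%n. LINT th:{0<..<pi}|lebesgue. V n (cos th, sin th) * Im (cis th * f (cis th))) ---> 0"
 proof (rule L2_tendsto_integral[where K=K])
 show "(%x. indicat_real {0<..<pi} x * V n (cos x, sin x)) \<in> borel_measurable lebesgue" for n
 unfolding V_def by (intro lebm csp continuous_intros cpol)
 show "(%n. \<integral>\<^sup>+x. indicator {0<..<pi} x * ennreal ((V n (cos x, sin x))^2) \<partial>lebesgue) ---> 0"
 proof (rule tendsto_sandwich[OF _ _ tendsto_const excess]; intro always_eventually allI)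
 fix n
 show "(\<integral>\<^sup>+x. indicator {0<..<pi} x * ennreal ((V n (cos x, sin x))^2) \<partial>lebesgue) <=
 (\<integral>\<^sup>+th. indicator {0<..<pi} th * ennreal ((max (v n (cos th, sin th) - c) 0)^2) \<partial>lebesgue)"
 unfolding V_def by (intro nn_integral_mono mult_left_mono ennreal_leI power_mono smooth_pos_bounds tq) auto
 qed auto
 qed (use K in \<open>auto\<close>)
 then show ?thesis unfolding V_def by (subst toHK) (auto intro!: continuous_intros csp cpol cf)
 qed
 have flat0: "?flat ---> (LBINT t:{-1..1}. smooth_pos tq (\<mu> t - c) * Re (f t))"
 proof -
 have ck: "continuous_on {-1..1::real} (%t. Re (f t))" by (intro continuous_intros cf)
 obtain K where K: "!!x. x \<in> {-1..1} ==> norm (Re (f (of_real x))) <= K" using continuous_on_compact_bound[OF compact_Icc ck] by blast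
 have "(%n. LINT t:{-1<..<1}|lebesgue. (V n (t, 0) - smooth_pos tq (\<mu> t - c)) * Re (f t)) ---> 0"
 proof (rule L2_tendsto_integral[where K=K])
 show "(%x. indicat_real {-1<..<1} x * (V n (x, 0) - smooth_pos tq (\<mu> x - c))) \<in> borel_measurable lebesgue" for n
 unfolding V_def by (intro lebm continuous_intros csp cflat mu)
 show "(%n. \<integral>\<^sup>+x. indicator {-1<..<1} x * ennreal ((V n (x, 0) - smooth_pos tq (\<mu> x - c))^2) \<partial>lebesgue) ---> 0"
 proof (rule tendsto_sandwich[OF _ _ tendsto_const v(3)]; intro always_eventually allI)
 fix n
 have "(V n (t, 0) - smooth_pos tq (\<mu> t - c))^2 <= (v n (t, 0) - \<mu> t)^2" for t
 using smooth_pos_lipschitz[of tq "v n (t, 0) - c" "\<mu> t - c"] by (simp add: V_def flip: abs_le_square_iff)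
 then show "(\<integral>\<^sup>+x. indicator {-1<..<1} x * ennreal ((V n (x, 0) - smooth_pos tq (\<mu> x - c))^2) \<partial>lebesgue) \<le>
 (\<integral>\<^sup>+t. indicator {-1<..<1} t * ennreal ((v n (t, 0) - \<mu> t)^2) \<partial>lebesgue)"
 by (intro nn_integral_mono mult_left_mono ennreal_leI) auto
 qed auto
 qed (use K in \<open>auto\<close>)
 then have "(%n. LBINT t:{-1..1}. (V n (t, 0) - smooth_pos tq (\<mu> t - c)) * Re (f t)) ---> 0"
 unfolding V_def by (subst toHK) (auto intro!: continuous_intros csp cflat cf mu)
 moreover have "(LBINT t:{-1..1}. (V n (t, 0) - smooth_pos tq (\<mu> t - c)) * Re (f t)) = ?flat n - (LBINT t:{-1..1}. smooth_pos tq (\<mu> t - c) * Re (f t))" for n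
 unfolding left_diff_distrib V_def by (intro set_integral_diff(2) LBINT_eq_HK(2) continuous_intros csp cflat cf mu)
 ultimately show ?thesis by (simp add: LIM_zero_iff)
 qed
 \<comment> \<open>The inequality (a + b)^2 \<le> (1 + hq) a^2 + (1 + 1/hq) b^2 separates the energy
   of \<open>G\<close> from the approximation error; n goes to infinity before \<open>hq\<close>
   goes to 0.\<close>
 have up: "2 * (?arc n - ?flat n) - F <= (1 + hq) * A + (1 + 1 / hq) * enn2real (W12_dist_sq Hp (v n) (Dv n) w G)"
 if hq: "hq > 0" and fin: "W12_dist_sq Hp (v n) (Dv n) w G < \<infinity>" for n hq
 proof -
 have "ennreal (LBINT x:Hp. (norm (Dv n x))^2) = (\<integral>\<^sup>+x. indicator Hp x * ennreal ((norm (Dv n x))^2) \<partial>lebesgue)"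
 by (rule nn_integral_Hp_eq[symmetric]) (auto intro!: continuous_intros C1_funD[OF v(1)])
 also have "... <= ennreal (1 + hq) * (\<integral>\<^sup>+x. indicator Hp x * ennreal ((norm (G x))^2) \<partial>lebesgue) + ennreal (1 + 1 / hq) * W12_dist_sq Hp (v n) (Dv n) w G"
 unfolding W12_dist_sq_def
 proof (rule nn_integral_sq_add_le)
 have [measurable]: "(%x. indicator Hp x *\<^sub>R G x) \<in> borel_measurable lebesgue" using L(2) by (simp add: L2_on_def)
 have "(%x. ennreal ((norm (indicator Hp x *\<^sub>R G x))^2)) \<in> borel_measurable lebesgue" by measurable
 then show "(%x. indicator Hp x * ennreal ((norm (G x))^2)) \<in> borel_measurable lebesgue"
 by (rule measurable_cong[THEN iffD1, rotated]) (auto simp: indicator_def)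
 fix x
 let ?a = "norm (G x)" and ?b = "norm (Dv n x - G x)"
 have "norm (Dv n x) <= ?a + ?b" using norm_triangle_ineq[of "G x" "Dv n x - G x"] by simp
 then have "(norm (Dv n x))^2 <= (?a + ?b)^2" by (intro power_mono) auto
 also have "... <= (1 + hq) * ?a\<^sup>2 + (1 + 1 / hq) * ?b\<^sup>2"
 proof -
 have "0 <= (hq * ?a - ?b)^2 / hq" using hq by simp
 also have "... = hq * ?a\<^sup>2 + ?b\<^sup>2 / hq - 2 * ?a * ?b" using hq by (simp add: power2_eq_square field_simps)
 finally show ?thesis by (simp add: power2_sum algebra_simps)
 qed
 also have "... <= (1 + hq) * ?a\<^sup>2 + (1 + 1 / hq) * ((v n x - w x)^2 + ?b\<^sup>2)"
 using hq by (intro add_left_mono mult_left_mono) auto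
 finally have "ennreal ((norm (Dv n x))^2) <= ennreal ((1 + hq) * ?a\<^sup>2 + (1 + 1 / hq) * ((v n x - w x)^2 + ?b\<^sup>2))" by (rule ennreal_leI)
 also have "... = ennreal (1 + hq) * ennreal (?a\<^sup>2) + ennreal (1 + 1 / hq) * ennreal ((v n x - w x)^2 + ?b\<^sup>2)"
 using hq by (subst ennreal_plus) (auto simp del: ennreal_plus simp: ennreal_mult intro!: mult_nonneg_nonneg add_nonneg_nonneg)
 finally show "indicator Hp x * ennreal ((norm (Dv n x))^2) <= ennreal (1 + hq) * (indicator Hp x * ennreal (?a\<^sup>2)) +
 ennreal (1 + 1 / hq) * (indicator Hp x * ennreal ((v n x - w x)^2 + ?b\<^sup>2))"
 by (cases "x \<in> Hp") auto
 qed (rule W12_dist_sq_components(3)[OF L v(1)])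
 also have "... = ennreal ((1 + hq) * A + (1 + 1 / hq) * enn2real (W12_dist_sq Hp (v n) (Dv n) w G))"
 using hq A fin by (subst ennreal_plus) (auto simp: ennreal_mult simp del: ennreal_plus intro!: mult_nonneg_nonneg add_nonneg_nonneg)
 finally have "(LBINT x:Hp. (norm (Dv n x))^2) <= (1 + hq) * A + (1 + 1 / hq) * enn2real (W12_dist_sq Hp (v n) (Dv n) w G)"
 using hq A by (subst (asm) ennreal_le_iff) (auto intro!: mult_nonneg_nonneg add_nonneg_nonneg)
 with step[of n] show ?thesis by linarith
 qed
 let ?I = "LBINT t:{-1..1}. smooth_pos tq (\<mu> t - c) * Re (f t)"
 have limhq: "2 * (0 - ?I) - F <= (1 + hq) * A" if hq: "hq > 0" for hq
 proof (rule tendsto_le[OF _ _ tendsto_diff[OF tendsto_mult_left[OF tendsto_diff[OF arc0 flat0]] tendsto_const]])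
 have "(%n. enn2real (W12_dist_sq Hp (v n) (Dv n) w G)) ---> 0"
 by (rule tendsto_enn2real) (use v(2) in simp_all)
 then have "(%n. (1 + hq) * A + (1 + 1 / hq) * enn2real (W12_dist_sq Hp (v n) (Dv n) w G)) ---> (1 + hq) * A + (1 + 1 / hq) * 0"
 by (intro tendsto_add tendsto_const tendsto_mult_left)
 then show "(%n. (1 + hq) * A + (1 + 1 / hq) * enn2real (W12_dist_sq Hp (v n) (Dv n) w G)) ---> (1 + hq) * A" by simp
 have "\<forall>\<^sub>F n in sequentially. W12_dist_sq Hp (v n) (Dv n) w G < \<infinity>"
 by (rule order_tendstoD(2)[OF v(2)]) simp
 then show "\<forall>\<^sub>F n in sequentially. 2 * (?arc n - ?flat n) - F <= (1 + hq) * A + (1 + 1 / hq) * enn2real (W12_dist_sq Hp (v n) (Dv n) w G)"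
 by eventually_elim (rule up[OF hq])
 qed simp
 have "2 * (0 - ?I) - F <= A"
 proof (rule field_le_epsilon)
 fix e :: real assume e: "e > 0"
 have "e / (A + 1) > 0" using e A by simp
 from limhq[OF this] have "2 * (0 - ?I) - F <= A + e * (A / (A + 1))" by (simp add: algebra_simps)
 also have "... <= A + e * 1" using e A by (intro add_left_mono mult_left_mono) (auto simp: divide_le_eq)
 finally show "2 * (0 - ?I) - F <= A + e" by simp
 qed
 moreover have "(LBINT t:{-1..1}. smooth_pos tq (\<mu> t - c) * (- Re (f t))) = - ?I"
 by (subst set_integral_uminus[symmetric]) (auto intro!: LBINT_eq_HK(2) continuous_intros csp cf mu)
 ultimately show ?thesis by simp
 qed
 let ?J = "LBINT t:{-1..1}. max (\<mu> t - c) 0 * (- Re (f t))"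
 define K where "K = (LBINT t:{-1..1::real}. \<bar>Re (f t)\<bar>)"
 have K0: "K \<ge> 0" unfolding K_def set_lebesgue_integral_def by (rule Bochner_Integration.integral_nonneg) auto
 have "2 * ?J - F <= A"
 proof (rule field_le_epsilon)
 fix e :: real assume e: "e > 0"
 \<comment> \<open>Smoothing changes the positive part by at most tq, hence the flat integral by at
   most tq * K, and the factor 2 of the duality doubles this.\<close>
 define tq where "tq = e / (2 * (K + 1))"
 have tq: "tq > 0" using e K0 by (simp add: tq_def)
 have diff: "?J - (LBINT t:{-1..1}. smooth_pos tq (\<mu> t - c) * (- Re (f t))) <= tq * K"
 proof -
 have "?J - (LBINT t:{-1..1}. smooth_pos tq (\<mu> t - c) * (- Re (f t)))
 = (LBINT t:{-1..1}. max (\<mu> t - c) 0 * (- Re (f t)) - smooth_pos tq (\<mu> t - c) * (- Re (f t)))"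
 by (intro set_integral_diff(2)[symmetric] LBINT_eq_HK(2) continuous_intros csp cf mu)
 also have "... <= (LBINT t:{-1..1::real}. tq * \<bar>Re (f t)\<bar>)"
 proof (rule set_integral_mono)
 show "set_integrable lborel {-1..1} (%t. max (\<mu> t - c) 0 * (- Re (f t)) - smooth_pos tq (\<mu> t - c) * (- Re (f t)))"
 "set_integrable lborel {-1..1} (%t. tq * \<bar>Re (f (of_real t))\<bar>)"
 by (intro LBINT_eq_HK(2) continuous_intros csp cf mu)+
 fix t :: real
 have "\<bar>max (\<mu> t - c) 0 - smooth_pos tq (\<mu> t - c)\<bar> <= tq"
 using smooth_pos_bounds[OF tq, of "\<mu> t - c"] by linarith
 then have "\<bar>max (\<mu> t - c) 0 - smooth_pos tq (\<mu> t - c)\<bar> * \<bar>Re (f t)\<bar> <= tq * \<bar>Re (f t)\<bar>" by (rule mult_right_mono) simp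
 then have "\<bar>(max (\<mu> t - c) 0 - smooth_pos tq (\<mu> t - c)) * (- Re (f t))\<bar> <= tq * \<bar>Re (f t)\<bar>" by (simp only: abs_mult abs_minus_cancel)
 then show "max (\<mu> t - c) 0 * (- Re (f t)) - smooth_pos tq (\<mu> t - c) * (- Re (f t)) <= tq * \<bar>Re (f t)\<bar>"
 unfolding left_diff_distrib by linarith
 qed
 also have "... = tq * K" by (simp add: K_def)
 finally show ?thesis .
 qed
 have "2 * (tq * K) <= e"
 proof -
 have "tq * (2 * (K + 1)) = e" using K0 by (simp add: tq_def)
 then show ?thesis using tq by (simp add: algebra_simps)
 qed
 then show "2 * ?J - F <= A + e" using main[OF tq] diff by linarith
 qed
 then show ?thesis unfolding A(1) F_def c_def by (rule ennreal_leI)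
qed

section \<open>Logarithmic potentials with poles below the flat side\<close>

lemma integrable_L2_unit_continuous:
 fixes k :: "real => 'b::euclidean_space"
 assumes g: "L2_unit g" and k: "continuous_on {-1..1} k"
 shows "integrable lborel (%t. g t *\<^sub>R k t)"
proof -
 obtain B where B: "!!t. t \<in> {-1..1} ==> norm (k t) <= B" using continuous_on_compact_bound[OF compact_Icc k] by blast
 have "integrable lborel (%t. g t *\<^sub>R (indicator {-1..1} t *\<^sub>R k t))"
 proof (rule integrable_L2_unit_bounded[OF g, where K=B])
 show "(%t. indicat_real {-1..1} t *\<^sub>R k t) \<in> borel_measurable borel"
 by (rule borel_measurable_continuous_on_indicator[OF _ k]) simp
 show "norm (indicat_real {-1..1} t *\<^sub>R k t) <= B" if "\<bar>t\<bar> < 1" for t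
 using that B[of t] by (auto simp: abs_less_iff)
 qed
 moreover have "(%t. g t *\<^sub>R (indicator {-1..1} t *\<^sub>R k t)) = (%t. g t *\<^sub>R k t)"
 proof
 show "g t *\<^sub>R (indicator {-1..1} t *\<^sub>R k t) = g t *\<^sub>R k t" for t
 using L2_unit_zero[OF g, of t] by (cases "t \<in> {-1<..<1}") auto
 qed
 ultimately show ?thesis by simp
qed

lemma norm_integral_L2_unit_le:
 fixes k :: "real => 'b::euclidean_space"
 assumes g: "L2_unit g" and i: "integrable lborel (%t. g t *\<^sub>R k t)"
 and B: "!!t. t \<in> {-1<..<1} ==> norm (k t) <= B"
 shows "norm (\<integral>t. g t *\<^sub>R k t \<partial>lborel) <= B * (\<integral>t. \<bar>g t\<bar> \<partial>lborel)"
proof -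
 have "norm (\<integral>t. g t *\<^sub>R k t \<partial>lborel) <= (\<integral>t. norm (g t *\<^sub>R k t) \<partial>lborel)" by (rule integral_norm_bound)
 also have "... <= (\<integral>t. B * \<bar>g t\<bar> \<partial>lborel)"
 proof (rule integral_mono)
 show "norm (g t *\<^sub>R k t) <= B * \<bar>g t\<bar>" for t
 using B[of t] L2_unit_zero[OF g, of t] by (cases "t \<in> {-1<..<1}") (auto simp: mult.commute[of B] intro: mult_left_mono)
 qed (use integrable_norm[OF i] L2_unit_integrable[OF g] in simp_all)
 finally show ?thesis by simp
qed

lemma continuous_on_Pair_const: "continuous_on S (Pair a)"
proof -
 have "continuous_on S (%t. (a, t))" by (intro continuous_on_Pair continuous_on_const continuous_on_id)
 then show ?thesis by simp
qed

text \<open>The mean value inequality on a ball bounds the Taylor remainder by the oscillation of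
  \<open>K'\<close>, uniformly in t because \<open>K'\<close> is uniformly continuous on a compact
  product. Integrating against |g| keeps the bound.\<close>

lemma has_field_derivative_parameter_integral:
 fixes K K' :: "complex => real => complex"
 assumes g: "L2_unit g" and S: "open S" "z \<in> S"
 and D: "!!z t. z \<in> S ==> t \<in> {-1..1} ==> ((%z. K z t) has_field_derivative K' z t) (at z)"
 and cK: "!!z. z \<in> S ==> continuous_on {-1..1} (K z)"
 and cK': "continuous_on (S \<times> {-1..1}) (%(z, t). K' z t)"
 shows "((%z. \<integral>t. g t *\<^sub>R K z t \<partial>lborel) has_field_derivative (\<integral>t. g t *\<^sub>R K' z t \<partial>lborel)) (at z)"
proof -
 obtain r where r: "r > 0" "cball z r \<subseteq> S" using S open_contains_cball by blast
 have cK'z: "continuous_on {-1..1} (K' w)" if "w \<in> S" for w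
 using continuous_on_compose2[OF cK' continuous_on_Pair_const[of "{-1..1}" w]] that by auto
 have uc: "uniformly_continuous_on (cball z r \<times> {-1..1}) (%(z, t). K' z t)"
 by (intro compact_uniformly_continuous continuous_on_subset[OF cK'] compact_Times) (use r in auto)
 define N where "N = (\<integral>t. \<bar>g t\<bar> \<partial>lborel)"
 have N: "N \<ge> 0" unfolding N_def by (rule Bochner_Integration.integral_nonneg) auto
 note iK = integrable_L2_unit_continuous[OF g cK]
 note iK' = integrable_L2_unit_continuous[OF g cK'z]
 show ?thesis
 unfolding has_field_derivative_def has_derivative_at_alt
 proof (intro conjI allI impI bounded_linear_mult_right)
 fix e :: real assume e: "e > 0"
 define hq where "hq = e / (N + 1)"
 have hq: "hq > 0" using e N by (simp add: hq_def)
 obtain d where d: "d > 0" "!!x x'. x \<in> cball z r \<times> {-1..1} ==> x' \<in> cball z r \<times> {-1..1} ==> dist x' x < d ==> dist (case x' of (z, t) => K' z t) (case x of (z, t) => K' z t) < hq"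
 using uc hq unfolding uniformly_continuous_on_def by meson
 show "\<exists>d>0. \<forall>y. norm (y - z) < d \<longrightarrow> norm ((\<integral>t. g t *\<^sub>R K y t \<partial>lborel) - (\<integral>t. g t *\<^sub>R K z t \<partial>lborel) - (\<integral>t. g t *\<^sub>R K' z t \<partial>lborel) * (y - z)) <= e * norm (y - z)"
 proof (intro exI[of _ "min d r"] conjI allI impI)
 fix y assume y: "norm (y - z) < min d r"
 then have yS: "y \<in> S" using r by (auto simp: dist_norm norm_minus_commute)
 have est: "norm (K y t - K z t - K' z t * (y - z)) <= hq * norm (y - z)" if t: "t \<in> {-1..1}" for t
 proof -
 have "norm ((K y t - K' z t * y) - (K z t - K' z t * z)) <= hq * norm (y - z)"
 proof (rule field_differentiable_bound[where S="ball z (min d r)" and f="%w. K w t - K' z t * w" and f'="%w. K' w t - K' z t"])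
 fix w assume w: "w \<in> ball z (min d r)"
 then have wS: "w \<in> S" and wr: "w \<in> cball z r" using r by auto
 have "((%w. K w t - K' z t * w) has_field_derivative K' w t - K' z t) (at w)"
 by (rule derivative_eq_intros refl D wS t | simp)+
 then show "((%w. K w t - K' z t * w) has_field_derivative K' w t - K' z t) (at w within ball z (min d r))"
 by (rule has_field_derivative_at_within)
 show "norm (K' w t - K' z t) <= hq"
 using d(2)[of "(z, t)" "(w, t)"] wr t r w by (auto simp: dist_Pair_Pair dist_norm norm_minus_commute)
 qed (use y d r in \<open>auto simp: dist_norm norm_minus_commute\<close>)
 then show ?thesis by (simp add: algebra_simps)
 qed
 have "(\<integral>t. g t *\<^sub>R K y t \<partial>lborel) - (\<integral>t. g t *\<^sub>R K z t \<partial>lborel) - (\<integral>t. g t *\<^sub>R K' z t \<partial>lborel) * (y - z)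
 = (\<integral>t. g t *\<^sub>R (K y t - K z t - K' z t * (y - z)) \<partial>lborel)"
 using iK[OF yS] iK[OF S(2)] iK'[OF S(2)]
 by (simp add: scaleR_diff_right mult_scaleR_left[symmetric] del: mult_scaleR_left)
 also have "norm ... <= (hq * norm (y - z)) * N"
 unfolding N_def
 by (rule norm_integral_L2_unit_le[OF g])
 (auto intro!: integrable_L2_unit_continuous[OF g] continuous_intros cK cK'z yS S(2) est)
 also have "... = (e * norm (y - z)) * (N / (N + 1))" by (simp add: hq_def)
 also have "... <= (e * norm (y - z)) * 1" using e N by (intro mult_left_mono) (auto simp: divide_le_eq)
 finally show "norm ((\<integral>t. g t *\<^sub>R K y t \<partial>lborel) - (\<integral>t. g t *\<^sub>R K z t \<partial>lborel) - (\<integral>t. g t *\<^sub>R K' z t \<partial>lborel) * (y - z)) <= e * norm (y - z)" by simp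
 qed (use d r in auto)
 qed
qed

lemma tendsto_parameter_integral:
 fixes k :: "real => real => 'b::euclidean_space"
 assumes g: "L2_unit g" and k: "continuous_on ({0..h0} \<times> {-1..1}) (%(h, t). k h t)"
 and X: "X ---> 0" "!!n. X n \<in> {0..h0}"
 shows "(%n. \<integral>t. g t *\<^sub>R k (X n) t \<partial>lborel) ---> (\<integral>t. g t *\<^sub>R k 0 t \<partial>lborel)"
proof -
 have h0: "0 <= h0" using X(2)[of 0] by auto
 have kc: "continuous_on {-1..1} (k h)" if "h \<in> {0..h0}" for h
 using continuous_on_compose2[OF k continuous_on_Pair_const[of "{-1..1}" h]] that by (simp add: image_subset_iff)
 obtain B where B: "!!p. p \<in> {0..h0} \<times> {-1..1} ==> norm (case p of (h, t) => k h t) <= B"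
 using continuous_on_compact_bound[OF compact_Times[OF compact_Icc compact_Icc] k] by blast
 show ?thesis
 proof (rule integral_dominated_convergence[where w="%t. B * \<bar>g t\<bar>"])
 show "AE t in lborel. (%n. g t *\<^sub>R k (X n) t) ---> g t *\<^sub>R k 0 t"
 proof (rule AE_I2)
 fix t :: real
 show "(%n. g t *\<^sub>R k (X n) t) ---> g t *\<^sub>R k 0 t"
 proof (cases "t \<in> {-1<..<1}")
 case True
 have "continuous_on {0..h0} (%h. k h t)"
 using continuous_on_compose2[OF k, of "{0..h0}" "%h. (h, t)"] True
 by (simp add: image_subset_iff continuous_on_Pair)
 then have "(%n. k (X n) t) ---> k 0 t"
 using X h0 by (auto simp: continuous_on_sequentially comp_def)
 then show ?thesis by (intro tendsto_intros)
 qed (use L2_unit_zero[OF g, of t] in simp)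
 qed
 show "AE t in lborel. norm (g t *\<^sub>R k (X n) t) <= B * \<bar>g t\<bar>" for n
 proof (rule AE_I2)
 fix t :: real
 show "norm (g t *\<^sub>R k (X n) t) <= B * \<bar>g t\<bar>"
 using B[of "(X n, t)"] X(2)[of n] L2_unit_zero[OF g, of t]
 by (cases "t \<in> {-1<..<1}") (auto simp: mult.commute[of B] intro: mult_left_mono)
 qed
 show "(%t. g t *\<^sub>R k 0 t) \<in> borel_measurable lborel" "(%t. g t *\<^sub>R k (X n) t) \<in> borel_measurable lborel" for n
 using integrable_L2_unit_continuous[OF g kc] h0 X(2)[of n] by (auto intro: borel_measurable_integrable)
 qed (use L2_unit_integrable[OF g] in auto)
qed

text \<open>The Neumann kernel of the half disc with pole \<open>t - \<i>h\<close> below the flat side; the second term is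
 the image under inversion in the unit circle.\<close>

definition ker :: "real => real => complex => complex" where
 "ker h t z = Ln (z - (of_real t - \<i> * of_real h)) + Ln (1 - (of_real t + \<i> * of_real h) * z)"

definition dker :: "real => real => complex => complex" where
 "dker h t z = 1 / (z - (of_real t - \<i> * of_real h)) - (of_real t + \<i> * of_real h) / (1 - (of_real t + \<i> * of_real h) * z)"

text \<open>Sign and factor are chosen so that, for total mass 0, the imaginary part vanishes on the
  arc and tends to \<open>prim g\<close> on the flat side as h tends to 0. Thus 1 - gm + Im (pot g
  0) is the harmonic extension of 1 - gm + \<open>prim g\<close>.\<close>

definition pot :: "(real => real) => real => complex => complex" where
 "pot g h z = - (\<integral>t. g t *\<^sub>R ker h t z \<partial>lborel) / of_real pi"

definition dpot :: "(real => real) => real => complex => complex" where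
 "dpot g h z = - (\<integral>t. g t *\<^sub>R dker h t z \<partial>lborel) / of_real pi"

text \<open>For h > 0 the image pole 1 / (t + ih) has imaginary part -h / (t^2 + h^2). Since t^2 +
  h^2 < 2, this is below -h/2, which is why the domain is cut at half the depth. Eliminating Re z
  shows that the whole branch cut of the second logarithm stays outside as well.\<close>

lemma ker_args:
 assumes h: "0 <= h" "h < 1" and t: "t \<in> {-1..1}" and z: "- (h / 2) < Im z"
 shows "z - (of_real t - \<i> * of_real h) \<notin> \<real>\<^sub>\<le>\<^sub>0" "1 - (of_real t + \<i> * of_real h) * z \<notin> \<real>\<^sub>\<le>\<^sub>0"
 "0 < Im (z - (of_real t - \<i> * of_real h))"
proof -
 show "0 < Im (z - (of_real t - \<i> * of_real h))" using assms by simp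
 then show "z - (of_real t - \<i> * of_real h) \<notin> \<real>\<^sub>\<le>\<^sub>0" using complex_nonpos_Reals_iff by fastforce
 show "1 - (of_real t + \<i> * of_real h) * z \<notin> \<real>\<^sub>\<le>\<^sub>0"
 proof
 assume "1 - (of_real t + \<i> * of_real h) * z \<in> \<real>\<^sub>\<le>\<^sub>0"
 then have I: "t * Im z + h * Re z = 0" and R: "1 - t * Re z + h * Im z <= 0"
 by (auto simp: complex_nonpos_Reals_iff)
 show False
 proof (cases "h = 0")
 case True then show False using I R z by auto
 next
 case False
 then have hp: "h > 0" using h by simp
 have "h * (1 - t * Re z + h * Im z) = h + (t^2 + h^2) * Im z"
 proof -
 have "h * Re z = - (t * Im z)" using I by linarith
 moreover have "h * (1 - t * Re z + h * Im z) = h - t * (h * Re z) + h^2 * Im z"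
 by (simp add: algebra_simps power2_eq_square)
 ultimately show ?thesis by (simp add: algebra_simps power2_eq_square)
 qed
 moreover have "(t^2 + h^2) * Im z \<ge> (t^2 + h^2) * (- (h / 2))" using z by (intro mult_left_mono) auto
 moreover have "t^2 + h^2 < 2"
 proof -
 have "t^2 <= 1" using t by (simp add: abs_square_le_1 abs_le_iff)
 moreover have "h^2 < 1" using h by (simp add: abs_square_less_1)
 ultimately show ?thesis by simp
 qed
 then have "(t^2 + h^2) * (h / 2) < 2 * (h / 2)" using hp by (intro mult_strict_right_mono) auto
 ultimately have "0 < h * (1 - t * Re z + h * Im z)" by simp
 then show False using R hp by (simp add: zero_less_mult_iff)
 qed
 qed
qed

lemma ker_args_nonzero:
 assumes "0 <= h" "h < 1" "t \<in> {-1..1}" "- (h / 2) < Im z"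
 shows "z - (of_real t - \<i> * of_real h) \<noteq> 0" "1 - (of_real t + \<i> * of_real h) * z \<noteq> 0"
 using ker_args[OF assms] by auto

lemma pot_has_derivative:
 assumes g: "L2_unit g" and h: "0 <= h" "h < 1" and z: "- (h / 2) < Im z"
 shows "(pot g h has_field_derivative dpot g h z) (at z)"
proof -
 let ?S = "{z. - (h / 2) < Im z}"
 have "((%z. \<integral>t. g t *\<^sub>R ker h t z \<partial>lborel) has_field_derivative (\<integral>t. g t *\<^sub>R dker h t z \<partial>lborel)) (at z)"
 proof (rule has_field_derivative_parameter_integral[OF g open_Im_gt])
 show "z \<in> ?S" using z by simp
 show "((%z. ker h t z) has_field_derivative dker h t w) (at w)" if "w \<in> ?S" "t \<in> {-1..1}" for w t
 proof -
 let ?a = "of_real t - \<i> * of_real h" and ?b = "of_real t + \<i> * of_real h"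
 have w: "- (h / 2) < Im w" using that by simp
 have "((%z. z - ?a) has_field_derivative (1 - 0)) (at w)" "((%z. 1 - ?b * z) has_field_derivative (0 - ?b * 1)) (at w)"
 by (intro DERIV_diff DERIV_ident DERIV_const DERIV_cmult)+
 from DERIV_add[OF DERIV_chain2[OF has_field_derivative_Ln[OF ker_args(1)[OF h that(2) w]] this(1)]
 DERIV_chain2[OF has_field_derivative_Ln[OF ker_args(2)[OF h that(2) w]] this(2)]]
 show ?thesis unfolding ker_def dker_def by (rule DERIV_cong) (simp add: divide_inverse algebra_simps)
 qed
 show "continuous_on {-1..1} (%t. ker h t w)" if "w \<in> ?S" for w
 unfolding ker_def using ker_args[OF h, of _ w] that by (intro continuous_intros) auto
 show "continuous_on (?S \<times> {-1..1}) (%(z, t). dker h t z)"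
 unfolding dker_def case_prod_unfold using ker_args_nonzero[OF h] by (intro continuous_intros) auto
 qed
 then have "((%z. - (\<integral>t. g t *\<^sub>R ker h t z \<partial>lborel) / of_real pi) has_field_derivative dpot g h z) (at z)"
 unfolding dpot_def by (intro DERIV_cdivide DERIV_minus)
 then show ?thesis unfolding pot_def[abs_def] .
qed

lemma holomorphic_pot:
 assumes g: "L2_unit g" and h: "0 <= h" "h < 1"
 shows "pot g h holomorphic_on {z. - (h / 2) < Im z}" "dpot g h holomorphic_on {z. - (h / 2) < Im z}"
 "- (h / 2) < Im z ==> deriv (pot g h) z = dpot g h z"
proof -
 note D = pot_has_derivative[OF g h]
 show 1: "pot g h holomorphic_on {z. - (h / 2) < Im z}"
 by (rule holomorphic_onI) (use D in \<open>auto intro: has_field_derivative_at_within simp: field_differentiable_def\<close>)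
 show d: "deriv (pot g h) z = dpot g h z" if "- (h / 2) < Im z" for z using D[OF that] by (rule DERIV_imp_deriv)
 show "dpot g h holomorphic_on {z. - (h / 2) < Im z}"
 by (rule holomorphic_transform[OF holomorphic_deriv[OF 1 open_Im_gt]]) (use d in auto)
qed

lemma tendsto_pot:
 assumes g: "L2_unit g" and z: "0 < Im z" and X: "X ---> 0" "!!n. X n \<in> {0..1/2}"
 shows "(%n. pot g (X n) z) ---> pot g 0 z" "(%n. dpot g (X n) z) ---> dpot g 0 z"
proof -
 have ok: "- (h / 2) < Im z" if "h \<in> {0..1/2}" for h using z that by auto
 have "continuous_on ({0..1/2} \<times> {-1..1}) (%(h, t). ker h t z)"
 unfolding ker_def case_prod_unfold using ker_args(1,2)[OF _ _ _ ok] by (intro continuous_intros) auto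
 from tendsto_parameter_integral[OF g this X] show "(%n. pot g (X n) z) ---> pot g 0 z"
 unfolding pot_def by (intro tendsto_intros) auto
 have "continuous_on ({0..1/2} \<times> {-1..1}) (%(h, t). dker h t z)"
 unfolding dker_def case_prod_unfold using ker_args_nonzero[OF _ _ _ ok] by (intro continuous_intros) auto
 from tendsto_parameter_integral[OF g this X] show "(%n. dpot g (X n) z) ---> dpot g 0 z"
 unfolding dpot_def by (intro tendsto_intros) auto
qed

lemma integrable_ker:
 assumes g: "L2_unit g" and h: "0 <= h" "h < 1" and z: "- (h / 2) < Im z"
 shows "integrable lborel (%t. g t *\<^sub>R ker h t z)" "integrable lborel (%t. g t *\<^sub>R dker h t z)"
proof -
 show "integrable lborel (%t. g t *\<^sub>R ker h t z)"
 by (rule integrable_L2_unit_continuous[OF g])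
 (unfold ker_def, use ker_args[OF h _ z] in \<open>intro continuous_intros; auto\<close>)
 show "integrable lborel (%t. g t *\<^sub>R dker h t z)"
 by (rule integrable_L2_unit_continuous[OF g])
 (unfold dker_def, use ker_args_nonzero[OF h _ z] in \<open>intro continuous_intros; auto\<close>)
qed

lemma Re_Im_pot:
 assumes "L2_unit g" "0 <= h" "h < 1" "- (h / 2) < Im z"
 shows "Re (pot g h z) = - (\<integral>t. g t * Re (ker h t z) \<partial>lborel) / pi"
 "Im (pot g h z) = - (\<integral>t. g t * Im (ker h t z) \<partial>lborel) / pi"
 "Re (dpot g h z) = - (\<integral>t. g t * Re (dker h t z) \<partial>lborel) / pi"
 "Im (dpot g h z) = - (\<integral>t. g t * Im (dker h t z) \<partial>lborel) / pi"
 using integral_bounded_linear[OF bounded_linear_Re integrable_ker(1)[OF assms]]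
 integral_bounded_linear[OF bounded_linear_Im integrable_ker(1)[OF assms]]
 integral_bounded_linear[OF bounded_linear_Re integrable_ker(2)[OF assms]]
 integral_bounded_linear[OF bounded_linear_Im integrable_ker(2)[OF assms]]
 by (simp_all add: pot_def dpot_def Re_divide_of_real Im_divide_of_real)

text \<open>For |z| = 1 and b = z - a, the factor 1 - cnj a z equals z cnj b. So the product of the
  two arguments of \<open>Ln\<close> is z |b|^2, whose argument th does not depend on the pole. A
  density of mass 0 therefore leaves nothing on the arc.\<close>

lemma ker_arc:
 assumes h: "0 <= h" "h < 1" and t: "t \<in> {-1..1}" and z: "cmod z = 1" "- (h / 2) < Im z"
 shows "Re (z * dker h t z) = 1"
 and "z = cis th ==> 0 <= th ==> th <= pi ==> Im (ker h t z) = th"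
proof -
 define a where "a = of_real t - \<i> * of_real h"
 have ca: "cnj a = of_real t + \<i> * of_real h" by (simp add: a_def)
 have zz: "z * cnj z = 1" using z(1) complex_norm_square[of z] by simp
 define b where "b = z - a"
 have b0: "b \<noteq> 0" using ker_args_nonzero[OF h t z(2)] by (simp add: b_def a_def)
 have b1: "1 - cnj a * z = z * cnj b" by (simp add: b_def algebra_simps zz)
 have z0: "z \<noteq> 0" using z(1) by auto
 have "z * dker h t z = z / b - cnj a * z / (z * cnj b)"
 unfolding dker_def ca[symmetric] b1 by (simp add: b_def a_def right_diff_distrib)
 also have "z / b = 1 + a / b" using b0 by (simp add: b_def field_simps)
 also have "cnj a * z / (z * cnj b) = cnj (a / b)" using z0 by simp
 finally show "Re (z * dker h t z) = 1" by (simp del: complex_cnj_divide)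
 assume th: "z = cis th" "0 <= th" "th <= pi"
 have k: "ker h t z = Ln b + Ln (1 - cnj a * z)" by (simp add: ker_def ca b_def a_def)
 have "exp (ker h t z) = b * (z * cnj b)"
 unfolding k exp_add using b0 z0 b1 by (simp add: exp_Ln)
 also have "... = of_real ((cmod b)^2) * cis th" using th(1) complex_norm_square[of b] by (simp add: complex_norm_square[symmetric] mult.assoc mult.left_commute)
 finally have E: "exp (ker h t z) = of_real ((cmod b)^2) * cis th" .
 have "cmod (exp (ker h t z)) = (cmod b)^2" unfolding E by (simp add: norm_mult norm_power)
 then have "exp (Re (ker h t z)) = (cmod b)^2" by simp
 then have "of_real ((cmod b)^2) * cis (Im (ker h t z)) = of_real ((cmod b)^2) * cis th"
 using E by (simp only: exp_eq_polar)
 then have "cis (Im (ker h t z)) = cis th" using b0 by simp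
 then have "cis (Im (ker h t z) - th) = 1" by (simp flip: cis_divide)
 then have "cos (Im (ker h t z) - th) = 1" by (metis cis.sel(1) one_complex.sel(1))
 then obtain n :: int where n: "Im (ker h t z) - th = of_int n * 2 * pi" using cos_one_2pi_int by blast
 \<comment> \<open>So far the imaginary part is th modulo 2 pi. The first logarithm contributes a
   value in (0, pi), the second one in (-pi, pi], and th is in [0, pi]; so the difference is less
   than 2 pi in modulus and the multiple is 0.\<close>
 have kk: "Im (ker h t z) = Im (Ln b) + Im (Ln (1 - cnj a * z))" by (simp only: k plus_complex.sel)
 have "0 < Im (Ln b)" "Im (Ln b) < pi"
 using Im_Ln_pos_lt[OF b0] ker_args(3)[OF h t z(2)] by (auto simp: b_def a_def)
 moreover have "- pi < Im (Ln (1 - cnj a * z))" "Im (Ln (1 - cnj a * z)) <= pi"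
 using mpi_less_Im_Ln Im_Ln_le_pi ker_args_nonzero(2)[OF h t z(2)] unfolding ca by blast+
 ultimately have "- (2 * pi) < Im (ker h t z) - th" "Im (ker h t z) - th < 2 * pi" using th(2,3) kk by linarith+
 then have "- 1 < real_of_int n" "real_of_int n < 1" unfolding n
 using mult_less_cancel_right_pos[OF pi_gt_zero, of "-2" "2 * real_of_int n"] mult_less_cancel_right_pos[OF pi_gt_zero, of "2 * real_of_int n" 2] by (simp_all add: mult.commute)
 then have "n = 0" by linarith
 then show "Im (ker h t z) = th" using n by simp
qed

text \<open>The depths along which poles are moved to the axis. The offset 2 keeps them at most 1/2,
  inside the compact parameter range of \<open>tendsto_pot\<close>. The same sequence later serves
  as smoothing width.\<close>

definition hs :: "nat => real" where "hs n = 1 / (real n + 2)"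

lemma hs: "0 < hs n" "hs n < 1" "hs n \<in> {0..1/2}" "hs ---> 0"
proof -
 show "0 < hs n" "hs n < 1" "hs n \<in> {0..1/2}" by (auto simp: hs_def field_simps)
 have "(%n. 1 / real (n + 2)) ---> 0" by (rule LIMSEQ_ignore_initial_segment[OF lim_1_over_n])
 then show "hs ---> 0" by (simp add: hs_def[abs_def] add.commute)
qed

lemma integral_L2_unit_cong:
 assumes "L2_unit g" "!!t. t \<in> {-1<..<1} ==> k t = k' t"
 shows "(\<integral>t. g t * k t \<partial>lborel) = (\<integral>t. g t * (k' t :: real) \<partial>lborel)"
proof (rule Bochner_Integration.integral_cong[OF refl])
 show "g t * k t = g t * k' t" for t
 using assms(2)[of t] L2_unit_zero[OF assms(1), of t] by (cases "t \<in> {-1<..<1}") auto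
qed

lemma pot_arc:
 assumes g: "L2_unit g" "prim g 1 = 0" and h: "0 <= h" "h < 1" and th: "0 <= th" "th <= pi" "- (h / 2) < sin th"
 shows "Im (pot g h (cis th)) = 0" "Re (cis th * dpot g h (cis th)) = 0"
proof -
 have z: "- (h / 2) < Im (cis th)" "cmod (cis th) = 1" using th by auto
 have g0: "(\<integral>t. g t \<partial>lborel) = 0" using g prim_upper[OF g(1), of 1] by simp
 have "(\<integral>t. g t * Im (ker h t (cis th)) \<partial>lborel) = (\<integral>t. g t * th \<partial>lborel)"
 by (rule integral_L2_unit_cong[OF g(1)], rule ker_arc(2)[OF h _ z(2,1) refl th(1,2)]) auto
 also have "... = 0" using g0 by simp
 finally show "Im (pot g h (cis th)) = 0" by (simp add: Re_Im_pot[OF g(1) h z(1)])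
 have bl: "bounded_linear (%w. Re (cis th * w))"
 by (rule bounded_linear_compose[OF bounded_linear_Re bounded_linear_mult_right])
 have "Re (cis th * (\<integral>t. g t *\<^sub>R dker h t (cis th) \<partial>lborel)) = (\<integral>t. Re (cis th * (g t *\<^sub>R dker h t (cis th))) \<partial>lborel)"
 using integral_bounded_linear[OF bl integrable_ker(2)[OF g(1) h z(1)]] by simp
 also have "... = (\<integral>t. g t * Re (cis th * dker h t (cis th)) \<partial>lborel)" by (simp only: mult_scaleR_right scaleR_complex.sel)
 also have "... = (\<integral>t. g t * 1 \<partial>lborel)"
 by (rule integral_L2_unit_cong[OF g(1)], rule ker_arc(1)[OF h _ z(2,1)]) auto
 also have "... = 0" using g0 by simp
 finally have "Re (cis th * (\<integral>t. g t *\<^sub>R dker h t (cis th) \<partial>lborel)) = 0" .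
 then show "Re (cis th * dpot g h (cis th)) = 0"
 unfolding dpot_def times_divide_eq_right Re_divide_of_real mult_minus_right by simp
qed

text \<open>The second formula is minus a sum of two Poisson kernels, one of the pole and one of its
  image; their constant sign makes L1 bounds uniform in h possible.\<close>

lemma ker_flat:
 assumes h: "0 < h" "h < 1" and t: "t \<in> {-1..1}"
 shows "Re (ker h t (of_real x)) = ln ((x - t)^2 + h^2) / 2 + ln ((1 - t * x)^2 + (h * x)^2) / 2"
 "Im (dker h t (of_real x)) = - (h / ((x - t)^2 + h^2) + h / ((1 - t * x)^2 + (h * x)^2))"
proof -
 have h0: "0 <= h" using h by simp
 note nz = ker_args_nonzero[OF h0 h(2) t, of "of_real x"]
 let ?A = "of_real x - (of_real t - \<i> * of_real h)" and ?B = "1 - (of_real t + \<i> * of_real h) * of_real x :: complex"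
 have nzA: "?A \<noteq> 0" and nzB: "?B \<noteq> 0" using nz h by auto
 have A: "(cmod ?A)^2 = (x - t)^2 + h^2" and B: "(cmod ?B)^2 = (1 - t * x)^2 + (h * x)^2" by (simp_all add: cmod_power2)
 have half: "ln c = ln (c^2) / 2" if "c > 0" for c :: real using that by (simp add: ln_realpow)
 show "Re (ker h t (of_real x)) = ln ((x - t)^2 + h^2) / 2 + ln ((1 - t * x)^2 + (h * x)^2) / 2"
 unfolding ker_def A[symmetric] B[symmetric] using half[of "cmod ?A"] half[of "cmod ?B"] nzA nzB by simp
 have "Im (1 / ?A) = - h / (cmod ?A)^2" by (simp add: Im_divide cmod_power2)
 moreover have "Im ((of_real t + \<i> * of_real h) / ?B) = h / (cmod ?B)^2"
 by (simp add: Im_divide cmod_power2) (simp add: algebra_simps)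
 ultimately show "Im (dker h t (of_real x)) = - (h / ((x - t)^2 + h^2) + h / ((1 - t * x)^2 + (h * x)^2))"
 unfolding dker_def A B by simp
qed

lemma poisson_le:
 assumes h: "h > 0"
 shows "(\<integral>\<^sup>+x. indicator {-1<..<1} x * ennreal (h / ((x - x0)^2 + h^2)) \<partial>lebesgue) <= ennreal pi"
proof -
 have pos: "0 < (x - x0)^2 + h^2" for x using h by (intro add_nonneg_pos) auto
 then have nz: "(x - x0)^2 + h^2 \<noteq> 0" for x by (metis less_irrefl)
 have c: "continuous_on S (%x. h / ((x - x0)^2 + h^2))" for S by (intro continuous_intros) (use nz in auto)
 have D: "((%x. arctan ((x - x0) / h)) has_real_derivative h / ((x - x0)^2 + h^2)) (at x)" for x
 proof -
 have "((%x. (x - x0) / h) has_real_derivative (1 - 0) / h) (at x)"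
 by (intro DERIV_cdivide DERIV_diff DERIV_ident DERIV_const)
 from DERIV_chain2[OF DERIV_arctan this] show ?thesis
 by (rule DERIV_cong) (use h pos[of x] in \<open>simp add: field_simps power2_eq_square\<close>)
 qed
 have "(LBINT x:{-1..1}. h / ((x - x0)^2 + h^2)) = arctan ((1 - x0) / h) - arctan ((-1 - x0) / h)"
 using FTC_open_interval[of "-1" 1, OF _ c D]
 by (simp add: integral_open_closed[symmetric]) (simp add: set_lebesgue_integral_def)
 also have "... <= pi" using arctan_ubound[of "(1 - x0) / h"] arctan_lbound[of "(-1 - x0) / h"] by linarith
 finally show ?thesis
 by (subst nn_integral_interval_eq[OF c]) (use h pos in \<open>auto intro!: ennreal_leI divide_nonneg_pos\<close>)
qed

text \<open>Completing the square: the image term is the Poisson kernel of the point t/r at depth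
  h/r, where r = t^2 + h^2.\<close>

lemma poisson_image_le:
 assumes h: "h > 0"
 shows "(\<integral>\<^sup>+x. indicator {-1<..<1} x * ennreal (h / ((1 - t * x)^2 + (h * x)^2)) \<partial>lebesgue) <= ennreal pi"
proof -
 define r where "r = t^2 + h^2"
 have r: "r > 0" unfolding r_def using h by (intro add_nonneg_pos) auto
 have "h / ((1 - t * x)^2 + (h * x)^2) = (h / r) / ((x - t / r)^2 + (h / r)^2)" for x
 proof -
 have "r * ((x - t / r)^2 + (h / r)^2) = r * x^2 - 2 * t * x + (t^2 + h^2) / r"
 using r by (simp add: power2_diff field_simps power2_eq_square)
 also have "... = (1 - t * x)^2 + (h * x)^2" using r by (simp add: r_def[symmetric]) (simp add: r_def power2_eq_square algebra_simps)
 finally have "(1 - t * x)^2 + (h * x)^2 = r * ((x - t / r)^2 + (h / r)^2)" by simp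
 then show ?thesis by simp
 qed
 then show ?thesis using poisson_le[of "h / r" "t / r"] h r by simp
qed

lemma continuous_on_pot_real:
 assumes "L2_unit g" "0 < h" "h < 1"
 shows "continuous_on S (%x::real. pot g h (of_real x))" "continuous_on S (%x::real. dpot g h (of_real x))"
 by (rule continuous_on_compose2[OF holomorphic_on_imp_continuous_on[OF holomorphic_pot(1)]]
 continuous_on_compose2[OF holomorphic_on_imp_continuous_on[OF holomorphic_pot(2)]];
 use assms in \<open>auto intro!: continuous_intros\<close>)+

text \<open>Each Poisson kernel has mass at most pi and \<open>dpot\<close> carries the factor 1/pi;
  pole and image together give the factor 2, whatever the depth.\<close>

lemma dpot_L1:
 assumes g: "L2_unit g" and h: "0 < h" "h < 1"
 shows "(LBINT x:{-1..1}. \<bar>Im (dpot g h (of_real x))\<bar>) <= 2 * (\<integral>t. \<bar>g t\<bar> \<partial>lborel)"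
proof -
 note [measurable] = L2_unit_measurable[OF g]
 let ?P = "%t x. h / ((x - t)^2 + h^2) + h / ((1 - t * x)^2 + (h * x)^2)"
 have P0: "0 <= ?P t x" for t x using h by (intro add_nonneg_nonneg divide_nonneg_nonneg) auto
 have "ennreal (LBINT x:{-1..1}. \<bar>Im (dpot g h (of_real x))\<bar>) = (\<integral>\<^sup>+x. indicator {-1<..<1} x * ennreal \<bar>Im (dpot g h (of_real x))\<bar> \<partial>lebesgue)"
 by (rule nn_integral_interval_eq[symmetric]) (use continuous_on_pot_real[OF g h] in \<open>auto intro!: continuous_intros\<close>)
 also have "... <= (\<integral>\<^sup>+x. (\<integral>\<^sup>+t. ennreal (\<bar>g t\<bar> / pi) * (indicator {-1<..<1} x * ennreal (?P t x)) \<partial>lborel) \<partial>lborel)"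
 unfolding nn_integral_completion
 proof (rule nn_integral_mono)
 fix x :: real
 show "indicator {-1<..<1} x * ennreal \<bar>Im (dpot g h (of_real x))\<bar> <= (\<integral>\<^sup>+t. ennreal (\<bar>g t\<bar> / pi) * (indicator {-1<..<1} x * ennreal (?P t x)) \<partial>lborel)"
 proof (cases "x \<in> {-1<..<1}")
 case True
 have z: "- (h / 2) < Im (of_real x)" using h by simp
 have "Im (dpot g h (of_real x)) = - (\<integral>t. g t * Im (dker h t (of_real x)) \<partial>lborel) / pi"
 using Re_Im_pot(4)[OF g _ h(2) z] h by simp
 also have "(\<integral>t. g t * Im (dker h t (of_real x)) \<partial>lborel) = (\<integral>t. g t * (- ?P t x) \<partial>lborel)"
 by (rule integral_L2_unit_cong[OF g], rule ker_flat(2)[OF h]) auto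
 also have "(\<integral>t. g t * (- ?P t x) \<partial>lborel) = - (\<integral>t. g t * ?P t x \<partial>lborel)"
 by (simp only: mult_minus_right Bochner_Integration.integral_minus)
 finally have I: "Im (dpot g h (of_real x)) = (\<integral>t. g t * ?P t x \<partial>lborel) / pi" by (simp only: minus_minus)
 have "integrable lborel (%t. g t * Im (dker h t (of_real x)))"
 using integrable_bounded_linear[OF bounded_linear_Im integrable_ker(2)[OF g _ h(2) z]] h by simp
 then have "integrable lborel (%t. - (g t * Im (dker h t (of_real x))))" by (rule integrable_minus)
 moreover have "(%t. - (g t * Im (dker h t (of_real x)))) = (%t. g t * ?P t x)"
 proof
 show "- (g t * Im (dker h t (of_real x))) = g t * ?P t x" for t
 proof (cases "t \<in> {-1<..<1}")
 case True
 then have "t \<in> {-1..1}" by auto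
 then show ?thesis by (simp only: ker_flat(2)[OF h] mult_minus_right minus_minus)
 qed (use L2_unit_zero[OF g, of t] in simp)
 qed
 ultimately have i: "integrable lborel (%t. g t * ?P t x)" by simp
 have "ennreal \<bar>Im (dpot g h (of_real x))\<bar> = ennreal (1 / pi) * ennreal (norm (\<integral>t. g t * ?P t x \<partial>lborel))"
 unfolding I by (simp add: ennreal_mult[symmetric])
 also have "... <= ennreal (1 / pi) * (\<integral>\<^sup>+t. ennreal (norm (g t * ?P t x)) \<partial>lborel)"
 by (intro mult_left_mono integral_norm_bound_ennreal i) auto
 also have "... = (\<integral>\<^sup>+t. ennreal (1 / pi) * ennreal (norm (g t * ?P t x)) \<partial>lborel)"
 by (rule nn_integral_cmult[symmetric]) measurable
 also have "... = (\<integral>\<^sup>+t. ennreal (\<bar>g t\<bar> / pi) * (indicator {-1<..<1} x * ennreal (?P t x)) \<partial>lborel)"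
 proof (rule nn_integral_cong)
 fix t
 show "ennreal (1 / pi) * ennreal (norm (g t * ?P t x)) = ennreal (\<bar>g t\<bar> / pi) * (indicator {-1<..<1} x * ennreal (?P t x))"
 using True P0[of x t] by (simp add: ennreal_mult[symmetric] abs_mult del: ennreal_plus)
 qed
 finally show ?thesis using True by simp
 qed simp
 qed
 also have "... = (\<integral>\<^sup>+t. (\<integral>\<^sup>+x. ennreal (\<bar>g t\<bar> / pi) * (indicator {-1<..<1} x * ennreal (?P t x)) \<partial>lborel) \<partial>lborel)"
 by (rule lborel_pair.Fubini') measurable
 also have "... <= (\<integral>\<^sup>+t. ennreal (\<bar>g t\<bar> / pi) * ennreal (2 * pi) \<partial>lborel)"
 proof (rule nn_integral_mono)
 fix t :: real
 have "(\<integral>\<^sup>+x. indicator {-1<..<1} x * ennreal (?P t x) \<partial>lborel) =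
 (\<integral>\<^sup>+x. indicator {-1<..<1} x * ennreal (h / ((x - t)^2 + h^2)) + indicator {-1<..<1} x * ennreal (h / ((1 - t * x)^2 + (h * x)^2)) \<partial>lborel)"
 using h by (intro nn_integral_cong) (simp add: indicator_def)
 also have "... = (\<integral>\<^sup>+x. indicator {-1<..<1} x * ennreal (h / ((x - t)^2 + h^2)) \<partial>lborel) + (\<integral>\<^sup>+x. indicator {-1<..<1} x * ennreal (h / ((1 - t * x)^2 + (h * x)^2)) \<partial>lborel)"
 by (rule nn_integral_add) measurable
 also have "... <= ennreal pi + ennreal pi"
 using poisson_le[OF h(1), of t] poisson_image_le[OF h(1), of t] unfolding nn_integral_completion by (rule add_mono)
 also have "... = ennreal (2 * pi)" by (simp add: ennreal_plus[symmetric] del: ennreal_plus)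
 finally show "(\<integral>\<^sup>+x. ennreal (\<bar>g t\<bar> / pi) * (indicator {-1<..<1} x * ennreal (?P t x)) \<partial>lborel) <= ennreal (\<bar>g t\<bar> / pi) * ennreal (2 * pi)"
 by (subst nn_integral_cmult) (auto intro!: mult_left_mono)
 qed
 also have "... = (\<integral>\<^sup>+t. ennreal (2 * \<bar>g t\<bar>) \<partial>lborel)"
 by (intro nn_integral_cong) (simp add: ennreal_mult[symmetric])
 also have "... = ennreal (2 * (\<integral>t. \<bar>g t\<bar> \<partial>lborel))"
 using nn_integral_eq_integral[of lborel "%t. 2 * \<bar>g t\<bar>"] L2_unit_integrable[OF g] by simp
 finally show ?thesis by (subst (asm) ennreal_le_iff) (auto intro!: Bochner_Integration.integral_nonneg)
qed

section \<open>Boundary values of the potentials and the logarithmic energy\<close>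

definition rq :: "real => real" where "rq y = sqrt (sqrt y)"

lemma rq_pos: "0 < y ==> 0 < rq y" and rq_nonneg: "0 <= y ==> 0 <= rq y" by (auto simp: rq_def)

lemma rq_hs: "(%n. rq (hs n)) ---> 0"
proof -
 have "(%n. sqrt (sqrt (hs n))) ---> sqrt (sqrt 0)" by (intro tendsto_real_sqrt hs)
 then show ?thesis by (simp add: rq_def)
qed

text \<open>With u = hq/A: 1 + u^2 \<le> (1 + u)^2 and 1 + u \<le> (1 + u^(1/4))^4. A fourth root is
  taken because the square of s^(-1/4) is still integrable, so that the error can be paired with an
  L2 density.\<close>

lemma ln_regularisation:
 assumes s: "0 < s" "s <= A" and hq: "0 <= hq" "hq <= h"
 shows "\<bar>ln (A^2 + hq^2) / 2 - ln A\<bar> <= 4 * rq h / rq s"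
proof -
 have A: "A > 0" using s by simp
 define u where "u = hq / A"
 have u: "0 <= u" "u <= h / s" unfolding u_def using A s hq by (auto intro: frac_le)
 have eq: "A^2 + hq^2 = A^2 * (1 + u^2)" using A by (simp add: u_def field_simps power_divide)
 have "ln (A^2 + hq^2) = 2 * ln A + ln (1 + u^2)"
 unfolding eq using A add_pos_nonneg[OF zero_less_one zero_le_power2[of u]] by (subst ln_mult) (auto simp: ln_realpow)
 then have d: "ln (A^2 + hq^2) / 2 - ln A = ln (1 + u^2) / 2" by linarith
 have "ln (1 + u^2) <= ln ((1 + u)^2)" using u by (subst ln_le_cancel_iff) (auto simp: power2_sum add_pos_nonneg)
 also have "... = 2 * ln (1 + u)" using u by (simp add: ln_realpow)
 finally have 1: "ln (1 + u^2) / 2 <= ln (1 + u)" by simp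
 define v where "v = rq u"
 have v: "v \<ge> 0" "u = v ^ 4"
 proof -
 show "v \<ge> 0" by (auto simp: v_def rq_def u)
 have "v^2 = sqrt u" using u by (simp add: v_def rq_def)
 then have "(v^2)^2 = u" using u by simp
 then show "u = v ^ 4" by (simp flip: power_mult)
 qed
 have "(1 + v) ^ 4 = 1 + v ^ 4 + (4 * v + 6 * v^2 + 4 * v ^ 3)"
 by (simp add: power4_eq_xxxx power2_eq_square power3_eq_cube algebra_simps)
 moreover have "0 <= 4 * v + 6 * v^2 + 4 * v ^ 3" using v by simp
 ultimately have "1 + u <= (1 + v) ^ 4" using v by simp
 then have "ln (1 + u) <= ln ((1 + v) ^ 4)" using u(1) v(1) by (subst ln_le_cancel_iff) auto
 also have "... = 4 * ln (1 + v)" using v by (simp add: ln_realpow)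
 also have "... <= 4 * v" using ln_add_one_self_le_self[OF v(1)] by simp
 also have "v <= rq (h / s)" unfolding v_def rq_def using u by (intro real_sqrt_le_mono) auto
 also have "rq (h / s) = rq h / rq s" by (simp add: rq_def real_sqrt_divide)
 finally have "ln (1 + u) <= 4 * (rq h / rq s)" by simp
 moreover have "0 <= ln (1 + u^2) / 2" by simp
 ultimately show ?thesis unfolding d using 1 by (simp only: abs_of_nonneg)
qed

text \<open>The interval \<open>{-2..2}\<close> contains all differences of two points of [-1, 1].
  The value at 0 is 0 by the convention on division.\<close>

definition inv_sqrt2 :: "real => real" where "inv_sqrt2 s = indicator {-2..2} s / sqrt \<bar>s\<bar>"

lemma integrable_inv_sqrt2: "integrable lborel inv_sqrt2"
proof -
 let ?f = "%s::real. if s \<in> {0..2} then s powr (-1/2) else 0"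
 have m: "?f \<in> borel_measurable borel" by measurable
 have "((%x. x powr (-1/2)) has_integral (2 powr (-1/2 + 1) / (-1/2 + 1))) {0..2::real}"
 by (rule has_integral_powr_from_0) auto
 then have "(?f has_integral (2 powr (-1/2 + 1) / (-1/2 + 1))) UNIV" by (simp only: has_integral_restrict_UNIV)
 from nn_integral_has_integral_lborel[OF m _ this] have i: "integrable lborel ?f"
 by (intro integrableI_nonneg m) auto
 have "integrable lborel (%s. ?f (0 + (-1) * s))" using lborel_integrable_real_affine[OF i, of "-1" 0] by simp
 from Bochner_Integration.integrable_add[OF i this]
 have "integrable lborel (%s. ?f s + ?f (0 + (-1) * s))" .
 moreover have "(%s. ?f s + ?f (0 + (-1) * s)) = inv_sqrt2"
 proof
 have p: "y powr (-1/2) = 1 / sqrt y" if "y > 0" for y :: real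
 proof -
 have "(-1/2::real) = - (1/2)" by simp
 then have "y powr (-1/2) = inverse (y powr (1/2))" by (simp only: powr_minus)
 also have "y powr (1/2) = sqrt y" by (rule powr_half_sqrt) (use that in simp)
 finally show ?thesis by (simp only: inverse_eq_divide)
 qed
 show "?f s + ?f (0 + (-1) * s) = inv_sqrt2 s" for s
 proof -
 consider "s = 0" | "s > 0" | "s < 0" by linarith
 then show ?thesis
 proof cases
 case 2 then show ?thesis using p[OF 2] by (simp add: inv_sqrt2_def indicator_def)
 next
 case 3 then show ?thesis using p[of "-s"] by (simp add: inv_sqrt2_def indicator_def)
 qed (simp add: inv_sqrt2_def)
 qed
 qed
 ultimately show ?thesis by simp
qed

definition flat_ker :: "real => real => real" where
 "flat_ker t x = ln \<bar>x - t\<bar> + ln (1 - t * x)"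

definition flat_pot :: "(real => real) => real => real" where
 "flat_pot g x = - (\<integral>t. g t * flat_ker t x \<partial>lborel) / pi"

definition flat_const :: "(real => real) => real" where
 "flat_const g = 4 / pi * ((\<integral>t. (g t)^2 \<partial>lborel) + (\<integral>s. inv_sqrt2 s \<partial>lborel))"

lemma flat_const_nonneg: "0 <= flat_const g"
 unfolding flat_const_def
 by (intro mult_nonneg_nonneg add_nonneg_nonneg Bochner_Integration.integral_nonneg) (auto simp: inv_sqrt2_def)

text \<open>Both (1 - x)(1 + t) and (1 + x)(1 - t) are nonnegative. The image singularity is thus
  nowhere stronger than the direct one, and both logarithms can be controlled by s = |x -
  t|.\<close>

lemma one_minus_mult_ge:
 assumes "\<bar>t\<bar> <= 1" "\<bar>x\<bar> <= 1" shows "\<bar>x - t\<bar> <= 1 - t * (x::real)"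
proof -
 have "0 <= (1 - x) * (1 + t)" "0 <= (1 + x) * (1 - t)" using assms by (auto intro!: mult_nonneg_nonneg)
 then show ?thesis by (auto simp: abs_le_iff algebra_simps)
qed

text \<open>The convergence on the flat side is uniform in x. Each of the two logarithms errs by at
  most 4 h^(1/4) s^(-1/4), and 2 |g| s^(-1/4) \<le> g^2 + s^(-1/2) separates the density from the
  singularity; this is the origin of \<open>flat_const\<close>.\<close>

lemma flat_pot_approx:
 assumes g: "L2_unit g" and h: "0 < h" "h < 1" and x: "\<bar>x\<bar> < 1"
 shows "\<bar>Re (pot g h (of_real x)) - flat_pot g x\<bar> <= flat_const g * rq h"
 and integrable_flat_ker: "integrable lborel (%t. g t * flat_ker t x)"
proof -
 note [measurable] = L2_unit_measurable[OF g]
 have z: "- (h / 2) < Im (of_real x)" using h by simp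
 let ?R = "%t. Re (ker h t (of_real x))"
 let ?W = "%t. 4 * rq h * ((g t)^2 + inv_sqrt2 (x + (-1) * t))"
 have i1: "integrable lborel (%t. g t * ?R t)"
 using integrable_bounded_linear[OF bounded_linear_Re integrable_ker(1)[OF g _ h(2) z]] h by simp
 have iS: "integrable lborel (%t. inv_sqrt2 (x + (-1) * t))"
 using lborel_integrable_real_affine[OF integrable_inv_sqrt2, of "-1" x] by simp
 have iW: "integrable lborel ?W" by (intro integrable_mult_right Bochner_Integration.integrable_add L2_unit_sq[OF g] iS)
 have bound: "\<bar>g t * ?R t - g t * flat_ker t x\<bar> <= ?W t" if "t \<noteq> x" for t
 proof (cases "t \<in> {-1<..<1}")
 case True
 define s where "s = \<bar>x - t\<bar>"
 have s: "0 < s" "s <= 1 - t * x" "s <= 2" using that True x one_minus_mult_ge[of t x] by (auto simp: s_def)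
 have hx: "\<bar>h * x\<bar> <= h" using h x mult_left_mono[of "\<bar>x\<bar>" 1 h] by (simp add: abs_mult)
 have "\<bar>ln ((x - t)^2 + h^2) / 2 - ln \<bar>x - t\<bar>\<bar> <= 4 * rq h / rq s"
 using ln_regularisation[of s "\<bar>x - t\<bar>" h h] s h by (simp add: s_def)
 moreover have "\<bar>ln ((1 - t * x)^2 + (h * x)^2) / 2 - ln (1 - t * x)\<bar> <= 4 * rq h / rq s"
 using ln_regularisation[of s "1 - t * x" "\<bar>h * x\<bar>" h] s hx by simp
 ultimately have "\<bar>?R t - flat_ker t x\<bar> <= 8 * rq h / rq s"
 using ker_flat(1)[OF h, of t x] True by (simp add: flat_ker_def abs_le_iff)
 then have "\<bar>g t\<bar> * \<bar>?R t - flat_ker t x\<bar> <= \<bar>g t\<bar> * (8 * rq h / rq s)" by (rule mult_left_mono) simp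
 also have "... = 4 * rq h * (2 * \<bar>g t\<bar> * (1 / rq s))" by simp
 also have "... <= 4 * rq h * ((g t)^2 + (1 / rq s)^2)"
 using zero_le_power2[of "\<bar>g t\<bar> - 1 / rq s"] rq_nonneg[of h] h by (intro mult_left_mono) (auto simp: power2_diff)
 also have "(1 / rq s)^2 = inv_sqrt2 (x + (-1) * t)" using s by (simp add: rq_def power_divide inv_sqrt2_def s_def abs_le_iff)
 finally show ?thesis by (simp add: abs_mult flip: right_diff_distrib)
 next
 case False
 then show ?thesis using L2_unit_zero[OF g False] rq_nonneg[of h] h by (auto simp: inv_sqrt2_def)
 qed
 then have ae: "AE t in lborel. norm (g t * ?R t - g t * flat_ker t x) <= ?W t"
 using AE_lborel_singleton[of x] by (auto elim!: eventually_mono)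
 have m: "(%t. g t * ?R t - g t * flat_ker t x) \<in> borel_measurable lborel"
 using borel_measurable_integrable[OF i1] unfolding flat_ker_def by measurable
 have id: "integrable lborel (%t. g t * ?R t - g t * flat_ker t x)"
 by (rule Bochner_Integration.integrable_bound[OF iW m]) (use ae in eventually_elim, auto)
 from Bochner_Integration.integrable_diff[OF i1 id] show i2: "integrable lborel (%t. g t * flat_ker t x)" by simp
 have "\<bar>(\<integral>t. g t * ?R t \<partial>lborel) - (\<integral>t. g t * flat_ker t x \<partial>lborel)\<bar> = norm (\<integral>t. g t * ?R t - g t * flat_ker t x \<partial>lborel)"
 using i1 i2 by simp
 also have "... <= (\<integral>t. norm (g t * ?R t - g t * flat_ker t x) \<partial>lborel)" by (rule integral_norm_bound)
 also have "... <= (\<integral>t. ?W t \<partial>lborel)" by (rule integral_mono_AE[OF integrable_norm[OF id] iW ae])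
 also have "... = 4 * rq h * ((\<integral>t. (g t)^2 \<partial>lborel) + (\<integral>t. inv_sqrt2 (x + (-1) * t) \<partial>lborel))"
 by (subst integral_mult_right_zero, subst Bochner_Integration.integral_add[OF L2_unit_sq[OF g] iS]) simp
 also have "(\<integral>t. inv_sqrt2 (x + (-1) * t) \<partial>lborel) = (\<integral>s. inv_sqrt2 s \<partial>lborel)"
 using lborel_integral_real_affine[of "-1" inv_sqrt2 x] by simp
 finally have *: "\<bar>(\<integral>t. g t * ?R t \<partial>lborel) - (\<integral>t. g t * flat_ker t x \<partial>lborel)\<bar> <= pi * flat_const g * rq h"
 by (simp add: flat_const_def algebra_simps)
 have "Re (pot g h (of_real x)) - flat_pot g x = - ((\<integral>t. g t * ?R t \<partial>lborel) - (\<integral>t. g t * flat_ker t x \<partial>lborel)) / pi"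
 using Re_Im_pot(1)[OF g _ h(2) z] h by (simp add: flat_pot_def diff_divide_distrib)
 also have "\<bar>...\<bar> <= pi * flat_const g * rq h / pi"
 unfolding abs_divide abs_minus_cancel using * by (intro frac_le) auto
 finally show "\<bar>Re (pot g h (of_real x)) - flat_pot g x\<bar> <= flat_const g * rq h" by simp
qed

text \<open>Two different depths are allowed so that one can be sent to 0 while the other keeps its
  field smooth up to the flat side.\<close>

definition dpot_inner :: "(real => real) => real => real => real" where
 "dpot_inner g h h' = (LBINT x:Hp. Re (dpot g h (cx x)) * Re (dpot g h' (cx x)) + Im (dpot g h (cx x)) * Im (dpot g h' (cx x)))"

definition log_energy :: "(real => real) => real" where
 "log_energy g = (\<integral>t. g t * flat_pot g t \<partial>lborel)"

abbreviation L1n :: "(real => real) => real" where "L1n g \<equiv> \<integral>t. \<bar>g t\<bar> \<partial>lborel"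

lemma pot_ext:
 assumes g: "L2_unit g" and h: "0 < h" "h < 1"
 obtains v Dv where "C1_fun v Dv" "!!x. snd x \<ge> 0 ==> v x = Im (pot g h (cx x))"
 "!!x. snd x \<ge> 0 ==> Dv x = (Im (dpot g h (cx x)), Re (dpot g h (cx x)))"
proof -
 have h0: "0 <= h" using h by simp
 from C1_ext[OF _ holomorphic_pot(1)[OF g h0 h(2)]] h obtain v Dv where
 "C1_fun v Dv" "\<forall>x. snd x \<ge> 0 \<longrightarrow> v x = Im (pot g h (cx x)) \<and> Dv x = (Im (deriv (pot g h) (cx x)), Re (deriv (pot g h) (cx x)))" by auto
 then show thesis using holomorphic_pot(3)[OF g h0 h(2)] h by (intro that[of v Dv]) auto
qed

lemma pot_ext_Re:
 assumes g: "L2_unit g" and h: "0 < h" "h < 1"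
 obtains v Dv where "C1_fun v Dv" "!!x. snd x \<ge> 0 ==> v x = Re (pot g h (cx x))"
 "!!x. snd x \<ge> 0 ==> Dv x = (Re (dpot g h (cx x)), - Im (dpot g h (cx x)))"
proof -
 have h0: "0 <= h" using h by simp
 have hol: "(%z. \<i> * pot g h z) holomorphic_on {z. - (h / 2) < Im z}"
 by (intro holomorphic_intros holomorphic_pot[OF g h0 h(2)])
 have d: "deriv (%z. \<i> * pot g h z) z = \<i> * dpot g h z" if "- (h / 2) < Im z" for z
 using pot_has_derivative[OF g h0 h(2) that] by (intro DERIV_imp_deriv DERIV_cmult)
 from C1_ext[OF _ hol] h obtain v Dv where
 "C1_fun v Dv" "\<forall>x. snd x \<ge> 0 \<longrightarrow> v x = Im (\<i> * pot g h (cx x)) \<and> Dv x = (Im (deriv (%z. \<i> * pot g h z) (cx x)), Re (deriv (%z. \<i> * pot g h z) (cx x)))" by auto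
 then show thesis using d h by (intro that[of v Dv]) auto
qed

lemma continuous_pot_Kp:
 assumes "L2_unit g" "0 < h" "h < 1"
 shows "continuous_on Kp (%x. pot g h (cx x))" "continuous_on Kp (%x. dpot g h (cx x))"
 using continuous_holo_cx(1)[OF _ holomorphic_pot(1)] continuous_holo_cx(1)[OF _ holomorphic_pot(2)] assms by auto

text \<open>Green's formula for the real and for the imaginary part of the second potential. On the
  arc the first field has no normal component, and in the second case the function vanishes. The
  first form is estimated by sup norm times L1 norm; in the second one the limit
  \<open>prim g\<close> can be inserted.\<close>

lemma dpot_inner_flat:
 assumes g: "L2_unit g" "prim g 1 = 0" and h: "0 < h" "h < 1" and h': "0 < h'" "h' < 1"
 shows "dpot_inner g h h' = (LBINT t:{-1..1}. Re (pot g h' (of_real t)) * Im (dpot g h (of_real t)))"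
 and "dpot_inner g h h' = - (LBINT t:{-1..1}. Im (pot g h' (of_real t)) * Re (dpot g h (of_real t)))"
proof -
 have h0: "0 <= h" "0 <= h'" using h h' by auto
 have c: "h / 2 > 0" using h by simp
 note hol = holomorphic_pot(2)[OF g(1) h0(1) h(2)]
 have holi: "(%z. \<i> * dpot g h z) holomorphic_on {z. - (h / 2) < Im z}" by (intro holomorphic_intros hol)
 have arc: "Re (cis th * dpot g h (cis th)) = 0" "Im (pot g h' (cis th)) = 0" if "th \<in> {0..pi}" for th
 using that sin_ge_zero[of th] h h' by (intro pot_arc[OF g]; simp)+
 have Hp0: "snd x \<ge> 0" if "x \<in> Hp" for x using that by (auto simp: Hp_def)
 obtain v Dv where v: "C1_fun v Dv" "!!x. snd x \<ge> 0 ==> v x = Re (pot g h' (cx x))"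
 "!!x. snd x \<ge> 0 ==> Dv x = (Re (dpot g h' (cx x)), - Im (dpot g h' (cx x)))" using pot_ext_Re[OF g(1) h'] by blast
 have "dpot_inner g h h' = (LBINT x:Hp. (Im (\<i> * dpot g h (cx x)), Re (\<i> * dpot g h (cx x))) \<bullet> Dv x)"
 unfolding dpot_inner_def by (intro set_lebesgue_integral_cong) (auto simp: v(3) Hp0 inner_prod_def)
 also have "... = (LBINT th:{0..pi}. v (cos th, sin th) * Im (cis th * (\<i> * dpot g h (cis th)))) - (LBINT t:{-1..1}. v (t, 0) * Re (\<i> * dpot g h (of_real t)))"
 by (rule green_holo[OF c holi v(1)])
 also have "(LBINT th:{0..pi}. v (cos th, sin th) * Im (cis th * (\<i> * dpot g h (cis th)))) = (LBINT th:{0..pi}. 0)"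
 proof (intro set_lebesgue_integral_cong allI impI)
 fix th :: real assume "th \<in> {0..pi}"
 from arc(1)[OF this] show "v (cos th, sin th) * Im (cis th * (\<i> * dpot g h (cis th))) = 0"
 by (simp only: mult.left_commute[of "cis th" \<i>]) simp
 qed simp
 also have "(LBINT t:{-1..1}. v (t, 0) * Re (\<i> * dpot g h (of_real t))) = (LBINT t:{-1..1}. - (Re (pot g h' (of_real t)) * Im (dpot g h (of_real t))))"
 by (intro set_lebesgue_integral_cong) (auto simp: v(2))
 finally show "dpot_inner g h h' = (LBINT t:{-1..1}. Re (pot g h' (of_real t)) * Im (dpot g h (of_real t)))"
 by (simp add: set_lebesgue_integral_def)
 obtain u Du where u: "C1_fun u Du" "!!x. snd x \<ge> 0 ==> u x = Im (pot g h' (cx x))"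
 "!!x. snd x \<ge> 0 ==> Du x = (Im (dpot g h' (cx x)), Re (dpot g h' (cx x)))" using pot_ext[OF g(1) h'] by blast
 have "dpot_inner g h h' = (LBINT x:Hp. (Im (dpot g h (cx x)), Re (dpot g h (cx x))) \<bullet> Du x)"
 unfolding dpot_inner_def by (intro set_lebesgue_integral_cong) (auto simp: u(3) Hp0 inner_prod_def)
 also have "... = (LBINT th:{0..pi}. u (cos th, sin th) * Im (cis th * dpot g h (cis th))) - (LBINT t:{-1..1}. u (t, 0) * Re (dpot g h (of_real t)))"
 by (rule green_holo[OF c hol u(1)])
 also have "(LBINT th:{0..pi}. u (cos th, sin th) * Im (cis th * dpot g h (cis th))) = (LBINT th:{0..pi}. 0)"
 by (intro set_lebesgue_integral_cong) (auto simp: u(2) arc(2) sin_ge_zero)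
 also have "(LBINT t:{-1..1}. u (t, 0) * Re (dpot g h (of_real t))) = (LBINT t:{-1..1}. Im (pot g h' (of_real t)) * Re (dpot g h (of_real t)))"
 by (intro set_lebesgue_integral_cong) (auto simp: u(2))
 finally show "dpot_inner g h h' = - (LBINT t:{-1..1}. Im (pot g h' (of_real t)) * Re (dpot g h (of_real t)))"
 by (simp add: set_lebesgue_integral_def)
qed

lemma abs_Im_pot_le:
 assumes g: "L2_unit g" and h: "0 <= h" "h < 1" and z: "- (h / 2) < Im z"
 shows "\<bar>Im (pot g h z)\<bar> <= 2 * L1n g"
proof -
 have i: "integrable lborel (%t. g t *\<^sub>R Im (ker h t z))"
 using integrable_bounded_linear[OF bounded_linear_Im integrable_ker(1)[OF g h z]] by simp
 have "norm (\<integral>t. g t *\<^sub>R Im (ker h t z) \<partial>lborel) <= (2 * pi) * L1n g"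
 proof (rule norm_integral_L2_unit_le[OF g i])
 fix t :: real assume "t \<in> {-1<..<1}"
 then have t: "t \<in> {-1..1}" by auto
 have "\<bar>Im (Ln w)\<bar> <= pi" if "w \<noteq> 0" for w using mpi_less_Im_Ln[OF that] Im_Ln_le_pi[OF that] by simp
 from this[OF ker_args_nonzero(1)[OF h t z]] this[OF ker_args_nonzero(2)[OF h t z]]
 show "norm (Im (ker h t z)) <= 2 * pi" unfolding ker_def plus_complex.sel real_norm_def by linarith
 qed
 then have "\<bar>\<integral>t. g t * Im (ker h t z) \<partial>lborel\<bar> / pi <= (2 * pi) * L1n g / pi" by (intro divide_right_mono) auto
 then show ?thesis by (simp add: Re_Im_pot(2)[OF g h z])
qed

lemma Im_Ln_above_negative:
 assumes "Im z > 0" "Re z < 0" shows "Im (Ln z) = pi + Im (Ln (- z))"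
proof -
 have "Ln (- (- z)) = Ln (- z) + \<i> * of_real pi"
 using assms by (subst Ln_minus) (auto simp: complex_eq_iff)
 then show ?thesis by simp
qed

text \<open>As h tends to 0, the argument of x - t + ih tends to 0 for t < x and to pi for t > x,
  and that of the image factor tends to 0. The limit is minus the mass to the right of x, which is
  \<open>prim g x\<close> when the total mass is 0.\<close>

lemma Im_pot_flat_tendsto:
 assumes g: "L2_unit g" "prim g 1 = 0" and x: "\<bar>x\<bar> < 1"
 shows "(%n. Im (pot g (hs n) (of_real x))) ---> prim g x"
proof -
 note [measurable] = L2_unit_measurable[OF g(1)]
 have z: "- (hs n / 2) < Im (of_real x)" for n using hs(1)[of n] by simp
 have h0: "0 <= hs n" for n using hs(1)[of n] by simp
 have i: "integrable lborel (%t. g t * Im (ker (hs n) t (of_real x)))" for n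
 using integrable_bounded_linear[OF bounded_linear_Im integrable_ker(1)[OF g(1) h0 hs(2) z]] by simp
 have lim: "(%n. Im (ker (hs n) t (of_real x))) ---> pi * indicator {x<..} t" if t: "t \<in> {-1<..<1}" "t \<noteq> x" for t
 proof -
 have "\<bar>t * x\<bar> < 1 * 1" unfolding abs_mult using t x by (intro mult_strict_mono) auto
 then have tx: "1 - t * x > 0" by (auto simp: abs_less_iff)
 have l1: "(%n. 1 - (of_real t + \<i> * of_real (hs n)) * of_real x) ---> 1 - (of_real t + \<i> * of_real 0) * of_real x"
 by (intro tendsto_intros hs)
 have "(%n. Ln (1 - (of_real t + \<i> * of_real (hs n)) * of_real x)) ---> Ln (of_real (1 - t * x))"
 using tendsto_Ln[OF l1] tx by (simp add: complex_nonpos_Reals_iff)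
 then have L1: "(%n. Im (Ln (1 - (of_real t + \<i> * of_real (hs n)) * of_real x))) ---> 0"
 using tx tendsto_Im[of _ "Ln (of_real (1 - t * x))"] by (fastforce simp: Ln_of_real simp del: of_real_diff of_real_mult)
 have L2: "(%n. Im (Ln (of_real x - (of_real t - \<i> * of_real (hs n))))) ---> pi * indicator {x<..} t"
 proof (cases "t < x")
 case True
 have "(%n. of_real x - (of_real t - \<i> * of_real (hs n))) ---> (of_real x - (of_real t - \<i> * of_real 0) :: complex)"
 by (intro tendsto_intros hs)
 from tendsto_Ln[OF this] have "(%n. Ln (of_real x - (of_real t - \<i> * of_real (hs n)))) ---> Ln (of_real (x - t))"
 using True by (simp add: complex_nonpos_Reals_iff)
 from tendsto_Im[OF this] show ?thesis using True by (simp add: Ln_of_real del: of_real_diff)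
 next
 case False
 then have xt: "x < t" using t by simp
 \<comment> \<open>For t > x the limit lies on the branch cut and is approached from above. Passing
   to the negative moves it to the positive axis, where \<open>Ln\<close> is continuous.\<close>
 have eq: "Im (Ln (of_real x - (of_real t - \<i> * of_real (hs n)))) = pi + Im (Ln (- (of_real x - (of_real t - \<i> * of_real (hs n)))))" for n
 by (rule Im_Ln_above_negative) (use xt hs(1)[of n] in auto)
 have "(%n. - (of_real x - (of_real t - \<i> * of_real (hs n)))) ---> (- (of_real x - (of_real t - \<i> * of_real 0)) :: complex)"
 by (intro tendsto_intros hs)
 from tendsto_Ln[OF this] have "(%n. Ln (- (of_real x - (of_real t - \<i> * of_real (hs n))))) ---> Ln (of_real (t - x))"
 using xt by (simp add: complex_nonpos_Reals_iff)
 from tendsto_add[OF tendsto_const tendsto_Im[OF this], of pi] show ?thesis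
 unfolding eq using xt by (simp add: Ln_of_real del: of_real_diff)
 qed
 from tendsto_add[OF L2 L1] show ?thesis by (simp add: ker_def)
 qed
 have "(%n. \<integral>t. g t * Im (ker (hs n) t (of_real x)) \<partial>lborel) ---> (\<integral>t. g t * (pi * indicator {x<..} t) \<partial>lborel)"
 proof (rule integral_dominated_convergence[where w="%t. \<bar>g t\<bar> * (2 * pi)"])
 show "AE t in lborel. (%n. g t * Im (ker (hs n) t (of_real x))) ---> g t * (pi * indicator {x<..} t)"
 using AE_lborel_singleton[of x]
 proof eventually_elim
 case (elim t)
 show ?case
 proof (cases "t \<in> {-1<..<1}")
 case True then show ?thesis using elim by (intro tendsto_intros lim) auto
 qed (use L2_unit_zero[OF g(1), of t] in simp)
 qed
 show "AE t in lborel. norm (g t * Im (ker (hs n) t (of_real x))) <= \<bar>g t\<bar> * (2 * pi)" for n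
 proof (rule AE_I2)
 fix t :: real
 show "norm (g t * Im (ker (hs n) t (of_real x))) <= \<bar>g t\<bar> * (2 * pi)"
 proof (cases "t \<in> {-1<..<1}")
 case True
 then have t: "t \<in> {-1..1}" by auto
 have "\<bar>Im (Ln w)\<bar> <= pi" if "w \<noteq> 0" for w using mpi_less_Im_Ln[OF that] Im_Ln_le_pi[OF that] by simp
 from this[OF ker_args_nonzero(1)[OF h0[of n] hs(2) t z]] this[OF ker_args_nonzero(2)[OF h0[of n] hs(2) t z]]
 have "\<bar>Im (ker (hs n) t (of_real x))\<bar> <= 2 * pi" unfolding ker_def plus_complex.sel by linarith
 then show ?thesis by (simp add: abs_mult mult_left_mono)
 qed (use L2_unit_zero[OF g(1), of t] in simp)
 qed
 show "(%t. g t * Im (ker (hs n) t (of_real x))) \<in> borel_measurable lborel" for n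
 using i by (rule borel_measurable_integrable)
 qed (use L2_unit_integrable[OF g(1)] in auto)
 moreover have "(\<integral>t. g t * (pi * indicator {x<..} t) \<partial>lborel) = - pi * prim g x"
 proof -
 have "(\<integral>t. indicator {x<..} t * g t \<partial>lborel) = (\<integral>t. indicator {x<..1} t * g t \<partial>lborel)"
 using L2_unit_zero[OF g(1)] by (intro Bochner_Integration.integral_cong) (auto simp: indicator_def)
 also have "... = prim g 1 - prim g x" using prim_diff[OF g(1), of x 1] x by simp
 finally have "pi * (\<integral>t. indicator {x<..} t * g t \<partial>lborel) = - pi * prim g x" using g(2) by simp
 then show ?thesis by (simp add: mult_ac)
 qed
 ultimately have "(%n. \<integral>t. g t * Im (ker (hs n) t (of_real x)) \<partial>lborel) ---> - pi * prim g x" by simp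
 from tendsto_divide[OF tendsto_minus[OF this] tendsto_const[of pi]]
 show ?thesis using Re_Im_pot(2)[OF g(1) h0 hs(2) z] by simp
qed

lemma pot_real_DERIV:
 assumes g: "L2_unit g" and h: "0 < h" "h < 1"
 shows "((%t. Re (pot g h (of_real t))) has_real_derivative Re (dpot g h (of_real t))) (at t)"
proof -
 have "(pot g h has_field_derivative dpot g h (cx (t, 0))) (at (cx (t, 0)))"
 using h by (intro pot_has_derivative[OF g]) auto
 from has_derivative_grad_partials(1)[OF has_derivative_holo(2)[OF this]] show ?thesis by simp
qed

lemma prim_dpot_flat:
 assumes g: "L2_unit g" "prim g 1 = 0" and h: "0 < h" "h < 1"
 shows "(LBINT t:{-1..1}. prim g t * Re (dpot g h (of_real t))) = - (\<integral>t. g t * Re (pot g h (of_real t)) \<partial>lborel)"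
 using integral_mult_by_parts[OF g(1) pot_real_DERIV[OF g(1) h]] continuous_on_pot_real(2)[OF g(1) h] g(2)
 by (simp add: continuous_on_Re)

text \<open>Measurability and integrability are inherited from the regularised potentials, which
  converge pointwise with the uniform rate of \<open>flat_pot_approx\<close>.\<close>

lemma flat_pot_measurable:
 assumes g: "L2_unit g"
 shows "integrable lborel (%t. g t * flat_pot g t)"
 and "0 < h ==> h < 1 ==> \<bar>(\<integral>t. g t * Re (pot g h (of_real t)) \<partial>lborel) - log_energy g\<bar> <= flat_const g * rq h * L1n g"
proof -
 note [measurable] = L2_unit_measurable[OF g]
 have iR: "integrable lborel (%t. g t * Re (pot g h (of_real t)))" if "0 < h" "h < 1" for h
 using integrable_L2_unit_continuous[OF g continuous_on_Re[OF continuous_on_pot_real(1)[OF g that]]] by simp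
 have m: "(%t. g t * flat_pot g t) \<in> borel_measurable lborel"
 proof (rule borel_measurable_LIMSEQ_real)
 show "(%n. g t * Re (pot g (hs n) (of_real t))) ---> g t * flat_pot g t" for t
 proof (cases "t \<in> {-1<..<1}")
 case True
 have "(%n. Re (pot g (hs n) (of_real t)) - flat_pot g t) ---> 0"
 proof (rule Lim_null_comparison)
 show "\<forall>\<^sub>F n in sequentially. norm (Re (pot g (hs n) (of_real t)) - flat_pot g t) <= flat_const g * rq (hs n)"
 using flat_pot_approx[OF g hs(1,2)] True by (intro always_eventually allI) (auto simp: abs_less_iff)
 show "(%n. flat_const g * rq (hs n)) ---> 0" using tendsto_mult_left[OF rq_hs, of "flat_const g"] by simp
 qed
 then have "(%n. Re (pot g (hs n) (of_real t))) ---> flat_pot g t" by (simp add: LIM_zero_iff)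
 then show ?thesis by (intro tendsto_intros)
 qed (use L2_unit_zero[OF g, of t] in simp)
 show "(%t. g t * Re (pot g (hs n) (of_real t))) \<in> borel_measurable lborel" for n
 using iR[OF hs(1,2)] by (rule borel_measurable_integrable)
 qed
 have bnd: "\<bar>g t * Re (pot g h (of_real t)) - g t * flat_pot g t\<bar> <= flat_const g * rq h * \<bar>g t\<bar>" if "0 < h" "h < 1" for h t
 proof (cases "t \<in> {-1<..<1}")
 case True
 then have "\<bar>Re (pot g h (of_real t)) - flat_pot g t\<bar> <= flat_const g * rq h" by (intro flat_pot_approx[OF g that]) auto
 from mult_left_mono[OF this abs_ge_zero[of "g t"]] show ?thesis by (simp add: abs_mult mult.commute flip: right_diff_distrib)
 qed (use L2_unit_zero[OF g, of t] in simp)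
 have id: "integrable lborel (%t. g t * Re (pot g h (of_real t)) - g t * flat_pot g t)" if "0 < h" "h < 1" for h
 proof (rule Bochner_Integration.integrable_bound)
 show "integrable lborel (%t. flat_const g * rq h * \<bar>g t\<bar>)" using L2_unit_integrable[OF g] by simp
 show "AE t in lborel. norm (g t * Re (pot g h (of_real t)) - g t * flat_pot g t) <= norm (flat_const g * rq h * \<bar>g t\<bar>)"
 proof (rule AE_I2)
 show "norm (g t * Re (pot g h (of_real t)) - g t * flat_pot g t) <= norm (flat_const g * rq h * \<bar>g t\<bar>)" for t
 using bnd[OF that, of t] by simp
 qed
 show "(%t. g t * Re (pot g h (of_real t)) - g t * flat_pot g t) \<in> borel_measurable lborel"
 by (intro borel_measurable_diff m borel_measurable_integrable[OF iR[OF that]])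
 qed
 from Bochner_Integration.integrable_diff[OF iR id, of "1/2" "1/2"] show i: "integrable lborel (%t. g t * flat_pot g t)" by simp
 assume h: "0 < h" "h < 1"
 have "\<bar>(\<integral>t. g t * Re (pot g h (of_real t)) \<partial>lborel) - log_energy g\<bar> = norm (\<integral>t. g t * Re (pot g h (of_real t)) - g t * flat_pot g t \<partial>lborel)"
 unfolding log_energy_def using iR[OF h] i by simp
 also have "... <= (\<integral>t. norm (g t * Re (pot g h (of_real t)) - g t * flat_pot g t) \<partial>lborel)" by (rule integral_norm_bound)
 also have "... <= (\<integral>t. flat_const g * rq h * \<bar>g t\<bar> \<partial>lborel)"
 using bnd[OF h] L2_unit_integrable[OF g] by (intro integral_mono integrable_norm id h) auto
 finally show "\<bar>(\<integral>t. g t * Re (pot g h (of_real t)) \<partial>lborel) - log_energy g\<bar> <= flat_const g * rq h * L1n g" by simp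
qed

text \<open>For fixed h, dominated convergence in h' identifies the limit as the pairing of g with
  Re (pot g h), because \<open>dpot g h\<close> is continuous on the flat side. The uniform rate of
  \<open>flat_pot_approx\<close> against the uniform bound of \<open>dpot_L1\<close> shows how
  little h' matters; only then is h compared with 0.\<close>

lemma dpot_inner_approx:
 assumes g: "L2_unit g" "prim g 1 = 0" and h: "0 < h" "h < 1" and h': "0 < h'" "h' < 1"
 shows "\<bar>dpot_inner g h h' - log_energy g\<bar> <= 2 * flat_const g * L1n g * (rq h + rq h')"
proof -
 define C where "C = flat_const g"
 define N where "N = L1n g"
 have C0: "C \<ge> 0" and N0: "N \<ge> 0" using flat_const_nonneg by (auto simp: C_def N_def intro!: Bochner_Integration.integral_nonneg)
 define q where "q = (\<integral>t. g t * Re (pot g h (of_real t)) \<partial>lborel)"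
 note cR = continuous_on_pot_real[OF g(1)]
 have iP: "set_integrable lborel {-1..1} (%t. Re (pot g k (of_real t)) * Im (dpot g h (of_real t)))" if "0 < k" "k < 1" for k
 by (intro LBINT_eq_HK(2) continuous_intros cR that h)
 have cp: "continuous_on {-1..1} (%t. Re (pot g k (of_real t)))" if "0 < k" "k < 1" for k
 by (intro continuous_on_Re cR that)
 have ci: "continuous_on {-1..1} (%t. Im (dpot g h (of_real t)))" by (intro continuous_on_Im cR h)
 have step: "\<bar>dpot_inner g h h' - dpot_inner g h k\<bar> <= C * (rq h' + rq k) * (2 * N)" if k: "0 < k" "k < 1" for k
 proof -
 have "dpot_inner g h h' - dpot_inner g h k = (LBINT t:{-1..1}. Re (pot g h' (of_real t)) * Im (dpot g h (of_real t)) - Re (pot g k (of_real t)) * Im (dpot g h (of_real t)))"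
 unfolding dpot_inner_flat(1)[OF g h h'] dpot_inner_flat(1)[OF g h k] by (rule set_integral_diff(2)[symmetric, OF iP[OF h'] iP[OF k]])
 also have "... = (LBINT t:{-1<..<1}. Re (pot g h' (of_real t)) * Im (dpot g h (of_real t)) - Re (pot g k (of_real t)) * Im (dpot g h (of_real t)))"
 by (rule integral_open_closed[symmetric])
 finally have "\<bar>dpot_inner g h h' - dpot_inner g h k\<bar> = norm (LBINT t:{-1<..<1}. Re (pot g h' (of_real t)) * Im (dpot g h (of_real t)) - Re (pot g k (of_real t)) * Im (dpot g h (of_real t)))"
 by (simp only: real_norm_def)
 also have "... <= (LBINT t:{-1<..<1}. norm (Re (pot g h' (of_real t)) * Im (dpot g h (of_real t)) - Re (pot g k (of_real t)) * Im (dpot g h (of_real t))))"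
 by (rule set_integral_norm_bound, rule set_integrable_subset[OF set_integral_diff(1)[OF iP[OF h'] iP[OF k]]]) auto
 also have "... <= (LBINT t:{-1<..<1}. C * (rq h' + rq k) * \<bar>Im (dpot g h (of_real t))\<bar>)"
 proof (rule set_integral_mono)
 have c1: "continuous_on {-1..1} (%t. norm (Re (pot g h' (of_real t)) * Im (dpot g h (of_real t)) - Re (pot g k (of_real t)) * Im (dpot g h (of_real t))))"
 by (intro continuous_on_norm continuous_on_diff continuous_on_mult cp ci h' k)
 have c2: "continuous_on {-1..1} (%t. C * (rq h' + rq k) * \<bar>Im (dpot g h (of_real t))\<bar>)"
 by (intro continuous_on_mult continuous_on_const continuous_on_rabs ci)
 show "set_integrable lborel {-1<..<1} (%t. norm (Re (pot g h' (of_real t)) * Im (dpot g h (of_real t)) - Re (pot g k (of_real t)) * Im (dpot g h (of_real t))))"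
 by (rule set_integrable_subset[OF LBINT_eq_HK(2)[OF c1]]) auto
 show "set_integrable lborel {-1<..<1} (%t. C * (rq h' + rq k) * \<bar>Im (dpot g h (of_real t))\<bar>)"
 by (rule set_integrable_subset[OF LBINT_eq_HK(2)[OF c2]]) auto
 fix t :: real assume "t \<in> {-1<..<1}"
 then have t: "\<bar>t\<bar> < 1" by auto
 have "\<bar>Re (pot g h' (of_real t)) - Re (pot g k (of_real t))\<bar> <= C * rq h' + C * rq k"
 using flat_pot_approx(1)[OF g(1) h' t] flat_pot_approx(1)[OF g(1) k t] unfolding C_def by linarith
 from mult_right_mono[OF this abs_ge_zero[of "Im (dpot g h (of_real t))"]]
 show "norm (Re (pot g h' (of_real t)) * Im (dpot g h (of_real t)) - Re (pot g k (of_real t)) * Im (dpot g h (of_real t))) <= C * (rq h' + rq k) * \<bar>Im (dpot g h (of_real t))\<bar>"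
 by (simp add: abs_mult distrib_left flip: left_diff_distrib)
 qed
 also have "... = C * (rq h' + rq k) * (LBINT t:{-1..1}. \<bar>Im (dpot g h (of_real t))\<bar>)" unfolding integral_open_closed by simp
 also have "... <= C * (rq h' + rq k) * (2 * N)"
 unfolding N_def by (intro mult_left_mono dpot_L1 g h mult_nonneg_nonneg add_nonneg_nonneg rq_nonneg C0) (use h' k in auto)
 finally show ?thesis .
 qed
 have lim: "(%n. dpot_inner g h (hs n)) ---> q"
 proof -
 have "(%n. \<integral>t. indicator {-1<..<1} t *\<^sub>R (Im (pot g (hs n) (of_real t)) * Re (dpot g h (of_real t))) \<partial>lborel)
 ---> (\<integral>t. indicator {-1<..<1} t *\<^sub>R (prim g t * Re (dpot g h (of_real t))) \<partial>lborel)"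
 proof (rule integral_dominated_convergence[where w="%t. indicator {-1..1} t *\<^sub>R (2 * N * \<bar>Re (dpot g h (of_real t))\<bar>)"])
 show "integrable lborel (%t. indicator {-1..1} t *\<^sub>R (2 * N * \<bar>Re (dpot g h (of_real t))\<bar>))"
 by (rule borel_integrable_compact) (auto intro!: continuous_intros cR h)
 show "AE t in lborel. (%n. indicator {-1<..<1} t *\<^sub>R (Im (pot g (hs n) (of_real t)) * Re (dpot g h (of_real t)))) ---> indicator {-1<..<1} t *\<^sub>R (prim g t * Re (dpot g h (of_real t)))"
 proof (rule AE_I2)
 fix t :: real
 show "(%n. indicator {-1<..<1} t *\<^sub>R (Im (pot g (hs n) (of_real t)) * Re (dpot g h (of_real t)))) ---> indicator {-1<..<1} t *\<^sub>R (prim g t * Re (dpot g h (of_real t)))"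
 by (cases "t \<in> {-1<..<1}") (auto intro!: tendsto_intros Im_pot_flat_tendsto[OF g])
 qed
 show "AE t in lborel. norm (indicator {-1<..<1} t *\<^sub>R (Im (pot g (hs n) (of_real t)) * Re (dpot g h (of_real t)))) <= indicator {-1..1} t *\<^sub>R (2 * N * \<bar>Re (dpot g h (of_real t))\<bar>)" for n
 proof (rule AE_I2)
 fix t :: real
 have "\<bar>Im (pot g (hs n) (of_real t))\<bar> <= 2 * N"
 unfolding N_def using hs(1,2)[of n] by (intro abs_Im_pot_le[OF g(1)]) auto
 from mult_right_mono[OF this abs_ge_zero[of "Re (dpot g h (of_real t))"]] N0
 show "norm (indicator {-1<..<1} t *\<^sub>R (Im (pot g (hs n) (of_real t)) * Re (dpot g h (of_real t)))) <= indicator {-1..1} t *\<^sub>R (2 * N * \<bar>Re (dpot g h (of_real t))\<bar>)"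
 by (auto simp: indicator_def abs_mult)
 qed
 have "continuous_on {-1<..<1} (%t. prim g t * Re (dpot g h (of_real t)))"
 by (intro continuous_on_mult continuous_prim g continuous_on_Re cR h)
 from borel_measurable_continuous_on_indicator[OF _ this]
 show "(%t. indicator {-1<..<1} t *\<^sub>R (prim g t * Re (dpot g h (of_real t)))) \<in> borel_measurable lborel" by simp
 have "continuous_on {-1<..<1} (%t. Im (pot g (hs n) (of_real t)) * Re (dpot g h (of_real t)))" for n
 by (intro continuous_on_mult continuous_on_Im continuous_on_Re cR h hs)
 from borel_measurable_continuous_on_indicator[OF _ this]
 show "(%t. indicator {-1<..<1} t *\<^sub>R (Im (pot g (hs n) (of_real t)) * Re (dpot g h (of_real t)))) \<in> borel_measurable lborel" for n by simp
 qed
 then have "(%n. LBINT t:{-1<..<1}. Im (pot g (hs n) (of_real t)) * Re (dpot g h (of_real t))) ---> (LBINT t:{-1<..<1}. prim g t * Re (dpot g h (of_real t)))"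
 unfolding set_lebesgue_integral_def .
 from tendsto_minus[OF this] have "(%n. - (LBINT t:{-1..1}. Im (pot g (hs n) (of_real t)) * Re (dpot g h (of_real t)))) ---> - (LBINT t:{-1..1}. prim g t * Re (dpot g h (of_real t)))"
 unfolding integral_open_closed .
 then show ?thesis unfolding dpot_inner_flat(2)[OF g h hs(1,2)] prim_dpot_flat[OF g h] q_def by simp
 qed
 have "\<bar>dpot_inner g h h' - q\<bar> <= C * (rq h' + 0) * (2 * N)"
 proof (rule tendsto_le[OF _ _ tendsto_rabs[OF tendsto_diff[OF tendsto_const lim]]])
 show "(%n. C * (rq h' + rq (hs n)) * (2 * N)) ---> C * (rq h' + 0) * (2 * N)" by (intro tendsto_intros rq_hs)
 qed (use step[OF hs(1,2)] in auto)
 moreover have "\<bar>q - log_energy g\<bar> <= C * rq h * N" unfolding q_def C_def N_def by (rule flat_pot_measurable(2)[OF g(1) h])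
 moreover have "C * rq h * N <= 2 * (C * rq h * N)" using C0 N0 rq_nonneg[of h] h by simp
 ultimately show ?thesis unfolding C_def[symmetric] N_def[symmetric] by (simp add: algebra_simps)
qed

section \<open>Dirichlet energy of the minimal extension\<close>

lemma Fatou_Hp:
 assumes c: "!!m. continuous_on Kp (f m)" and nn: "!!m x. x \<in> Hp ==> 0 <= f m x"
 and lim: "!!x. x \<in> Hp ==> (%m. f m x) ---> F x"
 and b: "!!m. (LBINT x:Hp. f m x) <= b m" "b ---> L"
 shows "(\<integral>\<^sup>+x. indicator Hp x * ennreal (F x) \<partial>lebesgue) <= ennreal L"
proof -
 have meas: "(%x. indicator Hp x * ennreal (f m x)) \<in> borel_measurable lborel" for m
 proof -
 have "(%x. ennreal (indicator Hp x *\<^sub>R f m x)) \<in> borel_measurable borel"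
 using indicator_Hp_measurable(1)[OF c, of m] by measurable
 moreover have "(%x. ennreal (indicator Hp x *\<^sub>R f m x)) = (%x. indicator Hp x * ennreal (f m x))" by (auto simp: indicator_def)
 ultimately show ?thesis by simp
 qed
 have "(\<integral>\<^sup>+x. indicator Hp x * ennreal (F x) \<partial>lborel) = (\<integral>\<^sup>+x. liminf (%m. indicator Hp x * ennreal (f m x)) \<partial>lborel)"
 proof (rule nn_integral_cong)
 fix x :: "real \<times> real"
 have "(%m. indicator Hp x * ennreal (f m x)) ---> indicator Hp x * ennreal (F x)"
 by (cases "x \<in> Hp") (auto intro!: tendsto_ennrealI lim)
 then show "indicator Hp x * ennreal (F x) = liminf (%m. indicator Hp x * ennreal (f m x))"
 by (rule lim_imp_Liminf[OF sequentially_bot, symmetric])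
 qed
 also have "... <= liminf (%m. \<integral>\<^sup>+x. indicator Hp x * ennreal (f m x) \<partial>lborel)"
 by (rule nn_integral_liminf[OF meas])
 also have "... <= liminf (%m. ennreal (b m))"
 proof (rule Liminf_mono, rule always_eventually, rule allI)
 fix m
 have "(\<integral>\<^sup>+x. indicator Hp x * ennreal (f m x) \<partial>lborel) = ennreal (LBINT x:Hp. f m x)"
 using nn_integral_Hp_eq[OF c nn, of m] by (simp add: nn_integral_completion)
 also have "... <= ennreal (b m)" by (rule ennreal_leI[OF b(1)])
 finally show "(\<integral>\<^sup>+x. indicator Hp x * ennreal (f m x) \<partial>lborel) <= ennreal (b m)" .
 qed
 also have "... = ennreal L" by (rule lim_imp_Liminf[OF sequentially_bot tendsto_ennrealI[OF b(2)]])
 finally show ?thesis by (simp add: nn_integral_completion)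
qed

lemma dpot_inner_hs_tendsto:
 assumes g: "L2_unit g" "prim g 1 = 0"
 shows "(%n. dpot_inner g (hs n) (hs n)) ---> log_energy g"
proof -
 have "(%n. dpot_inner g (hs n) (hs n) - log_energy g) ---> 0"
 proof (rule Lim_null_comparison)
 show "\<forall>\<^sub>F n in sequentially. norm (dpot_inner g (hs n) (hs n) - log_energy g) <= 2 * flat_const g * L1n g * (rq (hs n) + rq (hs n))"
 unfolding real_norm_def by (intro always_eventually allI dpot_inner_approx[OF g hs(1,2) hs(1,2)])
 have "(%n. 2 * flat_const g * L1n g * (rq (hs n) + rq (hs n))) ---> 2 * flat_const g * L1n g * (0 + 0)"
 by (intro tendsto_intros rq_hs)
 then show "(%n. 2 * flat_const g * L1n g * (rq (hs n) + rq (hs n))) ---> 0" by simp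
 qed
 then show ?thesis by (simp add: LIM_zero_iff)
qed

lemma dpot_inner_self: "dpot_inner g h h = (LBINT x:Hp. (cmod (dpot g h (cx x)))^2)"
 unfolding dpot_inner_def cmod_power2 by (simp add: power2_eq_square)

text \<open>At depth 0 Fatou yields an inequality; the matching bound from below comes from duality
  in \<open>dir_inf_ge\<close>.\<close>

lemma dpot_energy_le:
 assumes g: "L2_unit g" "prim g 1 = 0"
 shows "(\<integral>\<^sup>+x. indicator Hp x * ennreal ((cmod (dpot g 0 (cx x)))^2) \<partial>lebesgue) <= ennreal (log_energy g)"
proof (rule Fatou_Hp[where f="%m x. (cmod (dpot g (hs m) (cx x)))^2"])
 show "continuous_on Kp (%x. (cmod (dpot g (hs m) (cx x)))^2)" for m
 by (intro continuous_intros continuous_pot_Kp g hs)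
 show "(%m. (cmod (dpot g (hs m) (cx x)))^2) ---> (cmod (dpot g 0 (cx x)))^2" if "x \<in> Hp" for x
 using that by (intro tendsto_intros tendsto_pot[OF g(1) _ hs(4,3)]) (auto simp: Hp_def)
 show "(%n. dpot_inner g (hs n) (hs n)) ---> log_energy g" by (rule dpot_inner_hs_tendsto[OF g])
qed (simp_all add: dpot_inner_self)

lemma log_energy_nonneg:
 assumes g: "L2_unit g" "prim g 1 = 0"
 shows "0 <= log_energy g"
 by (rule LIMSEQ_le_const[OF dpot_inner_hs_tendsto[OF g]])
 (auto simp: dpot_inner_self set_lebesgue_integral_def intro!: Bochner_Integration.integral_nonneg)

text \<open>Duality against the field of the potential itself: both the pairing and the energy of
  the field tend to the logarithmic energy Q, which leaves 2 Q - Q. Only the positive part over 1 -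
  gm enters, so \<mu> may dip below that level.\<close>

lemma dir_inf_ge:
 assumes g: "L2_unit g" "prim g 1 = 0" and mu: "continuous_on {-1..1} \<mu>"
 and m: "!!x. x \<in> {-1..1} ==> max (\<mu> x - (1 - gm)) 0 = prim g x"
 shows "ennreal (log_energy g) <= dir_inf gm \<mu>"
 unfolding dir_inf_def
proof (rule INF_greatest)
 fix wG assume "wG \<in> {(w, G). W12_mu gm \<mu> w G}"
 then obtain w G where wG: "wG = (w, G)" "W12_mu gm \<mu> w G" by auto
 let ?q = "%n. \<integral>t. g t * Re (pot g (hs n) (of_real t)) \<partial>lborel"
 have q: "?q ---> log_energy g"
 proof -
 have "(%n. ?q n - log_energy g) ---> 0"
 proof (rule Lim_null_comparison)
 show "\<forall>\<^sub>F n in sequentially. norm (?q n - log_energy g) <= flat_const g * rq (hs n) * L1n g"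
 using flat_pot_measurable(2)[OF g(1) hs(1,2)] by (intro always_eventually allI) simp
 have "(%n. flat_const g * rq (hs n) * L1n g) ---> flat_const g * 0 * L1n g" by (intro tendsto_intros rq_hs)
 then show "(%n. flat_const g * rq (hs n) * L1n g) ---> 0" by simp
 qed
 then show ?thesis by (simp add: LIM_zero_iff)
 qed
 have "(%n. ennreal (2 * ?q n - dpot_inner g (hs n) (hs n))) ---> ennreal (2 * log_energy g - log_energy g)"
 by (intro tendsto_ennrealI tendsto_diff tendsto_mult_left q dpot_inner_hs_tendsto g)
 moreover have "ennreal (2 * ?q n - dpot_inner g (hs n) (hs n)) <= (\<integral>\<^sup>+x. indicator Hp x * ennreal ((norm (G x))^2) \<partial>lebesgue)" for n
 proof -
 have "(LBINT t:{-1..1}. max (\<mu> t - (1 - gm)) 0 * (- Re (dpot g (hs n) (of_real t)))) = (LBINT t:{-1..1}. - (prim g t * Re (dpot g (hs n) (of_real t))))"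
 by (intro set_lebesgue_integral_cong) (auto simp: m)
 also have "... = ?q n" using prim_dpot_flat[OF g hs(1,2), of n] by (simp add: set_lebesgue_integral_def)
 finally have e: "(LBINT t:{-1..1}. max (\<mu> t - (1 - gm)) 0 * (- Re (dpot g (hs n) (of_real t)))) = ?q n" .
 have "hs n / 2 > 0" "0 <= hs n" using hs(1)[of n] by auto
 from dirichlet_dual_bound[OF mu wG(2) this(1) holomorphic_pot(2)[OF g(1) this(2) hs(2)]]
 show ?thesis unfolding e dpot_inner_self .
 qed
 ultimately have "ennreal (2 * log_energy g - log_energy g) <= (\<integral>\<^sup>+x. indicator Hp x * ennreal ((norm (G x))^2) \<partial>lebesgue)"
 by (intro tendsto_upperbound[where f="%n. ennreal (2 * ?q n - dpot_inner g (hs n) (hs n))"]) auto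
 then show "ennreal (log_energy g) <= (\<integral>\<^sup>+x. indicator Hp x * ennreal ((norm (snd wG x))^2) \<partial>lebesgue)"
 by (simp add: wG(1))
qed

text \<open>In the expanded square all three inner products are close to
  \<open>log_energy g\<close>, which cancels. The regularised fields thus form a Cauchy sequence in
  L2.\<close>

lemma dpot_diff_energy_le:
 assumes g: "L2_unit g" "prim g 1 = 0" and h: "0 < h" "h < 1" and h': "0 < h'" "h' < 1"
 shows "(LBINT x:Hp. (cmod (dpot g h (cx x) - dpot g h' (cx x)))^2) <= 8 * flat_const g * L1n g * (rq h + rq h')"
proof -
 define C where "C = 2 * flat_const g * L1n g"
 let ?n = "%a b. %x. Re (dpot g a (cx x)) * Re (dpot g b (cx x)) + Im (dpot g a (cx x)) * Im (dpot g b (cx x))"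
 have i: "set_integrable lborel Hp (?n a b)" if "0 < a" "a < 1" "0 < b" "b < 1" for a b
 by (intro set_integrable_Hp continuous_intros continuous_pot_Kp g that)
 have "(LBINT x:Hp. (cmod (dpot g h (cx x) - dpot g h' (cx x)))^2) = (LBINT x:Hp. ?n h h x + ?n h' h' x - 2 * ?n h h' x)"
 unfolding cmod_power2 by (simp add: power2_eq_square algebra_simps)
 also have "... = (LBINT x:Hp. ?n h h x + ?n h' h' x) - (LBINT x:Hp. 2 * ?n h h' x)"
 by (intro set_integral_diff(2) set_integral_add(1) set_integrable_mult_right i h h')
 also have "... = dpot_inner g h h + dpot_inner g h' h' - 2 * dpot_inner g h h'"
 unfolding dpot_inner_def set_integral_mult_right by (subst set_integral_add(2)) (auto intro!: i h h')
 also have "... <= C * (rq h + rq h) + C * (rq h' + rq h') + 2 * (C * (rq h + rq h'))"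
 using dpot_inner_approx[OF g h h] dpot_inner_approx[OF g h' h'] dpot_inner_approx[OF g h h']
 unfolding C_def[symmetric] by linarith
 also have "... = 8 * flat_const g * L1n g * (rq h + rq h')" by (simp add: C_def algebra_simps)
 finally show ?thesis .
qed

lemma nn_integral_bounded_tendsto_0:
 fixes f :: "nat => 'a::euclidean_space => real"
 assumes A: "A \<in> sets borel" "emeasure lborel A < \<infinity>"
 and m: "!!n. (%x. indicator A x * f n x) \<in> borel_measurable borel"
 and b: "!!n x. x \<in> A ==> \<bar>f n x\<bar> <= B" and lim: "!!x. x \<in> A ==> (%n. f n x) ---> 0"
 shows "(%n. \<integral>\<^sup>+x. indicator A x * ennreal ((f n x)^2) \<partial>lebesgue) ---> 0"
proof -
 have meas: "(%x. indicator A x * ennreal ((f n x)^2)) \<in> borel_measurable lborel" for n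
 proof -
 have "(%x. ennreal ((indicator A x * f n x)^2)) \<in> borel_measurable borel" using m[of n] by measurable
 moreover have "(%x. ennreal ((indicator A x * f n x)^2)) = (%x. indicator A x * ennreal ((f n x)^2))" by (auto simp: indicator_def)
 ultimately show ?thesis by simp
 qed
 have "(%n. \<integral>\<^sup>+x. indicator A x * ennreal ((f n x)^2) \<partial>lborel) ---> (\<integral>\<^sup>+x. 0 \<partial>(lborel :: 'a measure))"
 proof (rule nn_integral_dominated_convergence[where w="%x. ennreal (B^2) * indicator A x"])
 show "AE x in lborel. indicator A x * ennreal ((f n x)^2) <= ennreal (B^2) * indicator A x" for n
 proof (rule AE_I2)
 fix x
 show "indicator A x * ennreal ((f n x)^2) <= ennreal (B^2) * indicator A x"
 proof (cases "x \<in> A")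
 case True
 have "\<bar>f n x\<bar>\<^sup>2 <= B^2" by (intro power_mono b True) auto
 then show ?thesis using True by (simp add: ennreal_leI)
 qed simp
 qed
 show "(\<integral>\<^sup>+x. ennreal (B^2) * indicator A x \<partial>lborel) < \<infinity>"
 using A by (simp add: nn_integral_cmult_indicator ennreal_mult_less_top)
 show "AE x in lborel. (%n. indicator A x * ennreal ((f n x)^2)) ---> 0"
 proof (rule AE_I2)
 fix x
 show "(%n. indicator A x * ennreal ((f n x)^2)) ---> 0"
 proof (cases "x \<in> A")
 case True
 have "(%n. ennreal ((f n x)^2)) ---> ennreal (0^2)" by (intro tendsto_ennrealI tendsto_intros lim True)
 then show ?thesis using True by simp
 qed simp
 qed
 qed (use meas A in auto)
 then show ?thesis by (simp add: nn_integral_completion)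
qed

text \<open>The candidate is 1 - gm + Im (pot g 0). Its approximants have poles at depth
  \<open>hs n\<close> and equal 1 - gm on the arc. Their values converge boundedly, their gradients
  by \<open>dpot_diff_energy_le\<close> with the second depth sent to 0 by Fatou.\<close>

lemma dir_inf_le:
 assumes g: "L2_unit g" "prim g 1 = 0" and nu: "!!x. x \<in> {-1..1} ==> \<nu> x = 1 - gm + prim g x"
 shows "dir_inf gm \<nu> <= ennreal (log_energy g)"
proof -
 define c where "c = 1 - gm"
 define N where "N = L1n g"
 define w where "w x = c + Im (pot g 0 (cx x))" for x
 define G where "G x = (Im (dpot g 0 (cx x)), Re (dpot g 0 (cx x)))" for x
 have HpK: "0 < Im (cx x)" if "x \<in> Hp" for x using that by (simp add: Hp_def)
 have nG: "(norm (G x))^2 = (cmod (dpot g 0 (cx x)))^2" for x by (simp add: G_def norm_Pair cmod_power2)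
 have "\<exists>v Dv. C1_fun v Dv \<and> (\<forall>x. snd x \<ge> 0 \<longrightarrow> v x = Im (pot g (hs n) (cx x))) \<and> (\<forall>x. snd x \<ge> 0 \<longrightarrow> Dv x = (Im (dpot g (hs n) (cx x)), Re (dpot g (hs n) (cx x))))" for n
 by (rule pot_ext[OF g(1) hs(1,2)[of n]]) blast
 then obtain u Du where u: "!!n. C1_fun (u n) (Du n)" "!!n x. snd x \<ge> 0 ==> u n x = Im (pot g (hs n) (cx x))"
 "!!n x. snd x \<ge> 0 ==> Du n x = (Im (dpot g (hs n) (cx x)), Re (dpot g (hs n) (cx x)))" by metis
 define v where "v n x = c + u n x" for n x
 have v: "C1_fun (v n) (Du n)" for n
 unfolding C1_fun_def v_def
 using has_derivative_add[OF has_derivative_const C1_funD(1)[OF u(1)], of c] C1_funD(2)[OF u(1)] by auto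
 have hol0: "pot g 0 holomorphic_on {z. 0 < Im z}" "dpot g 0 holomorphic_on {z. 0 < Im z}"
 using holomorphic_pot(1,2)[OF g(1), of 0] by auto
 have c0: "continuous_on Hp (%x. pot g 0 (cx x))" "continuous_on Hp (%x. dpot g 0 (cx x))"
 by (rule continuous_on_compose2[OF holomorphic_on_imp_continuous_on[OF hol0(1)]]
 continuous_on_compose2[OF holomorphic_on_imp_continuous_on[OF hol0(2)]]; use HpK in \<open>auto intro!: continuous_intros\<close>)+
 have im0: "(%x. indicator Hp x *\<^sub>R f x) \<in> borel_measurable borel" if "continuous_on Hp f" for f :: "real \<times> real => 'b::euclidean_space"
 by (rule borel_measurable_continuous_on_indicator[OF _ that]) simp
 have N0: "\<bar>Im (pot g (hs n) z)\<bar> <= 2 * N" if "0 <= Im z" for n z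
 unfolding N_def using hs(1,2)[of n] that by (intro abs_Im_pot_le[OF g(1)]) auto
 have N1: "\<bar>Im (pot g 0 z)\<bar> <= 2 * N" if "0 < Im z" for z
 unfolding N_def using that by (intro abs_Im_pot_le[OF g(1)]) auto
 have Np: "\<bar>prim g t\<bar> <= 2 * N" if "t \<in> {-1<..<1}" for t
 proof (rule LIMSEQ_le_const2[OF tendsto_rabs[OF Im_pot_flat_tendsto[OF g]]])
 show "\<bar>t\<bar> < 1" using that by auto
 show "\<exists>M. \<forall>n\<ge>M. \<bar>Im (pot g (hs n) (of_real t))\<bar> <= 2 * N" using N0 by auto
 qed
 have Lw: "L2_on Hp w"
 unfolding L2_on_def
 proof
 have "(%x. indicator Hp x *\<^sub>R w x) \<in> borel_measurable borel"
 unfolding w_def by (intro im0 continuous_intros c0)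
 then show "(%x. indicator Hp x *\<^sub>R w x) \<in> borel_measurable lebesgue" by (intro measurable_completion) simp
 have "(\<integral>\<^sup>+x. indicator Hp x * ennreal ((norm (w x))^2) \<partial>lebesgue) <= (\<integral>\<^sup>+x. ennreal ((\<bar>c\<bar> + 2 * N)^2) * indicator Hp x \<partial>lebesgue)"
 proof (rule nn_integral_mono)
 fix x
 show "indicator Hp x * ennreal ((norm (w x))^2) <= ennreal ((\<bar>c\<bar> + 2 * N)^2) * indicator Hp x"
 proof (cases "x \<in> Hp")
 case True
 have "(norm (w x))^2 <= (\<bar>c\<bar> + 2 * N)^2" using N1[OF HpK[OF True]] by (intro power_mono) (auto simp: w_def)
 then show ?thesis using True by (simp add: ennreal_leI)
 qed simp
 qed
 also have "... < \<infinity>" using emeasure_Hp unfolding nn_integral_completion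
 by (simp add: nn_integral_cmult_indicator ennreal_mult_less_top)
 finally show "(\<integral>\<^sup>+x. indicator Hp x * ennreal ((norm (w x))^2) \<partial>lebesgue) < \<infinity>" .
 qed
 have EG: "(\<integral>\<^sup>+x. indicator Hp x * ennreal ((norm (G x))^2) \<partial>lebesgue) <= ennreal (log_energy g)"
 unfolding nG by (rule dpot_energy_le[OF g])
 have LG: "L2_on Hp G"
 unfolding L2_on_def
 proof
 have "(%x. indicator Hp x *\<^sub>R G x) \<in> borel_measurable borel"
 unfolding G_def by (intro im0 continuous_intros c0)
 then show "(%x. indicator Hp x *\<^sub>R G x) \<in> borel_measurable lebesgue" by (intro measurable_completion) simp
 show "(\<integral>\<^sup>+x. indicator Hp x * ennreal ((norm (G x))^2) \<partial>lebesgue) < \<infinity>"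
 using EG by (rule le_less_trans) simp
 qed
 have "W12_mu gm \<nu> w G"
 proof (rule W12_muI[OF v Lw LG])
 have D1: "(%n. \<integral>\<^sup>+x. indicator Hp x * ennreal ((v n x - w x)^2) \<partial>lebesgue) ---> 0"
 proof (rule nn_integral_bounded_tendsto_0[where B="4 * N"])
 have "(%x. indicator Hp x *\<^sub>R (v n x - w x)) \<in> borel_measurable borel" for n
 unfolding w_def by (intro im0 continuous_intros c0 C1_funD(3)[OF v])
 then show "(%x. indicator Hp x * (v n x - w x)) \<in> borel_measurable borel" for n by simp
 fix x assume x: "x \<in> Hp"
 have e: "v n x - w x = Im (pot g (hs n) (cx x)) - Im (pot g 0 (cx x))" for n
 using x by (simp add: v_def w_def u(2) Hp_def)
 show "\<bar>v n x - w x\<bar> <= 4 * N" for n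
 unfolding e using N0[of "cx x" n] N1[OF HpK[OF x]] HpK[OF x] by linarith
 have "(%n. Im (pot g (hs n) (cx x)) - Im (pot g 0 (cx x))) ---> Im (pot g 0 (cx x)) - Im (pot g 0 (cx x))"
 by (intro tendsto_intros tendsto_pot[OF g(1) HpK[OF x] hs(4,3)])
 then show "(%n. v n x - w x) ---> 0" unfolding e by simp
 qed (auto simp: emeasure_Hp[simplified])
 have D2: "(\<integral>\<^sup>+x. indicator Hp x * ennreal ((norm (Du n x - G x))^2) \<partial>lebesgue) <= ennreal (8 * flat_const g * L1n g * (rq (hs n) + 0))" for n
 proof -
 have "(\<integral>\<^sup>+x. indicator Hp x * ennreal ((norm (Du n x - G x))^2) \<partial>lebesgue) = (\<integral>\<^sup>+x. indicator Hp x * ennreal ((cmod (dpot g (hs n) (cx x) - dpot g 0 (cx x)))^2) \<partial>lebesgue)"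
 proof (rule nn_integral_cong)
 fix x
 show "indicator Hp x * ennreal ((norm (Du n x - G x))^2) = indicator Hp x * ennreal ((cmod (dpot g (hs n) (cx x) - dpot g 0 (cx x)))^2)"
 by (cases "x \<in> Hp") (auto simp: u(3) G_def Hp_def norm_Pair cmod_power2)
 qed
 also have "... <= ennreal (8 * flat_const g * L1n g * (rq (hs n) + 0))"
 proof (rule Fatou_Hp[where f="%m x. (cmod (dpot g (hs n) (cx x) - dpot g (hs m) (cx x)))^2"])
 show "continuous_on Kp (%x. (cmod (dpot g (hs n) (cx x) - dpot g (hs m) (cx x)))^2)" for m
 by (intro continuous_intros continuous_pot_Kp g hs)
 show "(%m. (cmod (dpot g (hs n) (cx x) - dpot g (hs m) (cx x)))^2) ---> (cmod (dpot g (hs n) (cx x) - dpot g 0 (cx x)))^2" if "x \<in> Hp" for x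
 by (intro tendsto_intros tendsto_pot[OF g(1) HpK[OF that] hs(4,3)])
 show "(LBINT x:Hp. (cmod (dpot g (hs n) (cx x) - dpot g (hs m) (cx x)))^2) <= 8 * flat_const g * L1n g * (rq (hs n) + rq (hs m))" for m
 by (rule dpot_diff_energy_le[OF g hs(1,2) hs(1,2)])
 show "(%m. 8 * flat_const g * L1n g * (rq (hs n) + rq (hs m))) ---> 8 * flat_const g * L1n g * (rq (hs n) + 0)"
 by (intro tendsto_intros rq_hs)
 qed simp
 finally show ?thesis .
 qed
 have "(%n. ennreal (8 * flat_const g * L1n g * (rq (hs n) + 0))) ---> ennreal (8 * flat_const g * L1n g * (0 + 0))"
 by (intro tendsto_ennrealI tendsto_intros rq_hs)
 then have D3: "(%n. ennreal (8 * flat_const g * L1n g * (rq (hs n) + 0))) ---> 0" by simp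
 have "W12_dist_sq Hp (v n) (Du n) w G <= 1 * (\<integral>\<^sup>+x. indicator Hp x * ennreal ((v n x - w x)^2) \<partial>lebesgue) + 1 * (\<integral>\<^sup>+x. indicator Hp x * ennreal ((norm (Du n x - G x))^2) \<partial>lebesgue)" for n
 unfolding W12_dist_sq_def
 proof (rule nn_integral_sq_add_le)
 have [measurable]: "(%x. indicator Hp x * (v n x - w x)) \<in> borel_measurable lebesgue" "(%x. indicator Hp x *\<^sub>R (Du n x - G x)) \<in> borel_measurable lebesgue"
 using W12_dist_sq_components[OF Lw LG v] by auto
 have m: "(%x. ennreal ((indicator Hp x * (v n x - w x))^2)) \<in> borel_measurable lebesgue" "(%x. ennreal ((norm (indicator Hp x *\<^sub>R (Du n x - G x)))^2)) \<in> borel_measurable lebesgue"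
 by measurable
 have e: "(%x. ennreal ((indicator Hp x * (v n x - w x))^2)) = (%x. indicator Hp x * ennreal ((v n x - w x)^2))"
 "(%x. ennreal ((norm (indicator Hp x *\<^sub>R (Du n x - G x)))^2)) = (%x. indicator Hp x * ennreal ((norm (Du n x - G x))^2))"
 by (auto simp: indicator_def)
 show "(%x. indicator Hp x * ennreal ((v n x - w x)^2)) \<in> borel_measurable lebesgue" "(%x. indicator Hp x * ennreal ((norm (Du n x - G x))^2)) \<in> borel_measurable lebesgue"
 using m unfolding e by blast+
 qed (auto simp: indicator_def ennreal_plus[symmetric] simp del: ennreal_plus)
 then have le: "W12_dist_sq Hp (v n) (Du n) w G <= (\<integral>\<^sup>+x. indicator Hp x * ennreal ((v n x - w x)^2) \<partial>lebesgue) + ennreal (8 * flat_const g * L1n g * (rq (hs n) + 0))" for n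
 using D2[of n] unfolding mult_1 by (meson add_left_mono order_trans)
 have "(%n. (\<integral>\<^sup>+x. indicator Hp x * ennreal ((v n x - w x)^2) \<partial>lebesgue) + ennreal (8 * flat_const g * L1n g * (rq (hs n) + 0))) ---> 0 + 0"
 by (rule tendsto_add[OF D1 D3])
 then have z: "(%n. (\<integral>\<^sup>+x. indicator Hp x * ennreal ((v n x - w x)^2) \<partial>lebesgue) + ennreal (8 * flat_const g * L1n g * (rq (hs n) + 0))) ---> 0" by simp
 show "(%n. W12_dist_sq Hp (v n) (Du n) w G) ---> 0"
 by (rule tendsto_sandwich[OF _ _ tendsto_const z]) (use le in \<open>simp_all add: always_eventually\<close>)
 show "(%n. \<integral>\<^sup>+t. indicator {-1<..<1} t * ennreal ((v n (t, 0) - \<nu> t)^2) \<partial>lebesgue) ---> 0"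
 proof (rule nn_integral_bounded_tendsto_0[where B="4 * N"])
 have e: "v n (t, 0) - \<nu> t = Im (pot g (hs n) (of_real t)) - prim g t" if "t \<in> {-1<..<1}" for n t
 using that nu[of t] by (simp add: v_def u(2) c_def)
 have "(%t. indicator {-1<..<1} t *\<^sub>R (Im (pot g (hs n) (of_real t)) - prim g t)) \<in> borel_measurable borel" for n
 by (rule borel_measurable_continuous_on_indicator) (auto intro!: continuous_intros continuous_on_pot_real[OF g(1)] hs continuous_prim g)
 moreover have "(%t. indicator {-1<..<1} t *\<^sub>R (Im (pot g (hs n) (of_real t)) - prim g t)) = (%t. indicator {-1<..<1} t * (v n (t, 0) - \<nu> t))" for n
 by (rule ext) (auto simp: indicator_def e)
 ultimately show "(%t. indicator {-1<..<1} t * (v n (t, 0) - \<nu> t)) \<in> borel_measurable borel" for n by metis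
 fix t :: real assume t: "t \<in> {-1<..<1}"
 show "\<bar>v n (t, 0) - \<nu> t\<bar> <= 4 * N" for n unfolding e[OF t] using N0[of "of_real t" n] Np[OF t] by simp
 have "(%n. Im (pot g (hs n) (of_real t)) - prim g t) ---> prim g t - prim g t"
 using t by (intro tendsto_intros Im_pot_flat_tendsto g) auto
 then show "(%n. v n (t, 0) - \<nu> t) ---> 0" unfolding e[OF t] by simp
 qed auto
 show "v n (cos th, sin th) = 1 - gm" if "0 < th" "th < pi" for n th
 using pot_arc(1)[OF g, of "hs n" th] that hs(1,2)[of n] sin_gt_zero[OF that] by (simp add: v_def u(2) c_def)
 qed
 then have "dir_inf gm \<nu> <= (\<integral>\<^sup>+x. indicator Hp x * ennreal ((norm (snd (w, G) x))^2) \<partial>lebesgue)"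
 unfolding dir_inf_def by (intro INF_lower) auto
 also have "... <= ennreal (log_energy g)" using EG by simp
 finally show ?thesis .
qed

section \<open>Chain rule for primitives and truncation of the minimiser\<close>

lemma L2_unit_scaled_bound:
 assumes g: "L2_unit g" and h: "h \<in> borel_measurable borel" "!!x. \<bar>h x\<bar> <= C * \<bar>g x\<bar>"
 shows "L2_unit h"
proof -
 have "L2_unit (%x. C * g x)"
 unfolding L2_unit_def using g by (auto simp: L2_unit_def power_mult_distrib)
 then show ?thesis
 proof (rule L2_unit_bound[OF _ h(1)])
 show "\<bar>h x\<bar> <= \<bar>C * g x\<bar>" for x
 using h(2)[of x] mult_right_mono[OF abs_ge_self[of C] abs_ge_zero[of "g x"]] by (simp add: abs_mult)
 qed
qed

text \<open>On short intervals \<psi> (M x) minus the primitive of \<psi>' (M t) g t varies by at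
  most \<open>hq\<close> times the integral of |g|. This estimate adds up over adjacent intervals,
  so a Bolzano bisection makes it global, and \<open>hq\<close> is arbitrary.\<close>

lemma prim_chain:
 assumes g: "L2_unit g" and M: "!!x. M x = a + prim g x"
 and D: "!!y. (\<psi> has_real_derivative \<psi>' y) (at y)" and c: "continuous_on UNIV \<psi>'"
 and x: "x \<in> {-1..1}"
 shows "\<psi> (M x) = \<psi> a + prim (%t. \<psi>' (M t) * g t) x" "L2_unit (%t. \<psi>' (M t) * g t)"
proof -
 note [measurable] = L2_unit_measurable[OF g]
 have cM: "continuous_on S M" for S unfolding M by (intro continuous_intros continuous_prim g)
 have cpM: "continuous_on S (%t. \<psi>' (M t))" for S
 by (rule continuous_on_compose2[OF c cM]) auto
 obtain B where B: "B \<ge> 0" "!!t. t \<in> {-1..1} ==> norm (\<psi>' (M t)) <= B"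
 using continuous_on_compact_bound[OF compact_Icc cpM] by blast
 define k where "k t = \<psi>' (M t) * g t" for t
 have km: "k \<in> borel_measurable borel" unfolding k_def[abs_def]
 using borel_measurable_continuous_onI[OF cpM] by measurable
 have kb: "\<bar>k t\<bar> <= B * \<bar>g t\<bar>" for t
 using B(2)[of t] L2_unit_zero[OF g, of t] by (cases "t \<in> {-1<..<1}") (auto simp: k_def abs_mult intro: mult_right_mono)
 show k: "L2_unit (%t. \<psi>' (M t) * g t)" using L2_unit_scaled_bound[OF g km kb] by (simp add: k_def[abs_def])
 then have k': "L2_unit k" by (simp add: k_def[abs_def])
 have ga: "L2_unit (%t. \<bar>g t\<bar>)" by (rule L2_unit_bound[OF g]) auto
 define h where "h x = \<psi> (M x) - prim k x" for x
 define A where "A = prim (%t. \<bar>g t\<bar>)"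
 have A0: "A x <= L1n g" "0 <= A (-1)"
 proof -
 have "A x <= A 1" using prim_diff_bound[OF ga, of x 1] x by (simp add: A_def)
 then show "A x <= L1n g" using prim_upper[OF ga, of 1] by (simp add: A_def)
 show "0 <= A (-1)" using prim_lower[OF ga, of "-1"] by (simp add: A_def)
 qed
 have est: "\<bar>h x - h (-1)\<bar> <= hq * (A x - A (-1))" if hq: "hq > 0" for hq
 proof -
 define P where "P u v \<longleftrightarrow> (-1 <= u \<and> v <= 1 \<longrightarrow> \<bar>h v - h u\<bar> <= hq * (A v - A u))" for u v
 have "P (-1) x"
 proof (rule Bolzano)
 show "-1 <= x" using x by simp
 fix p q r :: real
 assume "P p q" "P q r" "p <= q" "q <= r"
 then show "P p r" unfolding P_def by (auto simp: right_diff_distrib)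
 next
 fix y :: real assume "-1 <= y" "y <= x"
 have "isCont (%t. \<psi>' (M t)) y" using cpM[of UNIV] by (simp add: continuous_on_eq_continuous_at)
 then obtain d where d: "d > 0" "!!s. \<bar>s - y\<bar> < d ==> \<bar>\<psi>' (M s) - \<psi>' (M y)\<bar> < hq / 2"
 using hq unfolding continuous_at_eps_delta dist_real_def by (metis half_gt_zero)
 show "\<exists>d>0. \<forall>u v. u <= y \<and> y <= v \<and> v - u < d \<longrightarrow> P u v"
 unfolding P_def
 proof (intro exI[of _ d] conjI allI impI d(1))
 fix u v assume uv: "u <= y \<and> y <= v \<and> v - u < d" "-1 <= u \<and> v <= 1"
 then have le: "u <= v" by simp
 \<comment> \<open>The mean value theorem for \<psi> gives a value between M u and M v, and the
   intermediate value theorem writes it as M z; so continuity of \<psi>' (M t) at y controls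
   it.\<close>
 obtain z where z: "z \<in> {u..v}" "\<psi> (M v) - \<psi> (M u) = \<psi>' (M z) * (M v - M u)"
 proof -
 consider "M u = M v" | "M u < M v" | "M v < M u" by linarith
 then show thesis
 proof cases
 case 1 then show thesis using le that[of u] by simp
 next
 case 2
 obtain \<xi> where \<xi>: "M u < \<xi>" "\<xi> < M v" "\<psi> (M v) - \<psi> (M u) = (M v - M u) * \<psi>' \<xi>" using MVT2[OF 2] D by blast
 obtain z where "u <= z" "z <= v" "M z = \<xi>" using IVT'[of M u \<xi> v] \<xi> le cM by auto
 then show thesis using \<xi> that[of z] by simp
 next
 case 3
 obtain \<xi> where \<xi>: "M v < \<xi>" "\<xi> < M u" "\<psi> (M u) - \<psi> (M v) = (M u - M v) * \<psi>' \<xi>" using MVT2[OF 3] D by blast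
 obtain z where "u <= z" "z <= v" "M z = \<xi>" using IVT2'[of M v \<xi> u] \<xi> le cM by auto
 then show thesis using \<xi> that[of z] by (simp add: algebra_simps)
 qed
 qed
 have ig: "integrable lborel (%t. indicator {u<..v} t * f t)" if "L2_unit f" for f
 using integrable_mult_indicator[OF _ L2_unit_integrable[OF that], of "{u<..v}"] by simp
 have "h v - h u = \<psi>' (M z) * (prim g v - prim g u) - (prim k v - prim k u)" using z(2) M by (simp add: h_def)
 also have "... = (\<integral>t. \<psi>' (M z) * (indicator {u<..v} t * g t) - indicator {u<..v} t * k t \<partial>lborel)"
 unfolding prim_diff[OF g le] prim_diff[OF k' le] using ig[OF g] ig[OF k'] by simp
 finally have "\<bar>h v - h u\<bar> <= (\<integral>t. norm (\<psi>' (M z) * (indicator {u<..v} t * g t) - indicator {u<..v} t * k t) \<partial>lborel)"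
 using integral_norm_bound[of lborel "%t. \<psi>' (M z) * (indicator {u<..v} t * g t) - indicator {u<..v} t * k t"] by simp
 also have "... <= (\<integral>t. hq * (indicator {u<..v} t * \<bar>g t\<bar>) \<partial>lborel)"
 proof (rule integral_mono)
 show "integrable lborel (%t. norm (\<psi>' (M z) * (indicator {u<..v} t * g t) - indicator {u<..v} t * k t))"
 "integrable lborel (%t. hq * (indicator {u<..v} t * \<bar>g t\<bar>))"
 using ig[OF g] ig[OF k'] ig[OF ga] by (auto intro!: integrable_norm)
 fix t :: real
 show "norm (\<psi>' (M z) * (indicator {u<..v} t * g t) - indicator {u<..v} t * k t) <= hq * (indicator {u<..v} t * \<bar>g t\<bar>)"
 proof (cases "t \<in> {u<..v}")
 case True
 have "\<bar>t - y\<bar> < d" "\<bar>z - y\<bar> < d" using True z(1) uv by auto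
 from d(2)[OF this(1)] d(2)[OF this(2)] have "\<bar>\<psi>' (M z) - \<psi>' (M t)\<bar> <= hq" by linarith
 then have "\<bar>\<psi>' (M z) - \<psi>' (M t)\<bar> * \<bar>g t\<bar> <= hq * \<bar>g t\<bar>" by (rule mult_right_mono) simp
 then show ?thesis using True by (simp add: k_def abs_mult flip: left_diff_distrib)
 qed simp
 qed
 also have "... = hq * (A v - A u)" unfolding A_def prim_diff[OF ga le] by simp
 finally show "\<bar>h v - h u\<bar> <= hq * (A v - A u)" .
 qed
 qed
 then show ?thesis using x by (simp add: P_def)
 qed
 have "\<bar>h x - h (-1)\<bar> <= 0"
 proof (rule field_le_epsilon)
 fix e :: real assume e: "e > 0"
 define N where "N = L1n g"
 have N: "0 <= N" unfolding N_def by (rule Bochner_Integration.integral_nonneg) simp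
 have "\<bar>h x - h (-1)\<bar> <= e / (N + 1) * (A x - A (-1))" by (rule est) (use e N in simp)
 also have "... <= e / (N + 1) * (N + 1)" using A0 e N by (intro mult_left_mono) (auto simp: N_def)
 also have "... = e" using N by simp
 finally show "\<bar>h x - h (-1)\<bar> <= 0 + e" by simp
 qed
 then show "\<psi> (M x) = \<psi> a + prim (%t. \<psi>' (M t) * g t) x"
 using prim_lower[OF k', of "-1"] prim_lower[OF g, of "-1"] M by (simp add: h_def k_def[abs_def])
qed

text \<open>Limit of the chain rule for the smoothed positive part, whose derivative tends to 1
  where M > c and is 0 elsewhere.\<close>

lemma prim_positive_part:
 assumes g: "L2_unit g" and M: "!!x. M x = a + prim g x" and x: "x \<in> {-1..1}"
 shows "max (M x - c) 0 = max (a - c) 0 + prim (%t. if M t > c then g t else 0) x"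
 and "L2_unit (%t. if M t > c then g t else 0)"
proof -
 note [measurable] = L2_unit_measurable[OF g]
 have cM: "continuous_on S M" for S unfolding M by (intro continuous_intros continuous_prim g)
 then have [measurable]: "M \<in> borel_measurable borel" by (intro borel_measurable_continuous_onI)
 let ?g = "%t. if M t > c then g t else 0"
 have gmeas: "?g \<in> borel_measurable borel" by measurable
 show "L2_unit ?g" by (rule L2_unit_bound[OF g gmeas]) auto
 let ?d = "%n y. max (y - c) 0 / sqrt ((max (y - c) 0)^2 + (hs n)^2)"
 have eq: "smooth_pos (hs n) (M x - c) = smooth_pos (hs n) (a - c) + prim (%t. ?d n (M t) * g t) x" for n
 proof (rule prim_chain(1)[OF g M _ _ x, where \<psi>="%y. smooth_pos (hs n) (y - c)" and \<psi>'="?d n"])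
 show "((%y. smooth_pos (hs n) (y - c)) has_real_derivative ?d n y) (at y)" for y
 using DERIV_chain2[OF smooth_pos_DERIV[OF hs(1)] DERIV_diff[OF DERIV_ident DERIV_const]] by simp
 have "sqrt ((max (y - c) 0)^2 + (hs n)^2) \<noteq> 0" for y
 using add_nonneg_pos[of "(max (y - c) 0)^2" "(hs n)^2"] hs(1)[of n] by auto
 then show "continuous_on UNIV (?d n)" by (intro continuous_intros) auto
 qed
 have l: "(%n. smooth_pos (hs n) y) ---> max y 0" for y
 proof -
 have "(%n. smooth_pos (hs n) y) ---> sqrt ((max y 0)^2 + 0^2) - 0"
 unfolding smooth_pos_def by (intro tendsto_intros hs)
 then show ?thesis by simp
 qed
 have r: "(%n. prim (%t. ?d n (M t) * g t) x) ---> prim ?g x"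
 unfolding prim_def
 proof (rule integral_dominated_convergence[where w="%t. \<bar>g t\<bar>"])
 show "AE t in lborel. (%n. indicator {..x} t * (?d n (M t) * g t)) ---> indicator {..x} t * ?g t"
 proof (rule AE_I2)
 fix t
 have "(%n. ?d n (M t)) ---> (if M t > c then 1 else 0)"
 proof (cases "M t > c")
 case True
 have "(%n. ?d n (M t)) ---> max (M t - c) 0 / sqrt ((max (M t - c) 0)^2 + 0^2)"
 by (intro tendsto_intros hs) (use True in auto)
 then show ?thesis using True by simp
 qed simp
 from tendsto_mult_right[OF this, of "g t"] have "(%n. ?d n (M t) * g t) ---> ?g t" by (auto split: if_splits)
 then show "(%n. indicator {..x} t * (?d n (M t) * g t)) ---> indicator {..x} t * ?g t" by (rule tendsto_mult_left)
 qed
 show "AE t in lborel. norm (indicator {..x} t * (?d n (M t) * g t)) <= \<bar>g t\<bar>" for n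
 proof (rule AE_I2)
 fix t
 define q where "q = ?d n (M t)"
 have "\<bar>q\<bar> <= 1" using smooth_pos_deriv_bounds[OF hs(1), of "M t - c" n] by (simp add: q_def)
 from mult_right_mono[OF this abs_ge_zero[of "g t"]]
 show "norm (indicator {..x} t * (?d n (M t) * g t)) <= \<bar>g t\<bar>"
 unfolding q_def[symmetric] by (auto simp: indicator_def abs_mult)
 qed
 qed (use L2_unit_integrable[OF g] in auto)
 have "(%n. smooth_pos (hs n) (M x - c)) ---> max (a - c) 0 + prim ?g x"
 unfolding eq by (intro tendsto_add l r)
 with l[of "M x - c"] show "max (M x - c) 0 = max (a - c) 0 + prim ?g x" by (rule LIMSEQ_unique)
qed

lemma wgt_eq_0: "wgt m d = 0 \<longleftrightarrow> d = 0"
 by (auto simp: wgt_def divide_le_0_iff ennreal_eq_0_iff)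

lemma wterm_cong_AE:
 assumes "AE t in lebesgue. t \<in> {-1<..<1} \<longrightarrow> g t = g' t"
 shows "wterm \<mu> g = wterm \<mu> g'"
 unfolding wterm_def by (rule nn_integral_cong_AE) (use assms in eventually_elim, auto simp: indicator_def)

text \<open>The truncation max \<mu> (1 - gm) is admissible. It does not raise the Dirichlet term,
  which is bounded below through the positive part of \<mu> - (1 - gm), and it loses the weighted
  energy of the set where \<mu> \<le> 1 - gm. By minimality that energy is 0, and the weight
  vanishes only together with the derivative; so \<mu> is its own truncation.\<close>

lemma minimiser_structure:
 assumes gm: "0 < gm" and eps: "0 < eps" and min: "is_minimiser eps gm \<mu> g" and fin: "Eng eps gm \<mu> g < \<infinity>"
 obtains g0 where "L2_unit g0" "prim g0 1 = 0" "!!x. x \<in> {-1..1} ==> \<mu> x = 1 - gm + prim g0 x"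
 "!!x. x \<in> {-1..1} ==> 0 <= prim g0 x" "AE t in lebesgue. t \<in> {-1<..<1} \<longrightarrow> g t = g0 t"
 "wterm \<mu> g = wterm \<mu> g0" "dir_inf gm \<mu> = ennreal (log_energy g0)"
proof -
 have inM: "in_M gm \<mu> g" using min by (simp add: is_minimiser_def)
 then have W: "W12_interval \<mu> g" and mu0: "\<mu> 0 = 1" "\<mu> (-1) <= 1 - gm" "\<mu> 1 <= 1 - gm" by (auto simp: in_M_def)
 obtain g0 where g0: "L2_unit g0" and ae: "AE t in lebesgue. t \<in> {-1<..<1} \<longrightarrow> g t = g0 t"
 and mu: "!!x. x \<in> {-1..1} ==> \<mu> x = \<mu> (-1) + prim g0 x" using W12_intervalE[OF W] by blast
 note [measurable] = L2_unit_measurable[OF g0]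
 have wt: "wterm \<mu> g = wterm \<mu> g0" by (rule wterm_cong_AE[OF ae])
 define c where "c = 1 - gm"
 define M where "M x = \<mu> (-1) + prim g0 x" for x
 have cM: "continuous_on UNIV M" unfolding M_def by (intro continuous_intros continuous_prim g0)
 then have [measurable]: "M \<in> borel_measurable borel" by (rule borel_measurable_continuous_onI)
 define g1 where "g1 t = (if M t > c then g0 t else 0)" for t
 have g1: "L2_unit g1" using prim_positive_part(2)[OF g0 M_def, of 0 c] by (simp add: g1_def[abs_def])
 have pos: "max (\<mu> x - c) 0 = prim g1 x" if "x \<in> {-1..1}" for x
 using prim_positive_part(1)[OF g0 M_def that, of c] mu[OF that] mu0(2) by (simp add: g1_def[abs_def] M_def c_def)
 have p1: "prim g1 1 = 0" using pos[of 1] mu0(3) by (simp add: c_def)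
 define \<nu> where "\<nu> x = c + prim g1 x" for x
 have inM\<nu>: "in_M gm \<nu> g1"
 unfolding in_M_def
 proof (intro conjI)
 show "W12_interval \<nu> g1" by (rule W12_interval_prim[OF g1]) (simp add: \<nu>_def)
 show "\<nu> 0 = 1" using pos[of 0] mu0 gm by (simp add: \<nu>_def c_def)
 show "\<nu> (-1) <= 1 - gm" "\<nu> 1 <= 1 - gm" using p1 prim_lower[OF g1, of "-1"] by (simp_all add: \<nu>_def c_def)
 qed
 have cmu: "continuous_on {-1..1} \<mu>" using W by (simp add: W12_interval_def)
 have Qle: "ennreal (log_energy g1) <= dir_inf gm \<mu>"
 by (rule dir_inf_ge[OF g1 p1 cmu]) (use pos in \<open>auto simp: c_def\<close>)
 have leQ: "dir_inf gm \<nu> <= ennreal (log_energy g1)"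
 by (rule dir_inf_le[OF g1 p1]) (simp add: \<nu>_def c_def)
 let ?f = "%t. indicator {-1<..<1} t * wgt (M t) (g0 t)"
 have fm: "(%t. wgt (M t) (g0 t)) \<in> borel_measurable borel" unfolding wgt_def by measurable
 have mset: "(%t. indicator {t. M t > c} t :: ennreal) \<in> borel_measurable lborel" "(%t. indicator {t. M t <= c} t :: ennreal) \<in> borel_measurable lborel"
 by (simp_all add: borel_measurable_indicator')
 have fM: "?f \<in> borel_measurable lborel"
 using fm by (intro borel_measurable_times_ennreal) simp_all
 have wM: "wterm \<mu> g0 = (\<integral>\<^sup>+t. ?f t \<partial>lborel)"
 unfolding wterm_def nn_integral_completion   proof (rule nn_integral_cong)
 show "indicator {-1<..<1} t * wgt (\<mu> t) (g0 t) = ?f t" for t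
 using mu[of t] by (cases "t \<in> {-1<..<1}") (simp_all add: M_def)
 qed
 define Wp where "Wp = (\<integral>\<^sup>+t. indicator {t. M t > c} t * ?f t \<partial>lborel)"
 define Wm where "Wm = (\<integral>\<^sup>+t. indicator {t. M t <= c} t * ?f t \<partial>lborel)"
 have split: "wterm \<mu> g0 = Wp + Wm"
 proof -
 have "wterm \<mu> g0 = (\<integral>\<^sup>+t. indicator {t. M t > c} t * ?f t + indicator {t. M t <= c} t * ?f t \<partial>lborel)"
 unfolding wM by (rule nn_integral_cong) (auto simp: indicator_def)
 also have "... = Wp + Wm" unfolding Wp_def Wm_def by (rule nn_integral_add) (intro borel_measurable_times_ennreal fM mset)+
 finally show ?thesis .
 qed
 have W\<nu>: "wterm \<nu> g1 = Wp"
 unfolding wterm_def nn_integral_completion Wp_def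
 proof (rule nn_integral_cong)
 fix t :: real
 show "indicator {-1<..<1} t * wgt (\<nu> t) (g1 t) = indicator {t. M t > c} t * ?f t"
 proof (cases "t \<in> {-1<..<1}")
 case True
 then have t: "t \<in> {-1..1}" by auto
 show ?thesis
 proof (cases "M t > c")
 case True
 then have "\<nu> t = M t" using pos[OF t] mu[OF t] by (simp add: \<nu>_def M_def)
 then show ?thesis using True by (simp add: g1_def)
 next
 case False
 then show ?thesis by (simp add: g1_def wgt_eq_0)
 qed
 qed simp
 qed
 have "Eng eps gm \<mu> g <= Eng eps gm \<nu> g1" using min inM\<nu> by (simp add: is_minimiser_def)
 also have "... <= ennreal (eps / 2) * Wp + ennreal (1 / 2) * dir_inf gm \<mu>"
 unfolding Eng_def W\<nu> using leQ Qle by (intro add_left_mono mult_left_mono) auto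
 finally have E0: "Eng eps gm \<mu> g <= ennreal (eps / 2) * Wp + ennreal (1 / 2) * dir_inf gm \<mu>" .
 have "(ennreal (eps / 2) * Wp + ennreal (1 / 2) * dir_inf gm \<mu>) + ennreal (eps / 2) * Wm = Eng eps gm \<mu> g"
 unfolding Eng_def wt split distrib_left by (simp only: add_ac)
 with E0 have E: "(ennreal (eps / 2) * Wp + ennreal (1 / 2) * dir_inf gm \<mu>) + ennreal (eps / 2) * Wm <= (ennreal (eps / 2) * Wp + ennreal (1 / 2) * dir_inf gm \<mu>) + 0"
 by (simp only: add_0_right)
 have "ennreal (eps / 2) * Wp + ennreal (1 / 2) * dir_inf gm \<mu> <= Eng eps gm \<mu> g"
 unfolding Eng_def wt split by (intro add_right_mono mult_left_mono) auto
 then have "ennreal (eps / 2) * Wp + ennreal (1 / 2) * dir_inf gm \<mu> < \<infinity>" using fin by (rule le_less_trans)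
 \<comment> \<open>Cancelling a common summand in \<open>ennreal\<close> requires it to be finite;
   this is what finiteness of \<open>Eng\<close> supplies.\<close>
 then have "ennreal (eps / 2) * Wm <= 0" using E by (subst (asm) ennreal_add_left_cancel_le) auto
 then have "Wm = 0" using eps by (auto simp: ennreal_eq_0_iff)
 then have "AE t in lborel. indicator {t. M t <= c} t * ?f t = 0"
 unfolding Wm_def using nn_integral_0_iff_AE[OF borel_measurable_times_ennreal[OF mset(2) fM]] by simp
 then have ae1: "AE t in lborel. g0 t = g1 t"
 proof eventually_elim
 case (elim t)
 show ?case
 proof (cases "t \<in> {-1<..<1} \<and> M t <= c")
 case True then show ?thesis using elim by (simp add: wgt_eq_0 g1_def)
 next
 case False then show ?thesis using L2_unit_zero[OF g0, of t] by (auto simp: g1_def)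
 qed
 qed
 have peq: "prim g0 x = prim g1 x" for x
 unfolding prim_def using L2_unit_measurable[OF g1]
 by (intro integral_cong_AE) (use ae1 in \<open>auto elim: eventually_mono\<close>)
 \<comment> \<open>The primitives of the two densities agree, and at 0 both \<mu> and its truncation
   equal 1; this fixes the constant of integration.\<close>
 have "\<mu> (-1) = c" using mu[of 0] pos[of 0] mu0 gm peq[of 0] by (simp add: c_def)
 then have mu': "\<mu> x = 1 - gm + prim g0 x" if "x \<in> {-1..1}" for x using mu[OF that] by (simp add: c_def)
 have pn: "0 <= prim g0 x" if "x \<in> {-1..1}" for x using pos[OF that] peq by (metis max.cobounded2)
 have p0: "prim g0 1 = 0" using p1 peq by simp
 have "dir_inf gm \<mu> = ennreal (log_energy g0)"
 proof (rule antisym)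
 show "dir_inf gm \<mu> <= ennreal (log_energy g0)" by (rule dir_inf_le[OF g0 p0 mu'])
 show "ennreal (log_energy g0) <= dir_inf gm \<mu>"
 by (rule dir_inf_ge[OF g0 p0 cmu]) (use mu' pn in auto)
 qed
 then show thesis using that g0 p0 mu' pn ae wt by blast
qed

section \<open>Moments, dilations and the first variation\<close>

definition moment :: "(real => real) => nat => real" where
 "moment g k = (\<integral>t. g t * t ^ k \<partial>lborel)"

lemma abs_moment_le:
 assumes g: "L2_unit g"
 shows "\<bar>moment g k\<bar> <= L1n g"
proof -
 have i: "integrable lborel (%t. g t *\<^sub>R t ^ k)"
 by (rule integrable_L2_unit_continuous[OF g]) (intro continuous_intros)
 have "norm (\<integral>t. g t *\<^sub>R t ^ k \<partial>lborel) <= 1 * L1n g"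
 by (rule norm_integral_L2_unit_le[OF g i]) (auto simp: power_abs abs_le_iff intro!: power_le_one)
 then show ?thesis by (simp add: moment_def)
qed

lemma ln_one_minus_sums:
 assumes "\<bar>y\<bar> < (1::real)"
 shows "(%k. y ^ Suc k / real (Suc k)) sums (- ln (1 - y))"
proof -
 have "(%n. - ((- (- y)) ^ n) / of_nat n) sums ln (1 + - y)"
 by (rule ln_series') (use assms in simp)
 from sums_minus[OF this] have "(%n. y ^ n / real n) sums - ln (1 - y)" by simp
 then show ?thesis by (subst sums_Suc_iff) simp
qed

lemma ln_one_minus_partial_sum:
 assumes "0 <= y" "y < (1::real)"
 shows "(\<Sum>k<n. y ^ Suc k / real (Suc k)) <= - ln (1 - y)"
proof -
 have s: "(%k. y ^ Suc k / real (Suc k)) sums (- ln (1 - y))" using assms by (intro ln_one_minus_sums) simp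
 have "(\<Sum>k<n. y ^ Suc k / real (Suc k)) <= (\<Sum>k. y ^ Suc k / real (Suc k))"
 by (rule sum_le_suminf[OF sums_summable[OF s] finite_lessThan]) (use assms in auto)
 then show ?thesis unfolding sums_unique[OF s, symmetric] .
qed

text \<open>The image part of the kernel integrated against g. The original density has a = 1; after
  dilation by r the same integral appears with a = r^2.\<close>

definition log_image :: "(real => real) => real => real => real" where
 "log_image g a x = (\<integral>t. g t * ln (1 - a * t * x) \<partial>lborel)"

lemma log_image_sums:
 assumes g: "L2_unit g" and a: "0 <= a" "a <= 1" and x: "\<bar>x\<bar> < 1"
 shows "(%k. a ^ Suc k * moment g (Suc k) * x ^ Suc k / real (Suc k)) sums (- log_image g a x)"
proof -
 have ax: "\<bar>a * t * x\<bar> <= \<bar>x\<bar>" if "\<bar>t\<bar> < 1" for t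
 proof -
 have "a * \<bar>t\<bar> <= 1 * 1" using a that by (intro mult_mono) auto
 then have "a * \<bar>t\<bar> * \<bar>x\<bar> <= 1 * \<bar>x\<bar>" by (intro mult_right_mono) auto
 then show ?thesis using a by (simp add: abs_mult)
 qed
 have zero: "g t = 0" if "\<not> \<bar>t\<bar> < 1" for t by (rule L2_unit_zero[OF g]) (use that in auto)
 have i: "integrable lborel (%t. g t * (c * t ^ k))" for c k
 using integrable_L2_unit_continuous[OF g, of "%t. c * t ^ k"] by (simp add: continuous_intros)
 note [measurable] = L2_unit_measurable[OF g]
 have "(%n. \<integral>t. g t * (\<Sum>k<n. (a * t * x) ^ Suc k / real (Suc k)) \<partial>lborel) ---> (\<integral>t. g t * (- ln (1 - a * t * x)) \<partial>lborel)"
 proof (rule integral_dominated_convergence[where w="%t. \<bar>g t\<bar> * (- ln (1 - \<bar>x\<bar>))"])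
 show "AE t in lborel. (%n. g t * (\<Sum>k<n. (a * t * x) ^ Suc k / real (Suc k))) ---> g t * (- ln (1 - a * t * x))"
 proof (rule AE_I2)
 fix t
 show "(%n. g t * (\<Sum>k<n. (a * t * x) ^ Suc k / real (Suc k))) ---> g t * (- ln (1 - a * t * x))"
 proof (cases "\<bar>t\<bar> < 1")
 case True
 then have "\<bar>a * t * x\<bar> < 1" using ax[OF True] x by linarith
 from ln_one_minus_sums[OF this] show ?thesis unfolding sums_def by (rule tendsto_mult_left)
 qed (simp add: zero)
 qed
 show "AE t in lborel. norm (g t * (\<Sum>k<n. (a * t * x) ^ Suc k / real (Suc k))) <= \<bar>g t\<bar> * (- ln (1 - \<bar>x\<bar>))" for n
 proof (rule AE_I2)
 fix t
 show "norm (g t * (\<Sum>k<n. (a * t * x) ^ Suc k / real (Suc k))) <= \<bar>g t\<bar> * (- ln (1 - \<bar>x\<bar>))"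
 proof (cases "\<bar>t\<bar> < 1")
 case True
 have "norm (\<Sum>k<n. (a * t * x) ^ Suc k / real (Suc k)) <= (\<Sum>k<n. \<bar>x\<bar> ^ Suc k / real (Suc k))"
 proof (rule order_trans[OF norm_sum], rule sum_mono)
 fix k
 have "\<bar>a * t * x\<bar> ^ Suc k <= \<bar>x\<bar> ^ Suc k" by (intro power_mono ax[OF True]) auto
 then show "norm ((a * t * x) ^ Suc k / real (Suc k)) <= \<bar>x\<bar> ^ Suc k / real (Suc k)"
 unfolding real_norm_def abs_divide power_abs abs_of_nat by (intro divide_right_mono) auto
 qed
 also have "... <= - ln (1 - \<bar>x\<bar>)"
 by (rule ln_one_minus_partial_sum) (use x in auto)
 finally have "\<bar>g t\<bar> * norm (\<Sum>k<n. (a * t * x) ^ Suc k / real (Suc k)) <= \<bar>g t\<bar> * (- ln (1 - \<bar>x\<bar>))"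
 by (rule mult_left_mono) simp
 then show ?thesis unfolding real_norm_def abs_mult[of "g t"] .
 qed (simp add: zero)
 qed
 qed (use L2_unit_integrable[OF g] in auto)
 moreover have "(\<integral>t. g t * (\<Sum>k<n. (a * t * x) ^ Suc k / real (Suc k)) \<partial>lborel) = (\<Sum>k<n. a ^ Suc k * moment g (Suc k) * x ^ Suc k / real (Suc k))" for n
 proof -
 have "(\<integral>t. g t * (\<Sum>k<n. (a * t * x) ^ Suc k / real (Suc k)) \<partial>lborel) = (\<integral>t. (\<Sum>k<n. g t * ((a ^ Suc k * x ^ Suc k / real (Suc k)) * t ^ Suc k)) \<partial>lborel)"
 by (intro Bochner_Integration.integral_cong refl) (simp add: sum_distrib_left power_mult_distrib field_simps)
 also have "... = (\<Sum>k<n. \<integral>t. g t * ((a ^ Suc k * x ^ Suc k / real (Suc k)) * t ^ Suc k) \<partial>lborel)"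
 by (rule Bochner_Integration.integral_sum) (rule i)
 also have "... = (\<Sum>k<n. a ^ Suc k * moment g (Suc k) * x ^ Suc k / real (Suc k))"
 proof (rule sum.cong[OF refl])
 fix k
 have "(\<integral>t. g t * ((a ^ Suc k * x ^ Suc k / real (Suc k)) * t ^ Suc k) \<partial>lborel) = (\<integral>t. (a ^ Suc k * x ^ Suc k / real (Suc k)) * (g t * t ^ Suc k) \<partial>lborel)"
 by (simp only: mult_ac)
 also have "... = (a ^ Suc k * x ^ Suc k / real (Suc k)) * moment g (Suc k)" unfolding moment_def by (rule integral_mult_right_zero)
 finally show "(\<integral>t. g t * ((a ^ Suc k * x ^ Suc k / real (Suc k)) * t ^ Suc k) \<partial>lborel) = a ^ Suc k * moment g (Suc k) * x ^ Suc k / real (Suc k)" by simp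
 qed
 finally show ?thesis .
 qed
 ultimately show ?thesis by (simp add: sums_def log_image_def)
qed

definition dilate :: "real => (real => real) => real => real" where
 "dilate r g x = g (x / r) / r"

lemma dilate_integral:
 assumes "r > 0"
 shows "(\<integral>x. dilate r g x * k x \<partial>lborel) = (\<integral>t. g t * k (r * t) \<partial>lborel)"
proof -
 have "(\<integral>x. dilate r g x * k x \<partial>lborel) = \<bar>r\<bar> *\<^sub>R (\<integral>t. dilate r g (0 + r * t) * k (0 + r * t) \<partial>lborel)"
 using assms by (intro lborel_integral_real_affine) auto
 also have "... = (\<integral>t. r * (dilate r g (r * t) * k (r * t)) \<partial>lborel)" using assms by simp
 also have "... = (\<integral>t. g t * k (r * t) \<partial>lborel)" using assms by (simp add: dilate_def)
 finally show ?thesis .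
qed

lemma L2_unit_dilate:
 assumes g: "L2_unit g" and l: "0 < r" "r < 1"
 shows "L2_unit (dilate r g)" "prim (dilate r g) x = prim g (x / r)"
proof -
 note [measurable] = L2_unit_measurable[OF g]
 show "L2_unit (dilate r g)"
 unfolding L2_unit_def
 proof (intro conjI allI impI)
 show "dilate r g \<in> borel_measurable borel" unfolding dilate_def[abs_def] by measurable
 show "dilate r g x = 0" if "x \<notin> {-1<..<1}" for x
 proof -
 have "1 <= \<bar>x / r\<bar>" using that l by (auto simp: abs_divide pos_le_divide_eq)
 then have "x / r \<notin> {-1<..<1}" by auto
 then show ?thesis using L2_unit_zero[OF g] by (simp add: dilate_def)
 qed
 have "integrable lborel (%x. (g (0 + (1 / r) * x))^2)"
 using lborel_integrable_real_affine[OF L2_unit_sq[OF g], of "1 / r" 0] l by simp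
 then show "integrable lborel (%x. (dilate r g x)^2)" by (simp add: dilate_def power_divide)
 qed
 have "prim (dilate r g) x = (\<integral>t. g t * indicator {..x} (r * t) \<partial>lborel)"
 unfolding prim_def using dilate_integral[OF l(1), of g "indicator {..x}"] by (simp add: mult.commute)
 also have "... = prim g (x / r)" unfolding prim_def
 using l by (intro Bochner_Integration.integral_cong) (auto simp: indicator_def field_simps)
 finally show "prim (dilate r g) x = prim g (x / r)" .
qed

lemma integrable_log_image:
 assumes g: "L2_unit g" and a: "0 <= a" "a <= 1" and x: "\<bar>x\<bar> < 1"
 shows "integrable lborel (%t. g t * ln (1 - a * t * x))" "\<bar>log_image g a x\<bar> <= L1n g * (- ln (1 - \<bar>x\<bar>))"
proof -
 note [measurable] = L2_unit_measurable[OF g]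
 have b: "\<bar>g t * ln (1 - a * t * x)\<bar> <= (- ln (1 - \<bar>x\<bar>)) * \<bar>g t\<bar>" for t
 proof (cases "t \<in> {-1<..<1}")
 case True
 have "a * \<bar>t\<bar> <= 1 * 1" using a True by (intro mult_mono) auto
 then have "a * \<bar>t\<bar> * \<bar>x\<bar> <= 1 * \<bar>x\<bar>" by (intro mult_right_mono) auto
 then have ax: "\<bar>a * t * x\<bar> <= \<bar>x\<bar>" using a by (simp add: abs_mult)
 have l1: "ln (1 - \<bar>x\<bar>) <= ln (1 - a * t * x)" using ax x by (subst ln_le_cancel_iff) auto
 have "ln (1 - a * t * x) <= ln (1 + \<bar>x\<bar>)" using ax x by (subst ln_le_cancel_iff) auto
 also have "... <= - ln (1 - \<bar>x\<bar>)"
 proof -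
 have "ln (1 + \<bar>x\<bar>) + ln (1 - \<bar>x\<bar>) = ln ((1 + \<bar>x\<bar>) * (1 - \<bar>x\<bar>))" using x by (subst ln_mult) auto
 also have "(1 + \<bar>x\<bar>) * (1 - \<bar>x\<bar>) = 1 - x^2" by (simp add: algebra_simps power2_eq_square)
 also have "ln (1 - x^2) <= ln 1" using x by (subst ln_le_cancel_iff) (auto simp: abs_square_less_1)
 finally show ?thesis by simp
 qed
 finally have "\<bar>ln (1 - a * t * x)\<bar> <= - ln (1 - \<bar>x\<bar>)" using l1 by simp
 from mult_left_mono[OF this abs_ge_zero[of "g t"]] show ?thesis by (simp add: abs_mult mult.commute)
 qed (use L2_unit_zero[OF g, of t] in simp)
 have iw: "integrable lborel (%t. (- ln (1 - \<bar>x\<bar>)) * \<bar>g t\<bar>)" using L2_unit_integrable[OF g] by simp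
 show i: "integrable lborel (%t. g t * ln (1 - a * t * x))"
 proof (rule Bochner_Integration.integrable_bound[OF iw])
 show "AE t in lborel. norm (g t * ln (1 - a * t * x)) <= norm ((- ln (1 - \<bar>x\<bar>)) * \<bar>g t\<bar>)"
 using b by (intro AE_I2) (metis abs_ge_self order_trans real_norm_def)
 qed simp
 have "\<bar>log_image g a x\<bar> <= (\<integral>t. norm (g t * ln (1 - a * t * x)) \<partial>lborel)"
 unfolding log_image_def using integral_norm_bound[of lborel "%t. g t * ln (1 - a * t * x)"] by simp
 also have "... <= (\<integral>t. (- ln (1 - \<bar>x\<bar>)) * \<bar>g t\<bar> \<partial>lborel)"
 using b by (intro integral_mono integrable_norm i iw) auto
 finally show "\<bar>log_image g a x\<bar> <= L1n g * (- ln (1 - \<bar>x\<bar>))" by (simp add: mult.commute)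
qed

text \<open>Dilation changes the direct logarithm by the constant ln r, which a density of mass 0
  does not see. Only the image term reacts to the size of the half disc.\<close>

lemma flat_pot_dilate:
 assumes g: "L2_unit g" "prim g 1 = 0" and l: "0 < r" "r < 1" and x: "\<bar>x\<bar> < 1"
 shows "flat_pot (dilate r g) (r * x) = flat_pot g x + (log_image g 1 x - log_image g (r^2) x) / pi"
proof -
 note [measurable] = L2_unit_measurable[OF g(1)]
 have g0: "(\<integral>t. g t \<partial>lborel) = 0" using g prim_upper[OF g(1), of 1] by simp
 have l2: "0 <= r^2" "r^2 <= 1" using l by (auto intro: power_le_one)
 have i1: "integrable lborel (%t. g t * flat_ker t x)" by (rule integrable_flat_ker[OF g(1), of "1/2"]) (use x in auto)
 have i2: "integrable lborel (%t. g t * ln (1 - r^2 * t * x))" by (rule integrable_log_image[OF g(1) l2 x])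
 have i3: "integrable lborel (%t. g t * ln (1 - 1 * t * x))" by (rule integrable_log_image[OF g(1) _ _ x]) auto
 have i0: "integrable lborel g" by (rule L2_unit_integrable[OF g(1)])
 have "(\<integral>t. dilate r g t * flat_ker t (r * x) \<partial>lborel) = (\<integral>t. g t * flat_ker (r * t) (r * x) \<partial>lborel)"
 by (rule dilate_integral[OF l(1)])
 also have "... = (\<integral>t. g t * ln r + (g t * flat_ker t x + (g t * ln (1 - r^2 * t * x) - g t * ln (1 - 1 * t * x))) \<partial>lborel)"
 proof (rule integral_cong_AE)
 show "AE t in lborel. g t * flat_ker (r * t) (r * x) = g t * ln r + (g t * flat_ker t x + (g t * ln (1 - r^2 * t * x) - g t * ln (1 - 1 * t * x)))"
 using AE_lborel_singleton[of x]
 proof eventually_elim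
 case (elim t)
 have "ln \<bar>r * x - r * t\<bar> = ln r + ln \<bar>x - t\<bar>"
 proof -
 have "\<bar>r * x - r * t\<bar> = r * \<bar>x - t\<bar>" using l by (simp add: abs_mult flip: right_diff_distrib)
 then show ?thesis using l elim by (simp add: ln_mult)
 qed
 then show ?case by (simp add: flat_ker_def algebra_simps power2_eq_square)
 qed
 qed (unfold flat_ker_def, measurable)
 also have "... = ln r * (\<integral>t. g t \<partial>lborel) + ((\<integral>t. g t * flat_ker t x \<partial>lborel) + (log_image g (r^2) x - log_image g 1 x))"
 unfolding log_image_def using i0 i1 i2 i3 by simp
 finally have "(\<integral>t. dilate r g t * flat_ker t (r * x) \<partial>lborel) = (\<integral>t. g t * flat_ker t x \<partial>lborel) + (log_image g (r^2) x - log_image g 1 x)"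
 using g0 by simp
 then show ?thesis by (simp add: flat_pot_def diff_divide_distrib add_divide_distrib)
qed

text \<open>The fourth root once more: for s = 1 - |x|, -ln s \<le> 4 s^(-1/4), and the square of
  s^(-1/4) is integrable at both ends.\<close>

lemma integrable_L2_unit_log:
 assumes g: "L2_unit g"
 shows "integrable lborel (%x. g x * (- ln (1 - \<bar>x\<bar>)))"
proof -
 note [measurable] = L2_unit_measurable[OF g]
 have iS: "integrable lborel (%x. inv_sqrt2 (1 + (-1) * x))" "integrable lborel (%x. inv_sqrt2 (1 + 1 * x))"
 using lborel_integrable_real_affine[OF integrable_inv_sqrt2, of "-1" 1] lborel_integrable_real_affine[OF integrable_inv_sqrt2, of 1 1] by simp_all
 have iw: "integrable lborel (%x. 4 * ((g x)^2 + (inv_sqrt2 (1 + (-1) * x) + inv_sqrt2 (1 + 1 * x))))"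
 by (intro integrable_mult_right Bochner_Integration.integrable_add L2_unit_sq[OF g] iS)
 show ?thesis
 proof (rule Bochner_Integration.integrable_bound[OF iw])
 show "AE x in lborel. norm (g x * (- ln (1 - \<bar>x\<bar>))) <= norm (4 * ((g x)^2 + (inv_sqrt2 (1 + (-1) * x) + inv_sqrt2 (1 + 1 * x))))"
 proof (rule AE_I2)
 fix x
 have nn: "0 <= inv_sqrt2 s" for s by (simp add: inv_sqrt2_def)
 show "norm (g x * (- ln (1 - \<bar>x\<bar>))) <= norm (4 * ((g x)^2 + (inv_sqrt2 (1 + (-1) * x) + inv_sqrt2 (1 + 1 * x))))"
 proof (cases "x \<in> {-1<..<1}")
 case True
 define s where "s = 1 - \<bar>x\<bar>"
 have s: "0 < s" "s <= 1" using True by (auto simp: s_def)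
 define v where "v = rq s"
 have v: "0 < v" "v ^ 4 = s"
 proof -
 show "0 < v" unfolding v_def by (rule rq_pos[OF s(1)])
 have "v^2 = sqrt s" using s by (simp add: v_def rq_def)
 then have "(v^2)^2 = s" using s by simp
 then show "v ^ 4 = s" by (simp flip: power_mult)
 qed
 have "- ln s = 4 * ln (1 / v)" unfolding v(2)[symmetric] using v(1) by (simp add: ln_realpow ln_div)
 also have "... <= 4 * (1 / v)" by (intro mult_left_mono less_imp_le[OF ln_less_self]) (use v(1) in auto)
 finally have l1: "- ln s <= 4 * (1 / v)" .
 have "\<bar>- ln s\<bar> <= 4 * (1 / v)" using l1 s by simp
 then have "\<bar>g x\<bar> * \<bar>- ln s\<bar> <= \<bar>g x\<bar> * (4 * (1 / v))" by (rule mult_left_mono) simp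
 also have "... <= 4 * ((g x)^2 + (1 / v)^2)"
 proof -
 have "0 <= (\<bar>g x\<bar> - 1 / v)^2" by simp
 also have "... = (g x)^2 + (1 / v)^2 - 2 * (\<bar>g x\<bar> * (1 / v))" by (simp add: power2_diff)
 finally have "2 * (\<bar>g x\<bar> * (1 / v)) <= (g x)^2 + (1 / v)^2" by simp
 moreover have "0 <= \<bar>g x\<bar> * (1 / v)" using v(1) by simp
 ultimately show ?thesis by simp
 qed
 also have "(1 / v)^2 = inv_sqrt2 s" using s by (simp add: v_def rq_def power_divide inv_sqrt2_def)
 also have "inv_sqrt2 s <= inv_sqrt2 (1 + (-1) * x) + inv_sqrt2 (1 + 1 * x)"
 using nn[of "1 + (-1) * x"] nn[of "1 + 1 * x"] by (cases "x \<ge> 0") (auto simp: s_def)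
 finally have "\<bar>g x\<bar> * \<bar>- ln s\<bar> <= 4 * ((g x)^2 + (inv_sqrt2 (1 + (-1) * x) + inv_sqrt2 (1 + 1 * x)))" by simp
 then show ?thesis unfolding s_def[symmetric] by (simp add: abs_mult)
 qed (use L2_unit_zero[OF g, of x] in simp)
 qed
 qed simp
qed

text \<open>Only a difference of image terms survives. Its power series has the moments as
  coefficients, and the second pairing with g squares them. The partial sums are dominated by a
  multiple of -ln (1 - |x|), which is integrable against |g|.\<close>

lemma log_energy_dilate_sums:
 assumes g: "L2_unit g" "prim g 1 = 0" and l: "0 < r" "r < 1"
 shows "(%k. (1 - (r^2) ^ Suc k) * (moment g (Suc k))^2 / real (Suc k)) sums (pi * (log_energy g - log_energy (dilate r g)))"
proof -
 note [measurable] = L2_unit_measurable[OF g(1)]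
 have l2: "0 <= r^2" "r^2 <= 1" using l by (auto intro: power_le_one)
 let ?b = "%k. (1 - (r^2) ^ Suc k) * moment g (Suc k) / real (Suc k)"
 let ?e = "%x. log_image g (r^2) x - log_image g 1 x"
 have S: "(%k. ?b k * x ^ Suc k) sums ?e x" if "\<bar>x\<bar> < 1" for x
 proof -
 have "(%k. 1 ^ Suc k * moment g (Suc k) * x ^ Suc k / real (Suc k) - (r^2) ^ Suc k * moment g (Suc k) * x ^ Suc k / real (Suc k)) sums (- log_image g 1 x - (- log_image g (r^2) x))"
 by (intro sums_diff log_image_sums g that l2) auto
 moreover have "1 ^ Suc k * moment g (Suc k) * x ^ Suc k / real (Suc k) - (r^2) ^ Suc k * moment g (Suc k) * x ^ Suc k / real (Suc k) = ?b k * x ^ Suc k" for k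
 by (simp only: power_one left_diff_distrib diff_divide_distrib mult_1_left times_divide_eq_left)
 ultimately show ?thesis by simp
 qed
 have D: "(\<integral>t. dilate r g t * flat_pot (dilate r g) t \<partial>lborel) = (\<integral>x. g x * flat_pot (dilate r g) (r * x) \<partial>lborel)"
 by (rule dilate_integral[OF l(1)])
 have i0: "integrable lborel (%t. g t * (c * t ^ k))" for c k
 using integrable_L2_unit_continuous[OF g(1), of "%t. c * t ^ k"] by (simp add: continuous_intros)
 let ?N = "L1n g"
 have N0: "0 <= ?N" by (rule Bochner_Integration.integral_nonneg) simp
 have lim: "(%n. \<integral>x. g x * (\<Sum>k<n. ?b k * x ^ Suc k) \<partial>lborel) ---> (\<integral>x. g x * (if \<bar>x\<bar> < 1 then ?e x else 0) \<partial>lborel)"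
 and ie: "integrable lborel (%x. g x * (if \<bar>x\<bar> < 1 then ?e x else 0))"
 proof -
 have ptw: "(%n. g x * (\<Sum>k<n. ?b k * x ^ Suc k)) ---> g x * (if \<bar>x\<bar> < 1 then ?e x else 0)" for x
 proof (cases "\<bar>x\<bar> < 1")
 case True
 then show ?thesis using tendsto_mult_left[OF S[OF True, unfolded sums_def], of "g x"] by simp
 next
 case False
 then have "g x = 0" by (intro L2_unit_zero[OF g(1)]) auto
 then show ?thesis by simp
 qed
 have meas: "(%x. g x * (\<Sum>k<n. ?b k * x ^ Suc k)) \<in> borel_measurable lborel" for n by measurable
 have bnd: "norm (g x * (\<Sum>k<n. ?b k * x ^ Suc k)) <= ?N * \<bar>g x * (- ln (1 - \<bar>x\<bar>))\<bar>" for n x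
 proof (cases "\<bar>x\<bar> < 1")
 case True
 have "norm (\<Sum>k<n. ?b k * x ^ Suc k) <= (\<Sum>k<n. ?N * (\<bar>x\<bar> ^ Suc k / real (Suc k)))"
 proof (rule order_trans[OF norm_sum], rule sum_mono)
 fix k
 have p: "0 <= 1 - (r^2) ^ Suc k" "1 - (r^2) ^ Suc k <= 1" using l2 power_le_one[of "r^2" "Suc k"] zero_le_power[of "r^2" "Suc k"] by linarith+
 have "\<bar>(1 - (r^2) ^ Suc k) * moment g (Suc k)\<bar> <= 1 * ?N"
 unfolding abs_mult using p abs_moment_le[OF g(1), of "Suc k"] by (intro mult_mono) auto
 then have "\<bar>(1 - (r^2) ^ Suc k) * moment g (Suc k)\<bar> * (\<bar>x\<bar> ^ Suc k / real (Suc k)) <= ?N * (\<bar>x\<bar> ^ Suc k / real (Suc k))"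
 by (intro mult_right_mono) auto
 then show "norm (?b k * x ^ Suc k) <= ?N * (\<bar>x\<bar> ^ Suc k / real (Suc k))" by (simp add: abs_mult power_abs)
 qed
 also have "... = ?N * (\<Sum>k<n. \<bar>x\<bar> ^ Suc k / real (Suc k))" by (simp only: sum_distrib_left)
 also have "... <= ?N * (- ln (1 - \<bar>x\<bar>))"
 using True by (intro mult_left_mono[OF _ N0] ln_one_minus_partial_sum) auto
 finally have "\<bar>g x\<bar> * norm (\<Sum>k<n. ?b k * x ^ Suc k) <= \<bar>g x\<bar> * (?N * (- ln (1 - \<bar>x\<bar>)))" by (rule mult_left_mono) simp
 also have "... <= ?N * \<bar>g x * (- ln (1 - \<bar>x\<bar>))\<bar>"
 proof -
 have "\<bar>g x\<bar> * (- ln (1 - \<bar>x\<bar>)) <= \<bar>g x * (- ln (1 - \<bar>x\<bar>))\<bar>" unfolding abs_mult by (intro mult_left_mono abs_ge_self) auto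
 from mult_left_mono[OF this N0] show ?thesis by (simp only: mult.left_commute)
 qed
 finally show ?thesis unfolding real_norm_def abs_mult[of "g x" "sum _ _"] .
 next
 case False
 then have "g x = 0" by (intro L2_unit_zero[OF g(1)]) auto
 then show ?thesis by simp
 qed
 have iw: "integrable lborel (%x. ?N * \<bar>g x * (- ln (1 - \<bar>x\<bar>))\<bar>)" using integrable_L2_unit_log[OF g(1)] by simp
 have em: "(%x. g x * (if \<bar>x\<bar> < 1 then ?e x else 0)) \<in> borel_measurable lborel"
 by (rule borel_measurable_LIMSEQ_real[OF ptw meas])
 show "(%n. \<integral>x. g x * (\<Sum>k<n. ?b k * x ^ Suc k) \<partial>lborel) ---> (\<integral>x. g x * (if \<bar>x\<bar> < 1 then ?e x else 0) \<partial>lborel)"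
 by (rule integral_dominated_convergence[OF em meas iw AE_I2[OF ptw] AE_I2[OF bnd]])
 show "integrable lborel (%x. g x * (if \<bar>x\<bar> < 1 then ?e x else 0))"
 by (rule integrable_dominated_convergence[OF em meas iw AE_I2[OF ptw] AE_I2[OF bnd]])
 qed
 have sumeq: "(\<integral>x. g x * (\<Sum>k<n. ?b k * x ^ Suc k) \<partial>lborel) = (\<Sum>k<n. (1 - (r^2) ^ Suc k) * (moment g (Suc k))^2 / real (Suc k))" for n
 proof -
 have "(\<integral>x. g x * (\<Sum>k<n. ?b k * x ^ Suc k) \<partial>lborel) = (\<Sum>k<n. \<integral>x. g x * (?b k * x ^ Suc k) \<partial>lborel)"
 unfolding sum_distrib_left by (rule Bochner_Integration.integral_sum) (rule i0)
 also have "... = (\<Sum>k<n. ?b k * moment g (Suc k))"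
 unfolding moment_def mult.left_commute[of "g _"] by (simp only: integral_mult_right_zero)
 finally show ?thesis by (simp add: power2_eq_square mult.assoc)
 qed
 have "log_energy (dilate r g) = (\<integral>x. g x * flat_pot g x - (1 / pi) * (g x * (if \<bar>x\<bar> < 1 then ?e x else 0)) \<partial>lborel)"
 unfolding log_energy_def D
 proof (rule Bochner_Integration.integral_cong[OF refl])
 fix x
 show "g x * flat_pot (dilate r g) (r * x) = g x * flat_pot g x - (1 / pi) * (g x * (if \<bar>x\<bar> < 1 then ?e x else 0))"
 proof (cases "\<bar>x\<bar> < 1")
 case True
 then show ?thesis by (simp add: flat_pot_dilate[OF g l True] field_simps)
 next
 case False
 then have "g x = 0" by (intro L2_unit_zero[OF g(1)]) auto
 then show ?thesis by simp
 qed
 qed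
 also have "... = log_energy g - (1 / pi) * (\<integral>x. g x * (if \<bar>x\<bar> < 1 then ?e x else 0) \<partial>lborel)"
 unfolding log_energy_def using flat_pot_measurable(1)[OF g(1)] ie by simp
 finally have "pi * (log_energy g - log_energy (dilate r g)) = (\<integral>x. g x * (if \<bar>x\<bar> < 1 then ?e x else 0) \<partial>lborel)" by (simp add: field_simps)
 then show ?thesis using lim unfolding sumeq sums_def by simp
qed

text \<open>The squared derivative contributes the factor 1/r^2 and the change of variables the
  factor r.\<close>

lemma wterm_dilate_le:
 assumes g: "L2_unit g" and r: "0 < r" "r < 1" and mu: "!!x. x \<in> {-1..1} ==> \<mu> x = a + prim g x"
 shows "wterm (%x. a + prim g (x / r)) (dilate r g) <= ennreal (1 / r) * wterm \<mu> g"
proof -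
 note [measurable] = L2_unit_measurable[OF g] borel_measurable_continuous_onI[OF continuous_prim[OF g]]
 define F where "F t = wgt (a + prim g t) (g t)" for t
 have F[measurable]: "F \<in> borel_measurable borel" unfolding F_def[abs_def] wgt_def by measurable
 have "wterm (%x. a + prim g (x / r)) (dilate r g) <= (\<integral>\<^sup>+x. ennreal (1 / r^2) * F (x / r) \<partial>lebesgue)"
 unfolding wterm_def
 proof (rule nn_integral_mono)
 fix x
 have "wgt (a + prim g (x / r)) (dilate r g x) <= ennreal (1 / r^2) * F (x / r)"
 using r by (auto simp: wgt_def F_def dilate_def power_divide ennreal_mult_top field_simps abs_square_less_1 simp flip: ennreal_mult')
 then show "indicator {-1<..<1} x * wgt (a + prim g (x / r)) (dilate r g x) <= ennreal (1 / r^2) * F (x / r)"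
 by (auto simp: indicator_def)
 qed
 also have "... = ennreal (1 / r^2) * (\<integral>\<^sup>+x. F (x / r) \<partial>lborel)"
 by (simp add: nn_integral_completion nn_integral_cmult)
 also have "(\<integral>\<^sup>+x. F (x / r) \<partial>lborel) = ennreal r * (\<integral>\<^sup>+x. F x \<partial>lborel)"
 using nn_integral_real_affine[of "%x. F (x / r)" r 0] r by simp
 also have "(\<integral>\<^sup>+x. F x \<partial>lborel) = wterm \<mu> g"
 unfolding wterm_def nn_integral_completion
 by (intro nn_integral_cong) (auto simp: indicator_def F_def mu L2_unit_zero[OF g] wgt_def)
 also have "ennreal (1 / r^2) * (ennreal r * wterm \<mu> g) = ennreal (1 / r^2 * r) * wterm \<mu> g"
 unfolding mult.assoc[symmetric] using r by (subst ennreal_mult) auto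
 also have "1 / r^2 * r = 1 / r" using r by (simp add: power2_eq_square)
 finally show ?thesis .
qed

text \<open>Passing to \<mu>(x/r) with r < 1 multiplies the weighted term by at most 1/r and lowers
  the logarithmic energy by the moment series. Dividing by 1 - r and letting r tend to 1 turns 1 -
  r^(2k) into 2k, which cancels the 1/k of the series. Stretching with r > 1 could violate the end
  conditions, so minimality gives an inequality, in the direction that is needed.\<close>

lemma minimiser_moment_bound:
 assumes min: "is_minimiser eps gm \<mu> g" and eps: "0 < eps" and g0: "L2_unit g0" "prim g0 1 = 0"
 and mu: "!!x. x \<in> {-1..1} ==> \<mu> x = 1 - gm + prim g0 x"
 and W: "wterm \<mu> g = wterm \<mu> g0" "wterm \<mu> g0 = ennreal W" "0 <= W" and D: "dir_inf gm \<mu> = ennreal (log_energy g0)"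
 shows "(2 / pi) * (\<Sum>k<K. (moment g0 (Suc k))^2) <= eps * W"
proof -
 have mu0: "\<mu> 0 = 1" using min by (simp add: is_minimiser_def in_M_def)
 have step: "(\<Sum>k<K. (\<Sum>i<2 * Suc k. r ^ i) * (moment g0 (Suc k))^2 / real (Suc k)) <= pi * (eps * W) / r"
 if r: "0 < r" "r < 1" for r
 proof -
 let ?g = "dilate r g0" and ?nu = "%x. 1 - gm + prim g0 (x / r)"
 note gd = L2_unit_dilate[OF g0(1) r]
 have "(\<integral>t. g0 t \<partial>lborel) = 0" using prim_upper[OF g0(1), of 1] g0(2) by simp
 \<comment> \<open>Mass 0 makes the primitive vanish beyond both ends, so \<mu>(x/r) is continued by
   1 - gm for |x| \<ge> r and meets the end conditions.\<close>
 then have out: "prim g0 x = 0" if "1 <= \<bar>x\<bar>" for x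
 using prim_upper[OF g0(1), of x] prim_lower[OF g0(1), of x] that by linarith
 have r1: "1 <= \<bar>1 / r\<bar>" "1 <= \<bar>- 1 / r\<bar>" using r by auto
 have p1: "prim ?g 1 = 0" unfolding gd by (rule out) (rule r1)
 have M: "in_M gm ?nu ?g"
 unfolding in_M_def
 proof (intro conjI)
 show "W12_interval ?nu ?g" by (rule W12_interval_prim[OF gd(1), of _ "1 - gm"]) (simp add: gd)
 show "1 - gm + prim g0 (0 / r) = 1" using mu[of 0] mu0 by simp
 qed (use out[OF r1(1)] out[OF r1(2)] in auto)
 have Q: "0 <= log_energy g0" "0 <= log_energy ?g" by (rule log_energy_nonneg[OF g0], rule log_energy_nonneg[OF gd(1) p1])
 have E: "ennreal (eps / 2) * ennreal X + ennreal (1 / 2) * ennreal Y = ennreal (eps / 2 * X + 1 / 2 * Y)" if "0 <= X" "0 <= Y" for X Y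
 proof -
 have "ennreal (eps / 2 * X + 1 / 2 * Y) = ennreal (eps / 2 * X) + ennreal (1 / 2 * Y)" by (rule ennreal_plus) (use that eps in auto)
 also have "ennreal (eps / 2 * X) = ennreal (eps / 2) * ennreal X" by (rule ennreal_mult) (use that eps in auto)
 also have "ennreal (1 / 2 * Y) = ennreal (1 / 2) * ennreal Y" by (rule ennreal_mult) (use that in auto)
 finally show ?thesis ..
 qed
 have "Eng eps gm \<mu> g <= Eng eps gm ?nu ?g" using min M by (simp add: is_minimiser_def)
 also have "... <= ennreal (eps / 2) * (ennreal (1 / r) * ennreal W) + ennreal (1 / 2) * ennreal (log_energy ?g)"
 unfolding Eng_def W(2)[symmetric]
 by (intro add_mono mult_left_mono wterm_dilate_le[OF g0(1) r mu] dir_inf_le[OF gd(1) p1]) (auto simp: gd)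
 also have "... = ennreal (eps / 2 * (1 / r * W) + 1 / 2 * log_energy ?g)"
 unfolding E[OF mult_nonneg_nonneg[OF _ W(3)] Q(2), symmetric, OF divide_nonneg_pos[OF zero_le_one r(1)]]
 using r by (simp only: ennreal_mult'[OF divide_nonneg_pos[OF zero_le_one r(1)], symmetric])
 also have "Eng eps gm \<mu> g = ennreal (eps / 2 * W + 1 / 2 * log_energy g0)"
 unfolding Eng_def W(1,2) D using W(3) Q by (intro E)
 finally have "eps / 2 * W + 1 / 2 * log_energy g0 <= eps / 2 * (1 / r * W) + 1 / 2 * log_energy ?g"
 by (subst (asm) ennreal_le_iff) (use eps r W(3) Q in auto)
 then have diff: "log_energy g0 - log_energy ?g <= eps * W / r - eps * W"    proof -
 define a b where "a = eps * W / r" and "b = eps * W"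
 have "eps / 2 * (1 / r * W) = a / 2" "eps / 2 * W = b / 2" by (simp_all add: a_def b_def)
 with \<open>eps / 2 * W + _ <= _\<close> have "log_energy g0 - log_energy ?g <= a - b" by linarith
 then show ?thesis by (simp add: a_def b_def)
 qed
 note S = log_energy_dilate_sums[OF g0 r]
 have r2: "(r^2) ^ Suc k <= 1" for k using r by (intro power_le_one) (auto intro: power_le_one)
 have "(\<Sum>k<K. (1 - (r^2) ^ Suc k) * (moment g0 (Suc k))^2 / real (Suc k)) <= (\<Sum>k. (1 - (r^2) ^ Suc k) * (moment g0 (Suc k))^2 / real (Suc k))"
 by (rule sum_le_suminf[OF sums_summable[OF S] finite_lessThan]) (use r2 in \<open>auto intro!: divide_nonneg_nonneg mult_nonneg_nonneg simp del: power_Suc\<close>)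
 also have "... = pi * (log_energy g0 - log_energy ?g)" using S by (simp add: sums_iff)
 also have "... <= pi * (eps * W / r - eps * W)" using diff by (intro mult_left_mono) auto
 also have "... = (1 - r) * (pi * (eps * W) / r)" using r by (simp add: field_simps)
 also have "(\<Sum>k<K. (1 - (r^2) ^ Suc k) * (moment g0 (Suc k))^2 / real (Suc k))
 = (1 - r) * (\<Sum>k<K. (\<Sum>i<2 * Suc k. r ^ i) * (moment g0 (Suc k))^2 / real (Suc k))"
 unfolding sum_distrib_left
 proof (rule sum.cong[OF refl])
 fix k
 \<comment> \<open>The factor 1 - r is split off as a finite geometric sum, so that letting r tend
   to 1 only needs the continuity of polynomials.\<close>
 have "1 - (r^2) ^ Suc k = (1 - r) * (\<Sum>i<2 * Suc k. r ^ i)"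
 unfolding one_diff_power_eq[symmetric] by (simp only: power_mult)
 then show "(1 - (r^2) ^ Suc k) * (moment g0 (Suc k))^2 / real (Suc k) = (1 - r) * ((\<Sum>i<2 * Suc k. r ^ i) * (moment g0 (Suc k))^2 / real (Suc k))"
 by (simp only: mult.assoc times_divide_eq_right)
 qed
 finally show ?thesis by (rule mult_left_le_imp_le) (use r in simp)
 qed
 have lim: "(%n. 1 - hs n) ---> 1" using tendsto_diff[OF tendsto_const hs(4), of 1] by simp
 have "(\<Sum>k<K. (\<Sum>i<2 * Suc k. 1 ^ i) * (moment g0 (Suc k))^2 / real (Suc k)) <= pi * (eps * W) / 1"
 proof (rule LIMSEQ_le)
 show "(%n. \<Sum>k<K. (\<Sum>i<2 * Suc k. (1 - hs n) ^ i) * (moment g0 (Suc k))^2 / real (Suc k)) ---> (\<Sum>k<K. (\<Sum>i<2 * Suc k. 1 ^ i) * (moment g0 (Suc k))^2 / real (Suc k))"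
 by (intro tendsto_sum tendsto_divide tendsto_mult tendsto_power lim tendsto_const) auto
 show "(%n. pi * (eps * W) / (1 - hs n)) ---> pi * (eps * W) / 1" by (intro tendsto_divide tendsto_const lim) auto
 show "\<exists>N. \<forall>n\<ge>N. (\<Sum>k<K. (\<Sum>i<2 * Suc k. (1 - hs n) ^ i) * (moment g0 (Suc k))^2 / real (Suc k)) <= pi * (eps * W) / (1 - hs n)"
 using step[of "1 - hs _"] hs(1,2) by auto
 qed
 moreover have "(\<Sum>i<2 * Suc k. 1 ^ i) * (moment g0 (Suc k))^2 / real (Suc k) = 2 * (moment g0 (Suc k))^2" for k
 by (simp add: field_simps)
 ultimately have "2 * (\<Sum>k<K. (moment g0 (Suc k))^2) <= pi * (eps * W)" by (simp only: sum_distrib_left div_by_1)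
 then show ?thesis by (simp add: field_simps)
qed

section \<open>Gradient on the arc: sine series and Parseval\<close>

lemma integral_cos_int:
 "(LBINT x:{0..pi}. cos (of_int n * x)) = (if n = 0 then pi else 0)"
proof (cases "n = 0")
 case False
 have "(LBINT x:{0..pi}. cos (of_int n * x)) = sin (of_int n * pi) / of_int n - sin (of_int n * 0) / of_int n"
 unfolding set_lebesgue_integral_def real_scaleR_def mult.commute[of "indicator _ _"]
 by (rule integral_FTC_Icc_real) (use False in \<open>auto intro!: derivative_eq_intros continuous_intros\<close>)
 then show ?thesis using False sin_int_times_real[of n pi] by (simp add: sin_zero_iff_int2 sin_integer_2pi)
qed (simp add: set_lebesgue_integral_def)

lemma integral_sin_sin:
 "(LBINT x:{0..pi}. sin (real (Suc j) * x) * sin (real (Suc k) * x)) = (if j = k then pi / 2 else 0)"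
proof -
 have e: "sin (real (Suc j) * x) * sin (real (Suc k) * x) = (1 / 2) * cos (of_int (int j - int k) * x) - (1 / 2) * cos (of_int (int j + int k + 2) * x)" for x
 by (simp add: sin_times_sin algebra_simps diff_divide_distrib)
 have i: "set_integrable lborel {0..pi} (%x. (1 / 2) * cos (of_int n * x))" for n :: int
 by (rule borel_integrable_atLeastAtMost') (intro continuous_intros)
 show ?thesis unfolding e unfolding set_integral_diff(2)[OF i i] set_integral_mult_right integral_cos_int by auto
qed

lemma integral_sin_sum_sq:
 "(LBINT x:{0..pi}. (\<Sum>k<K. a k * sin (real (Suc k) * x))^2) = (pi / 2) * (\<Sum>k<K. (a k)^2)"
proof -
 have i: "set_integrable lborel {0..pi} (%x. c * (sin (real (Suc j) * x) * sin (real (Suc k) * x)))" for c j k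
 by (rule borel_integrable_atLeastAtMost') (intro continuous_intros)
 have "(\<Sum>k<K. a k * sin (real (Suc k) * x))^2 = (\<Sum>j<K. \<Sum>k<K. (a j * a k) * (sin (real (Suc j) * x) * sin (real (Suc k) * x)))" for x
 unfolding power2_eq_square sum_product by (intro sum.cong refl) (simp only: mult_ac)
 then have "(LBINT x:{0..pi}. (\<Sum>k<K. a k * sin (real (Suc k) * x))^2)
 = (\<Sum>j<K. \<Sum>k<K. (a j * a k) * (LBINT x:{0..pi}. sin (real (Suc j) * x) * sin (real (Suc k) * x)))"
 using i by (simp add: set_lebesgue_integral_def set_integrable_def sum_distrib_left mult.left_commute[of "indicator _ _"]
 Bochner_Integration.integral_sum Bochner_Integration.integrable_sum del: of_nat_Suc)
 also have "... = (\<Sum>j<K. \<Sum>k<K. if j = k then (a j)\<^sup>2 * (pi / 2) else 0)"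
 unfolding integral_sin_sin by (intro sum.cong refl) (simp add: power2_eq_square)
 also have "... = (pi / 2) * (\<Sum>k<K. (a k)^2)" by (simp add: sum_distrib_left mult.commute)
 finally show ?thesis .
qed

text \<open>For |w| = 1 the pole term w / (w - t) is the conjugate of 1 / (1 - t w), so pole and
  image contribute the same imaginary part; hence the factor 2. The geometric series in t w
  converges for |t| < 1, and its partial sums are bounded uniformly in t because w is not
  real.\<close>

lemma moment_sums_arc:
 assumes g: "L2_unit g" and th: "0 < th" "th < pi"
 shows "(%K. (2 / pi) * (\<Sum>k<K. moment g (Suc k) * sin (real (Suc k) * th))) ---> Im (cis th * dpot g 0 (cis th))"
proof -
 define w where "w = cis th"
 have w: "0 < Im w" "cmod w = 1" using th by (auto simp: w_def sin_gt_zero)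
 note [measurable] = L2_unit_measurable[OF g]
 have ne: "1 - of_real t * w \<noteq> 0" if "t \<in> {-1..1}" for t
 using ker_args_nonzero(2)[of 0 t w] that w by simp
 have ne2: "w - of_real t \<noteq> 0" if "t \<in> {-1..1}" for t
 using ker_args_nonzero(1)[of 0 t w] that w by simp
 have ck: "continuous_on {-1..1} (%t. 1 / (1 - of_real t * w))" using ne by (intro continuous_intros) auto
 obtain B where B: "B \<ge> 0" "!!t. t \<in> {-1..1} ==> norm (1 / (1 - of_real t * w)) <= B"
 using continuous_on_compact_bound[OF compact_Icc ck] by auto
 define H where "H t = of_real t * w / (1 - of_real t * w)" for t
 define P where "P K t = (\<Sum>k<K. (of_real t * w) ^ Suc k)" for K t
 have PH: "P K t = H t * (1 - (of_real t * w) ^ K)" if "t \<in> {-1..1}" for K t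
 proof -
 have "(1 - of_real t * w) * P K t = of_real t * w * ((1 - of_real t * w) * (\<Sum>k<K. (of_real t * w) ^ k))"
 unfolding P_def by (simp add: sum_distrib_left mult_ac)
 also have "(1 - of_real t * w) * (\<Sum>k<K. (of_real t * w) ^ k) = 1 - (of_real t * w) ^ K" by (rule one_diff_power_eq[symmetric])
 finally show ?thesis using ne[OF that] by (simp add: H_def field_simps)
 qed
 have tw: "cmod (of_real t * w) = \<bar>t\<bar>" for t using w by (simp add: norm_mult)
 have mw: "(%t. of_real t * w) \<in> borel_measurable borel" by (intro borel_measurable_continuous_onI continuous_intros)
 note [measurable] = mw
 have lim: "(%K. \<integral>t. g t *\<^sub>R P K t \<partial>lborel) ---> (\<integral>t. g t *\<^sub>R H t \<partial>lborel)"
 proof (rule integral_dominated_convergence[where w="%t. (B * 2) * \<bar>g t\<bar>"])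
 show "(%t. g t *\<^sub>R H t) \<in> borel_measurable lborel" unfolding H_def[abs_def] by measurable
 show "(%t. g t *\<^sub>R P K t) \<in> borel_measurable lborel" for K unfolding P_def by measurable
 show "integrable lborel (%t. (B * 2) * \<bar>g t\<bar>)" using L2_unit_integrable[OF g] by simp
 show "AE t in lborel. (%K. g t *\<^sub>R P K t) ---> g t *\<^sub>R H t"
 proof (rule AE_I2)
 fix t
 show "(%K. g t *\<^sub>R P K t) ---> g t *\<^sub>R H t"
 proof (cases "t \<in> {-1<..<1}")
 case True
 have "(%K. (of_real t * w) ^ K) ---> 0" using tw[of t] True by (intro LIMSEQ_power_zero) auto
 then have "(%K. g t *\<^sub>R (H t * (1 - (of_real t * w) ^ K))) ---> g t *\<^sub>R (H t * (1 - 0))"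
 by (rule tendsto_scaleR[OF tendsto_const tendsto_mult[OF tendsto_const tendsto_diff[OF tendsto_const]]])
 then show ?thesis using True by (simp add: PH)
 qed (simp add: L2_unit_zero[OF g])
 qed
 show "AE t in lborel. norm (g t *\<^sub>R P K t) <= (B * 2) * \<bar>g t\<bar>" for K
 proof (rule AE_I2)
 fix t
 show "norm (g t *\<^sub>R P K t) <= (B * 2) * \<bar>g t\<bar>"
 proof (cases "t \<in> {-1<..<1}")
 case True
 have n1: "norm (1 / (1 - of_real t * w)) <= B" by (rule B) (use True in auto)
 have a1: "norm (1 - (of_real t * w) ^ K) <= 1 + 1"
 by (rule order_trans[OF norm_triangle_ineq4], rule add_mono) (use True in \<open>auto simp: norm_power tw intro!: power_le_one\<close>)
 have "norm (P K t) = \<bar>t\<bar> * norm (1 / (1 - of_real t * w)) * norm (1 - (of_real t * w) ^ K)"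
 using True tw[of t] by (simp add: PH H_def norm_mult norm_divide)
 also have "... <= 1 * B * (1 + 1)" using True n1 a1 B(1) by (intro mult_mono) auto
 finally have "norm (P K t) <= B * 2" by simp
 from mult_left_mono[OF this abs_ge_zero[of "g t"]] show ?thesis by (simp add: mult.commute)
 qed (simp add: L2_unit_zero[OF g])
 qed
 qed
 have iP: "integrable lborel (%t. g t *\<^sub>R P K t)" for K
 by (rule integrable_L2_unit_continuous[OF g]) (unfold P_def, intro continuous_intros)
 have iH: "integrable lborel (%t. g t *\<^sub>R H t)"
 by (rule integrable_L2_unit_continuous[OF g]) (unfold H_def, use ne in \<open>intro continuous_intros; auto\<close>)
 have ImP: "Im (\<integral>t. g t *\<^sub>R P K t \<partial>lborel) = (\<Sum>k<K. moment g (Suc k) * sin (real (Suc k) * th))" for K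
 proof -
 have e: "Im (g t *\<^sub>R P K t) = (\<Sum>k<K. sin (real (Suc k) * th) * (g t *\<^sub>R t ^ Suc k))" for t
 unfolding P_def Im_sum scaleR_complex.sel sum_distrib_left
 proof (rule sum.cong[OF refl])
 fix k
 have "(of_real t * w) ^ Suc k = of_real (t ^ Suc k) * cis (real (Suc k) * th)"
 unfolding power_mult_distrib w_def Complex.DeMoivre of_real_power by (rule refl)
 then show "g t * Im ((of_real t * w) ^ Suc k) = sin (real (Suc k) * th) * (g t *\<^sub>R t ^ Suc k)"
 by (simp del: power_Suc of_nat_Suc)
 qed
 have "Im (\<integral>t. g t *\<^sub>R P K t \<partial>lborel) = (\<integral>t. Im (g t *\<^sub>R P K t) \<partial>lborel)"
 by (rule integral_bounded_linear[OF bounded_linear_Im iP, symmetric])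
 also have "... = (\<Sum>k<K. \<integral>t. sin (real (Suc k) * th) * (g t *\<^sub>R t ^ Suc k) \<partial>lborel)"
 unfolding e by (rule Bochner_Integration.integral_sum, rule integrable_mult_right, rule integrable_L2_unit_continuous[OF g]) (intro continuous_intros)
 also have "... = (\<Sum>k<K. moment g (Suc k) * sin (real (Suc k) * th))"
 by (simp add: moment_def mult.commute del: power_Suc of_nat_Suc)
 finally show ?thesis .
 qed
 have Imd: "Im (cis th * dpot g 0 (cis th)) = (2 / pi) * Im (\<integral>t. g t *\<^sub>R H t \<partial>lborel)"
 proof -
 have ik: "integrable lborel (%t. g t *\<^sub>R dker 0 t w)" by (rule integrable_ker(2)[OF g]) (use w in auto)
 have k: "Im (w * (g t *\<^sub>R dker 0 t w)) = - 2 * Im (g t *\<^sub>R H t)" for t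
 proof (cases "t \<in> {-1<..<1}")
 case True
 then have t: "t \<in> {-1..1}" by auto
 have ww: "w * cnj w = 1" using w by (simp add: complex_norm_square[symmetric])
 have "w / (w - of_real t) = cnj (1 / (1 - of_real t * w))"
 proof -
 have "cnj (1 - of_real t * w) \<noteq> 0" using ne[OF t] by (metis complex_cnj_zero_iff)
 moreover have "w * cnj (1 - of_real t * w) = w - of_real t"
 using ww by (simp add: algebra_simps)
 ultimately show ?thesis using ne2[OF t] by (simp add: divide_simps)
 qed
 moreover have "1 / (1 - of_real t * w) = 1 + H t" using ne[OF t] by (simp add: H_def divide_simps)
 ultimately have "Im (w / (w - of_real t)) = - Im (H t)" by simp
 moreover have "w * dker 0 t w = w / (w - of_real t) - H t" by (simp add: dker_def H_def right_diff_distrib mult.commute)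
 ultimately have "Im (w * dker 0 t w) = - 2 * Im (H t)" by simp
 moreover have "w * (g t *\<^sub>R dker 0 t w) = g t *\<^sub>R (w * dker 0 t w)" by simp
 ultimately show ?thesis by (simp only: scaleR_complex.sel)
 qed (simp add: L2_unit_zero[OF g])
 have "Im (w * dpot g 0 w) = - Im (w * (\<integral>t. g t *\<^sub>R dker 0 t w \<partial>lborel)) / pi"
 by (simp add: dpot_def diff_divide_distrib add_divide_distrib)
 also have "w * (\<integral>t. g t *\<^sub>R dker 0 t w \<partial>lborel) = (\<integral>t. w * (g t *\<^sub>R dker 0 t w) \<partial>lborel)" by (rule integral_mult_right_zero[symmetric])
 also have "Im ... = (\<integral>t. - 2 * Im (g t *\<^sub>R H t) \<partial>lborel)"
 unfolding k[symmetric] by (rule integral_bounded_linear[OF bounded_linear_Im integrable_mult_right[OF ik], symmetric])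
 also have "... = - 2 * (\<integral>t. Im (g t *\<^sub>R H t) \<partial>lborel)" by (rule integral_mult_right_zero)
 also have "(\<integral>t. Im (g t *\<^sub>R H t) \<partial>lborel) = Im (\<integral>t. g t *\<^sub>R H t \<partial>lborel)" by (rule integral_bounded_linear[OF bounded_linear_Im iH])
 finally show ?thesis by (simp add: w_def)
 qed
 have "(%K. (2 / pi) * Im (\<integral>t. g t *\<^sub>R P K t \<partial>lborel)) ---> (2 / pi) * Im (\<integral>t. g t *\<^sub>R H t \<partial>lborel)"
 by (intro tendsto_intros lim)
 then show ?thesis unfolding ImP Imd .
qed

text \<open>The radial component vanishes on the arc, so the gradient is the tangential sine series.
  Fatou over the partial sums takes the place of the full Parseval identity, and (2/pi)^2 times pi/2
  is 2/pi.\<close>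

lemma arc_gradient_le:
 assumes g: "L2_unit g" "prim g 1 = 0" and B: "!!K. (2 / pi) * (\<Sum>k<K. (moment g (Suc k))^2) <= B"
 shows "(\<integral>\<^sup>+th. indicator {0<..<pi} th * ennreal ((cmod (dpot g 0 (cis th)))^2) \<partial>lebesgue) <= ennreal B"
proof -
 let ?f = "%K th. ((2 / pi) * (\<Sum>k<K. moment g (Suc k) * sin (real (Suc k) * th)))^2"
 have "(\<integral>\<^sup>+th. indicator {0<..<pi} th * ennreal ((cmod (dpot g 0 (cis th)))^2) \<partial>lebesgue)
 = (\<integral>\<^sup>+th. liminf (%K. indicator {0<..<pi} th * ennreal (?f K th)) \<partial>lborel)"
 unfolding nn_integral_completion
 proof (rule nn_integral_cong)
 fix th :: real
 show "indicator {0<..<pi} th * ennreal ((cmod (dpot g 0 (cis th)))^2) = liminf (%K. indicator {0<..<pi} th * ennreal (?f K th))"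
 proof (cases "th \<in> {0<..<pi}")
 case True
 have "Re (cis th * dpot g 0 (cis th)) = 0" by (rule pot_arc(2)[OF g]) (use True in \<open>auto simp: sin_gt_zero\<close>)
 then have "(cmod (cis th * dpot g 0 (cis th)))^2 = (Im (cis th * dpot g 0 (cis th)))^2" by (simp only: cmod_power2) simp
 then have e: "(cmod (dpot g 0 (cis th)))^2 = (Im (cis th * dpot g 0 (cis th)))^2" by (simp add: norm_mult)
 have "(%K. ennreal (?f K th)) ---> ennreal ((Im (cis th * dpot g 0 (cis th)))^2)"
 by (intro tendsto_intros moment_sums_arc[OF g(1)]) (use True in auto)
 then have "liminf (%K. ennreal (?f K th)) = ennreal ((Im (cis th * dpot g 0 (cis th)))^2)"
 by (intro lim_imp_Liminf) auto
 then show ?thesis unfolding e using True by simp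
 qed (simp add: Liminf_const)
 qed
 also have "... <= liminf (%K. \<integral>\<^sup>+th. indicator {0<..<pi} th * ennreal (?f K th) \<partial>lborel)"
 by (rule nn_integral_liminf) measurable
 also have "... <= liminf (%K::nat. ennreal B)"
 proof (rule Liminf_mono, rule always_eventually, rule allI)
 fix K
 have "(\<integral>\<^sup>+th. indicator {0<..<pi} th * ennreal (?f K th) \<partial>lebesgue) = ennreal (LBINT th:{0..pi}. ?f K th)"
 by (rule nn_integral_interval_eq) (auto intro!: continuous_intros)
 also have "(LBINT th:{0..pi}. ?f K th) = (4 / pi^2) * (LBINT th:{0..pi}. (\<Sum>k<K. moment g (Suc k) * sin (real (Suc k) * th))^2)"
 by (simp add: power_mult_distrib power_divide del: of_nat_Suc)
 also have "... = (2 / pi) * (\<Sum>k<K. (moment g (Suc k))^2)" unfolding integral_sin_sum_sq by (simp add: field_simps power2_eq_square)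
 finally have "(\<integral>\<^sup>+th. indicator {0<..<pi} th * ennreal (?f K th) \<partial>lborel) = ennreal ((2 / pi) * (\<Sum>k<K. (moment g (Suc k))^2))"
 by (simp only: nn_integral_completion)
 also have "... <= ennreal B" by (rule ennreal_leI[OF B])
 finally show "(\<integral>\<^sup>+th. indicator {0<..<pi} th * ennreal (?f K th) \<partial>lborel) <= ennreal B" .
 qed
 finally show ?thesis by (simp add: Liminf_const)
qed

section \<open>Integration by parts against tangential fields\<close>

lemma Ck_const: "Ck k (%x. c)"
 by (induction k arbitrary: c) (auto intro!: exI[of _ "%x h. 0"])

lemma Ck_linear:
 assumes "bounded_linear f"
 shows "Ck k f"
proof (cases k)
 case 0
 then show ?thesis using linear_continuous_on[OF assms] by simp
next
 case (Suc m)
 then show ?thesis using bounded_linear_imp_has_derivative[OF assms] Ck_const by (auto intro!: exI[of _ "%x. f"])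
qed

lemma Ck_inverse:
 assumes "!!x. q x \<noteq> 0" "Ck k q"
 shows "Ck k (%x. inverse (q x))"
 using assms(2)
proof (induction k)
 case 0
 then show ?case using assms(1) by (simp add: continuous_on_inverse)
next
 case (Suc k)
 then obtain Dq where D: "!!x. (q has_derivative Dq x) (at x)" "!!h. Ck k (%x. Dq x h)" by auto
 note I = Suc.IH[OF Ck_Suc_imp_Ck[OF Suc.prems]]
 have "((%x. inverse (q x)) has_derivative (%h. - (inverse (q x) * Dq x h * inverse (q x)))) (at x)" for x
 by (rule Deriv.has_derivative_inverse[OF assms(1) D(1)])
 moreover have "Ck k (%x. - (inverse (q x) * Dq x h * inverse (q x)))" for h
 using Ck_scale[OF Ck_mult[OF Ck_mult[OF I D(2)] I], where c="-1"] by simp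
 ultimately show ?case by (auto intro!: exI[of _ "%x h. - (inverse (q x) * Dq x h * inverse (q x))"])
qed

lemma Ck_flat_poly_compose:
 assumes "Ck k f"
 shows "Ck k (%x. flat_poly p (f x))"
 using assms
proof (induction k arbitrary: p)
 case 0
 have "continuous_on UNIV (flat_poly p)"
 by (intro continuous_at_imp_continuous_on ballI DERIV_isCont[OF DERIV_flat_poly])
 then show ?case using 0 by (auto intro: continuous_on_compose2[of UNIV "flat_poly p"])
next
 case (Suc k)
 then obtain Df where D: "!!x. (f has_derivative Df x) (at x)" "!!h. Ck k (%x. Df x h)" by auto
 let ?q = "[:0,0,1:] * (p - pderiv p)"
 have "((%x. flat_poly p (f x)) has_derivative (%h. flat_poly ?q (f x) * Df x h)) (at x)" for x
 using has_derivative_compose[OF D(1) DERIV_flat_poly[unfolded has_field_derivative_def]] .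
 moreover have "Ck k (%x. flat_poly ?q (f x) * Df x h)" for h
 by (intro Ck_mult Suc.IH Ck_Suc_imp_Ck[OF Suc.prems] D(2))
 ultimately show ?case by (auto intro!: exI[of _ "%x h. flat_poly ?q (f x) * Df x h"])
qed

text \<open>The value 1 is reached only at infinity. Evaluated at n s - 1 the function still tends
  to 1 for every s > 0, and it vanishes for s \<le> 1/n.\<close>

definition step :: "real => real" where "step = flat_poly 1"
definition dstep :: "real => real" where "dstep = flat_poly [:0,0,1:]"

lemma step_DERIV: "(step has_real_derivative dstep x) (at x)"
 using DERIV_flat_poly[of 1 x] by (simp add: step_def dstep_def pderiv_1)

text \<open>The last bound is scale invariant: the derivative of a cut-off at distance about 1/n has
  size n, but distance times derivative is at most 3 for all n. The constant comes from the
  quadratic Taylor bound of \<open>exp\<close>.\<close>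

lemma step_bounds: "0 <= step x" "step x <= 1" "x <= 0 ==> step x = 0"
 "0 <= tq ==> \<bar>tq * dstep (tq - 1)\<bar> <= 3"
proof -
 show "\<bar>tq * dstep (tq - 1)\<bar> <= 3" if "0 <= tq"
 proof (cases "tq > 1")
 case True
 define v where "v = 1 / (tq - 1)"
 have v: "0 < v" "tq = 1 + 1 / v" using True by (auto simp: v_def)
 have "1 + v + v^2 / 2 <= exp v" using exp_lower_Taylor_quadratic[of v] v(1) by simp
 then have "v + v^2 <= 3 * exp v" using v(1) zero_le_power2[of v] by linarith
 then have "(v + v^2) * exp (- v) <= 3 * exp v * exp (- v)" by (rule mult_right_mono) simp
 then have e: "(v + v^2) * exp (- v) <= 3" unfolding mult.assoc exp_add[symmetric] by simp
 have "dstep (tq - 1) = v^2 * exp (- v)" using True by (simp add: dstep_def flat_poly_def v_def power2_eq_square)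
 then have "tq * dstep (tq - 1) = (v + v^2) * exp (- v)" using v by (simp add: distrib_right power2_eq_square)
 moreover have "0 <= (v + v^2) * exp (- v)" using v(1) by simp
 ultimately show ?thesis using e by simp
 qed (simp add: dstep_def flat_poly_def)
qed (auto simp: step_def flat_poly_def)

lemma step_limits:
 assumes "0 < s"
 shows "(%n. step (real n * s - 1)) ---> 1" "(%n. real n * s * dstep (real n * s - 1)) ---> 0"
proof -
 have L: "filterlim (%n. real n * s - 1) at_top sequentially" using assms by real_asymp
 have "((%x::real. exp (- 1 / x)) \<longlongrightarrow> 1) at_top" "((%x::real. (x + 1) * ((1 / x) * (1 / x) * exp (- 1 / x))) \<longlongrightarrow> 0) at_top" by real_asymp+
 from this[THEN filterlim_compose, OF L]
 have l: "(%n. exp (- 1 / (real n * s - 1))) ---> 1"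
 "(%n. (real n * s - 1 + 1) * ((1 / (real n * s - 1)) * (1 / (real n * s - 1)) * exp (- 1 / (real n * s - 1)))) ---> 0" .
 have ev: "eventually (%n. 0 < real n * s - 1) sequentially" using L unfolding filterlim_at_top_dense by blast
 show "(%n. step (real n * s - 1)) ---> 1"
 by (rule Lim_transform_eventually[OF l(1)], use ev in eventually_elim) (simp add: step_def flat_poly_def)
 show "(%n. real n * s * dstep (real n * s - 1)) ---> 0"
 by (rule Lim_transform_eventually[OF l(2)], use ev in eventually_elim) (simp add: dstep_def flat_poly_def)
qed

lemma L2_on_dominated_limit:
 fixes w :: "real \<times> real => real"
 assumes w: "L2_on Hp w" and c: "!!n. continuous_on Kp (E n)" and cE: "continuous_on Kp F"
 and b: "!!n x. x \<in> Hp ==> \<bar>E n x\<bar> <= K" and lim: "!!x. x \<in> Hp ==> (%n. E n x) ---> F x"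
 shows "(%n. LINT x:Hp|lebesgue. w x * E n x) ---> (LINT x:Hp|lebesgue. w x * F x)"
 unfolding set_lebesgue_integral_def
proof (rule integral_dominated_convergence[where w="%x. K * \<bar>indicator Hp x *\<^sub>R (w x * 1)\<bar>"])
 note i = L2_on_integrable_bounded[OF w, unfolded set_integrable_def]
 show "(%x. indicator Hp x *\<^sub>R (w x * F x)) \<in> borel_measurable lebesgue" using i[OF cE] by simp
 show "(%x. indicator Hp x *\<^sub>R (w x * E n x)) \<in> borel_measurable lebesgue" for n using i[OF c] by simp
 show "integrable lebesgue (%x. K * \<bar>indicator Hp x *\<^sub>R (w x * 1)\<bar>)"
 by (intro integrable_mult_right integrable_abs i continuous_on_const)
 show "AE x in lebesgue. (%n. indicator Hp x *\<^sub>R (w x * E n x)) ---> indicator Hp x *\<^sub>R (w x * F x)"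
 by (rule AE_I2) (auto simp: indicator_def intro!: tendsto_intros lim)
 show "AE x in lebesgue. norm (indicator Hp x *\<^sub>R (w x * E n x)) <= K * \<bar>indicator Hp x *\<^sub>R (w x * 1)\<bar>" for n
 using b by (intro AE_I2) (auto simp: indicator_def abs_mult mult.commute[of K] intro!: mult_left_mono)
qed

text \<open>A field that is tangential on the whole boundary vanishes there to first order in its normal component, so
 cutting it off costs nothing in the limit.\<close>
lemma tangential_field_by_parts:
 assumes W: "W12_on Hp u G"
 and X: "!!k. Ck k X1" "!!k. Ck k X2"
 and D: "!!x. (X1 has_derivative (%h. D1 x \<bullet> h)) (at x)" "!!x. (X2 has_derivative (%h. D2 x \<bullet> h)) (at x)"
 and cD: "continuous_on UNIV D1" "continuous_on UNIV D2" and cR: "continuous_on UNIV R1" "continuous_on UNIV R2"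
 and R2: "!!x. X2 x = snd x * R2 x"
 and R1: "!!x. fst x * X1 x + snd x * X2 x = (1 - ((fst x)^2 + (snd x)^2)) * R1 x"
 shows "(LINT x:Hp|lebesgue. u x * (fst (D1 x) + snd (D2 x))) = - (LINT x:Hp|lebesgue. G x \<bullet> (X1 x, X2 x))"
proof -
 have u: "L2_on Hp u" and G: "L2_on Hp G" and
 weak: "!!ph e. test_fun Hp ph ==> e \<in> Basis ==>
 (LINT x:Hp|lebesgue. u x * frechet_derivative ph (at x) e) = - (LINT x:Hp|lebesgue. (G x \<bullet> e) * ph x)"
 using W by (auto simp: W12_on_def)
 let ?r = "%x::real\<times>real. 1 - ((fst x)^2 + (snd x)^2)"
 \<comment> \<open>\<open>A\<close> cuts off near the flat side and \<open>B\<close> near the arc;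
   the shift by -1 keeps the supports at positive distance from the boundary.\<close>
 define A where "A n x = step (real n * snd x - 1)" for n and x :: "real \<times> real"
 define B where "B n x = step (real n * ?r x - 1)" for n x
 define dA where "dA n x = dstep (real n * snd x - 1)" for n and x :: "real \<times> real"
 define dB where "dB n x = dstep (real n * ?r x - 1)" for n x
 define E1 where "E1 n x = fst (D1 x) * (A n x * B n x) + X1 x * (A n x * (dB n x * (real n * (- 2 * fst x))))" for n x
 define E2 where "E2 n x = snd (D2 x) * (A n x * B n x) + X2 x * (dA n x * real n * B n x + A n x * (dB n x * (real n * (- 2 * snd x))))" for n x
 have Cpoly: "Ck k (%x::real\<times>real. real n * snd x - 1)" "Ck k (%x. real n * ?r x - 1)" for k n
 proof -
 note f = Ck_linear[OF bounded_linear_fst, of k] and s = Ck_linear[OF bounded_linear_snd, of k]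
 show "Ck k (%x::real\<times>real. real n * snd x - 1)"
 using Ck_add[OF Ck_scale[OF s, of "real n"] Ck_const[of k "-1"]] by (simp add: mult.commute)
 show "Ck k (%x. real n * ?r x - 1)"
 using Ck_add[OF Ck_scale[OF Ck_add[OF Ck_mult[OF f f] Ck_mult[OF s s]], of "- real n"] Ck_const[of k "real n - 1"]]
 by (simp add: power2_eq_square algebra_simps)
 qed
 have CA: "Ck k (A n)" "Ck k (B n)" for k n
 unfolding A_def[abs_def] B_def[abs_def] step_def by (intro Ck_flat_poly_compose Cpoly)+
 have AD: "(A n has_derivative (%h. dA n x * (real n * snd h))) (at x)" for n x
 unfolding A_def[abs_def] dA_def
 by (rule has_derivative_compose[OF _ step_DERIV[unfolded has_field_derivative_def]]) (auto intro!: derivative_eq_intros)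
 have BD: "(B n has_derivative (%h. dB n x * (real n * (- (2 * fst x * fst h + 2 * snd x * snd h))))) (at x)" for n x
 unfolding B_def[abs_def] dB_def
 by (rule has_derivative_compose[OF _ step_DERIV[unfolded has_field_derivative_def]]) (auto intro!: derivative_eq_intros)
 have supp: "test_fun Hp (%x. Y x * (A n x * B n x))" if "!!k. Ck k Y" for Y n
 unfolding test_fun_def
 proof (intro conjI allI)
 show "Ck k (%x. Y x * (A n x * B n x))" for k by (intro Ck_mult that CA)
 let ?S = "{x. 1 <= real n * snd x} \<inter> {x. 1 <= real n * ?r x}"
 have cl: "closed ?S" by (intro closed_Int closed_Collect_le continuous_intros)
 have sub: "{x. Y x * (A n x * B n x) \<noteq> 0} \<subseteq> ?S"
 proof
 fix x assume "x \<in> {x. Y x * (A n x * B n x) \<noteq> 0}"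
 then have "step (real n * snd x - 1) \<noteq> 0" "step (real n * ?r x - 1) \<noteq> 0" by (auto simp: A_def B_def)
 then have "\<not> real n * snd x - 1 <= 0" "\<not> real n * ?r x - 1 <= 0" using step_bounds(3) by blast+
 then show "x \<in> ?S" by auto
 qed
 then have c2: "closure {x. Y x * (A n x * B n x) \<noteq> 0} \<subseteq> ?S" by (rule closure_minimal[OF _ cl])
 have SH: "?S \<subseteq> Hp"
 proof
 fix x assume "x \<in> ?S"
 then have *: "1 <= real n * snd x" "1 <= real n * ?r x" by auto
 have "0 < real n * snd x" "0 < real n * ?r x" using * by linarith+
 then have "0 < snd x" "0 < ?r x" by (simp_all only: zero_less_mult_iff) auto
 then show "x \<in> Hp" using mem_Hp[of "fst x" "snd x"] by simp
 qed
 then show "closure {x. Y x * (A n x * B n x) \<noteq> 0} \<subseteq> Hp" using c2 by blast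
 have "bounded ?S" using SH Hp_subset_Kp compact_imp_bounded[OF compact_Kp] bounded_subset by blast
 then show "compact (closure {x. Y x * (A n x * B n x) \<noteq> 0})"
 using c2 bounded_subset by (auto simp: compact_eq_bounded_closed)
 qed
 have F1: "frechet_derivative (%x. X1 x * (A n x * B n x)) (at x) (1, 0) = E1 n x" for n x
 by (subst frechet_derivative_at[OF has_derivative_mult[OF D(1) has_derivative_mult[OF AD BD]], symmetric])
 (simp add: E1_def inner_prod_def)
 have F2: "frechet_derivative (%x. X2 x * (A n x * B n x)) (at x) (0, 1) = E2 n x" for n x
 by (subst frechet_derivative_at[OF has_derivative_mult[OF D(2) has_derivative_mult[OF AD BD]], symmetric])
 (simp add: E2_def inner_prod_def algebra_simps)
 have B: "(1, 0) \<in> (Basis :: (real \<times> real) set)" "(0, 1) \<in> (Basis :: (real \<times> real) set)" by (auto simp: Basis_prod_def)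
 have sc: "continuous_on UNIV step" "continuous_on UNIV dstep"
 using Ck_flat_poly[of 0 1 1 0] Ck_flat_poly[of 0 "[:0,0,1:]" 1 0] by (simp_all add: step_def dstep_def)
 have cX: "continuous_on Kp X1" "continuous_on Kp X2" using X(1)[of 0] X(2)[of 0] by (auto intro: continuous_on_subset)
 have cAB: "continuous_on Kp (A n)" "continuous_on Kp (B n)" "continuous_on Kp (dA n)" "continuous_on Kp (dB n)" for n
 unfolding A_def[abs_def] B_def[abs_def] dA_def[abs_def] dB_def[abs_def]
 by (intro continuous_on_compose2[OF sc(1)] continuous_on_compose2[OF sc(2)] continuous_intros subset_UNIV)+
 have cD': "continuous_on Kp D1" "continuous_on Kp D2" "continuous_on Kp R1" "continuous_on Kp R2"
 using cD cR continuous_on_subset by blast+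
 have cE: "continuous_on Kp (E1 n)" "continuous_on Kp (E2 n)" for n
 unfolding E1_def[abs_def] E2_def[abs_def] by (intro continuous_intros cAB cX cD')+
 let ?g1 = "%x. G x \<bullet> (1, 0)" and ?g2 = "%x. G x \<bullet> (0, 1)"
 have g12: "L2_on Hp ?g1" "L2_on Hp ?g2" by (intro L2_on_inner[OF G]; simp)+
 note iu = L2_on_integrable_bounded[OF u] and ig1 = L2_on_integrable_bounded[OF g12(1)] and ig2 = L2_on_integrable_bounded[OF g12(2)]
 have cc: "continuous_on Kp (%x. X1 x * (A n x * B n x))" "continuous_on Kp (%x. X2 x * (A n x * B n x))" for n
 by (intro continuous_intros cAB cX)+
 have eqn: "(LINT x:Hp|lebesgue. u x * (E1 n x + E2 n x)) = - ((LINT x:Hp|lebesgue. ?g1 x * (X1 x * (A n x * B n x))) + (LINT x:Hp|lebesgue. ?g2 x * (X2 x * (A n x * B n x))))" for n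
 using weak[OF supp[OF X(1)] B(1), of n] weak[OF supp[OF X(2)] B(2), of n] set_integral_add(2)[OF iu[OF cE(1)[of n]] iu[OF cE(2)[of n]]]
 unfolding F1 F2 by (simp add: distrib_left)
 define dv where "dv x = fst (D1 x) + snd (D2 x)" for x
 have cdv: "continuous_on Kp dv" unfolding dv_def[abs_def] by (intro continuous_intros cD')
 \<comment> \<open>The derivatives of the cut-offs meet only the normal components of the field, and
   by \<open>R1\<close> and \<open>R2\<close> these supply the missing factor of distance. Then
   \<open>step_bounds\<close> gives domination and \<open>step_limits\<close> the limit 0.\<close>
 have Esum: "E1 n x + E2 n x = dv x * (A n x * B n x) + R2 x * (real n * snd x * dA n x) * B n x - 2 * R1 x * A n x * (real n * ?r x * dB n x)" for n x
 proof -
 have "E1 n x + E2 n x = dv x * (A n x * B n x) + X2 x * (dA n x * real n * B n x) - 2 * A n x * dB n x * real n * (fst x * X1 x + snd x * X2 x)"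
 by (simp add: E1_def E2_def dv_def algebra_simps)
 then show ?thesis unfolding R1 unfolding R2 by (simp add: mult_ac)
 qed
 have AB1: "0 <= A n x" "A n x <= 1" "0 <= B n x" "B n x <= 1" for n x by (auto simp: A_def B_def step_bounds)
 obtain K1 where K1: "K1 \<ge> 0" "!!x. x \<in> Kp ==> norm (dv x) <= K1" using continuous_on_compact_bound[OF compact_Kp cdv] by blast
 obtain K2 where K2: "K2 \<ge> 0" "!!x. x \<in> Kp ==> norm (R1 x) <= K2" using continuous_on_compact_bound[OF compact_Kp cD'(3)] by blast
 obtain K3 where K3: "K3 \<ge> 0" "!!x. x \<in> Kp ==> norm (R2 x) <= K3" using continuous_on_compact_bound[OF compact_Kp cD'(4)] by blast
 obtain K4 where K4: "K4 \<ge> 0" "!!x. x \<in> Kp ==> norm (X1 x) <= K4" using continuous_on_compact_bound[OF compact_Kp cX(1)] by blast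
 obtain K5 where K5: "K5 \<ge> 0" "!!x. x \<in> Kp ==> norm (X2 x) <= K5" using continuous_on_compact_bound[OF compact_Kp cX(2)] by blast
 have pos: "0 < snd x" "0 < ?r x" "x \<in> Kp" if "x \<in> Hp" for x using Hp_bounds[OF that] Hp_subset_Kp that by auto
 have bE: "\<bar>E1 n x + E2 n x\<bar> <= K1 + K3 * 3 + 2 * K2 * 3" if x: "x \<in> Hp" for n x
 proof -
 note p = pos[OF x]
 have t: "\<bar>real n * snd x * dA n x\<bar> <= 3" "\<bar>real n * ?r x * dB n x\<bar> <= 3"
 unfolding dA_def dB_def using p by (intro step_bounds; simp)+
 have "\<bar>dv x * (A n x * B n x)\<bar> <= K1 * 1" unfolding abs_mult using K1 AB1[of n x] p by (intro mult_mono mult_le_one) (auto simp: real_norm_def)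
 moreover have "\<bar>R2 x * (real n * snd x * dA n x) * B n x\<bar> <= K3 * 3 * 1"
 unfolding abs_mult[of _ "B n x"] abs_mult[of "R2 x"] using K3 t AB1[of n x] p by (intro mult_mono) (auto simp: real_norm_def)
 moreover have "\<bar>2 * R1 x * A n x * (real n * ?r x * dB n x)\<bar> <= 2 * K2 * 1 * 3"
 unfolding abs_mult[of _ "real n * ?r x * dB n x"] abs_mult[of _ "A n x"] abs_mult[of 2] using K2 t AB1[of n x] p by (intro mult_mono) (auto simp: real_norm_def)
 ultimately show ?thesis unfolding Esum by linarith
 qed
 have limA: "(%n. A n x) ---> 1" "(%n. B n x) ---> 1" "(%n. real n * snd x * dA n x) ---> 0" "(%n. real n * ?r x * dB n x) ---> 0" if "x \<in> Hp" for x
 unfolding A_def B_def dA_def dB_def using pos[OF that] by (auto intro: step_limits)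
 have "(%n. LINT x:Hp|lebesgue. u x * (E1 n x + E2 n x)) ---> (LINT x:Hp|lebesgue. u x * dv x)"
 proof (rule L2_on_dominated_limit[OF u _ cdv bE])
 show "continuous_on Kp (%x. E1 n x + E2 n x)" for n by (intro continuous_intros cE)
 fix x assume x: "x \<in> Hp"
 have "(%n. E1 n x + E2 n x) ---> dv x * (1 * 1) + R2 x * 0 * 1 - 2 * R1 x * 1 * 0"
 unfolding Esum by (intro tendsto_intros limA x)
 then show "(%n. E1 n x + E2 n x) ---> dv x" by simp
 qed
 moreover have "(%n. LINT x:Hp|lebesgue. w x * (Y x * (A n x * B n x))) ---> (LINT x:Hp|lebesgue. w x * Y x)"
 if w: "L2_on Hp w" and Y: "continuous_on Kp Y" "!!x. x \<in> Kp ==> norm (Y x) <= K" "K \<ge> 0" for w Y K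
 proof (rule L2_on_dominated_limit[OF w _ Y(1)])
 show "continuous_on Kp (%x. Y x * (A n x * B n x))" for n by (intro continuous_intros cAB Y)
 fix x assume x: "x \<in> Hp"
 show "\<bar>Y x * (A n x * B n x)\<bar> <= K * 1" for n
 unfolding abs_mult using Y AB1[of n x] pos[OF x] by (intro mult_mono mult_le_one) (auto simp: real_norm_def)
 have "(%n. Y x * (A n x * B n x)) ---> Y x * (1 * 1)" by (intro tendsto_intros limA x)
 then show "(%n. Y x * (A n x * B n x)) ---> Y x" by simp
 qed
 from this[OF g12(1) cX(1) K4(2,1)] this[OF g12(2) cX(2) K5(2,1)]
 have "(%n. LINT x:Hp|lebesgue. u x * (E1 n x + E2 n x)) ---> - ((LINT x:Hp|lebesgue. ?g1 x * X1 x) + (LINT x:Hp|lebesgue. ?g2 x * X2 x))"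
 unfolding eqn by (intro tendsto_intros)
 ultimately have "(LINT x:Hp|lebesgue. u x * dv x) = - ((LINT x:Hp|lebesgue. ?g1 x * X1 x) + (LINT x:Hp|lebesgue. ?g2 x * X2 x))"
 by (rule LIMSEQ_unique)
 also have "(LINT x:Hp|lebesgue. ?g1 x * X1 x) + (LINT x:Hp|lebesgue. ?g2 x * X2 x) = (LINT x:Hp|lebesgue. ?g1 x * X1 x + ?g2 x * X2 x)"
 by (rule set_integral_add(2)[OF ig1[OF cX(1)] ig2[OF cX(2)], symmetric])
 also have "... = (LINT x:Hp|lebesgue. G x \<bullet> (X1 x, X2 x))" by (simp add: inner_prod_def)
 finally show ?thesis by (simp add: dv_def)
qed

section \<open>Regularised Neumann function by the method of images\<close>

definition qd :: "real => real => real => real => real \<times> real => real" where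
 "qd k c a b x = k * ((fst x)^2 + (snd x)^2) - 2 * (a * fst x + b * snd x) + c"

text \<open>k times \<open>qd\<close> is a sum of two squares plus k c - a^2 - b^2. With q = a^2 +
  b^2 + rh^2, the choice (k, c) = (1, q) is the smeared squared distance to the pole and (q, 1) its
  counterpart for the inverted pole; the surplus is rh^2 in both cases.\<close>

lemma qd_pos:
 assumes "0 < k" "a^2 + b^2 < k * c"
 shows "0 < qd k c a b x"
proof -
 have "k * qd k c a b x = (k * fst x - a)^2 + (k * snd x - b)^2 + (k * c - a^2 - b^2)"
 by (simp add: qd_def power2_eq_square algebra_simps)
 also have "... > 0" using assms(2) by (intro add_nonneg_pos add_nonneg_nonneg) auto
 finally show ?thesis using assms(1) by (simp add: zero_less_mult_iff)
qed

lemma qd_has_derivative: "(qd k c a b has_derivative (%h. (2 * (k * fst x - a), 2 * (k * snd x - b)) \<bullet> h)) (at x)"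
 unfolding qd_def[abs_def] by (auto intro!: derivative_eq_intros simp: inner_prod_def algebra_simps)

lemma continuous_qd [continuous_intros]: "continuous_on S (qd k c a b)"
 unfolding qd_def[abs_def] by (intro continuous_intros)

lemma Ck_qd: "Ck m (qd k c a b)"
proof -
 note f = Ck_linear[OF bounded_linear_fst, of m] and s = Ck_linear[OF bounded_linear_snd, of m]
 have "Ck m (%x::real\<times>real. (fst x * fst x + snd x * snd x) * k + (fst x * (- 2 * a) + (snd x * (- 2 * b) + c)))"
 by (intro Ck_add Ck_scale Ck_mult f s Ck_const)
 then show ?thesis by (simp add: qd_def[abs_def] power2_eq_square algebra_simps)
qed

text \<open>Half the gradient of the logarithm of \<open>qd\<close>; \<open>qhess1\<close> and
  \<open>qhess2\<close> are the gradients of its two components.\<close>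

definition qgrad :: "real => real => real => real => real \<times> real => real \<times> real" where
 "qgrad k c a b x = ((k * fst x - a) / qd k c a b x, (k * snd x - b) / qd k c a b x)"

definition qhess1 :: "real => real => real => real => real \<times> real => real \<times> real" where
 "qhess1 k c a b x = (k / qd k c a b x - 2 * (k * fst x - a)^2 / (qd k c a b x)^2, - 2 * (k * fst x - a) * (k * snd x - b) / (qd k c a b x)^2)"

definition qhess2 :: "real => real => real => real => real \<times> real => real \<times> real" where
 "qhess2 k c a b x = (- 2 * (k * fst x - a) * (k * snd x - b) / (qd k c a b x)^2, k / qd k c a b x - 2 * (k * snd x - b)^2 / (qd k c a b x)^2)"

text \<open>The last identity is half the Laplacian of ln \<open>qd\<close>. With surplus rh^2 it is
  a bump that concentrates at the pole as rh tends to 0.\<close>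

lemma qgrad_props:
 assumes "0 < k" "a^2 + b^2 < k * c"
 shows "((%x. ln (qd k c a b x)) has_derivative (%h. (2 *\<^sub>R qgrad k c a b x) \<bullet> h)) (at x)"
 "((%x. fst (qgrad k c a b x)) has_derivative (%h. qhess1 k c a b x \<bullet> h)) (at x)"
 "((%x. snd (qgrad k c a b x)) has_derivative (%h. qhess2 k c a b x \<bullet> h)) (at x)"
 "Ck m (%x. fst (qgrad k c a b x))" "Ck m (%x. snd (qgrad k c a b x))"
 "continuous_on S (qgrad k c a b)" "continuous_on S (qhess1 k c a b)" "continuous_on S (qhess2 k c a b)"
 "fst (qhess1 k c a b x) + snd (qhess2 k c a b x) = 2 * (k * c - a^2 - b^2) / (qd k c a b x)^2"
proof -
 note p = qd_pos[OF assms]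
 have nz: "qd k c a b x \<noteq> 0" for x using p[of x] by simp
 show "((%x. ln (qd k c a b x)) has_derivative (%h. (2 *\<^sub>R qgrad k c a b x) \<bullet> h)) (at x)"
 using has_derivative_ln[OF p qd_has_derivative]
 by (rule has_derivative_eq_rhs) (simp add: fun_eq_iff inner_prod_def qgrad_def divide_inverse algebra_simps)
 show "((%x. fst (qgrad k c a b x)) has_derivative (%h. qhess1 k c a b x \<bullet> h)) (at x)"
 unfolding qgrad_def fst_conv
 by (rule has_derivative_eq_rhs[OF has_derivative_divide'[OF _ qd_has_derivative nz]], auto intro!: derivative_eq_intros)
 (auto simp: fun_eq_iff inner_prod_def qhess1_def divide_simps nz power2_eq_square algebra_simps)
 show "((%x. snd (qgrad k c a b x)) has_derivative (%h. qhess2 k c a b x \<bullet> h)) (at x)"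
 unfolding qgrad_def snd_conv
 by (rule has_derivative_eq_rhs[OF has_derivative_divide'[OF _ qd_has_derivative nz]], auto intro!: derivative_eq_intros)
 (auto simp: fun_eq_iff inner_prod_def qhess2_def divide_simps nz power2_eq_square algebra_simps)
 note f = Ck_linear[OF bounded_linear_fst, of m] and s = Ck_linear[OF bounded_linear_snd, of m] and i = Ck_inverse[OF nz Ck_qd, of m]
 show "Ck m (%x. fst (qgrad k c a b x))"
 using Ck_mult[OF Ck_add[OF Ck_scale[OF f, of k] Ck_const[of m "- a"]] i] by (simp add: qgrad_def divide_inverse mult.commute)
 show "Ck m (%x. snd (qgrad k c a b x))"
 using Ck_mult[OF Ck_add[OF Ck_scale[OF s, of k] Ck_const[of m "- b"]] i] by (simp add: qgrad_def divide_inverse mult.commute)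
 show "continuous_on S (qgrad k c a b)" "continuous_on S (qhess1 k c a b)" "continuous_on S (qhess2 k c a b)"
 unfolding qgrad_def[abs_def] qhess1_def[abs_def] qhess2_def[abs_def]
 by (auto intro!: continuous_intros simp: nz)
 have "k * qd k c a b x = (k * fst x - a)^2 + (k * snd x - b)^2 + (k * c - a^2 - b^2)"
 by (simp add: qd_def power2_eq_square algebra_simps)
 moreover have "k / qd k c a b x = k * qd k c a b x / (qd k c a b x)^2" using nz by (simp add: power2_eq_square)
 ultimately have "2 * (k / qd k c a b x) = 2 * ((k * fst x - a)^2 + (k * snd x - b)^2 + (k * c - a^2 - b^2)) / (qd k c a b x)^2" by simp
 then show "fst (qhess1 k c a b x) + snd (qhess2 k c a b x) = 2 * (k * c - a^2 - b^2) / (qd k c a b x)^2"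
 by (simp add: qhess1_def qhess2_def add_divide_distrib diff_divide_distrib algebra_simps)
qed

text \<open>The sum over the pole \<open>(a, b)\<close>, its reflection in the axis, and the reflections of both in the unit circle;
 each pole is smeared out on the scale \<open>rh\<close>.\<close>
definition images :: "real => real => real => (real => real => real => real => 'v::ab_group_add) => 'v" where
 "images a b rh f = (let kq = a^2 + b^2 + rh^2 in f 1 kq a b + f 1 kq a (- b) + f kq 1 a b + f kq 1 a (- b))"

lemma images_args:
 fixes a b rh kq :: real
 assumes "0 < rh" "kq = a^2 + b^2 + rh^2"
 shows "0 < kq" "a^2 + b^2 < 1 * kq" "a^2 + (- b)^2 < 1 * kq" "a^2 + b^2 < kq * 1" "a^2 + (- b)^2 < kq * 1"
proof -
 have "0 < rh^2" using assms(1) by simp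
 then show "0 < kq" "a^2 + b^2 < 1 * kq" "a^2 + (- b)^2 < 1 * kq" "a^2 + b^2 < kq * 1" "a^2 + (- b)^2 < kq * 1"
 unfolding assms(2) using add_nonneg_pos[of "a^2 + b^2" "rh^2"] by simp_all
qed

text \<open>The four terms share the value rh^2 of k c - a^2 - b^2; handing it to the terms turns
  their Laplacians into the summands of \<open>sdelta\<close>.\<close>

lemma images_cong:
 assumes "0 < rh" "!!k c a b. 0 < k ==> a^2 + b^2 < k * c ==> k * c - a^2 - b^2 = rh^2 ==> f k c a b = h k c a b"
 shows "images a b rh f = images a b rh h"
proof -
 have "f 1 (a^2 + b^2 + rh^2) a b' = h 1 (a^2 + b^2 + rh^2) a b'" "f (a^2 + b^2 + rh^2) 1 a b' = h (a^2 + b^2 + rh^2) 1 a b'" if "b' = b \<or> b' = - b" for b'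
 using images_args[OF assms(1) refl, of a b] that by (auto intro!: assms(2))
 then show ?thesis by (simp add: images_def Let_def)
qed

lemma images_closed:
 assumes "0 < rh" and f: "!!k c a b. 0 < k ==> a^2 + b^2 < k * c ==> P (f k c a b)" and add: "!!u v. P u ==> P v ==> P (%x. u x + v x)"
 shows "P (%x. images a b rh (%k c a b. f k c a b x))"
 unfolding images_def Let_def by (intro add f images_args[OF assms(1) refl, of a b] zero_less_one)

lemma images_has_derivative:
 fixes f :: "real => real => real => real => real \<times> real => real"
 assumes "0 < rh" and f: "!!k c a b. 0 < k ==> a^2 + b^2 < k * c ==> (f k c a b has_derivative (%h. D k c a b \<bullet> h)) (at x)"
 shows "((%x. images a b rh (%k c a b. f k c a b x)) has_derivative (%h. images a b rh D \<bullet> h)) (at x)"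
 unfolding images_def Let_def inner_add_left by (intro has_derivative_add f images_args[OF assms(1) refl, of a b] zero_less_one)

lemma images_linear:
 "fst (images a b rh F) = images a b rh (%k c a b. fst (F k c a b))" "snd (images a b rh F) = images a b rh (%k c a b. snd (F k c a b))"
 "images a b rh (%k c a b. f k c a b + h k c a b) = images a b rh f + images a b rh h"
 "images a b rh (%k c a b. r *\<^sub>R w k c a b) = r *\<^sub>R (images a b rh w :: 'w::real_vector)"
 by (simp_all add: images_def Let_def algebra_simps)

text \<open>The quadratic term spreads a constant source 2/pi over the half disc, whose area is
  pi/2. It balances the unit source at the pole, as the solvability of a Neumann problem demands:
  the Laplacian of \<open>nkern\<close> is 2/pi - \<open>sdelta\<close>.\<close>

definition nkern :: "real => real => real => real \<times> real => real" where
 "nkern a b rh x = - images a b rh (%k c a b. ln (qd k c a b x)) / (4 * pi) + ((fst x)^2 + (snd x)^2) / (2 * pi)"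

definition nfield :: "real => real => real => real \<times> real => real \<times> real" where
 "nfield a b rh x = (- 1 / (2 * pi)) *\<^sub>R images a b rh (%k c a b. qgrad k c a b x) + (1 / pi) *\<^sub>R x"

definition sdelta :: "real => real => real => real \<times> real => real" where
 "sdelta a b rh x = images a b rh (%k c a b. rh^2 / (qd k c a b x)^2) / pi"

lemma C1_nkern:
 assumes "0 < rh"
 shows "C1_fun (nkern a b rh) (nfield a b rh)"
 unfolding C1_fun_def
proof (intro conjI allI)
 fix x
 have sq: "((%x. (fst x)^2 + (snd x)^2) has_derivative (%h. 2 * (x \<bullet> h))) (at x)"
 by (auto intro!: derivative_eq_intros simp: inner_prod_def algebra_simps)
 have "nkern a b rh = (%x. images a b rh (%k c a b. ln (qd k c a b x)) * (- 1 / (4 * pi)) + ((fst x)^2 + (snd x)^2) * (1 / (2 * pi)))"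
 by (simp add: fun_eq_iff nkern_def)
 moreover have "(... has_derivative (%h. (images a b rh (%k c a b. 2 *\<^sub>R qgrad k c a b x) \<bullet> h) * (- 1 / (4 * pi)) + (2 * (x \<bullet> h)) * (1 / (2 * pi)))) (at x)"
 by (intro has_derivative_add has_derivative_mult_left images_has_derivative[OF assms] qgrad_props sq)
 moreover have "(%h. (images a b rh (%k c a b. 2 *\<^sub>R qgrad k c a b x) \<bullet> h) * (- 1 / (4 * pi)) + (2 * (x \<bullet> h)) * (1 / (2 * pi))) = (%h. nfield a b rh x \<bullet> h)"
 by (simp add: fun_eq_iff nfield_def images_linear inner_diff_left)
 ultimately show "(nkern a b rh has_derivative (%h. nfield a b rh x \<bullet> h)) (at x)"
 by (simp only:)
 show "continuous_on UNIV (nfield a b rh)"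
 unfolding nfield_def[abs_def]
 by (intro continuous_on_add continuous_on_scaleR continuous_on_const continuous_on_id images_closed[OF assms, of "continuous_on UNIV"] qgrad_props)
qed

text \<open>The sources at (a, b) and (a, -b) are mirror images. Their quadratics differ by 4 b
  times the height, so the vertical components add up to a multiple of the height.\<close>

lemma nfield_flat_factor:
 assumes rh: "0 < rh"
 obtains R2 where "continuous_on UNIV R2" "!!x. snd (nfield a b rh x) = snd x * R2 x"
proof
 define kq where "kq = a^2 + b^2 + rh^2"
 note A = images_args[OF rh kq_def]
 define S where "S k c x = (2 * k * qd k c a b x + 4 * b * (k * snd x - b)) / (qd k c a b x * qd k c a (- b) x)" for k c x
 note q1 = qd_pos[OF zero_less_one A(2)] and q2 = qd_pos[OF zero_less_one A(3)] and q3 = qd_pos[OF A(1,4)] and q4 = qd_pos[OF A(1,5)]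
 have e: "snd (qgrad k c a b x) + snd (qgrad k c a (- b) x) = snd x * S k c x" if "0 < qd k c a b x" "0 < qd k c a (- b) x" for k c x
 proof -
 have q: "qd k c a (- b) x = qd k c a b x + 4 * b * snd x" by (simp add: qd_def)
 show ?thesis using that unfolding q by (simp add: qgrad_def S_def q divide_simps) (simp add: algebra_simps)
 qed
 show "continuous_on UNIV (%x. - (S 1 kq x + S kq 1 x) / (2 * pi) + 1 / pi)"
 unfolding S_def using q1 q2 q3 q4 by (intro continuous_intros) (auto simp: less_imp_neq[symmetric] dest: less_imp_neq)
 show "snd (nfield a b rh x) = snd x * (- (S 1 kq x + S kq 1 x) / (2 * pi) + 1 / pi)" for x
 proof -
 have "snd (images a b rh (%k c a b. qgrad k c a b x)) = snd x * (S 1 kq x + S kq 1 x)"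
 using e[OF q1 q2, of x] e[OF q3 q4, of x] by (simp add: images_def kq_def[symmetric] distrib_left)
 moreover have "snd (nfield a b rh x) = - 1 / (2 * pi) * snd (images a b rh (%k c a b. qgrad k c a b x)) + 1 / pi * snd x"
 by (simp add: nfield_def)
 moreover have "- 1 / (2 * pi) * (y * P) + 1 / pi * y = y * (- P / (2 * pi) + 1 / pi)" for y P :: real
 by (simp add: field_simps)
 ultimately show ?thesis by (simp only:)
 qed
qed

text \<open>On the unit circle the radial components of a pole and of its inversion have sum 1. The
  two pairs give 2, which the term x / pi cancels: -2 / (2 pi) + 1 / pi = 0. What remains contains
  the factor 1 - |x|^2.\<close>

lemma nfield_arc_factor:
 assumes rh: "0 < rh"
 obtains R1 where "continuous_on UNIV R1"
 "!!x. fst x * fst (nfield a b rh x) + snd x * snd (nfield a b rh x) = (1 - ((fst x)^2 + (snd x)^2)) * R1 x"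
proof
 define kq where "kq = a^2 + b^2 + rh^2"
 note A = images_args[OF rh kq_def]
 note q1 = qd_pos[OF zero_less_one A(2)] and q2 = qd_pos[OF zero_less_one A(3)] and q3 = qd_pos[OF A(1,4)] and q4 = qd_pos[OF A(1,5)]
 define T where "T b x = ((a * fst x + b * snd x) * (1 + kq) - kq * (1 + ((fst x)^2 + (snd x)^2))) / (qd 1 kq a b x * qd kq 1 a b x)" for b x
 have e: "(fst x * fst (qgrad 1 kq a b x) + snd x * snd (qgrad 1 kq a b x)) + (fst x * fst (qgrad kq 1 a b x) + snd x * snd (qgrad kq 1 a b x))
 = 1 + (1 - ((fst x)^2 + (snd x)^2)) * T b x" if "0 < qd 1 kq a b x" "0 < qd kq 1 a b x" for b x
 proof -
 define s \<beta> where "s = (fst x)^2 + (snd x)^2" and "\<beta> = a * fst x + b * snd x"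
 have q: "qd 1 kq a b x = s - 2 * \<beta> + kq" "qd kq 1 a b x = kq * s - 2 * \<beta> + 1" by (simp_all add: qd_def s_def \<beta>_def)
 have g: "fst x * fst (qgrad k c a b x) + snd x * snd (qgrad k c a b x) = (k * s - \<beta>) / qd k c a b x" for k c
 by (simp add: qgrad_def s_def \<beta>_def power2_eq_square algebra_simps add_divide_distrib diff_divide_distrib)
 show ?thesis unfolding g T_def s_def[symmetric] \<beta>_def[symmetric] using that unfolding q
 by (simp add: divide_simps) (simp add: algebra_simps)
 qed
 have nz: "qd 1 kq a b x * qd kq 1 a b x \<noteq> 0" "qd 1 kq a (- b) x * qd kq 1 a (- b) x \<noteq> 0" for x
 using q1[of x] q2[of x] q3[of x] q4[of x] by auto
 have "continuous_on UNIV (T b)" "continuous_on UNIV (T (- b))"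
 unfolding T_def[abs_def] by (rule continuous_on_divide; use nz in \<open>auto intro!: continuous_intros\<close>)+
 then show "continuous_on UNIV (%x. - (T b x + T (- b) x) / (2 * pi) - 1 / pi)"
 by (intro continuous_intros) auto
 show "fst x * fst (nfield a b rh x) + snd x * snd (nfield a b rh x)
 = (1 - ((fst x)^2 + (snd x)^2)) * (- (T b x + T (- b) x) / (2 * pi) - 1 / pi)" for x
 proof -
 define s where "s = (fst x)^2 + (snd x)^2"
 let ?I = "images a b rh (%k c a b. qgrad k c a b x)"
 have I: "fst x * fst ?I + snd x * snd ?I = 2 + (1 - s) * (T b x + T (- b) x)"
 using e[OF q1 q3, of x] e[OF q2 q4, of x] by (simp add: images_def kq_def[symmetric] s_def[symmetric] distrib_left)
 have "fst (nfield a b rh x) = - 1 / (2 * pi) * fst ?I + 1 / pi * fst x" "snd (nfield a b rh x) = - 1 / (2 * pi) * snd ?I + 1 / pi * snd x"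
 by (simp_all add: nfield_def)
 moreover have "y1 * (- 1 / (2 * pi) * p + 1 / pi * y1) + y2 * (- 1 / (2 * pi) * q + 1 / pi * y2) = - (y1 * p + y2 * q) / (2 * pi) + (y1^2 + y2^2) / pi" for y1 y2 p q
 by (simp add: field_simps power2_eq_square)
 moreover have "- (2 + (1 - r) * y) / (2 * pi) + r / pi = (1 - r) * (- y / (2 * pi) - 1 / pi)" for r y
 by (simp add: field_simps)
 ultimately show ?thesis unfolding s_def[symmetric] by (simp only: I s_def[symmetric])
 qed
qed

lemma nfield_by_parts:
 assumes W: "W12_on Hp u G" and rh: "0 < rh"
 shows "(LINT x:Hp|lebesgue. u x * (2 / pi - sdelta a b rh x)) = - (LINT x:Hp|lebesgue. G x \<bullet> nfield a b rh x)"
proof -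
 obtain R1 where R1: "continuous_on UNIV R1"
 "!!x. fst x * fst (nfield a b rh x) + snd x * snd (nfield a b rh x) = (1 - ((fst x)^2 + (snd x)^2)) * R1 x"
 using nfield_arc_factor[OF rh] by blast
 obtain R2 where R2: "continuous_on UNIV R2" "!!x. snd (nfield a b rh x) = snd x * R2 x"
 using nfield_flat_factor[OF rh] by blast
 let ?D1 = "%x. (- 1 / (2 * pi)) *\<^sub>R images a b rh (%k c a b. qhess1 k c a b x) + (1 / pi) *\<^sub>R (1, 0)"
 let ?D2 = "%x. (- 1 / (2 * pi)) *\<^sub>R images a b rh (%k c a b. qhess2 k c a b x) + (1 / pi) *\<^sub>R (0, 1)"
 have X: "fst (nfield a b rh x) = images a b rh (%k c a b. fst (qgrad k c a b x)) * (- 1 / (2 * pi)) + fst x * (1 / pi)"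
 "snd (nfield a b rh x) = images a b rh (%k c a b. snd (qgrad k c a b x)) * (- 1 / (2 * pi)) + snd x * (1 / pi)" for x
 by (simp_all add: nfield_def images_linear)
 have "(LINT x:Hp|lebesgue. u x * (fst (?D1 x) + snd (?D2 x))) = - (LINT x:Hp|lebesgue. G x \<bullet> (fst (nfield a b rh x), snd (nfield a b rh x)))"
 proof (rule tangential_field_by_parts[OF W _ _ _ _ _ _ R1(1) R2(1) R2(2) R1(2)])
 show "Ck k (%x. fst (nfield a b rh x))" for k
 unfolding X by (intro Ck_add[OF Ck_scale Ck_scale[OF Ck_linear[OF bounded_linear_fst]]] images_closed[OF rh, of "Ck k"] Ck_add qgrad_props)
 show "Ck k (%x. snd (nfield a b rh x))" for k
 unfolding X by (intro Ck_add[OF Ck_scale Ck_scale[OF Ck_linear[OF bounded_linear_snd]]] images_closed[OF rh, of "Ck k"] Ck_add qgrad_props)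
 show "((%x. fst (nfield a b rh x)) has_derivative (%h. ?D1 x \<bullet> h)) (at x)" for x
 unfolding X by (rule has_derivative_eq_rhs, rule has_derivative_add[OF has_derivative_mult_left[OF images_has_derivative[OF rh qgrad_props(2)]]
 has_derivative_mult_left[OF has_derivative_fst[OF has_derivative_ident]]]) (auto simp: fun_eq_iff inner_add_left inner_diff_left)
 show "((%x. snd (nfield a b rh x)) has_derivative (%h. ?D2 x \<bullet> h)) (at x)" for x
 unfolding X by (rule has_derivative_eq_rhs, rule has_derivative_add[OF has_derivative_mult_left[OF images_has_derivative[OF rh qgrad_props(3)]]
 has_derivative_mult_left[OF has_derivative_snd[OF has_derivative_ident]]]) (auto simp: fun_eq_iff inner_add_left inner_diff_left)
 show "continuous_on UNIV ?D1"
 by (intro continuous_on_add continuous_on_scaleR continuous_on_const images_closed[OF rh, of "continuous_on UNIV"] qgrad_props)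
 show "continuous_on UNIV ?D2"
 by (intro continuous_on_add continuous_on_scaleR continuous_on_const images_closed[OF rh, of "continuous_on UNIV"] qgrad_props)
 qed
 moreover have "fst (?D1 x) + snd (?D2 x) = 2 / pi - sdelta a b rh x" for x
 proof -
 have "fst (?D1 x) + snd (?D2 x) = 2 / pi - images a b rh (%k c a b. fst (qhess1 k c a b x) + snd (qhess2 k c a b x)) / (2 * pi)"
 by (simp add: images_linear add_divide_distrib)
 also have "images a b rh (%k c a b. fst (qhess1 k c a b x) + snd (qhess2 k c a b x)) = images a b rh (%k c a b. 2 *\<^sub>R (rh^2 / (qd k c a b x)^2))"
 by (rule images_cong[OF rh]) (simp add: qgrad_props(9))
 also have "... = 2 *\<^sub>R images a b rh (%k c a b. rh^2 / (qd k c a b x)^2)" by (rule images_linear(4))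
 finally show ?thesis by (simp add: sdelta_def)
 qed
 ultimately show ?thesis by simp
qed

lemma continuous_sdelta: "0 < rh ==> continuous_on S (sdelta a b rh)"
proof -
 assume rh: "0 < rh"
 have "continuous_on S (%x. r / (qd k c a b x)^2)" if "0 < k" "a^2 + b^2 < k * c" for k c a b r
 using qd_pos[OF that] by (intro continuous_intros) (auto simp: less_imp_neq[symmetric])
 then have "continuous_on S (%x. images a b rh (%k c a b. rh^2 / (qd k c a b x)^2))"
 by (intro images_closed[OF rh, where P="continuous_on S" and f="%k c a b x. rh^2 / (qd k c a b x)^2"] continuous_on_add)
 then show ?thesis unfolding sdelta_def[abs_def] by (rule continuous_on_divide[OF _ continuous_on_const]) simp
qed

lemma sdelta_nonneg: "0 <= sdelta a b rh x"
 by (simp add: sdelta_def images_def Let_def)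

text \<open>Integration by parts with the constant function 1, whose gradient is 0: the mass of
  \<open>sdelta\<close> equals that of the constant 2/pi over an area of pi/2. The four terms need
  not be integrated one by one.\<close>

lemma integral_sdelta:
 assumes rh: "0 < rh"
 shows "(LINT x:Hp|lebesgue. sdelta a b rh x) = 1"
proof -
 have "W12_on Hp (%_. 1) (%_. 0)"
 by (rule W12_on_limit[where v="%_ _. 1" and Dv="%_ _. 0"])
 (auto simp: C1_fun_def W12_dist_sq_def zero_prod_def[symmetric] intro!: L2_on_continuous continuous_intros)
 from nfield_by_parts[OF this rh]
 have "(LINT x:Hp|lebesgue. 1 * (2 / pi) - 1 * sdelta a b rh x) = 0" by (simp add: set_lebesgue_integral_def)
 moreover have i: "set_integrable lebesgue Hp (%x. 1 * f x)" if "continuous_on Kp f" for f :: "_ => real"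
 by (rule L2_on_integrable_bounded[OF L2_on_continuous that]) (rule continuous_on_const)
 ultimately have "(LINT x:Hp|lebesgue. 1 * sdelta a b rh x) = (LINT x:Hp|lebesgue. 1 * (2 / pi))"
 by (subst (asm) set_integral_diff(2)[OF i i]) (auto intro!: continuous_sdelta rh continuous_on_const)
 also have "... = (LBINT x:Hp. 1 * (2 / pi))"
 by (intro set_lebesgue_integral_lebesgue indicator_Hp_measurable continuous_on_const)
 also have "... = (LBINT x:Hp. 2 * (1 / pi + (norm x)^2 * 0))" by simp
 also have "... = pi * (1 / pi)"
 by (rule integral_radial(1)[of "%_. 1 / pi" "%_. 0"]) (auto intro!: derivative_eq_intros)
 finally show ?thesis by simp
qed

text \<open>Cauchy-Schwarz: seen from |x| < 1 an inverted pole stays at a distance governed by 1 -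
  |(a, b)|, uniformly in rh.\<close>

lemma qd_image_lower:
 assumes p: "a^2 + b^2 < 1" and x: "norm x < 1"
 shows "(1 - sqrt (a^2 + b^2))^2 <= qd (a^2 + b^2 + rh^2) 1 a b x"
proof -
 define n where "n = sqrt (a^2 + b^2)"
 have n: "0 <= n" "n < 1" "n^2 = a^2 + b^2" using p by (auto simp: n_def real_sqrt_less_iff[of _ 1, simplified])
 have s: "(fst x)^2 + (snd x)^2 = (norm x)^2" by (cases x) (simp add: norm_Pair)
 have "(a, b) \<bullet> x <= norm (a, b) * norm x" by (rule norm_cauchy_schwarz)
 then have cs: "a * fst x + b * snd x <= n * norm x" by (cases x) (simp add: n_def norm_Pair)
 have "n * norm x <= n * 1" using n x by (intro mult_left_mono) auto
 then have "(1 - n)^2 <= (1 - n * norm x)^2" using n by (intro power_mono) auto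
 also have "... = n^2 * (norm x)^2 - 2 * (n * norm x) + 1" by (simp add: power2_eq_square algebra_simps)
 also have "... <= (n^2 + rh^2) * (norm x)^2 - 2 * (a * fst x + b * snd x) + 1"
 proof -
 have "0 <= rh^2 * (norm x)^2" by simp
 moreover have "A - 2 * B + 1 <= A + R - 2 * C + 1" if "0 <= R" "C <= B" for A B C R :: real
 using that by linarith
 ultimately show ?thesis using cs unfolding distrib_right by blast
 qed
 finally have "(1 - n)^2 <= (a^2 + b^2 + rh^2) * (norm x)^2 - 2 * (a * fst x + b * snd x) + 1" unfolding n(3) .
 then show ?thesis unfolding qd_def s n_def .
qed

lemma sdelta_away:
 assumes p: "(a, b) \<in> Hp" and hq: "0 < hq"
 obtains m where "0 < m" "!!x rh. x \<in> Hp ==> hq <= dist x (a, b) ==> sdelta a b rh x <= m * rh^2"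
proof
 have ab: "0 < b" "a^2 + b^2 < 1" using p by (auto simp: mem_Hp)
 define m where "m = Min {hq\<^sup>2, b^2, (1 - sqrt (a^2 + b^2))^2}"
 have sq: "sqrt (a^2 + b^2) < 1" using ab by (simp add: real_sqrt_less_iff[of _ 1, simplified])
 have m: "0 < m" using ab hq sq by (simp add: m_def)
 then show "0 < 4 / (pi * m^2)" by simp
 have mm: "m <= hq^2" "m <= b^2" "m <= (1 - sqrt (a^2 + b^2))^2" by (simp_all add: m_def)
 fix x rh assume x: "x \<in> Hp" "hq <= dist x (a, b)"
 define kq where "kq = a^2 + b^2 + rh^2"
 have nx: "norm x < 1" "0 < snd x" using Hp_bounds[OF x(1)] by auto
 have d: "qd 1 kq a b' x = (fst x - a)^2 + (snd x - b')^2 + rh^2" if "b'^2 = b^2" for b'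
 using that by (simp add: qd_def kq_def power2_eq_square algebra_simps)
 have "hq^2 <= (dist x (a, b))^2" using x hq by (intro power_mono) auto
 also have "... = (fst x - a)^2 + (snd x - b)^2" by (cases x) (simp add: dist_Pair_Pair dist_real_def)
 finally have q1: "m <= qd 1 kq a b x" unfolding d[OF refl] using zero_le_power2[of rh] mm(1) by linarith
 have "b^2 <= (snd x + b)^2" using nx ab by (intro power_mono) auto
 then have q2: "m <= qd 1 kq a (- b) x" using mm(2) by (subst d) (auto intro!: order_trans[OF _ add_increasing2[OF zero_le_power2]] order_trans[OF _ add_increasing[OF zero_le_power2]])
 have q34: "m <= qd kq 1 a b x" "m <= qd kq 1 a (- b) x"
 using qd_image_lower[OF ab(2) nx(1), of rh] qd_image_lower[of a "- b" x rh] ab nx mm(3) by (simp_all add: kq_def)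
 have b: "rh^2 / (qd k c a' b' x)^2 <= rh^2 / m^2" if "m <= qd k c a' b' x" for k c a' b'
 using that m by (intro divide_left_mono power_mono mult_pos_pos zero_less_power) auto
 have "sdelta a b rh x <= (rh^2 / m^2 + rh^2 / m^2 + rh^2 / m^2 + rh^2 / m^2) / pi"
 unfolding sdelta_def images_def Let_def kq_def[symmetric] by (intro divide_right_mono add_mono b q1 q2 q34) auto
 then show "sdelta a b rh x <= 4 / (pi * m^2) * rh^2" by (simp add: field_simps)
qed

text \<open>An approximate identity. Near the pole the continuity of u is used together with the
  unit mass; away from it \<open>sdelta\<close> is O(rh^2) uniformly, so only the integral of |u - u
  (a, b)| enters.\<close>

lemma sdelta_tendsto:
 assumes u: "L2_on Hp u" and p: "(a, b) \<in> Hp" and c: "isCont u (a, b)"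
 shows "(%n. LINT x:Hp|lebesgue. u x * sdelta a b (hs n) x) ---> u (a, b)"
proof (rule LIMSEQ_I)
 fix e :: real assume e: "0 < e"
 then have e2: "0 < e / 2" by simp
 obtain hq where hq: "0 < hq" "!!x. dist x (a, b) < hq ==> dist (u x) (u (a, b)) < e / 2"
 using c e2 unfolding continuous_at_eps_delta by blast
 obtain m where m: "0 < m" "!!x rh. x \<in> Hp ==> hq <= dist x (a, b) ==> sdelta a b rh x <= m * rh^2"
 using sdelta_away[OF p hq(1)] by blast
 have one: "L2_on Hp (%x. 1::real)" by (intro L2_on_continuous continuous_on_const)
 have i: "set_integrable lebesgue Hp (%x. (u x - u (a, b)) * k x)" if "continuous_on Kp k" for k
 using set_integral_diff(1)[OF L2_on_integrable_bounded[OF u that] L2_on_integrable_bounded[OF one continuous_on_mult_left[OF that]], of "u (a, b)"]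
 by (simp add: left_diff_distrib)
 define N where "N = (LINT x:Hp|lebesgue. \<bar>u x - u (a, b)\<bar>)"
 have iN: "set_integrable lebesgue Hp (%x. \<bar>u x - u (a, b)\<bar>)"
 using set_integrable_abs[OF i[OF continuous_on_const[of _ 1]]] by simp
 have bound: "\<bar>(LINT x:Hp|lebesgue. u x * sdelta a b rh x) - u (a, b)\<bar> <= e / 2 + m * rh^2 * N" if rh: "0 < rh" for rh
 proof -
 let ?P = "sdelta a b rh"
 have cP: "continuous_on Kp ?P" by (rule continuous_sdelta[OF rh])
 have iP: "set_integrable lebesgue Hp ?P" using L2_on_integrable_bounded[OF one cP] by simp
 have "(LINT x:Hp|lebesgue. u x * ?P x) - u (a, b) = (LINT x:Hp|lebesgue. u x * ?P x) - (LINT x:Hp|lebesgue. u (a, b) * ?P x)"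
 by (simp add: integral_sdelta[OF rh])
 also have "... = (LINT x:Hp|lebesgue. (u x - u (a, b)) * ?P x)"
 unfolding left_diff_distrib
 by (rule set_integral_diff(2)[symmetric, OF L2_on_integrable_bounded[OF u cP]]) (simp add: iP)
 also have "\<bar>...\<bar> <= (LINT x:Hp|lebesgue. \<bar>(u x - u (a, b)) * ?P x\<bar>)"
 using set_integral_norm_bound[OF i[OF cP]] by simp
 also have "... <= (LINT x:Hp|lebesgue. e / 2 * ?P x + m * rh^2 * \<bar>u x - u (a, b)\<bar>)"
 proof (rule set_integral_mono)
 show "set_integrable lebesgue Hp (%x. \<bar>(u x - u (a, b)) * ?P x\<bar>)" by (rule set_integrable_abs[OF i[OF cP]])
 show "set_integrable lebesgue Hp (%x. e / 2 * ?P x + m * rh^2 * \<bar>u x - u (a, b)\<bar>)"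
 by (intro set_integral_add set_integrable_mult_right iP iN)
 fix x assume x: "x \<in> Hp"
 note P0 = sdelta_nonneg[of a b rh x]
 show "\<bar>(u x - u (a, b)) * ?P x\<bar> <= e / 2 * ?P x + m * rh^2 * \<bar>u x - u (a, b)\<bar>"
 proof (cases "dist x (a, b) < hq")
 case True
 have "\<bar>u x - u (a, b)\<bar> * ?P x <= e / 2 * ?P x" using hq(2)[OF True] P0 by (intro mult_right_mono) (auto simp: dist_real_def)
 moreover have "0 <= m * rh^2 * \<bar>u x - u (a, b)\<bar>" using m(1) by simp
 ultimately show ?thesis using P0 by (simp add: abs_mult)
 next
 case False
 have "\<bar>u x - u (a, b)\<bar> * ?P x <= \<bar>u x - u (a, b)\<bar> * (m * rh^2)" using m(2)[OF x, of rh] False by (intro mult_left_mono) auto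
 moreover have "0 <= e / 2 * ?P x" using e P0 by simp
 ultimately show ?thesis using P0 by (simp add: abs_mult mult.commute)
 qed
 qed
 also have "... = e / 2 + m * rh^2 * N"
 by (subst set_integral_add(2)) (simp_all add: iP iN N_def integral_sdelta[OF rh])
 finally show ?thesis .
 qed
 have "(%n. m * (hs n)^2 * N) ---> m * 0^2 * N" by (intro tendsto_intros hs)
 then have "eventually (%n. m * (hs n)^2 * N < e / 2) sequentially" using e2 by (intro order_tendstoD(2)[of _ "m * 0^2 * N"]) auto
 then obtain n0 where n0: "!!n. n \<ge> n0 ==> m * (hs n)^2 * N < e / 2" by (auto simp: eventually_sequentially)
 show "\<exists>n0. \<forall>n\<ge>n0. norm ((LINT x:Hp|lebesgue. u x * sdelta a b (hs n) x) - u (a, b)) < e"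
 using bound[OF hs(1)] n0 by (intro exI[of _ n0] allI impI) (fastforce intro: le_less_trans)
qed

lemma set_lebesgue_integral_AE_L2_unit:
 assumes g: "L2_on {-1<..<1} g" and g0: "L2_unit g0" "AE t in lebesgue. t \<in> {-1<..<1} \<longrightarrow> g t = g0 t" and k: "continuous_on UNIV k"
 shows "(LINT t:{-1<..<1}|lebesgue. g t * k t) = (\<integral>t. g0 t *\<^sub>R k t \<partial>lborel)"
proof -
 note [measurable] = L2_unit_measurable[OF g0(1)] borel_measurable_continuous_onI[OF k]
 have gm: "(%t. indicator {-1<..<1} t *\<^sub>R g t) \<in> borel_measurable lebesgue" using g by (simp add: L2_on_def)
 have bm: "(%t. g0 t *\<^sub>R k t) \<in> borel_measurable lborel" by measurable
 have km: "k \<in> borel_measurable lebesgue" using borel_measurable_continuous_onI[OF k] by (intro measurable_completion) simp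
 have "(LINT t:{-1<..<1}|lebesgue. g t * k t) = (\<integral>t. g0 t *\<^sub>R k t \<partial>lebesgue)"
 unfolding set_lebesgue_integral_def
 proof (rule integral_cong_AE)
 show "(%t. indicator {-1<..<1} t *\<^sub>R (g t * k t)) \<in> borel_measurable lebesgue"
 using borel_measurable_times[OF gm km] by (simp add: mult.assoc)
 show "(%t. g0 t *\<^sub>R k t) \<in> borel_measurable lebesgue" by (rule measurable_completion[OF bm])
 show "AE t in lebesgue. indicator {-1<..<1} t *\<^sub>R (g t * k t) = g0 t *\<^sub>R k t"
 using g0(2) by eventually_elim (auto simp: indicator_def L2_unit_zero[OF g0(1)])
 qed
 also have "... = (\<integral>t. g0 t *\<^sub>R k t \<partial>lborel)" by (rule integral_completion[OF bm])
 finally show ?thesis .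
qed

text \<open>On the axis a pole and its mirror image give the same value, which doubles the
  logarithms. In the limit they are ln |z - t| and ln |1 - t z| with the roles of pole and variable
  exchanged, that is, the real part of \<open>ker 0\<close>.\<close>

lemma nkern_flat_tendsto:
 assumes g: "L2_unit g" and p: "(a, b) \<in> Hp"
 shows "(%n. \<integral>t. g t *\<^sub>R nkern a b (hs n) (t, 0) \<partial>lborel)
 ---> Re (pot g 0 (cx (a, b))) + (\<integral>t. g t *\<^sub>R (t^2 / (2 * pi)) \<partial>lborel)"
proof -
 have ab: "0 < b" "a^2 + b^2 < 1" using p by (auto simp: mem_Hp)
 define Q1 where "Q1 h t = (t - a)^2 + b^2 + h^2" for h t :: real
 define Q2 where "Q2 h t = (1 - a * t)^2 + (b^2 + h^2) * t^2" for h t :: real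
 have Q: "qd 1 (a^2 + b^2 + h^2) a b' (t, 0) = Q1 h t" "qd (a^2 + b^2 + h^2) 1 a b' (t, 0) = Q2 h t" for h t b'
 by (simp_all add: qd_def Q1_def Q2_def power2_eq_square algebra_simps)
 have Qp: "0 < Q1 h t" "0 < Q2 h t" for h t
 proof -
 have "0 < b^2" using ab by simp
 then show "0 < Q1 h t" unfolding Q1_def by (intro add_pos_nonneg add_nonneg_pos) auto
 have "0 < (1 - a * t)^2 \<or> t \<noteq> 0" by (cases "t = 0") auto
 then show "0 < Q2 h t" unfolding Q2_def using \<open>0 < b^2\<close>
 by (auto intro: add_pos_nonneg add_nonneg_pos mult_pos_pos simp: add_pos_nonneg)
 qed
 have K: "nkern a b h (t, 0) = - (ln (Q1 h t) + ln (Q2 h t)) / (2 * pi) + t^2 / (2 * pi)" for h t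
 unfolding nkern_def images_def Let_def Q by (simp add: field_simps)
 have "(%n. \<integral>t. g t *\<^sub>R nkern a b (hs n) (t, 0) \<partial>lborel) ---> (\<integral>t. g t *\<^sub>R nkern a b 0 (t, 0) \<partial>lborel)"
 proof (rule tendsto_parameter_integral[OF g _ hs(4) hs(3)])
 have nz: "Q1 h t \<noteq> 0" "Q2 h t \<noteq> 0" for h t using Qp[of h t] by auto
 show "continuous_on ({0..1 / 2} \<times> {-1..1}) (%(h, t). nkern a b h (t, 0))"
 unfolding K case_prod_beta using nz unfolding Q1_def Q2_def by (intro continuous_intros) auto
 qed
 also have "(\<integral>t. g t *\<^sub>R nkern a b 0 (t, 0) \<partial>lborel) = (\<integral>t. - (g t * Re (ker 0 t (cx (a, b)))) / pi + g t *\<^sub>R (t^2 / (2 * pi)) \<partial>lborel)"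
 proof (rule Bochner_Integration.integral_cong[OF refl])
 fix t
 show "g t *\<^sub>R nkern a b 0 (t, 0) = - (g t * Re (ker 0 t (cx (a, b)))) / pi + g t *\<^sub>R (t^2 / (2 * pi))"
 proof (cases "t \<in> {-1<..<1}")
 case True
 note nz = ker_args_nonzero[of 0 t "cx (a, b)"]
 have n: "cx (a, b) - of_real t \<noteq> 0" "1 - of_real t * cx (a, b) \<noteq> 0" using nz True ab by auto
 have "cmod (cx (a, b) - of_real t) = sqrt (Q1 0 t)" by (simp add: cmod_def Q1_def power2_commute)
 moreover have "cmod (1 - of_real t * cx (a, b)) = sqrt (Q2 0 t)" by (simp add: cmod_def Q2_def power_mult_distrib mult.commute)
 ultimately have "Re (ker 0 t (cx (a, b))) = ln (Q1 0 t) / 2 + ln (Q2 0 t) / 2"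
 using n Qp[of 0 t] by (simp add: ker_def ln_sqrt)
 then show ?thesis unfolding K by (simp add: field_simps)
 qed (simp add: L2_unit_zero[OF g])
 qed
 also have "... = Re (pot g 0 (cx (a, b))) + (\<integral>t. g t *\<^sub>R (t^2 / (2 * pi)) \<partial>lborel)"
 proof -
 have "integrable lborel (%t. Re (g t *\<^sub>R ker 0 t (cx (a, b))))"
 by (intro integrable_Re integrable_ker(1)[OF g]) (use ab in auto)
 then have i1: "integrable lborel (%t. - (g t * Re (ker 0 t (cx (a, b)))) / pi)" by simp
 have i2: "integrable lborel (%t. g t *\<^sub>R (t^2 / (2 * pi)))"
 by (rule integrable_L2_unit_continuous[OF g]) (intro continuous_intros, auto)
 show ?thesis using Re_Im_pot(1)[OF g, of 0 "cx (a, b)"] ab by (subst Bochner_Integration.integral_add[OF i1 i2]) simp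
 qed
 finally show ?thesis .
qed

text \<open>The regularised Neumann function is a test function for the weak equation, while
  integration by parts evaluates u near the pole. In the limit u is the real part of the potential
  plus a constant that does not depend on the pole.\<close>

lemma neumann_sol_gradient:
 assumes ns: "neumann_sol g u G" and D: "!!x. x \<in> Hp ==> (u has_derivative (%h. G x \<bullet> h)) (at x)"
 and g: "L2_on {-1<..<1} g" and g0: "L2_unit g0" "AE t in lebesgue. t \<in> {-1<..<1} \<longrightarrow> g t = g0 t" and x: "x \<in> Hp"
 shows "G x = (Re (dpot g0 0 (cx x)), - Im (dpot g0 0 (cx x)))"
proof -
 have W: "W12_on Hp u G" and u: "L2_on Hp u" and weak: "!!ph Dph. C1_fun ph Dph ==>
 (LINT x:Hp|lebesgue. G x \<bullet> Dph x) = (LINT t:{-1<..<1}|lebesgue. g t * ph (t, 0))"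
 using ns by (auto simp: neumann_sol_def W12_on_def)
 define M where "M = (LINT x:Hp|lebesgue. u x * (2 / pi)) + (\<integral>t. g0 t *\<^sub>R (t^2 / (2 * pi)) \<partial>lborel)"
 have rep: "u p = M + Re (pot g0 0 (cx p))" if p: "p \<in> Hp" for p
 proof -
 obtain a b where ab: "p = (a, b)" by (cases p)
 have e: "(LINT x:Hp|lebesgue. u x * sdelta a b (hs n) x) = (LINT x:Hp|lebesgue. u x * (2 / pi)) + (\<integral>t. g0 t *\<^sub>R nkern a b (hs n) (t, 0) \<partial>lborel)" for n
 proof -
 note C = C1_nkern[OF hs(1), of a b n]
 have "continuous_on UNIV (%t. nkern a b (hs n) (t, 0))"
 by (rule continuous_on_compose2[OF C1_funD(3)[OF C, of UNIV]]) (auto intro!: continuous_intros)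
 then have f: "(LINT t:{-1<..<1}|lebesgue. g t * nkern a b (hs n) (t, 0)) = (\<integral>t. g0 t *\<^sub>R nkern a b (hs n) (t, 0) \<partial>lborel)"
 by (rule set_lebesgue_integral_AE_L2_unit[OF g g0])
 have "(LINT x:Hp|lebesgue. u x * (2 / pi - sdelta a b (hs n) x)) = (LINT x:Hp|lebesgue. u x * (2 / pi)) - (LINT x:Hp|lebesgue. u x * sdelta a b (hs n) x)"
 unfolding right_diff_distrib
 by (intro set_integral_diff(2) L2_on_integrable_bounded[OF u] continuous_on_const continuous_sdelta hs)
 then show ?thesis using nfield_by_parts[OF W hs(1), of a b n] weak[OF C] f by simp
 qed
 have "isCont u (a, b)" using has_derivative_continuous[OF D[OF p]] by (simp add: ab)
 from sdelta_tendsto[OF u _ this] p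
 have "(%n. (LINT x:Hp|lebesgue. u x * (2 / pi)) + (\<integral>t. g0 t *\<^sub>R nkern a b (hs n) (t, 0) \<partial>lborel)) ---> u p"
 by (simp add: ab e)
 moreover have "(%n. (LINT x:Hp|lebesgue. u x * (2 / pi)) + (\<integral>t. g0 t *\<^sub>R nkern a b (hs n) (t, 0) \<partial>lborel))
 ---> (LINT x:Hp|lebesgue. u x * (2 / pi)) + (Re (pot g0 0 (cx (a, b))) + (\<integral>t. g0 t *\<^sub>R (t^2 / (2 * pi)) \<partial>lborel))"
 by (intro tendsto_add tendsto_const nkern_flat_tendsto g0) (use p ab in simp)
 ultimately show ?thesis using LIMSEQ_unique by (fastforce simp: M_def ab)
 qed
 let ?f = "dpot g0 0 (cx x)"
 have "0 < snd x" using Hp_bounds[OF x] by auto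
 then have "(pot g0 0 has_field_derivative ?f) (at (cx x))" by (intro pot_has_derivative g0) auto
 from has_derivative_add[OF has_derivative_const has_derivative_holo(2)[OF this], of M]
 have "((%p. M + Re (pot g0 0 (cx p))) has_derivative (%h. (Re ?f, - Im ?f) \<bullet> h)) (at x)" by simp
 then have "(u has_derivative (%h. (Re ?f, - Im ?f) \<bullet> h)) (at x)"
 by (rule has_derivative_transform_within_open[OF _ open_Hp x]) (simp add: rep)
 from has_derivative_unique[OF D[OF x] this] have "G x \<bullet> h = (Re ?f, - Im ?f) \<bullet> h" for h by meson
 then show ?thesis by (metis inner_commute vector_eq_ldot)
qed

section \<open>Upper bound: the logarithmic competitor\<close>

lemma integral_log_radial_le:
 assumes r: "0 < r" and c: "0 <= c"
 shows "(LBINT x:Hp. ((norm x)^2 + c * r) / ((norm x)^2 + r)^2) <= pi / 2 * (ln (1 + 1 / r) + c)"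
proof -
 \<comment> \<open>Chosen so that, with s = |x|^2, 2 (s H)' exceeds the integrand by r ln (1 + s/r)
   / (s + r)^2 only, which is nonnegative.\<close>
 define H where "H s = (ln (1 + s / r) + c) / (2 * (s + r))" for s
 define H' where "H' s = 1 / (2 * (s + r)^2) - (ln (1 + s / r) + c) / (2 * (s + r)^2)" for s
 have D: "(H has_real_derivative H' s) (at s)" if "0 <= s" for s
 proof -
 have p: "0 < 1 + s / r" "0 < s + r" using that r by (auto intro: add_pos_nonneg)
 have l: "((%s. ln (1 + s / r)) has_real_derivative 1 / (s + r)) (at s)"
 proof -
 have i: "((%s. 1 + s / r) has_real_derivative 1 / r) (at s)" by (rule DERIV_cong[OF DERIV_add[OF DERIV_const DERIV_cdivide[OF DERIV_ident]]]) simp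
 have "1 / (1 + s / r) * (1 / r) = 1 / (r * (1 + s / r))" by simp
 also have "r * (1 + s / r) = s + r" using r by (simp add: distrib_left)
 finally show ?thesis using DERIV_chain2[OF DERIV_ln_divide[OF p(1)] i] by (simp only:)
 qed
 have "(H has_real_derivative ((1 / (s + r) + 0) * (2 * (s + r)) - (ln (1 + s / r) + c) * (2 * (1 + 0))) / ((2 * (s + r)) * (2 * (s + r)))) (at s)"
 unfolding H_def[abs_def] by (intro DERIV_divide DERIV_add l DERIV_const DERIV_cmult DERIV_ident) (use p in auto)
 moreover have "((1 / (s + r) + 0) * (2 * (s + r)) - (ln (1 + s / r) + c) * (2 * (1 + 0))) / ((2 * (s + r)) * (2 * (s + r))) = H' s"
 proof -
 have "((1 / a + 0) * (2 * a) - l * (2 * (1 + 0))) / ((2 * a) * (2 * a)) = 1 / (2 * a^2) - l / (2 * a^2)" if "a \<noteq> 0" for a l :: real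
 using that by (simp add: field_simps power2_eq_square)
 from this[of "s + r" "ln (1 + s / r) + c"] show ?thesis using p unfolding H'_def by (simp only:)
 qed
 ultimately show ?thesis by simp
 qed
 have nz: "s + r \<noteq> 0" "1 + s / r \<noteq> 0" if "0 <= s" for s using that r add_pos_nonneg[of 1 "s / r"] by auto
 have cH: "continuous_on {0..1} H'" unfolding H'_def[abs_def] using nz r by (intro continuous_intros) auto
 note R = integral_radial[of H H', OF D cH]
 have "(LBINT x:Hp. ((norm x)^2 + c * r) / ((norm x)^2 + r)^2) <= (LBINT x:Hp. 2 * (H ((norm x)^2) + (norm x)^2 * H' ((norm x)^2)))"
 proof (rule set_integral_mono)
 show "set_integrable lborel Hp (%x. ((norm x)^2 + c * r) / ((norm x)^2 + r)^2)"
 using nz by (intro set_integrable_Hp continuous_intros) auto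
 show "set_integrable lborel Hp (%x. 2 * (H ((norm x)^2) + (norm x)^2 * H' ((norm x)^2)))" by (rule R(2))
 fix x :: "real \<times> real"
 define s where "s = (norm x)^2"
 have s: "0 <= s" by (simp add: s_def)
 have "2 * (H s + s * H' s) = (s + r * (ln (1 + s / r) + c)) / (s + r)^2"
 proof -
 have "2 * (l / (2 * a) + s * (1 / (2 * a^2) - l / (2 * a^2))) = (s + (a - s) * l) / a^2" if "a \<noteq> 0" for a l :: real
 using that by (simp add: field_simps power2_eq_square)
 from this[OF nz(1)[OF s], of "ln (1 + s / r) + c"] show ?thesis unfolding H_def H'_def by simp
 qed
 moreover have "s + c * r <= s + r * (ln (1 + s / r) + c)" using s r by (simp add: algebra_simps)
 ultimately show "((norm x)^2 + c * r) / ((norm x)^2 + r)^2 <= 2 * (H ((norm x)^2) + (norm x)^2 * H' ((norm x)^2))"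
 unfolding s_def[symmetric] by (simp add: divide_right_mono)
 qed
 also have "... = pi * H 1" by (rule R(1))
 also have "... <= pi / 2 * (ln (1 + 1 / r) + c)"
 proof -
 have "H 1 <= (ln (1 + 1 / r) + c) / 2" unfolding H_def using r c by (intro divide_left_mono) auto
 then have "pi * H 1 <= pi * ((ln (1 + 1 / r) + c) / 2)" by (rule mult_left_mono) simp
 then show ?thesis by simp
 qed
 finally show ?thesis .
qed

text \<open>For \<Lambda> = ln (1/eps) one has L = \<Lambda> - ln \<Lambda> with -1/2 \<le> ln
  \<Lambda> \<le> \<Lambda>/2, so L and \<Lambda> agree up to a factor 2. The bound ln 2 \<ge> 2/3
  makes this valid up to eps = 1/2.\<close>

lemma log_scale_bounds:
 fixes eps :: real
 assumes eps: "0 < eps" "eps <= 1/2" and d: "dl = eps * ln (1 / eps)" and L: "L = ln (1 / dl)"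
 shows "0 < dl" "dl < 1" "0 < L" "dl * L <= 1" "L <= 2 * ln (1 / eps)" "ln (1 / eps) <= 2 * L"
proof -
 define \<Lambda> where "\<Lambda> = ln (1 / eps)"
 have "ln 2 <= \<Lambda>" unfolding \<Lambda>_def using eps by (subst ln_le_cancel_iff) (auto simp: field_simps)
 then have \<Lambda>: "2 / 3 <= \<Lambda>" using ln2_ge_two_thirds by linarith
 show dl: "0 < dl" using eps \<Lambda> by (simp add: d \<Lambda>_def[symmetric])
 have "1 / dl = (1 / eps) / \<Lambda>" by (simp add: d \<Lambda>_def[symmetric])
 then have "L = ln ((1 / eps) / \<Lambda>)" by (simp only: L)
 also have "... = \<Lambda> - ln \<Lambda>" using eps \<Lambda> by (subst ln_div) (auto simp only: \<Lambda>_def, auto)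
 finally have L2: "L = \<Lambda> - ln \<Lambda>" .
 have "ln \<Lambda> = ln (\<Lambda> / 2) + ln 2" using \<Lambda> by (simp add: ln_div)
 also have "... <= (\<Lambda> / 2 - 1) + 1" using \<Lambda> ln_le_minus_one[of "\<Lambda> / 2"] ln_le_minus_one[of 2] by simp
 finally have l1: "ln \<Lambda> <= \<Lambda> / 2" by simp
 have "- ln \<Lambda> = ln (1 / \<Lambda>)" using \<Lambda> by (simp add: ln_div)
 also have "... <= 1 / \<Lambda> - 1" using \<Lambda> by (intro ln_le_minus_one) auto
 also have "... <= 1 / 2" using \<Lambda> by (simp add: field_simps)
 finally have l2: "- ln \<Lambda> <= 1 / 2" .
 show "ln (1 / eps) <= 2 * L" "L <= 2 * ln (1 / eps)" using l1 l2 \<Lambda> by (simp_all add: L2 \<Lambda>_def[symmetric])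
 show Lp: "0 < L" using l1 \<Lambda> by (simp add: L2)
 then have "1 < 1 / dl" using dl ln_gt_zero_iff[of "1 / dl"] by (simp add: L)
 then show "dl < 1" using dl by simp
 have "L <= 1 / dl - 1" unfolding L using dl by (intro ln_le_minus_one) simp
 then have "L * dl <= (1 / dl - 1) * dl" using dl by (intro mult_right_mono) auto
 then show "dl * L <= 1" using dl by (simp add: algebra_simps)
qed

lemma L2_unit_prim_C1:
 assumes D: "!!x. (\<nu> has_real_derivative \<nu>' x) (at x)" and c: "continuous_on UNIV \<nu>'"
 shows "L2_unit (%t. indicator {-1<..<1} t * \<nu>' t)"
 and "x \<in> {-1..1} ==> \<nu> x = \<nu> (- 1) + prim (%t. indicator {-1<..<1} t * \<nu>' t) x"
proof -
 have c': "continuous_on S \<nu>'" for S using c by (rule continuous_on_subset) simp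
 note [measurable] = borel_measurable_continuous_onI[OF c]
 have "set_integrable lborel {-1<..<1} (%t. (\<nu>' t)^2)"
 by (rule set_integrable_subset[OF LBINT_eq_HK(2)[of "-1" 1]]) (auto intro!: continuous_intros c')
 moreover have "(%t. (indicator {-1<..<1} t * \<nu>' t)^2) = (%t. indicator {-1<..<1} t *\<^sub>R (\<nu>' t)^2)" by (auto simp: fun_eq_iff indicator_def)
 ultimately show "L2_unit (%t. indicator {-1<..<1} t * \<nu>' t)" by (simp add: L2_unit_def set_integrable_def)
 assume x: "x \<in> {-1..1}"
 have "prim (%t. indicator {-1<..<1} t * \<nu>' t) x = (\<integral>t. indicator {-1<..<x} t * \<nu>' t \<partial>lborel)"
 unfolding prim_def
 proof (rule integral_cong_AE)
 show "AE t in lborel. indicator {..x} t * (indicator {-1<..<1} t * \<nu>' t) = indicator {-1<..<x} t * \<nu>' t"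
 using AE_lborel_singleton[of x] by eventually_elim (use x in \<open>auto simp: indicator_def\<close>)
 qed measurable
 also have "... = \<nu> x - \<nu> (- 1)" by (rule FTC_open_interval) (use x in \<open>auto intro: D c'\<close>)
 finally show "\<nu> x = \<nu> (- 1) + prim (%t. indicator {-1<..<1} t * \<nu>' t) x" by simp
qed

lemma integral_cauchy_kernel:
 assumes "0 < r"
 shows "(LBINT t:{-1..1}. 1 / (t^2 + r^2)) = 2 * arctan (1 / r) / r" "(LBINT t:{-1..1}. 1 / (t^2 + r^2)) <= pi / r"
proof -
 have nz: "t^2 + r^2 \<noteq> 0" for t :: real using assms by (simp add: add_nonneg_eq_0_iff)
 have D: "((%t. arctan (t / r) / r) has_real_derivative 1 / (t^2 + r^2)) (at t)" for t
 proof -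
 have "((%t. arctan (t / r) / r) has_real_derivative (inverse (1 + (t / r)^2) * (1 / r)) / r) (at t)"
 using assms by (auto intro!: derivative_eq_intros)
 moreover have "(1 + (t / r)^2) * r^2 = t^2 + r^2" using assms by (simp add: field_simps)
 then have "(inverse (1 + (t / r)^2) * (1 / r)) / r = 1 / (t^2 + r^2)"
 by (metis divide_divide_eq_left divide_inverse inverse_eq_divide mult.commute mult_1 power2_eq_square)
 ultimately show ?thesis by simp
 qed
 have "(LBINT t:{-1<..<1}. 1 / (t^2 + r^2)) = arctan (1 / r) / r - arctan (- 1 / r) / r"
 unfolding set_lebesgue_integral_def real_scaleR_def
 by (rule FTC_open_interval) (use nz in \<open>auto intro!: D continuous_intros\<close>)
 also have "... = 2 * arctan (1 / r) / r" by (simp add: arctan_minus)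
 finally show e: "(LBINT t:{-1..1}. 1 / (t^2 + r^2)) = 2 * arctan (1 / r) / r" by (simp only: integral_open_closed)
 have "2 * arctan (1 / r) <= pi" using arctan_ubound[of "1 / r"] by simp
 then show "(LBINT t:{-1..1}. 1 / (t^2 + r^2)) <= pi / r" unfolding e using assms by (intro divide_right_mono) auto
qed

text \<open>The function 1 - (gm / L') ln ((|x|^2 + dl^2) / dl^2) is 1 at the origin and, by the
  choice of L', 1 - gm on the arc; it serves as the extension of its own flat values. Since L' \<ge>
  2 L, the Dirichlet bound comes out without an error term.\<close>

lemma logarithmic_competitor:
 assumes \<beta>: "0 < \<beta>" "0 < gm" "gm <= 2 - \<beta>" and d: "0 < dl" "dl < 1" and L: "L = ln (1 / dl)"
 obtains \<nu> g where "in_M gm \<nu> g" "wterm \<nu> g <= ennreal (4 * pi / (\<beta> * dl * L))" "dir_inf gm \<nu> <= ennreal (pi * gm^2 / L)"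
proof -
 define L' where "L' = ln (1 + 1 / dl^2)"
 have L0: "0 < L" unfolding L using d by (intro ln_gt_zero) simp
 have L2: "2 * L <= L'"
 proof -
 have "2 * L = ln ((1 / dl)^2)" unfolding L using d by (subst ln_realpow) auto
 also have "... <= L'" unfolding L'_def using d by (subst ln_le_cancel_iff) (auto simp: power_divide add_pos_pos)
 finally show ?thesis .
 qed
 define v where "v x = 1 - (gm / L') * (ln (qd 1 (dl^2) 0 0 x) - ln (dl^2))" for x
 define Dv where "Dv x = (- (gm / L')) *\<^sub>R (2 *\<^sub>R qgrad 1 (dl^2) 0 0 x)" for x
 have args: "(0::real) < 1" "(0::real)^2 + 0^2 < 1 * dl^2" using d by auto
 have q: "qd 1 (dl^2) 0 0 x = (norm x)^2 + dl^2" for x by (cases x) (simp add: qd_def norm_Pair)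
 have C: "C1_fun v Dv"
 unfolding C1_fun_def
 proof (intro conjI allI)
 fix x
 have "v = (%x. (1 + gm / L' * ln (dl^2)) + (- (gm / L')) * ln (qd 1 (dl^2) 0 0 x))" by (simp add: v_def fun_eq_iff algebra_simps)
 moreover have "(... has_derivative (%h. 0 + (- (gm / L')) * ((2 *\<^sub>R qgrad 1 (dl^2) 0 0 x) \<bullet> h))) (at x)"
 by (intro has_derivative_add has_derivative_const has_derivative_mult_right qgrad_props args)
 moreover have "(%h. 0 + (- (gm / L')) * ((2 *\<^sub>R qgrad 1 (dl^2) 0 0 x) \<bullet> h)) = (%h. Dv x \<bullet> h)" by (simp add: fun_eq_iff Dv_def)
 ultimately show "(v has_derivative (%h. Dv x \<bullet> h)) (at x)" by (simp only:)
 show "continuous_on UNIV Dv" unfolding Dv_def[abs_def] by (intro continuous_on_scaleR continuous_on_const qgrad_props args)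
 qed
 have cK: "continuous_on Kp v" "continuous_on Kp Dv" by (rule C1_funD[OF C])+
 define \<nu> where "\<nu> t = v (t, 0)" for t
 define \<nu>' where "\<nu>' t = fst (Dv (t, 0))" for t
 have D\<nu>: "(\<nu> has_real_derivative \<nu>' t) (at t)" for t unfolding \<nu>_def[abs_def] \<nu>'_def by (rule C1_funD(4)[OF C])
 have c\<nu>': "continuous_on UNIV \<nu>'" unfolding \<nu>'_def
 by (intro continuous_on_fst continuous_on_compose2[OF C1_funD(2)[OF C, of UNIV]] continuous_intros subset_UNIV)
 let ?g = "%t. indicator {-1<..<1} t * \<nu>' t"
 have v1: "v x = 1 - gm" if "norm x = 1" for x
 proof -
 have "ln (1 + dl^2) - ln (dl^2) = ln ((1 + dl^2) / dl^2)" using d add_pos_nonneg[of 1 "dl^2"] by (subst ln_div) auto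
 also have "(1 + dl^2) / dl^2 = 1 + 1 / dl^2" using d by (simp add: field_simps)
 finally show ?thesis using that L0 L2 by (simp add: v_def q L'_def[symmetric])
 qed
 have M: "in_M gm \<nu> ?g"
 unfolding in_M_def
 proof (intro conjI)
 show "W12_interval \<nu> ?g" by (rule W12_interval_prim[OF L2_unit_prim_C1[OF D\<nu> c\<nu>']])
 qed (auto simp: \<nu>_def v1 norm_Pair, simp add: v_def q)
 have wt: "wterm \<nu> ?g <= ennreal (4 * pi / (\<beta> * dl * L))"
 proof -
 \<comment> \<open>Near the origin (\<nu>')^2 and 1 - \<nu>^2 both vanish like t^2; their quotient
   is bounded by a Cauchy kernel of width dl, whose mass is at most pi / dl. At t = 0 itself
   \<open>wgt\<close> is 0 because the derivative is.\<close>
 have pw: "indicator {-1<..<1} t * wgt (\<nu> t) (?g t) <= indicator {-1<..<1} t * ennreal (4 * gm / (\<beta> * L') * (1 / (t^2 + dl^2)))" for t :: real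
 proof (cases "t \<in> {-1<..<1} \<and> t \<noteq> 0")
 case False
 then show ?thesis by (auto simp: indicator_def wgt_def \<nu>'_def Dv_def qgrad_def)
 next
 case True
 define P where "P = t^2 + dl^2"
 define l where "l = ln P - ln (dl^2)"
 have P: "0 < P" "0 < t^2" "t^2 < 1" using True d by (auto simp: P_def abs_square_less_1 intro: add_pos_pos)
 have \<nu>: "\<nu> t = 1 - gm / L' * l" "\<nu>' t = - (gm / L' * (2 * t / P))" by (auto simp: \<nu>_def v_def q norm_Pair l_def P_def \<nu>'_def Dv_def qgrad_def)
 have "- l = ln (dl^2 / P)" unfolding l_def using P(1) d by (subst ln_div) auto
 also have "... <= dl^2 / P - 1" using P d by (intro ln_le_minus_one) auto
 also have "... = - (t^2 / P)" using P by (simp add: P_def field_simps)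
 finally have l1: "t^2 / P <= l" by simp
 have "l = ln (P / dl^2)" unfolding l_def using P(1) d by (subst ln_div) auto
 also have "... <= L'" unfolding L'_def
 proof (subst ln_le_cancel_iff)
 have "P / dl^2 = t^2 / dl^2 + 1" using d by (simp add: P_def add_divide_distrib)
 also have "... <= 1 / dl^2 + 1" using P by (intro add_mono divide_right_mono) auto
 finally show "P / dl^2 <= 1 + 1 / dl^2" by simp
 qed (use P d in \<open>auto intro: add_pos_nonneg\<close>)
 finally have l2: "l <= L'" .
 have L'0: "0 < L'" using L0 L2 by simp
 have tP: "0 < t^2 / P" using P by simp
 define e where "e = gm / L' * l"
 have e0: "gm / L' * (t^2 / P) <= e" unfolding e_def using l1 \<beta> L'0 by (intro mult_left_mono) auto
 have ep: "0 < gm / L' * (t^2 / P)" using \<beta> L'0 P by (intro mult_pos_pos divide_pos_pos) auto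
 have "e <= gm / L' * L'" unfolding e_def using l2 \<beta> L'0 by (intro mult_left_mono) auto
 then have e2: "e <= 2 - \<beta>" using L'0 \<beta> by simp
 have \<nu>e: "\<nu> t = 1 - e" by (simp add: \<nu> e_def)
 \<comment> \<open>The factor 2 - e is at least \<beta>, since e \<le> gm \<le> 2 - \<beta>. This is
   where the distance of the competitor from -1 enters.\<close>
 have q1: "1 - (\<nu> t)^2 = e * (2 - e)" unfolding \<nu>e by (simp add: power2_eq_square algebra_simps)
 have "gm / L' * (t^2 / P) * \<beta> <= e * (2 - e)" using e0 e2 ep \<beta> by (intro mult_mono) auto
 then have q2: "gm / L' * (t^2 / P) * \<beta> <= 1 - (\<nu> t)^2" by (simp add: q1)
 have q3: "0 < gm / L' * (t^2 / P) * \<beta>" by (rule mult_pos_pos[OF ep \<beta>(1)])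
 have "(\<nu>' t)^2 / (1 - (\<nu> t)^2) <= (\<nu>' t)^2 / (gm / L' * (t^2 / P) * \<beta>)"
 by (rule divide_left_mono[OF q2 zero_le_power2 mult_pos_pos[OF less_le_trans[OF q3 q2] q3]])
 also have "... = 4 * gm / (\<beta> * L') * (1 / P)"
 unfolding \<nu> using P L'0 \<beta> True by (simp add: field_simps power2_eq_square)
 finally show ?thesis using True q2 q3 by (simp add: wgt_def P_def ennreal_leI)
 qed
 have "wterm \<nu> ?g <= (\<integral>\<^sup>+t. indicator {-1<..<1} t * ennreal (4 * gm / (\<beta> * L') * (1 / (t^2 + dl^2))) \<partial>lebesgue)"
 unfolding wterm_def by (rule nn_integral_mono) (rule pw)
 also have "... = ennreal (LBINT t:{-1..1}. 4 * gm / (\<beta> * L') * (1 / (t^2 + dl^2)))"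
 proof (rule nn_integral_interval_eq)
 have "t^2 + dl^2 \<noteq> 0" for t :: real using d by (simp add: add_nonneg_eq_0_iff)
 then show "continuous_on {-1..1} (%t. 4 * gm / (\<beta> * L') * (1 / (t^2 + dl^2)))" by (intro continuous_intros) auto
 qed (use \<beta> L0 L2 in auto)
 also have "... <= ennreal (4 * pi / (\<beta> * dl * L))"
 proof (rule ennreal_leI)
 have "(LBINT t:{-1..1}. 4 * gm / (\<beta> * L') * (1 / (t^2 + dl^2))) = 4 * gm / (\<beta> * L') * (LBINT t:{-1..1}. 1 / (t^2 + dl^2))" by (rule set_integral_mult_right)
 also have "... <= 4 * 2 / (\<beta> * (2 * L)) * (pi / dl)"
 proof (rule mult_mono[OF _ integral_cauchy_kernel(2)[OF d(1)]])
 show "4 * gm / (\<beta> * L') <= 4 * 2 / (\<beta> * (2 * L))" using \<beta> L0 L2 by (intro frac_le mult_left_mono) auto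
 show "0 <= (LBINT t:{-1..1}. 1 / (t^2 + dl^2))" unfolding set_lebesgue_integral_def
 by (rule Bochner_Integration.integral_nonneg) (auto simp: indicator_def)
 qed (use \<beta> L0 in auto)
 also have "... = 4 * pi / (\<beta> * dl * L)" by (simp add: field_simps)
 finally show "(LBINT t:{-1..1}. 4 * gm / (\<beta> * L') * (1 / (t^2 + dl^2))) <= 4 * pi / (\<beta> * dl * L)" .
 qed
 finally show ?thesis .
 qed
 have dr: "dir_inf gm \<nu> <= ennreal (pi * gm^2 / L)"
 proof -
 have "W12_mu gm \<nu> v Dv"
 by (rule W12_muI[where v="%_. v" and Dv="%_. Dv"])
 (auto simp: C W12_dist_sq_def \<nu>_def v1 norm_Pair intro!: L2_on_continuous cK)
 then have "dir_inf gm \<nu> <= (\<integral>\<^sup>+x. indicator Hp x * ennreal ((norm (Dv x))^2) \<partial>lebesgue)"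
 unfolding dir_inf_def by (intro INF_lower2[of "(v, Dv)"]) auto
 also have "... = ennreal (LBINT x:Hp. (norm (Dv x))^2)"
 by (rule nn_integral_Hp_eq) (intro continuous_intros cK, simp)
 also have "... <= ennreal (pi * gm^2 / L)"
 proof (rule ennreal_leI)
 have "(LBINT x:Hp. (norm (Dv x))^2) = (2 * gm / L')^2 * (LBINT x:Hp. ((norm x)^2 + 0 * dl^2) / ((norm x)^2 + dl^2)^2)"
 proof -
 have "(norm (Dv x))^2 = (2 * gm / L')^2 * (((norm x)^2 + 0 * dl^2) / ((norm x)^2 + dl^2)^2)" for x
 proof -
 have "qgrad 1 (dl^2) 0 0 x = (1 / ((norm x)^2 + dl^2)) *\<^sub>R x" by (cases x) (simp add: qgrad_def q)
 then show ?thesis by (simp add: Dv_def power_mult_distrib power_divide)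
 qed
 then show ?thesis by (simp only: set_integral_mult_right)
 qed
 also have "... <= (2 * gm / L')^2 * (pi / 2 * (L' + 0))"
 unfolding L'_def using d by (intro mult_left_mono integral_log_radial_le) auto
 also have "... = 2 * pi * gm^2 / L'" using L0 L2 by (simp add: power2_eq_square field_simps)
 also have "... <= 2 * pi * gm^2 / (2 * L)" using L0 L2 by (intro divide_left_mono) auto
 finally show "(LBINT x:Hp. (norm (Dv x))^2) <= pi * gm^2 / L" by simp
 qed
 finally show ?thesis .
 qed
 show ?thesis by (rule that[OF M wt dr])
qed

text \<open>With \<open>m\<close> the maximum of \<open>1 - \<mu>\<close> on \<open>[-r, r]\<close>, the weight is at most \<open>2 m\<close> there, and AM-GM at scale \<open>r\<close> gives
 \<open>m <= r W + m / 2\<close>.\<close>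
lemma one_minus_le_wterm:
 assumes g: "L2_unit g" and mu: "!!x. x \<in> {-1..1} ==> \<mu> x = a + prim g x" and mu0: "\<mu> 0 = 1"
 and W: "wterm \<mu> g = ennreal W" "0 <= W" and x: "x \<in> {-1..1}"
 shows "1 - \<mu> x <= 2 * W * \<bar>x\<bar>"
proof (cases "x = 0")
 case False
 define r where "r = \<bar>x\<bar>"
 have r: "0 < r" "r <= 1" using False x by (auto simp: r_def)
 note [measurable] = L2_unit_measurable[OF g] borel_measurable_continuous_onI[OF continuous_prim[OF g]]
 define M where "M t = a + prim g t" for t
 define F where "F t = wgt (M t) (g t)" for t
 have F[measurable]: "F \<in> borel_measurable borel" unfolding F_def[abs_def] M_def wgt_def by measurable
 have FW: "(\<integral>\<^sup>+t. F t \<partial>lborel) = ennreal W"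
 unfolding W(1)[symmetric] wterm_def nn_integral_completion
 by (intro nn_integral_cong) (auto simp: indicator_def F_def M_def mu L2_unit_zero[OF g] wgt_def)
 have M0: "M 0 = 1" using mu[of 0] mu0 by (simp add: M_def)
 have "continuous_on {-r..r} (%y. 1 - M y)" unfolding M_def by (intro continuous_intros continuous_prim g)
 then obtain y where y: "y \<in> {-r..r}" "!!t. t \<in> {-r..r} ==> 1 - M t <= 1 - M y"
 using continuous_attains_sup[of "{-r..r}" "%y. 1 - M y"] r by auto
 define m where "m = 1 - M y"
 have m: "0 <= m" using y(2)[of 0] r M0 by (simp add: m_def)
 have key: "\<bar>prim g hi - prim g lo\<bar> <= r * W + m / (2 * r) * (hi - lo)" if h: "- r <= lo" "lo <= hi" "hi <= r" for lo hi
 proof -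
 have pw: "ennreal \<bar>indicator {lo<..hi} t * g t\<bar> <= ennreal r * F t + ennreal (m / (2 * r)) * indicator {lo<..hi} t" for t
 proof (cases "t \<in> {lo<..hi} \<and> g t \<noteq> 0")
 case True
 define q where "q = 1 - (M t)^2"
 have "1 - M t <= m" using y(2)[of t] True h by (simp add: m_def)
 then have q: "q <= 2 * m" using zero_le_power2[of "1 - M t"] by (simp add: q_def power2_eq_square algebra_simps)
 show ?thesis
 proof (cases "0 < q")
 case q0: True
 have "0 <= (\<bar>g t\<bar> - q / (2 * r))^2" by simp
 also have "... = (g t)^2 + (q / (2 * r))^2 - \<bar>g t\<bar> * q / r" by (simp add: power2_diff)
 finally have "\<bar>g t\<bar> * (q / r) <= (g t)^2 + (q / (2 * r))^2" by simp
 then have "\<bar>g t\<bar> * (q / r) * (r / q) <= ((g t)^2 + (q / (2 * r))^2) * (r / q)" using q0 r by (intro mult_right_mono) auto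
 moreover have "\<bar>g t\<bar> * (q / r) * (r / q) = \<bar>g t\<bar>" using q0 r by simp
 moreover have "((g t)^2 + (q / (2 * r))^2) * (r / q) = r * ((g t)^2 / q) + q / (4 * r)"
 using q0 r by (simp add: field_simps power2_eq_square)
 ultimately have "\<bar>g t\<bar> <= r * ((g t)^2 / q) + q / (4 * r)" by (simp only:)
 also have "q / (4 * r) <= (2 * m) / (4 * r)" using q r by (intro divide_right_mono) auto
 finally have "\<bar>g t\<bar> <= r * ((g t)^2 / q) + m / (2 * r)" by simp
 then have "ennreal \<bar>g t\<bar> <= ennreal (r * ((g t)^2 / q) + m / (2 * r))" by (rule ennreal_leI)
 also have "... = ennreal (r * ((g t)^2 / q)) + ennreal (m / (2 * r))" using q0 r m by (intro ennreal_plus) auto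
 also have "ennreal (r * ((g t)^2 / q)) = ennreal r * F t" using q0 r by (subst ennreal_mult) (auto simp: F_def wgt_def q_def)
 finally show ?thesis using True by simp
 next
 \<comment> \<open>Where 1 - M^2 is not positive and the derivative is not 0, \<open>wgt\<close> is
   infinite and the bound is trivial.\<close>
 case False
 then have "F t = \<infinity>" using True by (simp add: F_def wgt_def q_def)
 then show ?thesis using r by (simp add: ennreal_mult_top)
 qed
 qed (auto simp: indicator_def)
 have i: "integrable lborel (%t. indicator {lo<..hi} t * g t)"
 by (rule Bochner_Integration.integrable_bound[OF L2_unit_integrable[OF g]]) (auto simp: indicator_def)
 have "ennreal \<bar>prim g hi - prim g lo\<bar> <= ennreal (\<integral>t. \<bar>indicator {lo<..hi} t * g t\<bar> \<partial>lborel)"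
 unfolding prim_diff[OF g h(2)] by (intro ennreal_leI integral_abs_bound)
 also have "... = (\<integral>\<^sup>+t. ennreal \<bar>indicator {lo<..hi} t * g t\<bar> \<partial>lborel)"
 using i by (intro nn_integral_eq_integral[symmetric] integrable_abs) auto
 also have "... <= (\<integral>\<^sup>+t. ennreal r * F t + ennreal (m / (2 * r)) * indicator {lo<..hi} t \<partial>lborel)" by (rule nn_integral_mono) (rule pw)
 also have "... = ennreal r * ennreal W + ennreal (m / (2 * r)) * ennreal (hi - lo)"
 using h by (subst nn_integral_add) (auto simp: nn_integral_cmult FW nn_integral_cmult_indicator)
 also have "... = ennreal (r * W + m / (2 * r) * (hi - lo))"
 proof -
 have "ennreal (r * W + m / (2 * r) * (hi - lo)) = ennreal (r * W) + ennreal (m / (2 * r) * (hi - lo))"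
 using h r m W(2) by (intro ennreal_plus) auto
 also have "ennreal (r * W) = ennreal r * ennreal W" using r W(2) by (intro ennreal_mult) auto
 also have "ennreal (m / (2 * r) * (hi - lo)) = ennreal (m / (2 * r)) * ennreal (hi - lo)" using h r m by (intro ennreal_mult) auto
 finally show ?thesis ..
 qed
 finally show ?thesis using h r m W(2) by (subst (asm) ennreal_le_iff) auto
 qed
 have my: "m = prim g 0 - prim g y" using M0 by (simp add: m_def M_def)
 have "m <= r * W + m / (2 * r) * \<bar>y\<bar>"
 using key[of 0 y] key[of y 0] y(1) r unfolding my by (cases "0 <= y") (auto simp: abs_le_iff)
 also have "m / (2 * r) * \<bar>y\<bar> <= m / (2 * r) * r" using y(1) r m by (intro mult_left_mono) auto
 also have "m / (2 * r) * r = m / 2" using r by simp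
 finally have "m <= 2 * (r * W)" by simp
 then have "m <= 2 * W * r" by (simp only: mult_ac)
 moreover have "x \<in> {-r..r}" by (auto simp: r_def)
 then have "1 - \<mu> x <= m" using y(2)[of x] mu[OF x] by (simp add: M_def m_def)
 ultimately show ?thesis by (simp add: r_def)
qed (use mu0 in simp)

section \<open>Lower bound: duality against a dipole\<close>

definition dipole :: "real => complex => complex" where
 "dipole rh z = - \<i> * (z + 2 * \<i> * of_real rh) / (z + \<i> * of_real rh)^2"

lemma dipole_holomorphic:
 assumes "0 < rh"
 shows "dipole rh holomorphic_on {z. - rh < Im z}"
proof -
 have "z + \<i> * of_real rh \<noteq> 0" if "- rh < Im z" for z using that by (auto simp: complex_eq_iff)
 then show ?thesis unfolding dipole_def[abs_def] by (intro holomorphic_intros) auto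
qed

text \<open>The field is -i / (z + i rh) + rh / (z + i rh)^2. The first summand alone has a Poisson
  kernel as its flux through the axis, with a first moment of order rh ln (1/rh). The second one
  makes the flux decay like x^(-4) while keeping it positive, so that the first moment is
  O(rh).\<close>

lemma dipole_flat:
 assumes "0 < rh"
 shows "- Re (dipole rh (of_real x)) = 2 * rh ^ 3 / (x^2 + rh^2)^2"
proof -
 define P where "P = x^2 + rh^2"
 have P: "0 < P" unfolding P_def using assms by (intro add_nonneg_pos) auto
 define w where "w = of_real x + \<i> * of_real rh"
 have w: "w * cnj w = of_real P" by (simp add: w_def P_def complex_eq_iff power2_eq_square)
 have "w \<noteq> 0" using w P by auto
 have "dipole rh (of_real x) = (- \<i> * (of_real x + 2 * \<i> * of_real rh) * (cnj w)^2) / (w * cnj w)^2"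
 using \<open>w \<noteq> 0\<close> by (simp add: dipole_def w_def[symmetric] power_mult_distrib)
 also have "(w * cnj w)^2 = of_real (P^2)" by (simp add: w)
 finally have "Re (dipole rh (of_real x)) = Re (- \<i> * (of_real x + 2 * \<i> * of_real rh) * (cnj w)^2) / P^2" by (simp only: Re_divide_of_real)
 also have "Re (- \<i> * (of_real x + 2 * \<i> * of_real rh) * (cnj w)^2) = - 2 * rh ^ 3"
 by (simp add: w_def power2_eq_square power3_eq_cube algebra_simps)
 finally show ?thesis by (simp add: P_def)
qed

text \<open>In terms of e = 2 rh times the height, the squared modulus is (P + 2 e + 3 rh^2) / (P +
  e)^2, which for e \<ge> 0 is at most its value at e = 0.\<close>

lemma dipole_sq_le:
 assumes rh: "0 < rh" and x: "0 <= snd x"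
 shows "(cmod (dipole rh (cx x)))^2 <= ((norm x)^2 + 4 * rh^2) / ((norm x)^2 + rh^2)^2"
proof -
 define P e where "P = (norm x)^2 + rh^2" and "e = 2 * rh * snd x"
 have P: "0 < P" "0 <= e" using rh x by (auto simp: P_def e_def intro: add_nonneg_pos)
 have n: "(norm x)^2 = (fst x)^2 + (snd x)^2" by (cases x) (simp add: norm_Pair)
 have A: "(cmod (cx x + \<i> * of_real rh))^2 = P + e" unfolding P_def n cmod_power2 by (simp add: e_def power2_eq_square algebra_simps)
 have N: "(cmod (cx x + 2 * \<i> * of_real rh))^2 = P + 2 * e + 3 * rh^2" unfolding P_def n cmod_power2 by (simp add: e_def power2_eq_square algebra_simps)
 have "(cmod (dipole rh (cx x)))^2 = (P + 2 * e + 3 * rh^2) / (P + e)^2"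
 unfolding N[symmetric] A[symmetric] by (simp add: dipole_def norm_divide norm_mult norm_power power_divide power_mult_distrib)
 also have "... <= (P + 3 * rh^2) / P^2"
 proof -
 have "0 <= P * e^2 + 3 * rh^2 * (2 * P * e + e^2)" using P by simp
 then have "(P + 2 * e + 3 * rh^2) * P^2 <= (P + 3 * rh^2) * (P + e)^2" by (simp add: power2_eq_square algebra_simps)
 then show ?thesis using P by (subst frac_le_eq) (auto simp: divide_simps mult.commute)
 qed
 also have "P + 3 * rh^2 = (norm x)^2 + 4 * rh^2" by (simp add: P_def)
 finally show ?thesis unfolding P_def .
qed

lemma dipole_energy_le:
 assumes rh: "0 < rh"
 shows "(LBINT x:Hp. (cmod (dipole rh (cx x)))^2) <= pi / 2 * (ln (1 + 1 / rh^2) + 4)"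
proof (rule order_trans[OF set_integral_mono integral_log_radial_le])
 show "set_integrable lborel Hp (%x. (cmod (dipole rh (cx x)))^2)"
 by (intro set_integrable_Hp continuous_intros continuous_holo_cx[OF rh] dipole_holomorphic rh)
 have "(norm x)^2 + rh^2 \<noteq> 0" for x :: "real \<times> real" using rh by (simp add: add_nonneg_eq_0_iff)
 then show "set_integrable lborel Hp (%x. ((norm x)^2 + 4 * rh^2) / ((norm x)^2 + rh^2)^2)"
 by (intro set_integrable_Hp continuous_intros) auto
qed (use rh dipole_sq_le Hp_bounds in \<open>auto simp: less_imp_le\<close>)

text \<open>The flux has mass at least pi - 2 rh and first moment at most pi rh, and it is paired
  with a function that lies above the cone gm - 2 W |x|.\<close>

lemma prim_dipole_ge:
 assumes g: "L2_unit g" and rh: "0 < rh" and W: "0 <= W" and p: "!!x. x \<in> {-1..1} ==> gm - 2 * W * \<bar>x\<bar> <= prim g x" and gm: "0 <= gm"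
 shows "gm * (pi - 2 * rh) - 2 * W * (pi * rh) <= (LBINT x:{-1..1}. prim g x * (- Re (dipole rh (of_real x))))"
proof -
 define k where "k x = 2 * rh ^ 3 / (x^2 + rh^2)^2" for x :: real
 have P: "0 < x^2 + rh^2" for x :: real using rh by (intro add_nonneg_pos) auto
 then have nz: "x^2 + rh^2 \<noteq> 0" for x :: real by (metis less_irrefl)
 have k0: "0 <= k x" for x using rh by (simp add: k_def)
 have ck: "continuous_on S k" for S unfolding k_def[abs_def] using nz by (intro continuous_intros) auto
 have i: "set_integrable lborel {-1..1} f" if "continuous_on {-1..1} f" for f :: "real => real" by (rule LBINT_eq_HK(2)[OF that])
 have k1: "pi - 2 * rh <= (LBINT x:{-1..1}. k x)"
 proof -
 \<comment> \<open>The flux differs from the Cauchy kernel, whose mass is 2 arctan (1/rh), by an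
   exact derivative with a nonnegative boundary contribution.\<close>
 have D: "((%x. rh * x / (x^2 + rh^2)) has_real_derivative k x - rh * (1 / (x^2 + rh^2))) (at x)" for x
 proof -
 have "((%x. rh * x / (x^2 + rh^2)) has_real_derivative (rh * (x^2 + rh^2) - rh * x * (2 * x)) / (x^2 + rh^2)^2) (at x)"
 using nz[of x] by (auto intro!: derivative_eq_intros simp: power2_eq_square)
 moreover have "rh * (1 / (x^2 + rh^2)) = rh * (x^2 + rh^2) / (x^2 + rh^2)^2" using nz[of x] by (simp add: power2_eq_square)
 then have "k x - rh * (1 / (x^2 + rh^2)) = (rh * (x^2 + rh^2) - rh * x * (2 * x)) / (x^2 + rh^2)^2"
 by (simp add: k_def diff_divide_distrib[symmetric]) (simp add: power2_eq_square power3_eq_cube algebra_simps)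
 ultimately show ?thesis by simp
 qed
 have c1: "continuous_on {-1..1} (%x. rh * (1 / (x^2 + rh^2)))" using nz by (intro continuous_intros) auto
 have "(LBINT x:{-1<..<1}. k x - rh * (1 / (x^2 + rh^2))) = rh * 1 / (1^2 + rh^2) - rh * (- 1) / ((- 1)^2 + rh^2)"
 unfolding set_lebesgue_integral_def real_scaleR_def
 by (rule FTC_open_interval[OF _ continuous_on_diff[OF ck c1] D]) simp
 also have "... = 2 * rh / (1 + rh^2)" by simp
 finally have "(LBINT x:{-1..1}. k x) = (LBINT x:{-1..1}. rh * (1 / (x^2 + rh^2))) + 2 * rh / (1 + rh^2)"
 unfolding integral_open_closed set_integral_diff(2)[OF i[OF ck] i[OF c1]] by simp
 also have "(LBINT x:{-1..1}. rh * (1 / (x^2 + rh^2))) = 2 * arctan (1 / rh)"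
 unfolding set_integral_mult_right integral_cauchy_kernel(1)[OF rh] using rh by simp
 finally have "(LBINT x:{-1..1}. k x) = 2 * arctan (1 / rh) + 2 * rh / (1 + rh^2)" .
 moreover have "arctan (1 / rh) = pi / 2 - arctan rh" using arctan_inverse[of rh] rh by (simp add: inverse_eq_divide)
 moreover have "arctan rh <= rh" using rh by (intro arctan_le_self) auto
 moreover have "0 <= 2 * rh / (1 + rh^2)" using rh by simp
 ultimately show ?thesis by linarith
 qed
 have k2: "(LBINT x:{-1..1}. \<bar>x\<bar> * k x) <= pi * rh"
 proof -
 have c1: "continuous_on {-1..1} (%x. rh^2 * (1 / (x^2 + rh^2)))" using nz by (intro continuous_intros) auto
 have "(LBINT x:{-1..1}. \<bar>x\<bar> * k x) <= (LBINT x:{-1..1}. rh^2 * (1 / (x^2 + rh^2)))"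
 proof (rule set_integral_mono[OF i i[OF c1]])
 show "continuous_on {-1..1} (%x. \<bar>x\<bar> * k x)" by (intro continuous_intros ck)
 fix x :: real
 have "0 <= (\<bar>x\<bar> - rh)^2" by simp
 also have "... = x^2 + rh^2 - 2 * rh * \<bar>x\<bar>" by (simp add: power2_eq_square algebra_simps)
 finally have "2 * rh * \<bar>x\<bar> <= x^2 + rh^2" by simp
 then have "2 * rh * \<bar>x\<bar> * (rh^2 / (x^2 + rh^2)^2) <= (x^2 + rh^2) * (rh^2 / (x^2 + rh^2)^2)" by (rule mult_right_mono) simp
 moreover have "2 * rh * \<bar>x\<bar> * (rh^2 / (x^2 + rh^2)^2) = \<bar>x\<bar> * k x" by (simp add: k_def power2_eq_square power3_eq_cube)
 moreover have "(x^2 + rh^2) * (rh^2 / (x^2 + rh^2)^2) = rh^2 * (1 / (x^2 + rh^2))" using nz[of x] by (simp add: power2_eq_square)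
 ultimately show "\<bar>x\<bar> * k x <= rh^2 * (1 / (x^2 + rh^2))" by simp
 qed
 also have "... <= rh^2 * (pi / rh)" unfolding set_integral_mult_right by (intro mult_left_mono integral_cauchy_kernel rh) simp
 also have "... = pi * rh" using rh by (simp add: power2_eq_square)
 finally show ?thesis .
 qed
 have "gm * (pi - 2 * rh) - 2 * W * (pi * rh) <= gm * (LBINT x:{-1..1}. k x) - 2 * W * (LBINT x:{-1..1}. \<bar>x\<bar> * k x)"
 using k1 k2 W gm by (intro diff_mono mult_left_mono) auto
 also have "... = (LBINT x:{-1..1}. gm * k x - 2 * W * (\<bar>x\<bar> * k x))"
 by (subst set_integral_diff(2)[OF i i]) (auto intro!: continuous_intros ck)
 also have "... <= (LBINT x:{-1..1}. prim g x * k x)"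
 proof (rule set_integral_mono[OF i i])
 show "gm * k x - 2 * W * (\<bar>x\<bar> * k x) <= prim g x * k x" if "x \<in> {-1..1}" for x
 using mult_right_mono[OF p[OF that] k0[of x]] by (simp add: left_diff_distrib mult.assoc)
 qed (auto intro!: continuous_intros ck continuous_prim g)
 finally show ?thesis unfolding dipole_flat[OF rh] k_def .
qed

text \<open>The energy of \<open>\<mu>\<close> is bounded below by duality against a dipole at depth \<open>dl / 128\<close>; the constant makes the loss
 near the origin absorbable into the weighted term.\<close>
lemma minimiser_energy:
 assumes \<beta>: "0 < \<beta>" "\<beta> < 1" and eps: "0 < eps" "eps <= 1/2" and gm: "\<beta> < gm" "gm < 2 - \<beta>"
 and d: "dl = eps * ln (1 / eps)" and L: "L = ln (1 / dl)" and rh: "rh = dl / 128"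
 and min: "is_minimiser eps gm \<mu> g"
 obtains g0 W where "L2_unit g0" "prim g0 1 = 0" "!!x. x \<in> {-1..1} ==> \<mu> x = 1 - gm + prim g0 x"
 "AE t in lebesgue. t \<in> {-1<..<1} \<longrightarrow> g t = g0 t" "0 <= W" "wterm \<mu> g = ennreal W" "wterm \<mu> g0 = ennreal W"
 "0 <= log_energy g0" "dir_inf gm \<mu> = ennreal (log_energy g0)"
 "eps * W + log_energy g0 <= pi * gm^2 / L + 26 / (\<beta> * L^2)"
 "pi * gm^2 / L - eps * W / 2 - 200 / L^2 <= 2 * (gm / L) * (LBINT x:{-1..1}. prim g0 x * (- Re (dipole rh (of_real x))))
 - (gm / L)\<^sup>2 * (LBINT x:Hp. (cmod (dipole rh (cx x)))^2)"
 "2 * (gm / L) * (LBINT x:{-1..1}. prim g0 x * (- Re (dipole rh (of_real x))))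
 - (gm / L)\<^sup>2 * (LBINT x:Hp. (cmod (dipole rh (cx x)))^2) <= log_energy g0"
proof -
 note S = log_scale_bounds[OF eps d L]
 have gm0: "0 < gm" "gm <= 2 - \<beta>" "gm < 2" using \<beta> gm by auto
 have g2: "gm^2 <= 4" using power_mono[of gm 2 2] gm0 by simp
 obtain \<nu> h where c: "in_M gm \<nu> h" "wterm \<nu> h <= ennreal (4 * pi / (\<beta> * dl * L))" "dir_inf gm \<nu> <= ennreal (pi * gm^2 / L)"
 using logarithmic_competitor[OF \<beta>(1) gm0(1,2) S(1,2) L] by blast
 define A where "A = eps * (4 * pi / (\<beta> * dl * L))"
 define B where "B = pi * gm^2 / L"
 have AB: "0 <= A" "0 <= B" using eps \<beta> S gm0 by (auto simp: A_def B_def)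
 have E: "ennreal (eps / 2) * ennreal X + ennreal (1 / 2) * ennreal Y = ennreal ((eps * X + Y) / 2)" if "0 <= X" "0 <= Y" for X Y
 proof -
 have "ennreal ((eps * X + Y) / 2) = ennreal (eps / 2 * X) + ennreal (1 / 2 * Y)"
 using that eps by (subst ennreal_plus[symmetric]) (auto simp: add_divide_distrib)
 also have "ennreal (eps / 2 * X) = ennreal (eps / 2) * ennreal X" by (rule ennreal_mult) (use that eps in auto)
 also have "ennreal (1 / 2 * Y) = ennreal (1 / 2) * ennreal Y" by (rule ennreal_mult) (use that in auto)
 finally show ?thesis ..
 qed
 have "Eng eps gm \<mu> g <= Eng eps gm \<nu> h" using min c(1) by (simp add: is_minimiser_def)
 also have "... <= ennreal (eps / 2) * ennreal (4 * pi / (\<beta> * dl * L)) + ennreal (1 / 2) * ennreal (pi * gm^2 / L)"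
 unfolding Eng_def by (intro add_mono mult_left_mono c) auto
 also have "... = ennreal ((A + B) / 2)" unfolding A_def B_def using \<beta> S gm0 by (intro E) auto
 finally have up: "Eng eps gm \<mu> g <= ennreal ((A + B) / 2)" .
 then have fin: "Eng eps gm \<mu> g < \<infinity>" by (rule le_less_trans) simp
 obtain g0 where g0: "L2_unit g0" "prim g0 1 = 0" "!!x. x \<in> {-1..1} ==> \<mu> x = 1 - gm + prim g0 x"
 "!!x. x \<in> {-1..1} ==> 0 <= prim g0 x" "AE t in lebesgue. t \<in> {-1<..<1} \<longrightarrow> g t = g0 t"
 "wterm \<mu> g = wterm \<mu> g0" "dir_inf gm \<mu> = ennreal (log_energy g0)"
 by (rule minimiser_structure[OF gm0(1) eps(1) min fin], rule that)
 define W where "W = enn2real (wterm \<mu> g0)"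
 have "wterm \<mu> g0 \<noteq> \<infinity>"
 proof
 assume "wterm \<mu> g0 = \<infinity>"
 then have "Eng eps gm \<mu> g = \<infinity>" using eps by (simp add: Eng_def g0(6) ennreal_mult_top)
 then show False using fin by simp
 qed
 then have W: "wterm \<mu> g0 = ennreal W" "0 <= W" by (auto simp: W_def ennreal_enn2real_if)
 have Q0: "0 <= log_energy g0" by (rule log_energy_nonneg[OF g0(1,2)])
 have "ennreal ((eps * W + log_energy g0) / 2) <= ennreal ((A + B) / 2)"
 using up unfolding Eng_def g0(6,7) W(1) E[OF W(2) Q0] .
 then have up2: "eps * W + log_energy g0 <= A + B" using AB by (subst (asm) ennreal_le_iff) auto
 have \<Lambda>: "0 < ln (1 / eps)" using eps by (intro ln_gt_zero) auto
 \<comment> \<open>eps / dl = 1 / ln (1/eps), and ln (1/eps) \<ge> L/2 turns this into the second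
   factor 1/L. The constant is 8 pi < 26.\<close>
 have "A = 4 * pi / (\<beta> * (ln (1 / eps) * L))" unfolding A_def d using eps \<Lambda> \<beta> S by (simp add: field_simps)
 also have "... <= 4 * pi / (\<beta> * (L / 2 * L))" using S \<beta> \<Lambda> by (intro divide_left_mono mult_left_mono mult_right_mono mult_pos_pos) auto
 also have "... = 8 * pi / (\<beta> * L^2)" by (simp add: power2_eq_square field_simps)
 also have "... <= 26 / (\<beta> * L^2)" using pi_less_4 pi_approx S \<beta> by (intro divide_right_mono) auto
 finally have A: "A <= 26 / (\<beta> * L^2)" .
 define X where "X = (LBINT x:{-1..1}. prim g0 x * (- Re (dipole rh (of_real x))))"
 define Y where "Y = (LBINT x:Hp. (cmod (dipole rh (cx x)))^2)"
 \<comment> \<open>X is close to pi gm and Y to pi L, so gm / L approximates X / Y, the maximiser of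
   2 t X - t^2 Y.\<close>
 define t where "t = gm / L"
 have t: "0 <= t" using gm0 S by (simp add: t_def)
 have rh0: "0 < rh" "rh <= 1" using S by (auto simp: rh)
 have \<mu>0: "\<mu> 0 = 1" using min by (simp add: is_minimiser_def in_M_def)
 have c\<mu>: "continuous_on {-1..1} \<mu>" using min by (simp add: is_minimiser_def in_M_def W12_interval_def)
 have X: "gm * (pi - 2 * rh) - 2 * W * (pi * rh) <= X"
 unfolding X_def
 proof (rule prim_dipole_ge[OF g0(1) rh0(1) W(2)])
 show "gm - 2 * W * \<bar>x\<bar> <= prim g0 x" if "x \<in> {-1..1}" for x
 using one_minus_le_wterm[OF g0(1,3) \<mu>0 W that] g0(3)[OF that] by simp
 qed (use gm0 in simp)
 \<comment> \<open>rh = dl / 128 gives 2 / rh^2 = 2^15 / dl^2. With ln 2 \<le> 1 the constants add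
   up to 19 pi / 2 < 30.\<close>
 have Y: "Y <= pi * L + 30"
 proof -
 have "1 + 1 / rh^2 <= 2 / rh^2"     proof -
 have "1 <= 1 / rh^2" using rh0 by (simp add: power_le_one)
 then show ?thesis by simp
 qed
 also have "... = 2 ^ 15 * (1 / dl)^2" by (simp add: rh power_divide)
 finally have "ln (1 + 1 / rh^2) <= ln (2 ^ 15 * (1 / dl)^2)" using rh0 S(1) add_pos_nonneg[of 1 "1 / rh^2"] by (subst ln_le_cancel_iff) auto
 also have "... = 15 * ln 2 + 2 * L"     proof -
 have "ln (2 ^ 15 * (1 / dl)^2) = ln (2 ^ 15) + ln ((1 / dl)^2)" using S(1) by (subst ln_mult) auto
 also have "ln ((2::real) ^ 15) = 15 * ln 2" using ln_realpow[of 2 15] by simp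
 also have "ln ((1 / dl)^2) = 2 * L" unfolding L using ln_realpow[of "1 / dl" 2] S(1) by simp
 finally show ?thesis .
 qed
 also have "... <= 15 + 2 * L" using ln_le_minus_one[of 2] by simp
 finally have "pi / 2 * (ln (1 + 1 / rh^2) + 4) <= pi / 2 * (15 + 2 * L + 4)" by (intro mult_left_mono add_right_mono) auto
 also have "... = pi * L + 19 / 2 * pi" by (simp add: algebra_simps)
 finally show ?thesis using dipole_energy_le[OF rh0(1)] pi_approx unfolding Y_def by simp
 qed
 have J: "pi * gm^2 / L - eps * W / 2 - 200 / L^2 <= 2 * t * X - t^2 * Y"
 proof -
 have "2 * t * (gm * (pi - 2 * rh) - 2 * W * (pi * rh)) - t^2 * (pi * L + 30) <= 2 * t * X - t^2 * Y"
 using X Y t by (intro diff_mono mult_left_mono) auto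
 moreover have "2 * t * (gm * (pi - 2 * rh) - 2 * W * (pi * rh)) - t^2 * (pi * L + 30)
 = pi * gm^2 / L - 4 * gm^2 * rh / L - 4 * pi * gm * W * rh / L - 30 * gm^2 / L^2"
 using S by (simp add: t_def field_simps power2_eq_square)
 moreover have "4 * gm^2 * rh / L <= 1 / L^2"
 proof -
 have "gm^2 * (dl * L) <= 4 * 1" using g2 S by (intro mult_mono) auto
 moreover have "4 * gm^2 * rh * L = gm^2 * (dl * L) / 32" by (simp add: rh)
 ultimately have "4 * gm^2 * rh * L <= 1" by linarith
 then have "4 * gm^2 * rh * L / L^2 <= 1 / L^2" by (intro divide_right_mono) auto
 then show ?thesis using S by (simp add: power2_eq_square)
 qed
 moreover have "30 * gm^2 / L^2 <= 120 / L^2" using g2 by (intro divide_right_mono) auto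
 \<comment> \<open>Here the depth pays off: rh / L = eps ln (1/eps) / (128 L) \<le> eps / 64, and 4
   pi gm < 32, so the loss is at most half of eps W.\<close>
 moreover have "4 * pi * gm * W * rh / L <= eps * W / 2"
 proof -
 have "rh / L <= eps / 64"
 proof -
 have "eps * ln (1 / eps) <= eps * (2 * L)" using S eps by (intro mult_left_mono) auto
 then show ?thesis using S by (simp add: rh d field_simps)
 qed
 then have "(4 * pi * gm) * W * (rh / L) <= (4 * 4 * 2) * W * (eps / 64)"
 using W(2) gm0 pi_less_4 rh0 S eps by (intro mult_mono) auto
 then show ?thesis by (simp add: mult.commute)
 qed
 moreover have "1 / L^2 + 120 / L^2 <= 200 / L^2" by (simp add: add_divide_distrib[symmetric] divide_right_mono)
 ultimately show ?thesis by linarith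
 qed
 have K: "2 * t * X - t^2 * Y <= log_energy g0"
 proof -
 let ?f = "%z. of_real t * dipole rh z"
 have "ennreal (2 * t * X - t^2 * Y) <= dir_inf gm \<mu>"
 unfolding dir_inf_def
 proof (rule INF_greatest)
 fix wG assume "wG \<in> {(w, G). W12_mu gm \<mu> w G}"
 then have w: "W12_mu gm \<mu> (fst wG) (snd wG)" by (auto simp: case_prod_beta)
 have hf: "?f holomorphic_on {z. - rh < Im z}" by (intro holomorphic_intros dipole_holomorphic rh0)
 have "2 * t * X - t^2 * Y = 2 * (LBINT x:{-1..1}. max (\<mu> x - (1 - gm)) 0 * (- Re (?f (of_real x)))) - (LBINT x:Hp. (cmod (?f (cx x)))^2)"
 proof -
 have "(LBINT x:{-1..1}. max (\<mu> x - (1 - gm)) 0 * (- Re (?f (of_real x)))) = (LBINT x:{-1..1}. t * (prim g0 x * (- Re (dipole rh (of_real x)))))"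
 by (rule set_lebesgue_integral_cong) (auto simp: g0(3,4) max_absorb1)
 moreover have "(LBINT x:Hp. (cmod (?f (cx x)))^2) = (LBINT x:Hp. t^2 * (cmod (dipole rh (cx x)))^2)"
 by (simp add: norm_mult power_mult_distrib)
 ultimately show ?thesis unfolding set_integral_mult_right X_def Y_def by simp
 qed
 then show "ennreal (2 * t * X - t^2 * Y) <= (\<integral>\<^sup>+x. indicator Hp x * ennreal ((norm (snd wG x))^2) \<partial>lebesgue)"
 using dirichlet_dual_bound[OF c\<mu> w rh0(1) hf] by simp
 qed
 then show ?thesis unfolding g0(7) using Q0 by (cases "0 <= 2 * t * X - t^2 * Y") (auto simp: ennreal_le_iff)
 qed
 show ?thesis
 by (rule that[OF g0(1,2,3,5) W(2) _ W(1) Q0 g0(7) _ J[unfolded t_def X_def Y_def] K[unfolded t_def X_def Y_def]])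
 (use g0(6) W up2 A in \<open>auto simp: B_def\<close>)
qed

section \<open>Distance of the gradient from the dipole and from the vortex\<close>

lemma neumann_dipole_distance:
 assumes ns: "neumann_sol g u G" and g: "L2_on {-1<..<1} g" and g0: "L2_unit g0" "AE t in lebesgue. t \<in> {-1<..<1} \<longrightarrow> g t = g0 t" "prim g0 1 = 0"
 and G: "!!x. x \<in> Hp ==> G x = (Re (dpot g0 0 (cx x)), - Im (dpot g0 0 (cx x)))"
 and rh: "0 < rh" and F: "!!x. F x = (Re (dipole rh (cx x)), - Im (dipole rh (cx x)))"
 obtains R where "0 <= R" "(%x. indicator Hp x *\<^sub>R (norm (G x - t *\<^sub>R F x))^2) \<in> borel_measurable lebesgue"
 "(\<integral>\<^sup>+x. indicator Hp x * ennreal ((norm (G x - t *\<^sub>R F x))^2) \<partial>lebesgue) = ennreal R"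
 "R <= log_energy g0 - (2 * t * (LBINT x:{-1..1}. prim g0 x * (- Re (dipole rh (of_real x)))) - t^2 * (LBINT x:Hp. (cmod (dipole rh (cx x)))^2))"
proof -
 \<comment> \<open>A primitive of i times the dipole. Its imaginary part extends to a C1 test
   function with gradient F on the half disc, so the weak Neumann equation evaluates the mixed term
   of the square.\<close>
 define \<Psi> where "\<Psi> z = Ln (z + \<i> * of_real rh) - \<i> * of_real rh / (z + \<i> * of_real rh)" for z
 have D: "(\<Psi> has_field_derivative \<i> * dipole rh z) (at z)" if "- rh < Im z" for z
 proof -
 have n: "z + \<i> * of_real rh \<notin> \<real>\<^sub>\<le>\<^sub>0" "z + \<i> * of_real rh \<noteq> 0" using that by (auto simp: complex_nonpos_Reals_iff complex_eq_iff)
 have "(\<Psi> has_field_derivative 1 / (z + \<i> * of_real rh) - - (\<i> * of_real rh) / (z + \<i> * of_real rh)^2) (at z)"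
 unfolding \<Psi>_def[abs_def] using n by (auto intro!: derivative_eq_intros simp: power2_eq_square divide_inverse)
 moreover have "1 / (z + \<i> * of_real rh) - - (\<i> * of_real rh) / (z + \<i> * of_real rh)^2 = \<i> * dipole rh z"
 using n(2) by (simp add: dipole_def divide_simps) (simp add: power2_eq_square algebra_simps)
 ultimately show ?thesis by simp
 qed
 have "\<Psi> holomorphic_on {z. - rh < Im z}" using D open_Im_gt by (auto simp: holomorphic_on_open)
 from C1_ext[OF rh this] obtain v Dv where C: "C1_fun v Dv"
 and vD: "!!x. 0 <= snd x ==> v x = Im (\<Psi> (cx x)) \<and> Dv x = (Im (deriv \<Psi> (cx x)), Re (deriv \<Psi> (cx x)))" by blast
 have DF: "Dv x = F x" if "0 <= snd x" for x
 proof -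
 have "deriv \<Psi> (cx x) = \<i> * dipole rh (cx x)" by (rule DERIV_imp_deriv[OF D]) (use that rh in simp)
 then show ?thesis using vD[OF that] by (simp add: F)
 qed
 have nF: "norm (F x) = cmod (dipole rh (cx x))" for x by (simp add: F norm_Pair cmod_def)
 define X where "X = (LBINT x:{-1..1}. prim g0 x * (- Re (dipole rh (of_real x))))"
 define Y where "Y = (LBINT x:Hp. (cmod (dipole rh (cx x)))^2)"
 have cv: "continuous_on UNIV (%t. v (t, 0))" "continuous_on UNIV (%t. fst (Dv (t, 0)))"
 by (intro continuous_on_fst continuous_on_compose2[OF C1_funD(3)[OF C, of UNIV]] continuous_on_compose2[OF C1_funD(2)[OF C, of UNIV]] continuous_intros subset_UNIV)+
 have "(LINT x:Hp|lebesgue. G x \<bullet> Dv x) = (LINT t:{-1<..<1}|lebesgue. g t * v (t, 0))"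
 using ns C by (auto simp: neumann_sol_def)
 also have "... = (\<integral>t. g0 t * v (t, 0) \<partial>lborel)" using set_lebesgue_integral_AE_L2_unit[OF g g0(1,2) cv(1)] by simp
 also have "... = prim g0 1 * v (1, 0) - (LBINT x:{-1..1}. prim g0 x * fst (Dv (x, 0)))"
 by (rule integral_mult_by_parts[OF g0(1) C1_funD(4)[OF C] cv(2)])
 also have "... = X"
 unfolding X_def g0(3) by (simp add: DF F set_lebesgue_integral_def)
 finally have GX: "(LINT x:Hp|lebesgue. G x \<bullet> Dv x) = X" .
 have L: "L2_on Hp G" using ns by (simp add: neumann_sol_def W12_on_def)
 have cD: "continuous_on Kp Dv" by (rule C1_funD[OF C])
 have "set_integrable lebesgue Hp (%x. (G x \<bullet> (1, 0)) * fst (Dv x))" "set_integrable lebesgue Hp (%x. (G x \<bullet> (0, 1)) * snd (Dv x))"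
 by (intro L2_on_integrable_bounded L2_on_inner[OF L] continuous_intros cD; simp)+
 from set_integral_add(1)[OF this] have i2: "set_integrable lebesgue Hp (%x. G x \<bullet> Dv x)" by (simp add: inner_prod_def)
 have one: "L2_on Hp (%x. 1::real)" by (intro L2_on_continuous continuous_on_const)
 have cD2: "continuous_on Kp (%x. (norm (Dv x))^2)" by (intro continuous_intros cD)
 have i3: "set_integrable lebesgue Hp (%x. (norm (Dv x))^2)" using L2_on_integrable_bounded[OF one cD2] by simp
 have m1: "(%x. indicator Hp x *\<^sub>R (norm (G x))^2) \<in> borel_measurable lebesgue"
 proof -
 have "(%x. indicator Hp x *\<^sub>R G x) \<in> borel_measurable lebesgue" using L by (simp add: L2_on_def)
 then have "(%x. (norm (indicator Hp x *\<^sub>R G x))^2) \<in> borel_measurable lebesgue" by measurable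
 then show ?thesis by (rule measurable_cong[THEN iffD1, rotated]) (auto simp: indicator_def)
 qed
 have e1: "ennreal (indicator Hp x *\<^sub>R r) = indicator Hp x * ennreal r" for r and x by (simp add: indicator_def)
 have i1: "set_integrable lebesgue Hp (%x. (norm (G x))^2)"
 unfolding set_integrable_def
 proof (rule integrableI_nonneg[OF m1])
 show "(\<integral>\<^sup>+x. ennreal (indicator Hp x *\<^sub>R (norm (G x))^2) \<partial>lebesgue) < \<infinity>"
 unfolding e1 using L by (simp only: L2_on_def)
 qed simp
 have N: "(LINT x:Hp|lebesgue. (norm (G x))^2) <= log_energy g0"
 proof -
 have "ennreal (LINT x:Hp|lebesgue. (norm (G x))^2) = (\<integral>\<^sup>+x. indicator Hp x * ennreal ((norm (G x))^2) \<partial>lebesgue)"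
 unfolding set_lebesgue_integral_def e1[symmetric] by (rule nn_integral_eq_integral[symmetric, OF i1[unfolded set_integrable_def]]) simp
 also have "... = (\<integral>\<^sup>+x. indicator Hp x * ennreal ((cmod (dpot g0 0 (cx x)))^2) \<partial>lebesgue)"
 by (intro nn_integral_cong) (auto simp: indicator_def G norm_Pair cmod_def)
 also have "... <= ennreal (log_energy g0)" by (rule dpot_energy_le[OF g0(1,3)])
 finally show ?thesis by (subst (asm) ennreal_le_iff) (use log_energy_nonneg[OF g0(1,3)] in auto)
 qed
 have Y: "(LINT x:Hp|lebesgue. (norm (Dv x))^2) = Y"
 proof -
 have "(LINT x:Hp|lebesgue. (norm (Dv x))^2) = (LBINT x:Hp. (norm (Dv x))^2)"
 by (intro set_lebesgue_integral_lebesgue indicator_Hp_measurable cD2)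
 also have "... = Y" unfolding Y_def by (rule set_lebesgue_integral_cong) (auto simp: DF nF less_imp_le dest: Hp_bounds)
 finally show ?thesis .
 qed
 \<comment> \<open>The expanded square. Its integral is at most \<open>log_energy g0\<close> minus 2
   t X - t^2 Y, which is exactly the gap between the energy and the dual value of t times the
   dipole.\<close>
 define q where "q x = (norm (G x))^2 - (2 * t) * (G x \<bullet> Dv x) + t^2 * (norm (Dv x))^2" for x
 have qe: "indicator Hp x *\<^sub>R (norm (G x - t *\<^sub>R F x))^2 = indicator Hp x *\<^sub>R q x" for x
 proof (cases "x \<in> Hp")
 case True
 then have "F x = Dv x" using Hp_bounds(1)[OF True] by (simp add: DF)
 then show ?thesis unfolding q_def power2_norm_eq_inner by (simp add: inner_diff_left inner_diff_right inner_commute power2_eq_square)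
 qed simp
 have iq: "set_integrable lebesgue Hp q" unfolding q_def[abs_def]
 by (intro set_integral_add(1) set_integral_diff(1) set_integrable_mult_right i1 i2 i3)
 have "(LINT x:Hp|lebesgue. q x) = (LINT x:Hp|lebesgue. (norm (G x))^2) - 2 * t * X + t^2 * Y"
 unfolding q_def by (simp add: set_integral_add(2) set_integral_diff set_integrable_mult_right i1 i2 i3 GX Y)
 then have "(LINT x:Hp|lebesgue. q x) <= log_energy g0 - (2 * t * X - t^2 * Y)" using N by simp
 moreover have "(%x. indicator Hp x *\<^sub>R (norm (G x - t *\<^sub>R F x))^2) \<in> borel_measurable lebesgue"
 unfolding qe using iq by (simp add: set_integrable_def)
 moreover have q0: "0 <= indicator Hp x *\<^sub>R q x" for x unfolding qe[symmetric] by simp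
 moreover have "0 <= (LINT x:Hp|lebesgue. q x)" unfolding set_lebesgue_integral_def by (rule Bochner_Integration.integral_nonneg) (rule q0)
 moreover have "(\<integral>\<^sup>+x. indicator Hp x * ennreal ((norm (G x - t *\<^sub>R F x))^2) \<partial>lebesgue) = ennreal (LINT x:Hp|lebesgue. q x)"
 unfolding e1[symmetric] qe set_lebesgue_integral_def
 by (rule nn_integral_eq_integral[OF iq[unfolded set_integrable_def]]) (use q0 in auto)
 ultimately show ?thesis using that unfolding X_def Y_def by blast
qed

text \<open>The vortex corresponds to -i/z. Outside the core the dipole differs from it by rh^2 / (z
  (z + i rh)^2) up to a unit factor, as the terms of first order in rh cancel; inside, the dipole is
  at most 2/rh in modulus. One profile of scale dl dominates both. The constant 262144 = 16 * 128^2
  comes from the core, where |x|^2 + dl^2 \<le> 2 dl^2.\<close>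

lemma dipole_vortex:
 assumes d: "0 < dl" and rh: "rh = dl / 128" and x: "0 < snd x" and F: "F = (Re (dipole rh (cx x)), - Im (dipole rh (cx x)))"
 shows "dl <= norm x ==> (norm (F - (1 / (norm x)^2) *\<^sub>R (- snd x, fst x)))^2 <= 262144 * (dl^2 / ((norm x)^2 + dl^2)^2)"
 and "norm x < dl ==> (norm F)^2 <= 262144 * (dl^2 / ((norm x)^2 + dl^2)^2)"
proof -
 define s where "s = (norm x)^2"
 define z where "z = cx x"
 have rh0: "0 < rh" using d by (simp add: rh)
 have nx: "x \<noteq> 0" using x by auto
 have s: "0 < s" "cmod z ^ 2 = s" using nx by (auto simp: s_def z_def)
 { assume dx: "dl <= norm x"
 have ds: "dl^2 <= s" unfolding s_def using dx d by (intro power_mono) auto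
 have z0: "z \<noteq> 0" using s by auto
 have w0: "z + \<i> * of_real rh \<noteq> 0" using x rh0 by (auto simp: complex_eq_iff z_def)
 have e: "dipole rh z + \<i> / z = - \<i> * of_real (rh^2) / (z * (z + \<i> * of_real rh)^2)"
 using z0 w0 by (simp add: dipole_def divide_simps) (simp add: power2_eq_square algebra_simps)
 have s1: "(fst x)^2 + (snd x)^2 = s" by (cases x) (simp add: s_def norm_Pair)
 have "Re (\<i> / z) = snd x / s" "Im (\<i> / z) = fst x / s"
 by (simp_all add: Re_divide Im_divide z_def s1)
 then have "F - (1 / s) *\<^sub>R (- snd x, fst x) = (Re (dipole rh z + \<i> / z), - Im (dipole rh z + \<i> / z))"
 unfolding F z_def[symmetric] by simp
 then have "(norm (F - (1 / s) *\<^sub>R (- snd x, fst x)))^2 = (cmod (dipole rh z + \<i> / z))^2"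
 proof -
 have "norm (Re w, - Im w) = cmod w" for w by (simp add: norm_Pair cmod_def)
 then show ?thesis using \<open>F - _ = _\<close> by (simp only:)
 qed
 also have "... = rh ^ 4 / (s * ((cmod (z + \<i> * of_real rh))^2)^2)"
 unfolding e s(2)[symmetric] by (simp add: norm_mult norm_divide norm_power power_mult_distrib power_divide flip: power_mult)
 also have "... <= rh ^ 4 / (dl^2 * ((s + dl^2) / 2)^2)"
 proof -
 have "(cmod (z + \<i> * of_real rh))^2 = s + 2 * rh * snd x + rh^2"
 unfolding cmod_power2 s1[symmetric] by (simp add: z_def power2_eq_square algebra_simps)
 moreover have "0 <= 2 * rh * snd x" using rh0 x by simp
 moreover have "(s + dl^2) / 2 <= s" using ds by simp
 ultimately have "(s + dl^2) / 2 <= (cmod (z + \<i> * of_real rh))^2" using zero_le_power2[of rh] by linarith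
 then have "dl^2 * ((s + dl^2) / 2)^2 <= s * ((cmod (z + \<i> * of_real rh))^2)^2"
 using ds s by (intro mult_mono power_mono) auto
 moreover have "0 < dl^2 * ((s + dl^2) / 2)^2" using d s by (intro mult_pos_pos zero_less_power) (auto intro: add_pos_pos)
 ultimately show ?thesis by (intro divide_left_mono mult_pos_pos[of "s * _"]) (auto intro: mult_pos_pos order_less_le_trans)
 qed
 also have "... = 4 / 128 ^ 4 * (dl^2 / (s + dl^2)^2)"
 using d by (simp add: rh power_divide power4_eq_xxxx power2_eq_square)
 also have "... <= 262144 * (dl^2 / (s + dl^2)^2)" by (intro mult_right_mono) auto
 finally show "(norm (F - (1 / (norm x)^2) *\<^sub>R (- snd x, fst x)))^2 <= 262144 * (dl^2 / ((norm x)^2 + dl^2)^2)"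
 unfolding s_def .
 }
 assume dx: "norm x < dl"
 have ds: "s <= dl^2" unfolding s_def using dx by (intro power_mono) auto
 have "(norm F)^2 = (cmod (dipole rh (cx x)))^2" by (simp add: F norm_Pair cmod_def)
 also have "... <= (s + 4 * rh^2) / (s + rh^2)^2" unfolding s_def using dipole_sq_le[OF rh0, of x] x by simp
 also have "... <= (4 * (s + rh^2)) / (s + rh^2)^2" using s by (intro divide_right_mono) auto
 also have "... = 4 / (s + rh^2)"
 proof -
 have "4 * a / a^2 = 4 / a" if "0 < a" for a :: real using that by (simp add: power2_eq_square)
 from this[OF add_pos_nonneg[OF s(1) zero_le_power2]] show ?thesis .
 qed
 also have "... <= 4 / rh^2" using s rh0 by (intro divide_left_mono mult_pos_pos) (auto intro: add_pos_pos)
 also have "... = 262144 * (dl^2 / (2 * dl^2)^2)" using d by (simp add: rh power_divide power2_eq_square)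
 also have "... <= 262144 * (dl^2 / (s + dl^2)^2)"
 using ds d s by (intro mult_left_mono divide_left_mono power_mono mult_pos_pos zero_less_power) (auto intro: add_pos_pos)
 finally show "(norm F)^2 <= 262144 * (dl^2 / ((norm x)^2 + dl^2)^2)" unfolding s_def .
qed

text \<open>The bound does not depend on r. Hence exchanging dipole and vortex costs O(t^2) =
  O(1/L^2) however small the core is.\<close>

lemma integral_core_le:
 assumes r: "0 < r"
 shows "(LBINT x:Hp. r / ((norm x)^2 + r)^2) <= pi / 2"
proof -
 let ?H = "%s::real. 1 / (2 * (s + r))" and ?H' = "%s::real. - 1 / (2 * (s + r)^2)"
 have D: "(?H has_real_derivative ?H' s) (at s)" if "0 <= s" for s
 proof -
 have "((%s. (1 / 2) * inverse (s + r)) has_real_derivative (1 / 2) * - (inverse (s + r) ^ Suc (Suc 0) * 1)) (at s)"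
 using that r by (intro DERIV_cmult DERIV_inverse_fun) (auto intro!: derivative_eq_intros)
 then show ?thesis by (simp add: field_simps power2_eq_square)
 qed
 have c: "continuous_on {0..1} ?H'" using r by (intro continuous_intros) auto
 have "(LBINT x:Hp. r / ((norm x)^2 + r)^2) = (LBINT x:Hp. 2 * (?H ((norm x)^2) + (norm x)^2 * ?H' ((norm x)^2)))"
 proof -
 have "2 * (?H s + s * ?H' s) = r / (s + r)^2" if "0 <= s" for s
 using that r by (simp add: divide_simps power2_eq_square) (simp add: algebra_simps)
 then show ?thesis by simp
 qed
 also have "... = pi * ?H 1" by (rule integral_radial(1)[OF D c])
 also have "... <= pi * (1 / 2)" using r by (intro mult_left_mono) auto
 finally show ?thesis by simp
qed

lemma vortex_distance_le:
 assumes d: "0 < dl" and rh: "rh = dl / 128" and F: "!!x. F x = (Re (dipole rh (cx x)), - Im (dipole rh (cx x)))"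
 and m: "(%x. indicator Hp x *\<^sub>R (norm (G x - t *\<^sub>R F x))^2) \<in> borel_measurable lebesgue"
 and R: "(\<integral>\<^sup>+x. indicator Hp x * ennreal ((norm (G x - t *\<^sub>R F x))^2) \<partial>lebesgue) = ennreal R" "0 <= R"
 shows "(\<integral>\<^sup>+x. indicator (Hp - ball 0 dl) x * ennreal ((norm (G x - (t / (norm x)^2) *\<^sub>R (- snd x, fst x)))^2) \<partial>lebesgue)
 + (\<integral>\<^sup>+x. indicator (Hp \<inter> ball 0 dl) x * ennreal ((norm (G x))^2) \<partial>lebesgue) <= ennreal (2 * R + 1048576 * t^2)"
proof -
 define b where "b x = dl^2 / ((norm x)^2 + dl^2)^2" for x :: "real \<times> real"
 define e where "e x = (norm (G x - t *\<^sub>R F x))^2" for x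
 define B where "B x = indicator Hp x * ennreal (2 * e x + 2 * t^2 * (262144 * b x))" for x
 have b0: "0 <= b x" for x by (simp add: b_def)
 have tri: "(norm (p - r))^2 <= 2 * (norm (p - q))^2 + 2 * (norm (q - r))^2" for p q r :: "real \<times> real"
 proof -
 have "(norm (p - r))^2 <= (norm (p - q) + norm (q - r))^2" using norm_triangle_ineq[of "p - q" "q - r"] by (intro power_mono) auto
 also have "... <= 2 * (norm (p - q))^2 + 2 * (norm (q - r))^2"
 using zero_le_power2[of "norm (p - q) - norm (q - r)"] by (simp add: power2_eq_square algebra_simps)
 finally show ?thesis .
 qed
 have p1: "indicator (Hp - ball 0 dl) x * ennreal ((norm (G x - (t / (norm x)^2) *\<^sub>R (- snd x, fst x)))^2) <= indicator (Hp - ball 0 dl) x * B x" for x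
 proof (cases "x \<in> Hp - ball 0 dl")
 case True
 then have x: "0 < snd x" "dl <= norm x" using Hp_bounds[of x] by (auto simp: dist_norm)
 let ?V = "(1 / (norm x)^2) *\<^sub>R (- snd x, fst x)"
 have "(norm (t *\<^sub>R F x - t *\<^sub>R ?V))^2 = t^2 * (norm (F x - ?V))^2"
 by (simp only: scaleR_diff_right[symmetric] norm_scaleR power_mult_distrib power2_abs)
 also have "... <= t^2 * (262144 * b x)" unfolding b_def by (intro mult_left_mono dipole_vortex(1)[OF d rh x(1) F x(2)]) simp
 finally have "(norm (G x - t *\<^sub>R ?V))^2 <= 2 * e x + 2 * t^2 * (262144 * b x)"
 using tri[of "G x" "t *\<^sub>R ?V" "t *\<^sub>R F x"] by (simp add: e_def)
 moreover have "(t / (norm x)^2) *\<^sub>R (- snd x, fst x) = t *\<^sub>R ?V" by simp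
 ultimately show ?thesis using True by (simp only: B_def) (simp add: ennreal_leI)
 qed simp
 have p2: "indicator (Hp \<inter> ball 0 dl) x * ennreal ((norm (G x))^2) <= indicator (Hp \<inter> ball 0 dl) x * B x" for x
 proof (cases "x \<in> Hp \<inter> ball 0 dl")
 case True
 then have x: "0 < snd x" "norm x < dl" using Hp_bounds[of x] by (auto simp: dist_norm)
 have "(norm (t *\<^sub>R F x - 0))^2 = t^2 * (norm (F x))^2" by (simp add: power_mult_distrib)
 also have "... <= t^2 * (262144 * b x)" unfolding b_def by (intro mult_left_mono dipole_vortex(2)[OF d rh x(1) F x(2)]) simp
 finally have "(norm (G x))^2 <= 2 * e x + 2 * t^2 * (262144 * b x)"
 using tri[of "G x" 0 "t *\<^sub>R F x"] by (simp add: e_def)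
 then show ?thesis using True by (simp add: B_def ennreal_leI)
 qed simp
 have cb: "continuous_on Kp (%x. 524288 * t^2 * b x)"
 proof -
 have "(norm x)^2 + dl^2 \<noteq> 0" for x :: "real \<times> real" using d by (simp add: add_nonneg_eq_0_iff)
 then show ?thesis unfolding b_def by (intro continuous_intros) auto
 qed
 have s1: "B x = 2 * (indicator Hp x * ennreal (e x)) + indicator Hp x * ennreal (524288 * t^2 * b x)" for x
 proof -
 have "ennreal (2 * e x + 2 * t^2 * (262144 * b x)) = ennreal (2 * e x) + ennreal (524288 * t^2 * b x)"
 using b0[of x] by (subst ennreal_plus[symmetric]) (auto simp: e_def)
 also have "ennreal (2 * e x) = 2 * ennreal (e x)" by (subst ennreal_mult) (auto simp: e_def)
 finally show ?thesis by (simp add: B_def indicator_def)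
 qed
 have em: "(%x. indicator Hp x * ennreal (e x)) \<in> borel_measurable lebesgue"
 proof -
 have "(%x. ennreal (indicator Hp x *\<^sub>R e x)) \<in> borel_measurable lebesgue" using m unfolding e_def by measurable
 then show ?thesis by (rule measurable_cong[THEN iffD1, rotated]) (auto simp: indicator_def)
 qed
 have bm: "(%x. indicator Hp x * ennreal (524288 * t^2 * b x)) \<in> borel_measurable lebesgue"
 proof -
 have "(%x. ennreal (indicator Hp x *\<^sub>R (524288 * t^2 * b x))) \<in> borel_measurable lebesgue" using indicator_Hp_measurable(2)[OF cb] by measurable
 then show ?thesis by (rule measurable_cong[THEN iffD1, rotated]) (auto simp: indicator_def)
 qed
 have Bm: "B \<in> borel_measurable lebesgue" unfolding s1[abs_def] using em bm by measurable
 have "(\<integral>\<^sup>+x. indicator (Hp - ball 0 dl) x * ennreal ((norm (G x - (t / (norm x)^2) *\<^sub>R (- snd x, fst x)))^2) \<partial>lebesgue)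
 + (\<integral>\<^sup>+x. indicator (Hp \<inter> ball 0 dl) x * ennreal ((norm (G x))^2) \<partial>lebesgue)
 <= (\<integral>\<^sup>+x. indicator (Hp - ball 0 dl) x * B x \<partial>lebesgue) + (\<integral>\<^sup>+x. indicator (Hp \<inter> ball 0 dl) x * B x \<partial>lebesgue)"
 by (intro add_mono nn_integral_mono p1 p2)
 also have "... = (\<integral>\<^sup>+x. indicator (Hp - ball 0 dl) x * B x + indicator (Hp \<inter> ball 0 dl) x * B x \<partial>lebesgue)"
 by (rule nn_integral_add[symmetric]; intro borel_measurable_times_ennreal Bm borel_measurable_indicator) auto
 also have "... = (\<integral>\<^sup>+x. 2 * (indicator Hp x * ennreal (e x)) + indicator Hp x * ennreal (524288 * t^2 * b x) \<partial>lebesgue)"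
 unfolding s1[symmetric] by (intro nn_integral_cong) (auto simp: B_def indicator_def)
 also have "... = 2 * (\<integral>\<^sup>+x. indicator Hp x * ennreal (e x) \<partial>lebesgue) + (\<integral>\<^sup>+x. indicator Hp x * ennreal (524288 * t^2 * b x) \<partial>lebesgue)"
 by (subst nn_integral_add) (use em bm in \<open>auto intro!: borel_measurable_times_ennreal simp: nn_integral_cmult\<close>)
 also have "(\<integral>\<^sup>+x. indicator Hp x * ennreal (e x) \<partial>lebesgue) = ennreal R" unfolding e_def by (rule R)
 also have "(\<integral>\<^sup>+x. indicator Hp x * ennreal (524288 * t^2 * b x) \<partial>lebesgue) = ennreal (LBINT x:Hp. 524288 * t^2 * b x)"
 by (rule nn_integral_Hp_eq[OF cb]) (simp add: b0)
 also have "2 * ennreal R + ennreal (LBINT x:Hp. 524288 * t^2 * b x) <= 2 * ennreal R + ennreal (524288 * t^2 * 2)"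
 proof (intro add_left_mono ennreal_leI)
 \<comment> \<open>pi/2 is rounded up to 2; together with the factor 2 of the squared triangle
   inequality, 262144 becomes 1048576.\<close>
 have "(LBINT x:Hp. b x) <= 2" using integral_core_le[of "dl^2"] d pi_less_4 by (simp add: b_def)
 then show "(LBINT x:Hp. 524288 * t^2 * b x) <= 524288 * t^2 * 2" unfolding set_integral_mult_right by (intro mult_left_mono) auto
 qed
 also have "... = ennreal (2 * R + 1048576 * t^2)"
 using R(2) by (simp add: ennreal_plus ennreal_mult)
 finally show ?thesis .
qed

section \<open>Combination of the estimates\<close>

theorem theorem4p4:
 fixes \<beta> :: real
 assumes "0 < \<beta>" "\<beta> < 1"
 shows "\<exists>C>0. \<forall>\<epsilon> \<gamma> \<mu> g. 0 < \<epsilon> \<and> \<epsilon> \<le> 1/2 \<and> \<beta> < \<gamma> \<and> \<gamma> < 2 - \<beta> \<and> is_minimiser \<epsilon> \<gamma> \<mu> g \<longrightarrow>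
 (let \<delta> = \<epsilon> * ln (1 / \<epsilon>); L = ln (1 / \<delta>) in
 Eng \<epsilon> \<gamma> \<mu> g < \<infinity> \<and>
 \<bar>enn2real (Eng \<epsilon> \<gamma> \<mu> g) - pi * \<gamma>\<^sup>2 / (2 * L)\<bar> \<le> C / L\<^sup>2 \<and>
 (\<forall>u G. neumann_sol g u G \<and> (\<forall>x\<in>Hp. (u has_derivative (\<lambda>h. G x \<bullet> h)) (at x)) \<longrightarrow>
 ennreal \<epsilon> * wterm \<mu> g
 + (\<integral>\<^sup>+x. indicator (Hp - ball 0 \<delta>) x *
 ennreal ((norm (G x - (\<gamma> / ((norm x)\<^sup>2 * L)) *\<^sub>R (- snd x, fst x)))\<^sup>2) \<partial>lebesgue)
 + (\<integral>\<^sup>+x. indicator (Hp \<inter> ball 0 \<delta>) x * ennreal ((norm (G x))\<^sup>2) \<partial>lebesgue)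
 \<le> ennreal (C / L\<^sup>2) \<and>
 (\<exists>T. (\<forall>\<theta>\<in>{0<..<pi}. (G \<longlongrightarrow> T \<theta>) (at (cos \<theta>, sin \<theta>) within Hp)) \<and>
 (\<integral>\<^sup>+\<theta>. indicator {0<..<pi} \<theta> * ennreal ((norm (T \<theta>))\<^sup>2) \<partial>lebesgue) \<le> ennreal (C / L\<^sup>2))))"
proof -
 \<comment> \<open>The largest contribution is 1048576 t^2 with t^2 \<le> 4 / L^2, about 4.2
   million; the factor 1/\<beta> comes from the weighted energy of the competitor.\<close>
 define C where "C = 5000000 / \<beta>"
 have "0 < C" using assms by (simp add: C_def)
 moreover have "let dl = eps * ln (1 / eps); L = ln (1 / dl) in
 Eng eps gm \<mu> g < \<infinity> \<and>
 \<bar>enn2real (Eng eps gm \<mu> g) - pi * gm^2 / (2 * L)\<bar> <= C / L^2 \<and>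
 (\<forall>u G. neumann_sol g u G \<and> (\<forall>x\<in>Hp. (u has_derivative (%h. G x \<bullet> h)) (at x)) \<longrightarrow>
 ennreal eps * wterm \<mu> g
 + (\<integral>\<^sup>+x. indicator (Hp - ball 0 dl) x *
 ennreal ((norm (G x - (gm / ((norm x)^2 * L)) *\<^sub>R (- snd x, fst x)))^2) \<partial>lebesgue)
 + (\<integral>\<^sup>+x. indicator (Hp \<inter> ball 0 dl) x * ennreal ((norm (G x))^2) \<partial>lebesgue)
 <= ennreal (C / L^2) \<and>
 (\<exists>T. (\<forall>th\<in>{0<..<pi}. (G \<longlongrightarrow> T th) (at (cos th, sin th) within Hp)) \<and>
 (\<integral>\<^sup>+th. indicator {0<..<pi} th * ennreal ((norm (T th))^2) \<partial>lebesgue) <= ennreal (C / L^2)))"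
 if eps: "0 < eps" "eps <= 1/2" and gm: "\<beta> < gm" "gm < 2 - \<beta>" and min: "is_minimiser eps gm \<mu> g" for eps gm \<mu> g
 proof -
 define dl where "dl = eps * ln (1 / eps)"
 define L where "L = ln (1 / dl)"
 define rh where "rh = dl / 128"
 define t where "t = gm / L"
 note S = log_scale_bounds[OF eps dl_def L_def]
 obtain g0 W where g0: "L2_unit g0" "prim g0 1 = 0" and mu: "!!x. x \<in> {-1..1} ==> \<mu> x = 1 - gm + prim g0 x"
 and ae: "AE t in lebesgue. t \<in> {-1<..<1} \<longrightarrow> g t = g0 t" and W: "0 <= W" "wterm \<mu> g = ennreal W" "wterm \<mu> g0 = ennreal W"
 and Q: "0 <= log_energy g0" "dir_inf gm \<mu> = ennreal (log_energy g0)"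
 and up: "eps * W + log_energy g0 <= pi * gm^2 / L + 26 / (\<beta> * L^2)"
 and lo: "pi * gm^2 / L - eps * W / 2 - 200 / L^2 <= 2 * (gm / L) * (LBINT x:{-1..1}. prim g0 x * (- Re (dipole rh (of_real x))))
 - (gm / L)\<^sup>2 * (LBINT x:Hp. (cmod (dipole rh (cx x)))^2)"
 and mid: "2 * (gm / L) * (LBINT x:{-1..1}. prim g0 x * (- Re (dipole rh (of_real x))))
 - (gm / L)\<^sup>2 * (LBINT x:Hp. (cmod (dipole rh (cx x)))^2) <= log_energy g0"
 by (rule minimiser_energy[OF assms eps gm dl_def L_def rh_def min], rule that)
 define k where "k = 1 / (\<beta> * L^2)"
 have k: "0 < k" "200 / L^2 <= 200 * k" "26 / (\<beta> * L^2) = 26 * k" "C / L^2 = 5000000 * k" "4 / L^2 <= 4 * k"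
 using assms S by (auto simp: k_def C_def field_simps)
 have eW0: "0 <= eps * W" using eps W by simp
 \<comment> \<open>Upper and lower bound together give eps W \<le> 226 k + eps W / 2, so the loss in
   the lower bound is absorbed.\<close>
 have eW: "eps * W <= 452 * k" using up lo mid k by linarith
 have Eng: "Eng eps gm \<mu> g = ennreal ((eps * W + log_energy g0) / 2)"
 proof -
 have "ennreal ((eps * W + log_energy g0) / 2) = ennreal (eps / 2 * W) + ennreal (1 / 2 * log_energy g0)"
 using eW0 Q(1) by (subst ennreal_plus[symmetric]) (auto simp: add_divide_distrib)
 also have "ennreal (eps / 2 * W) = ennreal (eps / 2) * ennreal W" by (rule ennreal_mult) (use eps W in auto)
 also have "ennreal (1 / 2 * log_energy g0) = ennreal (1 / 2) * ennreal (log_energy g0)" by (rule ennreal_mult) (use Q in auto)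
 finally show ?thesis unfolding Eng_def W(2) Q(2) by simp
 qed
 have part1: "Eng eps gm \<mu> g < \<infinity>" "\<bar>enn2real (Eng eps gm \<mu> g) - pi * gm^2 / (2 * L)\<bar> <= C / L^2"
 proof -
 show "Eng eps gm \<mu> g < \<infinity>" by (simp add: Eng)
 have gen: "\<bar>(a + q) / 2 - p / 2\<bar> <= 5000000 * k" if "a + q <= p + 26 * k" "p - a / 2 - l <= j" "l <= 200 * k" "j <= q" "0 <= a" "0 < k"
 for a q p l j k :: real
 proof -
 have b: "\<bar>a + q - p\<bar> <= 10000000 * k" by (rule abs_leI) (use that in \<open>simp_all add: field_simps\<close>)
 have e: "(a + q) / 2 - p / 2 = (a + q - p) / 2" by (simp add: diff_divide_distrib)
 show ?thesis unfolding e abs_divide using b by simp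
 qed
 have "pi * gm^2 / (2 * L) = (pi * gm^2 / L) / 2" by simp
 moreover have "enn2real (Eng eps gm \<mu> g) = (eps * W + log_energy g0) / 2" unfolding Eng using eW0 Q by (intro enn2real_ennreal) auto
 ultimately show "\<bar>enn2real (Eng eps gm \<mu> g) - pi * gm^2 / (2 * L)\<bar> <= C / L^2"
 using gen[OF up[unfolded k(3)] lo k(2) mid eW0 k(1)] k(4) by (simp only:)
 qed
 have part2: "ennreal eps * wterm \<mu> g
 + (\<integral>\<^sup>+x. indicator (Hp - ball 0 dl) x *
 ennreal ((norm (G x - (gm / ((norm x)^2 * L)) *\<^sub>R (- snd x, fst x)))^2) \<partial>lebesgue)
 + (\<integral>\<^sup>+x. indicator (Hp \<inter> ball 0 dl) x * ennreal ((norm (G x))^2) \<partial>lebesgue)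
 <= ennreal (C / L^2) \<and>
 (\<exists>T. (\<forall>th\<in>{0<..<pi}. (G \<longlongrightarrow> T th) (at (cos th, sin th) within Hp)) \<and>
 (\<integral>\<^sup>+th. indicator {0<..<pi} th * ennreal ((norm (T th))^2) \<partial>lebesgue) <= ennreal (C / L^2))"
 if ns: "neumann_sol g u G" and der: "\<forall>x\<in>Hp. (u has_derivative (%h. G x \<bullet> h)) (at x)" for u G
 proof (intro conjI exI ballI)
 have gL: "L2_on {-1<..<1} g" using min by (simp add: is_minimiser_def in_M_def W12_interval_def)
 have G: "G x = (Re (dpot g0 0 (cx x)), - Im (dpot g0 0 (cx x)))" if "x \<in> Hp" for x
 by (rule neumann_sol_gradient[OF ns _ gL g0(1) ae that]) (use der in blast)
 define F where "F x = (Re (dipole rh (cx x)), - Im (dipole rh (cx x)))" for x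
 have rh0: "0 < rh" using S by (simp add: rh_def)
 obtain R where R: "0 <= R" "(%x. indicator Hp x *\<^sub>R (norm (G x - t *\<^sub>R F x))^2) \<in> borel_measurable lebesgue"
 "(\<integral>\<^sup>+x. indicator Hp x * ennreal ((norm (G x - t *\<^sub>R F x))^2) \<partial>lebesgue) = ennreal R"
 "R <= log_energy g0 - (2 * t * (LBINT x:{-1..1}. prim g0 x * (- Re (dipole rh (of_real x)))) - t^2 * (LBINT x:Hp. (cmod (dipole rh (cx x)))^2))"
 by (rule neumann_dipole_distance[OF ns gL g0(1) ae g0(2) G rh0 F_def], assumption, rule that)
 have t2: "t^2 <= 4 * k"
 proof -
 have "gm^2 <= 2^2" using gm assms by (intro power_mono) auto
 then have "gm^2 / L^2 <= 4 / L^2" by (intro divide_right_mono) auto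
 then show ?thesis using k(5) by (simp add: t_def power_divide)
 qed
 have te: "gm / ((norm x)^2 * L) = t / (norm x)^2" for x :: "real \<times> real" by (simp add: t_def mult.commute)
 have V: "(\<integral>\<^sup>+x. indicator (Hp - ball 0 dl) x * ennreal ((norm (G x - (gm / ((norm x)^2 * L)) *\<^sub>R (- snd x, fst x)))^2) \<partial>lebesgue)
 + (\<integral>\<^sup>+x. indicator (Hp \<inter> ball 0 dl) x * ennreal ((norm (G x))^2) \<partial>lebesgue) <= ennreal (2 * R + 1048576 * t^2)"
 unfolding te by (rule vortex_distance_le[OF S(1) rh_def F_def R(2,3,1)])
 have eWe: "ennreal eps * wterm \<mu> g = ennreal (eps * W)" unfolding W(2) using eps W by (intro ennreal_mult[symmetric]) auto
 \<comment> \<open>The same two bounds give R \<le> 226 k, so the total is at most (452 + 452 +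
   4194304) k.\<close>
 have tot: "eps * W + (2 * R + 1048576 * t^2) <= C / L^2"
 using R(4) lo up eW t2 k eW0 unfolding t_def by linarith
 then have fin: "ennreal (eps * W) + ennreal (2 * R + 1048576 * t^2) <= ennreal (C / L^2)"
 proof -
 have e5: "ennreal (eps * W) + ennreal (2 * R + 1048576 * t^2) = ennreal (eps * W + (2 * R + 1048576 * t^2))"
 by (rule ennreal_plus[symmetric]) (use eW0 R(1) in auto)
 show ?thesis unfolding e5 by (rule ennreal_leI[OF tot])
 qed
 show "ennreal eps * wterm \<mu> g
 + (\<integral>\<^sup>+x. indicator (Hp - ball 0 dl) x *
 ennreal ((norm (G x - (gm / ((norm x)^2 * L)) *\<^sub>R (- snd x, fst x)))^2) \<partial>lebesgue)
 + (\<integral>\<^sup>+x. indicator (Hp \<inter> ball 0 dl) x * ennreal ((norm (G x))^2) \<partial>lebesgue) <= ennreal (C / L^2)"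
 unfolding eWe add.assoc by (rule order_trans[OF add_left_mono[OF V] fin])
 \<comment> \<open>At depth 0 the field is holomorphic in the whole upper half plane and so
   continuous across the open arc; the boundary value of the gradient is its value there.\<close>
 let ?T = "%th. (Re (dpot g0 0 (cis th)), - Im (dpot g0 0 (cis th)))"
 show "(G \<longlongrightarrow> ?T th) (at (cos th, sin th) within Hp)" if "th \<in> {0<..<pi}" for th
 proof -
 have im: "cis th \<in> {z. - (0 / 2) < Im z}" using that by (simp add: sin_gt_zero)
 have "continuous_on {z. - (0 / 2) < Im z} (dpot g0 0)"
 by (intro holomorphic_on_imp_continuous_on holomorphic_pot g0) auto
 then have "isCont (dpot g0 0) (cis th)" using im open_Im_gt continuous_on_eq_continuous_at by blast
 moreover have "(cx \<longlongrightarrow> cis th) (at (cos th, sin th) within Hp)"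
 using has_derivative_continuous[OF has_derivative_cx, of "(cos th, sin th)" Hp] by (simp add: continuous_within)
 ultimately have "((%x. dpot g0 0 (cx x)) \<longlongrightarrow> dpot g0 0 (cis th)) (at (cos th, sin th) within Hp)"
 by (rule isCont_tendsto_compose)
 then have "((%x. (Re (dpot g0 0 (cx x)), - Im (dpot g0 0 (cx x)))) \<longlongrightarrow> ?T th) (at (cos th, sin th) within Hp)"
 by (intro tendsto_intros)
 then show ?thesis by (rule Lim_transform_eventually) (auto simp: eventually_at_filter G)
 qed
 have "(\<integral>\<^sup>+th. indicator {0<..<pi} th * ennreal ((norm (?T th))^2) \<partial>lebesgue) = (\<integral>\<^sup>+th. indicator {0<..<pi} th * ennreal ((cmod (dpot g0 0 (cis th)))^2) \<partial>lebesgue)"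
 by (simp add: norm_Pair cmod_def)
 \<comment> \<open>The first variation bounds the arc energy by the weighted term, whose size is
   already known from \<open>eW\<close>.\<close>
 also have "... <= ennreal (eps * W)"
 by (rule arc_gradient_le[OF g0], rule minimiser_moment_bound[OF min eps(1) g0 mu _ W(3,1) Q(2)]) (use W in simp_all)
 also have "... <= ennreal (C / L^2)" using eW k by (intro ennreal_leI) linarith
 finally show "(\<integral>\<^sup>+th. indicator {0<..<pi} th * ennreal ((norm (?T th))^2) \<partial>lebesgue) <= ennreal (C / L^2)" .
 qed
 show ?thesis unfolding Let_def dl_def[symmetric] L_def[symmetric] using part1 part2 by blast
 qed
 ultimately show ?thesis by blast
qed

end
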